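(* Let $n\ge 1$, $0<\alpha\le 2$, and let $\mathfrak{u}_0:\mathbb{R}^n\to\mathbb{R}$ belong to the Sobolev space $H^1(\mathbb{R}^n)$. Let $\mathfrak{b}$ be a real-valued (generalised) function on $[0,+\infty[\times\mathbb{R}^n$ and assume that one of the following two cases holds: Case 1) $1<\alpha\le 2$ and $\mathfrak{b}\in L^\infty([0,+\infty[,H^{-\gamma}(\mathbb{R}^n))$ with $0\le\gamma<\alpha-1$; Case 2) $0<\alpha\le 1$ and $\mathfrak{b}\in L^\infty([0,+\infty[,H^{\gamma}(\mathbb{R}^n))$ with $0\le 1-\alpha<\gamma<1$. Then there exists a time $T_0>0$ such that the Cauchy problem $$\partial_t\mathfrak{u}=-(-\Delta)^{\frac{\alpha}{2}}\mathfrak{u}+\left((-\Delta)^{\frac12}\mathfrak{u}\right)^2\ast\mathfrak{b},\qquad \mathfrak{u}(0,x)=\mathfrak{u}_0(x),\quad x\in\mathbb{R}^n,$$ admits a unique mild solution in the space $L^\infty([0,T_0],H^1(\mathbb{R}^n))$.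
   Context: The convolution $\ast$ is in the space variable $x\in\mathbb{R}^n$. The fractional Laplacian $(-\Delta)^{\frac{\alpha}{2}}$ is the Fourier multiplier with symbol $|\xi|^\alpha$, and in particular $(-\Delta)^{\frac12}$ has symbol $|\xi|$; the semigroup $e^{-t(-\Delta)^{\frac{\alpha}{2}}}$ is the Fourier multiplier with symbol $e^{-t|\xi|^\alpha}$. For $s\in\mathbb{R}$, $H^s(\mathbb{R}^n)$ is the space of tempered distributions $\varphi$ with $\|\varphi\|_{H^s}=\|(Id-\Delta)^{\frac{s}{2}}\varphi\|_{L^2}<+\infty$, where $(Id-\Delta)^{\frac{s}{2}}$ is the Fourier multiplier with symbol $(1+|\xi|^2)^{\frac{s}{2}}$. A mild solution on $[0,T_0]$ is a function $\mathfrak{u}\in L^\infty([0,T_0],H^1(\mathbb{R}^n))$ satisfying $$\mathfrak{u}(t,x)=e^{-t(-\Delta)^{\frac{\alpha}{2}}}\mathfrak{u}_0(x)+\int_0^t e^{-(t-s)(-\Delta)^{\frac{\alpha}{2}}}\left(\left((-\Delta)^{\frac12}\mathfrak{u}\right)^2\ast\mathfrak{b}\right)(s,x)\,ds .$$ *)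

theory Defs
  imports "HOL-Analysis.Analysis"
begin

section \<open>Schwartz functions and tempered distributions\<close>

definition partial_deriv :: "'n::finite \<Rightarrow> (real^'n \<Rightarrow> complex) \<Rightarrow> real^'n \<Rightarrow> complex" where
  "partial_deriv i f x = frechet_derivative f (at x) (axis i 1)"

definition iter_partial :: "'n::finite list \<Rightarrow> (real^'n \<Rightarrow> complex) \<Rightarrow> real^'n \<Rightarrow> complex" where
  "iter_partial js f = foldr partial_deriv js f"

text \<open>A function is smooth iff all its iterated partial derivatives (including the function
  itself, \<open>js = []\<close>) are Frechet differentiable everywhere.\<close>

definition schwartz :: "(real^'n::finite \<Rightarrow> complex) \<Rightarrow> bool" where
  "schwartz f \<longleftrightarrow>
     (\<forall>js x. iter_partial js f differentiable (at x)) \<and>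
     (\<forall>js k. bdd_above (range (\<lambda>x. (1 + norm x) ^ k * cmod (iter_partial js f x))))"

definition schwartz_seminorm :: "nat \<Rightarrow> (real^'n::finite \<Rightarrow> complex) \<Rightarrow> real" where
  "schwartz_seminorm N f =
     (SUP (js, x) \<in> {js. length js \<le> N} \<times> UNIV. (1 + norm x) ^ N * cmod (iter_partial js f x))"

text \<open>A distribution is a functional on arbitrary functions of which only the values on Schwartz
  functions are meaningful; two distributions are equal when they agree on all Schwartz
  functions.\<close>

type_synonym 'n distr = "(real^'n \<Rightarrow> complex) \<Rightarrow> complex"

definition tempered_distr :: "'n::finite distr \<Rightarrow> bool" where
  "tempered_distr T \<longleftrightarrow>
     (\<forall>f g. schwartz f \<longrightarrow> schwartz g \<longrightarrow> T (\<lambda>x. f x + g x) = T f + T g) \<and>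
     (\<forall>c f. schwartz f \<longrightarrow> T (\<lambda>x. c * f x) = c * T f) \<and>
     (\<exists>N C. \<forall>f. schwartz f \<longrightarrow> cmod (T f) \<le> C * schwartz_seminorm N f)"

definition distr_eq :: "'n::finite distr \<Rightarrow> 'n distr \<Rightarrow> bool" where
  "distr_eq S T \<longleftrightarrow> (\<forall>f. schwartz f \<longrightarrow> S f = T f)"

definition real_distr :: "'n::finite distr \<Rightarrow> bool" where
  "real_distr T \<longleftrightarrow> (\<forall>f. schwartz f \<longrightarrow> T (\<lambda>x. cnj (f x)) = cnj (T f))"

definition distr_of :: "(real^'n::finite \<Rightarrow> complex) \<Rightarrow> 'n distr" where
  "distr_of g = (\<lambda>f. LINT x|lebesgue. g x * f x)"

text \<open>Without the integrability condition in the next definition, the integral in \<open>distr_of\<close> could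
  be the default value \<open>0\<close>.\<close>

definition regular :: "(real^'n::finite \<Rightarrow> complex) \<Rightarrow> bool" where
  "regular g \<longleftrightarrow>
     g \<in> borel_measurable lebesgue \<and> (\<forall>f. schwartz f \<longrightarrow> integrable lebesgue (\<lambda>x. g x * f x))"

definition represents :: "(real^'n::finite \<Rightarrow> complex) \<Rightarrow> 'n distr \<Rightarrow> bool" where
  "represents g T \<longleftrightarrow> regular g \<and> distr_eq T (distr_of g)"

text \<open>The function (determined almost everywhere) that a regular distribution is identified
  with.\<close>

definition fun_of :: "'n::finite distr \<Rightarrow> real^'n \<Rightarrow> complex" where
  "fun_of T = (SOME g. represents g T)"

section \<open>Fourier transform and Fourier multipliers\<close>

text \<open>The normalisation of the Fourier transform is the one for which \<open>- \<Delta>\<close> has symbol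
  \<open>|\<xi>|\<^sup>2\<close>.\<close>

definition fourier :: "(real^'n::finite \<Rightarrow> complex) \<Rightarrow> real^'n \<Rightarrow> complex" where
  "fourier f \<xi> = (LINT x|lebesgue. cis (- (x \<bullet> \<xi>)) * f x)"

definition inv_fourier :: "(real^'n::finite \<Rightarrow> complex) \<Rightarrow> real^'n \<Rightarrow> complex" where
  "inv_fourier f x =
     complex_of_real (1 / (2 * pi) ^ CARD('n)) * (LINT \<xi>|lebesgue. cis (x \<bullet> \<xi>) * f \<xi>)"

definition fourier_distr :: "'n::finite distr \<Rightarrow> 'n distr" where
  "fourier_distr T = (\<lambda>f. T (fourier f))"

definition inv_fourier_distr :: "'n::finite distr \<Rightarrow> 'n distr" where
  "inv_fourier_distr T = (\<lambda>f. T (inv_fourier f))"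

definition mult_distr :: "(real^'n::finite \<Rightarrow> complex) \<Rightarrow> 'n distr \<Rightarrow> 'n distr" where
  "mult_distr m T = (\<lambda>f. T (\<lambda>\<xi>. m \<xi> * f \<xi>))"

text \<open>The operator \<open>(Id - \<Delta>) ^ (s/2)\<close> on all tempered distributions: its symbol is smooth and of
  slow growth, so it can be multiplied with an arbitrary tempered distribution.\<close>

definition bessel :: "real \<Rightarrow> 'n::finite distr \<Rightarrow> 'n distr" where
  "bessel s T = inv_fourier_distr
     (mult_distr (\<lambda>\<xi>. complex_of_real ((1 + (norm \<xi>)\<^sup>2) powr (s / 2))) (fourier_distr T))"

text \<open>The symbols \<open>|\<xi>|\<close> and \<open>exp (- t |\<xi>|^\<alpha>)\<close> are not smooth at the origin and do not multiply
  Schwartz functions into Schwartz functions.  A multiplier with a merely measurable symbol is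
  therefore applied to distributions whose Fourier transform is a function, by pointwise
  multiplication.\<close>

definition fourier_multiplier ::
  "(real^'n::finite \<Rightarrow> complex) \<Rightarrow> 'n distr \<Rightarrow> 'n distr" where
  "fourier_multiplier m T =
     inv_fourier_distr (distr_of (\<lambda>\<xi>. m \<xi> * fun_of (fourier_distr T) \<xi>))"

definition frac_laplacian :: "real \<Rightarrow> 'n::finite distr \<Rightarrow> 'n distr" where
  "frac_laplacian \<alpha> = fourier_multiplier (\<lambda>\<xi>. complex_of_real (norm \<xi> powr \<alpha>))"
  \<comment> \<open>the operator \<open>(- \<Delta>) ^ (\<alpha>/2)\<close>\<close>

definition frac_heat :: "real \<Rightarrow> real \<Rightarrow> 'n::finite distr \<Rightarrow> 'n distr" where
  "frac_heat \<alpha> t = fourier_multiplier (\<lambda>\<xi>. complex_of_real (exp (- t * norm \<xi> powr \<alpha>)))"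
  \<comment> \<open>the semigroup \<open>exp (- t (- \<Delta>) ^ (\<alpha>/2))\<close>\<close>

section \<open>Sobolev spaces\<close>

definition square_integrable :: "(real^'n::finite \<Rightarrow> complex) \<Rightarrow> bool" where
  "square_integrable g \<longleftrightarrow>
     g \<in> borel_measurable lebesgue \<and> integrable lebesgue (\<lambda>x. (cmod (g x))\<^sup>2)"

definition sobolev :: "real \<Rightarrow> 'n::finite distr set" where
  "sobolev s = {T. tempered_distr T \<and> (\<exists>g. represents g (bessel s T) \<and> square_integrable g)}"

definition sobolev_norm :: "real \<Rightarrow> 'n::finite distr \<Rightarrow> real" where
  "sobolev_norm s T = sqrt (LINT x|lebesgue. (cmod (fun_of (bessel s T) x))\<^sup>2)"

text \<open>\<open>L_infty_sobolev I s\<close> is the Bochner space of essentially bounded, strongly measurable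
  functions from \<open>I\<close> to \<open>H^s\<close>: almost everywhere limits of measurable simple functions.  Its
  elements are representatives, to be identified when they agree almost everywhere.\<close>

definition L_infty_sobolev :: "real set \<Rightarrow> real \<Rightarrow> (real \<Rightarrow> 'n::finite distr) set" where
  "L_infty_sobolev I s = {u.
     (\<exists>S. (\<forall>k::nat. simple_function (lebesgue_on I) (S k) \<and> S k ` I \<subseteq> sobolev s) \<and>
          (AE t in lebesgue_on I. u t \<in> sobolev s \<and>
             (\<lambda>k. sobolev_norm s (\<lambda>f. u t f - S k t f)) \<longlonglongrightarrow> 0)) \<and>
     (\<exists>C. AE t in lebesgue_on I. sobolev_norm s (u t) \<le> C)}"

section \<open>The nonlinearity and mild solutions\<close>

text \<open>Convolution of a function \<open>g\<close> with a distribution \<open>T\<close>: the pairing of \<open>g \<otimes> T\<close> with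
  \<open>(y, x) \<mapsto> f (x + y)\<close>.\<close>

definition conv_distr :: "(real^'n::finite \<Rightarrow> complex) \<Rightarrow> 'n distr \<Rightarrow> 'n distr" where
  "conv_distr g T = (\<lambda>f. LINT y|lebesgue. g y * T (\<lambda>x. f (x + y)))"

definition nonlinearity :: "'n::finite distr \<Rightarrow> 'n distr \<Rightarrow> 'n distr" where
  "nonlinearity U B = conv_distr (\<lambda>x. (fun_of (frac_laplacian 1 U) x)\<^sup>2) B"

text \<open>The Duhamel formula is an identity between elements of \<open>L_infty_sobolev {0..T0} 1\<close>, hence
  for almost every \<open>t\<close>; the integral over \<open>s\<close> is taken in the space of tempered distributions,
  that is, after pairing with a test function.\<close>

definition mild_solution ::
  "real \<Rightarrow> (real \<Rightarrow> 'n::finite distr) \<Rightarrow> 'n distr \<Rightarrow> real \<Rightarrow> (real \<Rightarrow> 'n distr) \<Rightarrow> bool" where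
  "mild_solution \<alpha> b U0 T0 u \<longleftrightarrow>
     u \<in> L_infty_sobolev {0..T0} 1 \<and>
     (AE t in lebesgue_on {0..T0}. \<forall>f. schwartz f \<longrightarrow>
        integrable (lebesgue_on {0..t}) (\<lambda>s. frac_heat \<alpha> (t - s) (nonlinearity (u s) (b s)) f) \<and>
        u t f = frac_heat \<alpha> t U0 f +
          (LINT s|lebesgue_on {0..t}. frac_heat \<alpha> (t - s) (nonlinearity (u s) (b s)) f))"

end

theory Submission
  imports Defs "HOL-Probability.Characteristic_Functions"
begin

text \<open>
  Let \<open>\<beta>\<^sub>s\<close> be the symbol (the Fourier transform) of \<open>b(s)\<close>.  On the Fourier side the Duhamel formula
  reads \<open>\<tau>\<^sub>t = exp (- t |\<xi>|\<^sup>\<alpha>) \<tau>\<^sub>0 + \<integral> exp (- (t - s) |\<xi>|\<^sup>\<alpha>) q\<^sub>s \<beta>\<^sub>s ds\<close>, where \<open>q\<^sub>s\<close> is the Fourier transform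
  of the square of \<open>(- \<Delta>)\<^bsup>1/2\<^esup> u(s)\<close>.  For \<open>u(s) \<in> H\<^sup>1\<close> this square is integrable, so \<open>q\<^sub>s\<close> is merely a
  bounded function, quadratic in \<open>u(s)\<close>.  In both cases \<open>b\<close> takes values in \<open>H\<^bsup>\<sigma>\<^esup>\<close> with \<open>0 < 1 - \<sigma> < \<alpha>\<close>
  (\<open>\<sigma> = - \<gamma>\<close> or \<open>\<sigma> = \<gamma>\<close>), and passing from \<open>H\<^bsup>\<sigma>\<^esup>\<close> to \<open>H\<^sup>1\<close> costs the integrable factor
  \<open>(t - s)\<^bsup>-\<theta>\<^esup>\<close> with \<open>\<theta> = (1 - \<sigma>) / \<alpha> < 1\<close>.  The unknown of the Picard iteration is \<open>q\<close> rather than \<open>u\<close>: it lives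
  among the bounded jointly measurable functions with the supremum norm, where the map \<open>q \<mapsto> \<tau> \<mapsto> q\<close> is
  a contraction for short times.  An arbitrary mild solution yields a fixed point of the same map, and
  two fixed points agree by contraction on successive short time intervals.  Real data correspond
  to Hermitian symbols, a symmetry that the iteration preserves.
\<close>

section \<open>Square integrable functions\<close>

text \<open>The exponent \<theta> is forced: the supremum over r > 0 of r^p exp (- h r^\<alpha>) is
  a constant times h^(-p/\<alpha>), here with p = 1 - \<sigma>, the number of derivatives to be
  gained. Iterating on q has a further reason. A bounded function of (t, \<xi>) has values at every
  point, so limits, cut-offs and joint measurability are elementary. By contrast, the
  representatives \<open>fun_of\<close> and \<open>inv_plancherel\<close> are chosen by
  \<open>SOME\<close> and carry no measurability in t. Strong measurability of u is recovered
  afterwards: the symbol produced from q is right continuous in time with values in H^1, hence a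
  limit of its samples on a grid. Conversely, \<open>quad\<close> is Lipschitz from bounded sets of
  H^1 to the supremum norm, so a strongly measurable u yields a jointly measurable q. The symbol of
  b is not of this kind, since convergence in H^\<sigma> gives no pointwise limits; it needs a
  separate argument in the product space. Uniqueness is claimed among all mild solutions, whatever
  their size, so it cannot be read off from the contraction on a fixed ball.\<close>

definition L2 :: "'a measure \<Rightarrow> ('a \<Rightarrow> complex) \<Rightarrow> bool" where
  "L2 M f \<longleftrightarrow> f \<in> borel_measurable M \<and> integrable M (\<lambda>x. (cmod (f x))\<^sup>2)"

definition n2 :: "'a measure \<Rightarrow> ('a \<Rightarrow> complex) \<Rightarrow> real" where
  "n2 M f = sqrt (LINT x|M. (cmod (f x))\<^sup>2)"

lemma L2_integrable: "L2 M f \<Longrightarrow> integrable M (\<lambda>x. (cmod (f x))\<^sup>2)"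
  by (simp add: L2_def)

lemma n2_nonneg [simp]: "0 \<le> n2 M f"
  by (simp add: n2_def)

lemma n2_power2: "(n2 M f)\<^sup>2 = (LINT x|M. (cmod (f x))\<^sup>2)"
  by (simp add: n2_def)

lemma n2_nn_integral: "L2 M f \<Longrightarrow> (\<integral>\<^sup>+x. ennreal ((cmod (f x))\<^sup>2) \<partial>M) = ennreal ((n2 M f)\<^sup>2)"
  by (subst nn_integral_eq_integral) (auto simp: L2_def n2_power2)

lemma L2_iff_nn_integral:
  "L2 M f \<longleftrightarrow> f \<in> borel_measurable M \<and> (\<integral>\<^sup>+x. ennreal ((cmod (f x))\<^sup>2) \<partial>M) < \<infinity>"
  by (auto simp: L2_def integrable_iff_bounded)

text \<open>After an application of Tonelli only a nonnegative integral is under control; membership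
  in L2 and the norm bound are then obtained together.\<close>

lemma n2_le_nn_integral:
  assumes "f \<in> borel_measurable M" "(\<integral>\<^sup>+x. ennreal ((cmod (f x))\<^sup>2) \<partial>M) \<le> ennreal (C\<^sup>2)" "0 \<le> C"
  shows "L2 M f" "n2 M f \<le> C"
proof -
  show *: "L2 M f"
    using assms by (auto simp: L2_iff_nn_integral intro: le_less_trans)
  have "(n2 M f)\<^sup>2 \<le> C\<^sup>2"
    using assms(2) n2_nn_integral[OF *] by simp
  then show "n2 M f \<le> C"
    using \<open>0 \<le> C\<close> by (rule power2_le_imp_le)
qed

lemma L2_dominated:
  assumes "L2 M g" "f \<in> borel_measurable M" "AE x in M. cmod (f x) \<le> cmod (g x)"
  shows "L2 M f"
proof -
  have "AE x in M. norm ((cmod (f x))\<^sup>2) \<le> norm ((cmod (g x))\<^sup>2)"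
    using assms(3) by eventually_elim (auto intro: power_mono)
  then show ?thesis
    using assms unfolding L2_def by (auto intro: Bochner_Integration.integrable_bound)
qed

lemma n2_mono:
  assumes "L2 M g" "f \<in> borel_measurable M" "AE x in M. cmod (f x) \<le> cmod (g x)"
  shows "n2 M f \<le> n2 M g"
proof -
  have "L2 M f" using L2_dominated[OF assms] .
  moreover have "AE x in M. (cmod (f x))\<^sup>2 \<le> (cmod (g x))\<^sup>2"
    using assms(3) by eventually_elim (auto intro: power_mono)
  ultimately show ?thesis
    using assms(1) unfolding n2_def L2_def
    by (intro real_sqrt_le_mono integral_mono_AE) auto
qed

lemma L2_cong_AE:
  assumes "f \<in> borel_measurable M" "g \<in> borel_measurable M" "AE x in M. f x = g x"
  shows "L2 M f \<longleftrightarrow> L2 M g"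
proof -
  have "AE x in M. cmod (f x) \<le> cmod (g x)" "AE x in M. cmod (g x) \<le> cmod (f x)"
    using assms(3) by auto
  then show ?thesis using L2_dominated assms(1,2) by metis
qed

lemma n2_cong_AE:
  assumes "f \<in> borel_measurable M" "g \<in> borel_measurable M" "AE x in M. f x = g x"
  shows "n2 M f = n2 M g"
  unfolding n2_def using assms by (intro arg_cong[where f=sqrt] integral_cong_AE) auto

lemma L2_cmult: "L2 M f \<Longrightarrow> L2 M (\<lambda>x. c * f x)"
  by (auto simp: L2_def norm_mult power_mult_distrib)

lemma n2_cmult: "n2 M (\<lambda>x. c * f x) = cmod c * n2 M f"
  by (simp add: n2_def norm_mult power_mult_distrib real_sqrt_mult)

lemma L2_zero [simp]: "L2 M (\<lambda>x. 0)"
  by (simp add: L2_def)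

lemma n2_zero [simp]: "n2 M (\<lambda>x. 0) = 0"
  by (simp add: n2_def)

lemma n2_minus_commute: "n2 M (\<lambda>x. f x - g x) = n2 M (\<lambda>x. g x - f x)"
  by (simp add: n2_def norm_minus_commute)

lemma borel_measurable_cnj [measurable (raw)]:
  "f \<in> borel_measurable M \<Longrightarrow> (\<lambda>x. cnj (f x)) \<in> borel_measurable M"
  using measurable_compose[of f M borel cnj borel]
    borel_measurable_continuous_onI[of cnj] continuous_on_cnj[OF continuous_on_id] by simp

lemma L2_cnj: "L2 M f \<Longrightarrow> L2 M (\<lambda>x. cnj (f x))"
  by (simp add: L2_def borel_measurable_cnj)

lemma L2_add:
  assumes "L2 M f" "L2 M g"
  shows "L2 M (\<lambda>x. f x + g x)"
proof -
  have [measurable]: "f \<in> borel_measurable M" "g \<in> borel_measurable M"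
    using assms by (auto simp: L2_def)
  have "(cmod (f x + g x))\<^sup>2 \<le> 2 * (cmod (f x))\<^sup>2 + 2 * (cmod (g x))\<^sup>2" for x
  proof -
    have "(cmod (f x + g x))\<^sup>2 \<le> (cmod (f x) + cmod (g x))\<^sup>2"
      by (intro power_mono norm_triangle_ineq) auto
    also have "\<dots> \<le> 2 * (cmod (f x))\<^sup>2 + 2 * (cmod (g x))\<^sup>2"
      using zero_le_power2[of "cmod (f x) - cmod (g x)"] by (simp add: power2_eq_square algebra_simps)
    finally show ?thesis .
  qed
  then show ?thesis
    unfolding L2_def using assms[unfolded L2_def]
    by (auto intro!: Bochner_Integration.integrable_bound[where g = "\<lambda>x. (cmod (f x + g x))\<^sup>2"
          and f = "\<lambda>x. 2 * (cmod (f x))\<^sup>2 + 2 * (cmod (g x))\<^sup>2"])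
qed

lemma L2_diff: "L2 M f \<Longrightarrow> L2 M g \<Longrightarrow> L2 M (\<lambda>x. f x - g x)"
  using L2_add[of M f "\<lambda>x. -1 * g x"] L2_cmult[of M g "-1"] by simp

lemma L2_abs_mult_integrable:
  assumes "L2 M f" "L2 M g"
  shows "integrable M (\<lambda>x. cmod (f x) * cmod (g x))"
proof -
  have [measurable]: "f \<in> borel_measurable M" "g \<in> borel_measurable M"
    using assms by (auto simp: L2_def)
  have "norm (cmod (f x) * cmod (g x)) \<le> norm ((cmod (f x))\<^sup>2 + (cmod (g x))\<^sup>2)" for x
    using sum_squares_bound[of "cmod (f x)" "cmod (g x)"] mult_nonneg_nonneg[of "cmod (f x)" "cmod (g x)"]
    by (simp add: abs_mult del: mult_nonneg_nonneg)
  then show ?thesis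
    using assms[unfolded L2_def]
    by (auto intro!: Bochner_Integration.integrable_bound[where g = "\<lambda>x. cmod (f x) * cmod (g x)"
          and f = "\<lambda>x. (cmod (f x))\<^sup>2 + (cmod (g x))\<^sup>2"])
qed

lemma L2_mult_integrable:
  assumes "L2 M f" "L2 M g"
  shows "integrable M (\<lambda>x. f x * g x)"
proof -
  have [measurable]: "f \<in> borel_measurable M" "g \<in> borel_measurable M"
    using assms by (auto simp: L2_def)
  show ?thesis
    by (rule Bochner_Integration.integrable_bound[OF L2_abs_mult_integrable[OF assms]])
      (auto simp: norm_mult)
qed

lemma integral_cmod_mult_le:
  assumes "L2 M f" "L2 M g"
  shows "(LINT x|M. cmod (f x) * cmod (g x)) \<le> n2 M f * n2 M g"
proof -
  have [measurable]: "f \<in> borel_measurable M" "g \<in> borel_measurable M"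
    using assms by (auto simp: L2_def)
  let ?I = "LINT x|M. cmod (f x) * cmod (g x)"
  have I: "(\<integral>\<^sup>+x. ennreal (cmod (f x)) * ennreal (cmod (g x)) \<partial>M) = ennreal ?I"
    using L2_abs_mult_integrable[OF assms]
    by (subst nn_integral_eq_integral[symmetric]) (auto simp: ennreal_mult)
  have "ennreal (?I\<^sup>2) \<le> ennreal ((n2 M f)\<^sup>2 * (n2 M g)\<^sup>2)"
    using Cauchy_Schwarz_nn_integral[of "\<lambda>x. ennreal (cmod (f x))" M "\<lambda>x. ennreal (cmod (g x))"]
      n2_nn_integral[OF assms(1)] n2_nn_integral[OF assms(2)]
    by (simp add: I ennreal_power ennreal_mult Bochner_Integration.integral_nonneg)
  then have "?I\<^sup>2 \<le> (n2 M f * n2 M g)\<^sup>2"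
    by (simp add: power_mult_distrib)
  then show ?thesis
    by (rule power2_le_imp_le) auto
qed

lemma cmod_integral_mult_le:
  assumes "L2 M f" "L2 M g"
  shows "cmod (LINT x|M. f x * g x) \<le> n2 M f * n2 M g"
proof -
  have "cmod (LINT x|M. f x * g x) \<le> (LINT x|M. cmod (f x * g x))"
    by (rule integral_norm_bound)
  then show ?thesis
    using integral_cmod_mult_le[OF assms] by (simp add: norm_mult)
qed

lemma n2_triangle:
  assumes "L2 M f" "L2 M g"
  shows "n2 M (\<lambda>x. f x + g x) \<le> n2 M f + n2 M g"
proof -
  have [measurable]: "f \<in> borel_measurable M" "g \<in> borel_measurable M"
    using assms by (auto simp: L2_def)
  have "(n2 M (\<lambda>x. f x + g x))\<^sup>2 = (LINT x|M. (cmod (f x + g x))\<^sup>2)"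
    by (rule n2_power2)
  also have "\<dots> \<le> (LINT x|M. (cmod (f x))\<^sup>2 + 2 * (cmod (f x) * cmod (g x)) + (cmod (g x))\<^sup>2)"
  proof (rule integral_mono)
    show "integrable M (\<lambda>x. (cmod (f x + g x))\<^sup>2)"
      by (rule L2_integrable[OF L2_add[OF assms]])
    show "integrable M (\<lambda>x. (cmod (f x))\<^sup>2 + 2 * (cmod (f x) * cmod (g x)) + (cmod (g x))\<^sup>2)"
      using assms L2_abs_mult_integrable[OF assms] by (auto simp: L2_def)
    fix x
    have "(cmod (f x + g x))\<^sup>2 \<le> (cmod (f x) + cmod (g x))\<^sup>2"
      by (intro power_mono norm_triangle_ineq) auto
    then show "(cmod (f x + g x))\<^sup>2 \<le> (cmod (f x))\<^sup>2 + 2 * (cmod (f x) * cmod (g x)) + (cmod (g x))\<^sup>2"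
      by (simp add: power2_sum)
  qed
  also have "\<dots> = (n2 M f)\<^sup>2 + 2 * (LINT x|M. cmod (f x) * cmod (g x)) + (n2 M g)\<^sup>2"
    using assms L2_abs_mult_integrable[OF assms] by (simp add: L2_def n2_power2)
  also have "\<dots> \<le> (n2 M f)\<^sup>2 + 2 * (n2 M f * n2 M g) + (n2 M g)\<^sup>2"
    using integral_cmod_mult_le[OF assms] by simp
  also have "\<dots> = (n2 M f + n2 M g)\<^sup>2"
    by (simp add: power2_sum)
  finally show ?thesis
    by (rule power2_le_imp_le) simp
qed

lemma n2_triangle_diff:
  assumes "L2 M f" "L2 M g" "L2 M h"
  shows "n2 M (\<lambda>x. f x - h x) \<le> n2 M (\<lambda>x. f x - g x) + n2 M (\<lambda>x. g x - h x)"
  using n2_triangle[OF L2_diff[OF assms(1,2)] L2_diff[OF assms(2,3)]] by simp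

lemma n2_le_add_diff:
  assumes "L2 M f" "L2 M g"
  shows "n2 M f \<le> n2 M g + n2 M (\<lambda>x. f x - g x)"
  using n2_triangle[OF assms(2) L2_diff[OF assms]] by simp

lemma n2_diff_le:
  assumes "L2 M f" "L2 M g"
  shows "\<bar>n2 M f - n2 M g\<bar> \<le> n2 M (\<lambda>x. f x - g x)"
  using n2_le_add_diff[OF assms] n2_le_add_diff[OF assms(2,1)] n2_minus_commute[of M f g] by simp

lemma n2_eq_0_AE:
  assumes "L2 M f" "n2 M f = 0"
  shows "AE x in M. f x = 0"
proof -
  have "(LINT x|M. (cmod (f x))\<^sup>2) = 0"
    using assms(2) n2_power2[of M f] by simp
  then show ?thesis
    using integral_nonneg_eq_0_iff_AE[OF L2_integrable[OF assms(1)]] by simp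
qed

section \<open>Limits and completeness in L2\<close>

lemma L2_dominated_convergence:
  assumes "\<And>k. f k \<in> borel_measurable M" "g \<in> borel_measurable M" "L2 M h"
    and "\<And>k. AE x in M. cmod (f k x) \<le> cmod (h x)"
    and "AE x in M. (\<lambda>k. f k x) \<longlonglongrightarrow> g x"
  shows "L2 M g" "(\<lambda>k. n2 M (\<lambda>x. f k x - g x)) \<longlonglongrightarrow> 0"
proof -
  note [measurable] = assms(1,2)
  have all: "AE x in M. \<forall>k. cmod (f k x) \<le> cmod (h x)"
    using assms(4) by (simp add: AE_all_countable)
  have gh: "AE x in M. cmod (g x) \<le> cmod (h x)"
    using all assms(5)
  proof eventually_elim
    case (elim x)
    have "(\<lambda>k. cmod (f k x)) \<longlonglongrightarrow> cmod (g x)" using elim(2) by (rule tendsto_norm)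
    then show ?case by (rule LIMSEQ_le_const2) (use elim in auto)
  qed
  show "L2 M g" using L2_dominated[OF assms(3,2) gh] .
  have "(\<lambda>k. LINT x|M. (cmod (f k x - g x))\<^sup>2) \<longlonglongrightarrow> (LINT x|M. 0)"
  proof (rule integral_dominated_convergence)
    show "integrable M (\<lambda>x. 4 * (cmod (h x))\<^sup>2)" using assms(3) by (simp add: L2_def)
    show "AE x in M. (\<lambda>k. (cmod (f k x - g x))\<^sup>2) \<longlonglongrightarrow> 0"
      using assms(5)
    proof eventually_elim
      case (elim x)
      have "(\<lambda>k. (cmod (f k x - g x))\<^sup>2) \<longlonglongrightarrow> (cmod (g x - g x))\<^sup>2"
        by (intro tendsto_intros elim)
      then show ?case by simp
    qed
    fix k
    show "AE x in M. norm ((cmod (f k x - g x))\<^sup>2) \<le> 4 * (cmod (h x))\<^sup>2"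
      using all gh
    proof eventually_elim
      case (elim x)
      have "cmod (f k x - g x) \<le> 2 * cmod (h x)"
        using elim norm_triangle_ineq4[of "f k x" "g x"] by (smt (verit))
      then have "(cmod (f k x - g x))\<^sup>2 \<le> (2 * cmod (h x))\<^sup>2"
        by (intro power_mono) auto
      then show ?case by (simp add: power_mult_distrib)
    qed
  qed auto
  then have "(\<lambda>k. sqrt (LINT x|M. (cmod (f k x - g x))\<^sup>2)) \<longlonglongrightarrow> sqrt 0"
    by (intro tendsto_real_sqrt) simp
  then show "(\<lambda>k. n2 M (\<lambda>x. f k x - g x)) \<longlonglongrightarrow> 0"
    by (simp add: n2_def)
qed

text \<open>The bound may start late in the sequence because \<open>L2_complete\<close> applies this
  to differences that are small for large indices only.\<close>

lemma n2_Fatou: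
  assumes "\<And>k. L2 M (f k)" "g \<in> borel_measurable M" "AE x in M. (\<lambda>k. f k x) \<longlonglongrightarrow> g x"
    and "\<forall>\<^sub>F k in sequentially. n2 M (f k) \<le> C" "0 \<le> C"
  shows "L2 M g" "n2 M g \<le> C"
proof -
  have [measurable]: "\<And>k. f k \<in> borel_measurable M" "g \<in> borel_measurable M"
    using assms by (auto simp: L2_def)
  have "AE x in M. (\<lambda>k. ennreal ((cmod (f k x))\<^sup>2)) \<longlonglongrightarrow> ennreal ((cmod (g x))\<^sup>2)"
    using assms(3) by eventually_elim (intro tendsto_ennrealI tendsto_intros)
  then have eq: "AE x in M. ennreal ((cmod (g x))\<^sup>2) = liminf (\<lambda>k. ennreal ((cmod (f k x))\<^sup>2))"
    by eventually_elim (rule lim_imp_Liminf[symmetric], simp, assumption)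
  have "(\<integral>\<^sup>+x. ennreal ((cmod (g x))\<^sup>2) \<partial>M) = (\<integral>\<^sup>+x. liminf (\<lambda>k. ennreal ((cmod (f k x))\<^sup>2)) \<partial>M)"
    by (rule nn_integral_cong_AE[OF eq])
  also have "\<dots> \<le> liminf (\<lambda>k. \<integral>\<^sup>+x. ennreal ((cmod (f k x))\<^sup>2) \<partial>M)"
    by (rule nn_integral_liminf) auto
  also have "\<dots> = liminf (\<lambda>k. ennreal ((n2 M (f k))\<^sup>2))"
    using assms(1) by (simp add: n2_nn_integral)
  also have "\<dots> \<le> liminf (\<lambda>k. ennreal (C\<^sup>2))"
    by (rule Liminf_mono) (use assms(4) in \<open>eventually_elim, auto intro!: ennreal_leI power_mono\<close>)
  also have "\<dots> = ennreal (C\<^sup>2)"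
    by (simp add: Liminf_const)
  finally show "L2 M g" "n2 M g \<le> C"
    using n2_le_nn_integral[of g M C] assms(5) by auto
qed

text \<open>Riesz-Fischer. A subsequence with increments of norm at most 4^-k converges almost
  everywhere, and Fatou's lemma carries the Cauchy bound of the whole sequence over to its
  limit.\<close>

theorem L2_complete:
  assumes L2: "\<And>k. L2 M (f k)"
    and Cauchy: "\<And>e. 0 < e \<Longrightarrow> \<exists>N. \<forall>m\<ge>N. \<forall>n\<ge>N. n2 M (\<lambda>x. f m x - f n x) \<le> e"
  obtains g where "L2 M g" "(\<lambda>k. n2 M (\<lambda>x. f k x - g x)) \<longlonglongrightarrow> 0"
proof -
  have [measurable]: "\<And>k. f k \<in> borel_measurable M"
    using L2 by (auto simp: L2_def)
  have "\<forall>k. \<exists>N. \<forall>m\<ge>N. \<forall>n\<ge>N. n2 M (\<lambda>x. f m x - f n x) \<le> (1/4) ^ k"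
    using Cauchy by simp
  then obtain r0 where r0: "\<And>k m n. m \<ge> r0 k \<Longrightarrow> n \<ge> r0 k \<Longrightarrow> n2 M (\<lambda>x. f m x - f n x) \<le> (1/4) ^ k"
    by metis
  \<comment> \<open>Partial sums make the index sequence monotone and keep it above
    \<open>r0\<close>.\<close>
  define r where "r k = (\<Sum>i\<le>k. r0 i)" for k
  have r_ge: "r0 k \<le> r k" "r k \<le> r (Suc k)" for k
    unfolding r_def by (auto intro: member_le_sum)
  define h where "h k = f (r k)" for k
  have [measurable]: "\<And>k. h k \<in> borel_measurable M"
    by (simp add: h_def)
  have hL2: "L2 M (h k)" for k by (simp add: h_def L2)
  define d where "d k x = h (Suc k) x - h k x" for k x
  have [measurable]: "\<And>k. d k \<in> borel_measurable M"
    unfolding d_def[abs_def] by measurable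
  have dL2: "L2 M (d k)" for k unfolding d_def by (intro L2_diff hL2)
  have d_le: "n2 M (d k) \<le> (1/4) ^ k" for k
    unfolding d_def[abs_def] h_def using r_ge[of k] r0[of k] le_trans by blast
  \<comment> \<open>The weight 4^k is affordable because the squared norm of \<open>d k\<close> is
    at most 16^-k. Finiteness of the weighted sum bounds \<open>d k x\<close> by a constant times
    2^-k at almost every x, which is summable.\<close>
  have "(\<integral>\<^sup>+x. (\<Sum>k. ennreal (4 ^ k * (cmod (d k x))\<^sup>2)) \<partial>M)
      = (\<Sum>k. \<integral>\<^sup>+x. ennreal (4 ^ k * (cmod (d k x))\<^sup>2) \<partial>M)"
    by (rule nn_integral_suminf) simp
  also have "\<dots> = (\<Sum>k. ennreal (4 ^ k * (n2 M (d k))\<^sup>2))"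
    by (intro suminf_cong) (simp add: ennreal_mult nn_integral_cmult n2_nn_integral[OF dL2])
  also have "\<dots> \<le> (\<Sum>k. ennreal ((1/4) ^ k))"
  proof (intro suminf_le ennreal_leI)
    fix k
    have "4 ^ k * (n2 M (d k))\<^sup>2 \<le> 4 ^ k * ((1/4) ^ k)\<^sup>2"
      by (intro mult_left_mono power_mono d_le) auto
    also have "\<dots> = (1/4::real) ^ k"
      by (simp add: power2_eq_square power_divide)
    finally show "4 ^ k * (n2 M (d k))\<^sup>2 \<le> (1/4) ^ k" .
  qed auto
  also have "\<dots> = ennreal (\<Sum>k. (1/4) ^ k)"
    by (rule suminf_ennreal2) (auto intro: summable_geometric)
  finally have fin: "(\<integral>\<^sup>+x. (\<Sum>k. ennreal (4 ^ k * (cmod (d k x))\<^sup>2)) \<partial>M) \<noteq> \<infinity>"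
    by (auto simp: top_unique)
  have AE_fin: "AE x in M. (\<Sum>k. ennreal (4 ^ k * (cmod (d k x))\<^sup>2)) \<noteq> \<infinity>"
    by (rule nn_integral_PInf_AE[OF _ fin]) measurable
  have conv: "AE x in M. convergent (\<lambda>k. h k x)"
    using AE_fin
  proof eventually_elim
    case (elim x)
    then have "summable (\<lambda>k. 4 ^ k * (cmod (d k x))\<^sup>2)"
      by (intro summable_suminf_not_top) auto
    then have "Bseq (\<lambda>k. 4 ^ k * (cmod (d k x))\<^sup>2)"
      by (intro convergent_imp_Bseq) (use summable_LIMSEQ_zero convergent_def in blast)
    then obtain C where C: "0 < C" "\<And>k. norm (4 ^ k * (cmod (d k x))\<^sup>2) \<le> C"
      by (auto simp: Bseq_def)
    have "cmod (d k x) \<le> sqrt C * (1/2) ^ k" for k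
    proof -
      have "(2 ^ k * cmod (d k x))\<^sup>2 \<le> (sqrt C)\<^sup>2"
      proof -
        have "(2 ^ k)\<^sup>2 = (4::real) ^ k"
          by (simp add: power2_eq_square flip: power_mult_distrib)
        then show ?thesis
          using C(2)[of k] \<open>0 < C\<close> by (simp add: power_mult_distrib abs_mult)
      qed
      then have "2 ^ k * cmod (d k x) \<le> sqrt C"
        by (rule power2_le_imp_le) (use C in auto)
      then show ?thesis by (simp add: field_simps)
    qed
    then have "summable (\<lambda>k. d k x)"
      by (intro summable_comparison_test'[where g = "\<lambda>k. sqrt C * (1/2) ^ k" and N = 0 and f = "\<lambda>k. d k x",
            OF summable_mult[OF summable_geometric]]) simp_all
    then have "convergent (\<lambda>n. \<Sum>k<n. d k x)"
      by (simp add: summable_iff_convergent)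
    moreover have "(\<Sum>k<n. d k x) = h n x - h 0 x" for n
      unfolding d_def by (rule sum_lessThan_telescope)
    ultimately have "convergent (\<lambda>n. h n x - h 0 x)" by simp
    then have "convergent (\<lambda>n. (h n x - h 0 x) + h 0 x)"
      by (intro convergent_add convergent_const)
    then show ?case by simp
  qed
  define g where "g x = lim (\<lambda>k. h k x)" for x
  have [measurable]: "g \<in> borel_measurable M"
    unfolding g_def[abs_def] by measurable
  have lim: "AE x in M. (\<lambda>k. h k x) \<longlonglongrightarrow> g x"
    using conv by eventually_elim (simp add: g_def convergent_LIMSEQ_iff)
  have key: "L2 M (\<lambda>x. f m x - g x) \<and> n2 M (\<lambda>x. f m x - g x) \<le> (1/4) ^ j" if "m \<ge> r0 j" for m j
  proof -
    have "\<forall>\<^sub>F k in sequentially. n2 M (\<lambda>x. f m x - h k x) \<le> (1/4) ^ j"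
    proof (rule eventually_sequentiallyI)
      fix k assume "j \<le> k"
      have "mono r" by (rule incseq_SucI) (rule r_ge)
      then have "r j \<le> r k" using \<open>j \<le> k\<close> by (rule monoD)
      then show "n2 M (\<lambda>x. f m x - h k x) \<le> (1/4) ^ j"
        unfolding h_def using r_ge[of j] that by (intro r0) auto
    qed
    moreover have "AE x in M. (\<lambda>k. f m x - h k x) \<longlonglongrightarrow> f m x - g x"
      using lim by eventually_elim (intro tendsto_intros)
    ultimately show ?thesis
      using n2_Fatou[of M "\<lambda>k x. f m x - h k x" "\<lambda>x. f m x - g x" "(1/4)^j"] L2_diff[OF L2 hL2]
      by auto
  qed
  have "L2 M (\<lambda>x. f (r0 0) x - (f (r0 0) x - g x))"
    using L2_diff[OF L2, of "\<lambda>x. f (r0 0) x - g x" "r0 0"] key[of 0 "r0 0"] by blast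
  then have "L2 M g" by simp
  moreover have "(\<lambda>k. n2 M (\<lambda>x. f k x - g x)) \<longlonglongrightarrow> 0"
  proof (rule LIMSEQ_I)
    fix e :: real assume "0 < e"
    then obtain j where j: "(1/4::real) ^ j < e"
      using real_arch_pow_inv[of e "1/4"] by auto
    show "\<exists>N. \<forall>k\<ge>N. norm (n2 M (\<lambda>x. f k x - g x) - 0) < e"
      using key j by (intro exI[of _ "r0 j"]) (auto intro: le_less_trans)
  qed
  ultimately show thesis by (rule that)
qed

lemma L2_Cauchy_of_tendsto:
  assumes "\<And>k. L2 M (f k)" "L2 M g" "(\<lambda>k. n2 M (\<lambda>x. f k x - g x)) \<longlonglongrightarrow> 0" "0 < e"
  shows "\<exists>N. \<forall>m\<ge>N. \<forall>n\<ge>N. n2 M (\<lambda>x. f m x - f n x) \<le> e"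
proof -
  obtain N where N: "\<And>k. k \<ge> N \<Longrightarrow> norm (n2 M (\<lambda>x. f k x - g x) - 0) < e / 2"
    using LIMSEQ_D[OF assms(3), of "e/2"] \<open>0 < e\<close> by auto
  show ?thesis
  proof (intro exI[of _ N] allI impI)
    fix m n assume "N \<le> m" "N \<le> n"
    then show "n2 M (\<lambda>x. f m x - f n x) \<le> e"
      using n2_triangle_diff[OF assms(1)[of m] assms(2) assms(1)[of n]] N[of m] N[of n]
        n2_minus_commute[of M g "f n"] by simp
  qed
qed

lemma tendsto_n2:
  assumes "\<And>k. L2 M (f k)" "L2 M g" "(\<lambda>k. n2 M (\<lambda>x. f k x - g x)) \<longlonglongrightarrow> 0"
  shows "(\<lambda>k. n2 M (f k)) \<longlonglongrightarrow> n2 M g"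
proof -
  have "(\<lambda>k. n2 M (f k) - n2 M g) \<longlonglongrightarrow> 0"
    by (rule Lim_null_comparison[OF _ assms(3)]) (auto intro!: always_eventually n2_diff_le assms)
  then show ?thesis by (simp add: LIM_zero_iff)
qed

lemma tendsto_integral_L2_mult:
  assumes "\<And>k. L2 M (f k)" "L2 M g" "(\<lambda>k. n2 M (\<lambda>x. f k x - g x)) \<longlonglongrightarrow> 0" "L2 M h"
  shows "(\<lambda>k. LINT x|M. f k x * h x) \<longlonglongrightarrow> (LINT x|M. g x * h x)"
proof -
  have "(\<lambda>k. (LINT x|M. f k x * h x) - (LINT x|M. g x * h x)) \<longlonglongrightarrow> 0"
  proof (rule Lim_null_comparison)
    show "(\<lambda>k. n2 M (\<lambda>x. f k x - g x) * n2 M h) \<longlonglongrightarrow> 0"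
      using tendsto_mult_left_zero[OF assms(3)] .
    show "\<forall>\<^sub>F k in sequentially. cmod ((LINT x|M. f k x * h x) - (LINT x|M. g x * h x))
        \<le> n2 M (\<lambda>x. f k x - g x) * n2 M h"
    proof (rule always_eventually, rule allI)
      fix k
      have "(LINT x|M. f k x * h x) - (LINT x|M. g x * h x) = (LINT x|M. (f k x - g x) * h x)"
        using assms by (simp add: left_diff_distrib L2_mult_integrable)
      then show "cmod ((LINT x|M. f k x * h x) - (LINT x|M. g x * h x)) \<le> n2 M (\<lambda>x. f k x - g x) * n2 M h"
        using cmod_integral_mult_le[OF L2_diff[OF assms(1,2)] assms(4)] by simp
    qed
  qed
  then show ?thesis by (simp add: LIM_zero_iff)
qed

section \<open>Schwartz functions\<close>

lemma partial_deriv_eq: "(f has_derivative D) (at x) \<Longrightarrow> partial_deriv i f x = D (axis i 1)"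
  by (simp add: partial_deriv_def flip: frechet_derivative_at)

lemma differentiable_has_derivative:
  "f differentiable (at x) \<Longrightarrow> (f has_derivative frechet_derivative f (at x)) (at x)"
  by (simp add: frechet_derivative_works)

lemma partial_deriv_const: "partial_deriv i (\<lambda>x. c) = (\<lambda>x. 0)"
  by (rule ext, rule partial_deriv_eq[OF has_derivative_const])

lemma partial_deriv_add:
  assumes "\<And>x. f differentiable (at x)" "\<And>x. g differentiable (at x)"
  shows "partial_deriv i (\<lambda>x. f x + g x) = (\<lambda>x. partial_deriv i f x + partial_deriv i g x)"
  by (rule ext, rule trans[OF partial_deriv_eq[OF has_derivative_add
        [OF differentiable_has_derivative[OF assms(1)] differentiable_has_derivative[OF assms(2)]]]])
    (simp add: partial_deriv_def)

lemma partial_deriv_mult: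
  assumes "\<And>x. f differentiable (at x)" "\<And>x. g differentiable (at x)"
  shows "partial_deriv i (\<lambda>x. f x * g x) = (\<lambda>x. f x * partial_deriv i g x + partial_deriv i f x * g x)"
  by (rule ext, rule trans[OF partial_deriv_eq[OF has_derivative_mult
        [OF differentiable_has_derivative[OF assms(1)] differentiable_has_derivative[OF assms(2)]]]])
    (simp add: partial_deriv_def)

text \<open>Closure properties of the Schwartz class are proved by exhibiting a family
  \<open>P\<close> that is stable under partial derivatives; this avoids any formula for iterated
  derivatives of products or compositions.\<close>

lemma schwartz_coinduct:
  assumes "P f"
    and "\<And>g x. P g \<Longrightarrow> g differentiable (at x)"
    and "\<And>g j. P g \<Longrightarrow> P (partial_deriv j g)"
    and "\<And>g k. P g \<Longrightarrow> \<exists>C. \<forall>x. (1 + norm x) ^ k * cmod (g x) \<le> C"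
  shows "schwartz f"
proof -
  have P: "P (iter_partial js f)" for js
    by (induction js) (auto simp: iter_partial_def assms)
  have "bdd_above (range (\<lambda>x. (1 + norm x) ^ k * cmod (iter_partial js f x)))" for js k
    using assms(4)[OF P[of js], of k] by (auto simp: bdd_above_def)
  then show ?thesis
    using assms(2)[OF P] by (auto simp: schwartz_def)
qed

lemma schwartz_differentiable: "schwartz f \<Longrightarrow> f differentiable (at x)"
  by (drule schwartz_def[THEN iffD1], drule conjunct1, drule spec[of _ "[]"]) (simp add: iter_partial_def)

lemma schwartz_partial_deriv: "schwartz f \<Longrightarrow> schwartz (partial_deriv j f)"
proof -
  assume *: "schwartz f"
  have "iter_partial js (partial_deriv j f) = iter_partial (js @ [j]) f" for js
    by (simp add: iter_partial_def)
  then show ?thesis using * by (simp add: schwartz_def)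
qed

lemma schwartz_decay:
  assumes "schwartz f"
  obtains C where "\<And>x. (1 + norm x) ^ k * cmod (f x) \<le> C" "0 \<le> C"
proof -
  have "bdd_above (range (\<lambda>x. (1 + norm x) ^ k * cmod (iter_partial [] f x)))"
    using assms unfolding schwartz_def by (elim conjE allE)
  then obtain C where C: "\<And>x. (1 + norm x) ^ k * cmod (f x) \<le> C"
    by (auto simp: bdd_above_def iter_partial_def)
  have "0 \<le> (1 + norm (0::real^'a)) ^ k * cmod (f 0)" by simp
  also have "\<dots> \<le> C" by (rule C)
  finally show thesis using C that by blast
qed

lemma schwartz_continuous: "schwartz f \<Longrightarrow> continuous_on UNIV f"
  using schwartz_differentiable differentiable_imp_continuous_within
  by (metis continuous_at_imp_continuous_on)

lemma schwartz_measurable [measurable_dest]: "schwartz f \<Longrightarrow> f \<in> borel_measurable borel"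
  by (rule borel_measurable_continuous_onI[OF schwartz_continuous])

lemma schwartz_has_derivative:
  assumes "schwartz f"
  shows "(f has_derivative (\<lambda>h. \<Sum>j\<in>UNIV. complex_of_real (h $ j) * partial_deriv j f x)) (at x)"
proof -
  let ?D = "frechet_derivative f (at x)"
  have D: "(f has_derivative ?D) (at x)"
    by (rule differentiable_has_derivative[OF schwartz_differentiable[OF assms]])
  then have lin: "linear ?D" by (rule has_derivative_linear)
  have "?D h = (\<Sum>j\<in>UNIV. complex_of_real (h $ j) * partial_deriv j f x)" for h
  proof -
    have "?D h = ?D (\<Sum>j\<in>UNIV. (h $ j) *\<^sub>R axis j 1)"
      by (simp add: basis_expansion flip: scalar_mult_eq_scaleR)
    also have "\<dots> = (\<Sum>j\<in>UNIV. (h $ j) *\<^sub>R ?D (axis j 1))"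
      by (simp add: linear_sum[OF lin] linear_scale[OF lin])
    finally show ?thesis by (simp add: partial_deriv_def scaleR_conv_of_real)
  qed
  then have "?D = (\<lambda>h. \<Sum>j\<in>UNIV. complex_of_real (h $ j) * partial_deriv j f x)" by auto
  then show ?thesis using D by simp
qed

text \<open>Just large enough to contain the smooth multipliers of slow growth that occur below and to be
  closed under partial derivatives.\<close>

inductive slow :: "(real^'n::finite \<Rightarrow> complex) \<Rightarrow> bool" where
  slow_const: "slow (\<lambda>x. c)"
| slow_coord: "slow (\<lambda>x. complex_of_real (x $ j))"
| slow_bracket: "slow (\<lambda>x. complex_of_real ((1 + (norm x)\<^sup>2) powr r))"
| slow_add: "slow f \<Longrightarrow> slow g \<Longrightarrow> slow (\<lambda>x. f x + g x)"
| slow_mult: "slow f \<Longrightarrow> slow g \<Longrightarrow> slow (\<lambda>x. f x * g x)"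
| slow_exp: "slow p \<Longrightarrow> (\<And>x. 0 \<le> Re (p x)) \<Longrightarrow> slow (\<lambda>x. exp (- p x))"

lemma one_le_bracket: "1 \<le> (1::real) + (norm x)\<^sup>2"
  by simp

lemma has_derivative_bracket:
  fixes x :: "real^'n"
  shows "((\<lambda>x. complex_of_real ((1 + (norm x)\<^sup>2) powr r)) has_derivative
    (\<lambda>h. complex_of_real (r * (1 + (norm x)\<^sup>2) powr (r - 1) * (2 * (x \<bullet> h))))) (at x)"
proof -
  have pos: "0 < 1 + x \<bullet> x" using inner_ge_zero[of x] by linarith
  have 1: "((\<lambda>x. 1 + x \<bullet> x) has_derivative (\<lambda>h. 2 * (x \<bullet> h))) (at x)"
    using has_derivative_add[OF has_derivative_const has_derivative_inner[OF has_derivative_ident has_derivative_ident], of 1 x UNIV]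
    by (simp add: inner_commute mult_2[symmetric])
  have 2: "((\<lambda>y. y powr r) has_derivative (*) (r * (1 + x \<bullet> x) powr (r - 1))) (at (1 + x \<bullet> x))"
    using has_real_derivative_powr[OF pos, of r] by (simp add: has_field_derivative_def)
  have "((\<lambda>x. (1 + x \<bullet> x) powr r) has_derivative
      (\<lambda>h. r * (1 + x \<bullet> x) powr (r - 1) * (2 * (x \<bullet> h)))) (at x)"
    using has_derivative_compose[OF 1 2] by simp
  then show ?thesis
    unfolding power2_norm_eq_inner by (rule has_derivative_of_real)
qed

lemma slow_differentiable: "slow m \<Longrightarrow> m differentiable (at x)"
proof (induction rule: slow.induct)
  case (slow_coord j)
  have "((\<lambda>x. complex_of_real (x $ j)) has_derivative (\<lambda>x. complex_of_real (x $ j))) (at x)"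
    by (intro has_derivative_of_real bounded_linear_imp_has_derivative bounded_linear_vec_nth)
  then show ?case by (auto simp: differentiable_def)
next
  case (slow_bracket r)
  then show ?case using has_derivative_bracket by (auto simp: differentiable_def)
next
  case (slow_exp p)
  then obtain D where D: "(p has_derivative D) (at x)" by (auto simp: differentiable_def)
  have "(exp has_derivative (*) (exp (- p x))) (at (- p x))"
    using DERIV_exp[of "- p x"] by (simp add: has_field_derivative_def)
  from has_derivative_compose[OF has_derivative_minus[OF D] this] show ?case
    by (auto simp: differentiable_def)
qed (auto intro: differentiable_add differentiable_mult)

lemma slow_partial_deriv: "slow m \<Longrightarrow> slow (partial_deriv j m)"
proof (induction rule: slow.induct)
  case (slow_const c)
  then show ?case by (simp add: partial_deriv_const slow.slow_const)
next
  case (slow_coord i)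
  have "((\<lambda>x. complex_of_real (x $ i)) has_derivative (\<lambda>x. complex_of_real (x $ i))) (at x)" for x :: "real^'a"
    by (intro has_derivative_of_real bounded_linear_imp_has_derivative bounded_linear_vec_nth)
  from partial_deriv_eq[OF this] have "partial_deriv j (\<lambda>x. complex_of_real (x $ i))
      = (\<lambda>x. complex_of_real (axis j 1 $ i))" by auto
  then show ?case by (simp add: slow.slow_const)
next
  case (slow_bracket r)
  have eq: "partial_deriv j (\<lambda>x. complex_of_real ((1 + (norm x)\<^sup>2) powr r))
      = (\<lambda>x. (of_real (2 * r) * complex_of_real (x $ j)) * complex_of_real ((1 + (norm x)\<^sup>2) powr (r - 1)))"
    by (rule ext, rule trans[OF partial_deriv_eq[OF has_derivative_bracket]])
      (simp add: cart_eq_inner_axis[symmetric])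
  show ?case unfolding eq by (intro slow.intros)
next
  case (slow_add f g)
  then show ?case
    by (subst partial_deriv_add) (auto intro: slow_differentiable slow.slow_add)
next
  case (slow_mult f g)
  then show ?case
    by (subst partial_deriv_mult) (auto intro!: slow_differentiable slow.slow_add slow.slow_mult)
next
  case (slow_exp p)
  have "partial_deriv j (\<lambda>x. exp (- p x)) = (\<lambda>x. ((-1) * partial_deriv j p x) * exp (- p x))"
  proof
    fix x
    have D: "(p has_derivative frechet_derivative p (at x)) (at x)"
      by (rule differentiable_has_derivative[OF slow_differentiable[OF slow_exp(1)]])
    have "(exp has_derivative (*) (exp (- p x))) (at (- p x))"
      using DERIV_exp[of "- p x"] by (simp add: has_field_derivative_def)
    from partial_deriv_eq[OF has_derivative_compose[OF has_derivative_minus[OF D] this]]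
    show "partial_deriv j (\<lambda>x. exp (- p x)) x = ((-1) * partial_deriv j p x) * exp (- p x)"
      by (simp add: partial_deriv_def mult.commute)
  qed
  then show ?case
    using slow_exp by (simp only:) (intro slow.slow_mult slow.slow_const slow.slow_exp)
qed

lemma one_plus_norm_power_mono:
  "N \<le> K \<Longrightarrow> (1 + norm x) ^ N \<le> (1 + norm x) ^ K"
  by (rule power_increasing) auto

lemma slow_growth: "slow m \<Longrightarrow> \<exists>C N. 0 \<le> C \<and> (\<forall>x. cmod (m x) \<le> C * (1 + norm x) ^ N)"
proof (induction rule: slow.induct)
  case (slow_const c)
  then show ?case by (intro exI[of _ "cmod c"] exI[of _ 0]) auto
next
  case (slow_coord j)
  have "\<bar>x $ j\<bar> \<le> 1 + norm x" for x :: "real^'a"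
    using component_le_norm_cart[of x j] by simp
  then show ?case by (intro exI[of _ 1]) auto
next
  case (slow_bracket r)
  have "(1 + (norm x)\<^sup>2) powr r \<le> (1 + norm x) ^ (2 * nat \<lceil>\<bar>r\<bar>\<rceil>)" for x :: "real^'a"
  proof -
    have "(1 + (norm x)\<^sup>2) powr r \<le> (1 + (norm x)\<^sup>2) powr real (nat \<lceil>\<bar>r\<bar>\<rceil>)"
      by (rule powr_mono) (auto intro: order_trans[OF abs_ge_self] of_nat_ceiling)
    also have "\<dots> = (1 + (norm x)\<^sup>2) ^ nat \<lceil>\<bar>r\<bar>\<rceil>"
      by (rule powr_realpow) (use one_le_bracket[of x] in linarith)
    also have "\<dots> \<le> ((1 + norm x)\<^sup>2) ^ nat \<lceil>\<bar>r\<bar>\<rceil>"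
      by (rule power_mono) (auto simp: power2_sum)
    finally show ?thesis by (simp add: power_mult)
  qed
  then show ?case by (intro exI[of _ 1] exI[of _ "2 * nat \<lceil>\<bar>r\<bar>\<rceil>"]) auto
next
  case (slow_add f g)
  then obtain C N C' N' where *: "0 \<le> C" "0 \<le> C'" "\<And>x. cmod (f x) \<le> C * (1 + norm x) ^ N"
      "\<And>x. cmod (g x) \<le> C' * (1 + norm x) ^ N'" by blast
  have "cmod (f x + g x) \<le> (C + C') * (1 + norm x) ^ (N + N')" for x
  proof -
    have "cmod (f x + g x) \<le> C * (1 + norm x) ^ N + C' * (1 + norm x) ^ N'"
      using norm_triangle_ineq[of "f x" "g x"] *(3,4)[of x] by linarith
    also have "\<dots> \<le> C * (1 + norm x) ^ (N + N') + C' * (1 + norm x) ^ (N + N')"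
      by (intro add_mono mult_left_mono one_plus_norm_power_mono *) auto
    finally show ?thesis by (simp add: algebra_simps)
  qed
  then show ?case using * by (intro exI[of _ "C + C'"] exI[of _ "N + N'"]) auto
next
  case (slow_mult f g)
  then obtain C N C' N' where *: "0 \<le> C" "0 \<le> C'" "\<And>x. cmod (f x) \<le> C * (1 + norm x) ^ N"
      "\<And>x. cmod (g x) \<le> C' * (1 + norm x) ^ N'" by blast
  have "cmod (f x * g x) \<le> (C * C') * (1 + norm x) ^ (N + N')" for x
  proof -
    have "cmod (f x * g x) \<le> (C * (1 + norm x) ^ N) * (C' * (1 + norm x) ^ N')"
      unfolding norm_mult by (intro mult_mono *) (use *(1) in auto)
    then show ?thesis by (simp add: algebra_simps power_add)
  qed
  then show ?case using * by (intro exI[of _ "C * C'"] exI[of _ "N + N'"]) auto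
next
  \<comment> \<open>The nonnegative real part of \<open>p\<close> bounds the exponential by
    1.\<close>
  case (slow_exp p)
  then show ?case by (intro exI[of _ 1] exI[of _ 0]) auto
qed

text \<open>Products of a slow and a Schwartz function are not stable under partial derivatives,
  since the product rule yields a sum of two of them; finite sums of products are.\<close>

inductive slow_schwartz :: "(real^'n::finite \<Rightarrow> complex) \<Rightarrow> bool" where
  base: "slow m \<Longrightarrow> schwartz f \<Longrightarrow> slow_schwartz (\<lambda>x. m x * f x)"
| add: "slow_schwartz f \<Longrightarrow> slow_schwartz g \<Longrightarrow> slow_schwartz (\<lambda>x. f x + g x)"

lemma slow_schwartz_differentiable: "slow_schwartz f \<Longrightarrow> f differentiable (at x)"
  by (induction rule: slow_schwartz.induct)
    (auto intro: differentiable_add differentiable_mult slow_differentiable schwartz_differentiable)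

lemma slow_schwartz_imp_schwartz:
  assumes "slow_schwartz f"
  shows "schwartz f"
proof (rule schwartz_coinduct[where P = slow_schwartz])
  show "slow_schwartz f" by fact
next
  fix g :: "real^'a \<Rightarrow> complex" and x
  show "slow_schwartz g \<Longrightarrow> g differentiable (at x)" by (rule slow_schwartz_differentiable)
next
  fix g :: "real^'a \<Rightarrow> complex" and j
  assume "slow_schwartz g"
  then show "slow_schwartz (partial_deriv j g)"
  proof (induction rule: slow_schwartz.induct)
    case (base m f)
    have "slow_schwartz (\<lambda>x. m x * partial_deriv j f x + partial_deriv j m x * f x)"
      by (intro slow_schwartz.add slow_schwartz.base slow_partial_deriv schwartz_partial_deriv base)
    then show ?case
      by (simp add: partial_deriv_mult slow_differentiable[OF base(1)] schwartz_differentiable[OF base(2)])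
  next
    case (add f g)
    then show ?case
      by (subst partial_deriv_add) (auto intro: slow_schwartz_differentiable slow_schwartz.intros)
  qed
next
  fix g :: "real^'a \<Rightarrow> complex" and k
  assume "slow_schwartz g"
  then show "\<exists>C. \<forall>x. (1 + norm x) ^ k * cmod (g x) \<le> C"
  proof (induction rule: slow_schwartz.induct)
    case (base m f)
    obtain C N where C: "0 \<le> C" "\<And>x. cmod (m x) \<le> C * (1 + norm x) ^ N"
      using slow_growth[OF base(1)] by blast
    obtain C' where C': "\<And>x. (1 + norm x) ^ (k + N) * cmod (f x) \<le> C'"
      using schwartz_decay[OF base(2)] by metis
    have "(1 + norm x) ^ k * cmod (m x * f x) \<le> C * C'" for x
    proof -
      have "(1 + norm x) ^ k * cmod (m x * f x) \<le> (1 + norm x) ^ k * ((C * (1 + norm x) ^ N) * cmod (f x))"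
        unfolding norm_mult by (intro mult_left_mono mult_right_mono C) auto
      also have "\<dots> = C * ((1 + norm x) ^ (k + N) * cmod (f x))"
        by (simp add: power_add)
      also have "\<dots> \<le> C * C'" by (intro mult_left_mono C' C)
      finally show ?thesis .
    qed
    then show ?case by blast
  next
    case (add f g)
    then obtain C C' where *: "\<And>x. (1 + norm x) ^ k * cmod (f x) \<le> C" "\<And>x. (1 + norm x) ^ k * cmod (g x) \<le> C'"
      by blast
    have "(1 + norm x) ^ k * cmod (f x + g x) \<le> C + C'" for x
    proof -
      have "(1 + norm x) ^ k * cmod (f x + g x) \<le> (1 + norm x) ^ k * (cmod (f x) + cmod (g x))"
        by (intro mult_left_mono norm_triangle_ineq) auto
      then show ?thesis using *[of x] by (simp add: distrib_left)
    qed
    then show ?case by blast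
  qed
qed

section \<open>Closure properties of the Schwartz class\<close>

lemma schwartz_slow_mult: "slow m \<Longrightarrow> schwartz f \<Longrightarrow> schwartz (\<lambda>x. m x * f x)"
  by (rule slow_schwartz_imp_schwartz[OF slow_schwartz.base])

lemma schwartz_cmult: "schwartz f \<Longrightarrow> schwartz (\<lambda>x. c * f x)"
  using schwartz_slow_mult[OF slow_const] .

lemma schwartz_add:
  assumes "schwartz f" "schwartz g"
  shows "schwartz (\<lambda>x. f x + g x)"
proof -
  have "slow_schwartz (\<lambda>x. 1 * f x + 1 * g x)"
    by (intro slow_schwartz.intros slow_const assms)
  then show ?thesis by (auto dest: slow_schwartz_imp_schwartz)
qed

lemma schwartz_diff: "schwartz f \<Longrightarrow> schwartz g \<Longrightarrow> schwartz (\<lambda>x. f x - g x)"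
  using schwartz_add[of f "\<lambda>x. (-1) * g x"] schwartz_cmult[of g "-1"] by simp

text \<open>The family for \<open>schwartz_coinduct\<close> carries a free constant factor because
  each differentiation produces a factor \<open>c\<close>.\<close>

lemma schwartz_affine:
  fixes f :: "real^'n \<Rightarrow> complex"
  assumes "schwartz f" "c \<noteq> 0"
  shows "schwartz (\<lambda>x. f (c *\<^sub>R x + a))"
proof (rule schwartz_coinduct[where P = "\<lambda>h. \<exists>g b. schwartz g \<and> h = (\<lambda>x. b * g (c *\<^sub>R x + a))"])
  show "\<exists>g b. schwartz g \<and> (\<lambda>x. f (c *\<^sub>R x + a)) = (\<lambda>x. b * g (c *\<^sub>R x + a))"
    using assms by (intro exI[of _ f] exI[of _ 1]) auto
next
  fix h x assume "\<exists>g b. schwartz g \<and> h = (\<lambda>x. b * g (c *\<^sub>R x + a))"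
  then obtain g b where g: "schwartz g" "h = (\<lambda>x. b * g (c *\<^sub>R x + a))" by blast
  have D: "(h has_derivative (\<lambda>y. b * frechet_derivative g (at (c *\<^sub>R x + a)) (c *\<^sub>R y))) (at x)" for x
    unfolding g(2)
    by (intro has_derivative_mult_right has_derivative_compose[OF _ differentiable_has_derivative[OF schwartz_differentiable[OF g(1)]]])
      (auto intro!: derivative_eq_intros)
  then show "h differentiable (at x)" by (auto simp: differentiable_def)
  show "\<exists>g b. schwartz g \<and> partial_deriv j h = (\<lambda>x. b * g (c *\<^sub>R x + a))" for j
  proof (intro exI conjI)
    show "schwartz (partial_deriv j g)" by (rule schwartz_partial_deriv[OF g(1)])
    show "partial_deriv j h = (\<lambda>x. (b * c) * partial_deriv j g (c *\<^sub>R x + a))"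
    proof
      fix x
      have lin: "linear (frechet_derivative g (at (c *\<^sub>R x + a)))"
        by (rule linear_frechet_derivative[OF schwartz_differentiable[OF g(1)]])
      show "partial_deriv j h x = (b * c) * partial_deriv j g (c *\<^sub>R x + a)"
        unfolding partial_deriv_eq[OF D] linear_scale[OF lin] by (simp add: partial_deriv_def scaleR_conv_of_real)
    qed
  qed
next
  fix h k assume "\<exists>g b. schwartz g \<and> h = (\<lambda>x. b * g (c *\<^sub>R x + a))"
  then obtain g b where g: "schwartz g" "h = (\<lambda>x. b * g (c *\<^sub>R x + a))" by blast
  obtain C where C: "\<And>x. (1 + norm x) ^ k * cmod (g x) \<le> C"
    using schwartz_decay[OF g(1)] by metis
  \<comment> \<open>Undoing the substitution gives |c| |x| <= |c x + a| + |a|; the constant absorbs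
    both the shift and the scaling.\<close>
  define K where "K = 1 + (1 + norm a) / \<bar>c\<bar>"
  have K: "1 + norm x \<le> K * (1 + norm (c *\<^sub>R x + a))" for x
  proof -
    have "\<bar>c\<bar> * norm x \<le> norm (c *\<^sub>R x + a) + norm a"
      using norm_triangle_ineq4[of "c *\<^sub>R x + a" a] by simp
    then have "norm x \<le> (norm (c *\<^sub>R x + a) + norm a) / \<bar>c\<bar>"
      using \<open>c \<noteq> 0\<close> by (simp add: field_simps)
    also have "\<dots> \<le> ((1 + norm a) * (1 + norm (c *\<^sub>R x + a))) / \<bar>c\<bar>"
      by (intro divide_right_mono) (auto simp: algebra_simps)
    also have "\<dots> = (K - 1) * (1 + norm (c *\<^sub>R x + a))"
      by (simp add: K_def)
    finally show ?thesis by (simp add: left_diff_distrib) (use norm_ge_zero[of "c *\<^sub>R x + a"] in linarith)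
  qed
  have "(1 + norm x) ^ k * cmod (h x) \<le> K ^ k * cmod b * C" for x
  proof -
    have "(1 + norm x) ^ k * cmod (h x) \<le> (K * (1 + norm (c *\<^sub>R x + a))) ^ k * (cmod b * cmod (g (c *\<^sub>R x + a)))"
      unfolding g(2) norm_mult by (intro mult_right_mono power_mono K) auto
    also have "\<dots> = K ^ k * cmod b * ((1 + norm (c *\<^sub>R x + a)) ^ k * cmod (g (c *\<^sub>R x + a)))"
      by (simp add: power_mult_distrib)
    also have "\<dots> \<le> K ^ k * cmod b * C"
      by (intro mult_left_mono C) (simp add: K_def)
    finally show ?thesis .
  qed
  then show "\<exists>C. \<forall>x. (1 + norm x) ^ k * cmod (h x) \<le> C" by blast
qed

lemma schwartz_translate: "schwartz f \<Longrightarrow> schwartz (\<lambda>x. f (x + a))"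
  using schwartz_affine[of f 1 a] by simp

lemma schwartz_reflect: "schwartz f \<Longrightarrow> schwartz (\<lambda>x. f (- x))"
  using schwartz_affine[of f "-1" 0] by simp

lemma schwartz_cnj:
  assumes "schwartz f"
  shows "schwartz (\<lambda>x. cnj (f x))"
proof (rule schwartz_coinduct[where P = "\<lambda>h. \<exists>g. schwartz g \<and> h = (\<lambda>x. cnj (g x))"])
  show "\<exists>g. schwartz g \<and> (\<lambda>x. cnj (f x)) = (\<lambda>x. cnj (g x))" using assms by blast
next
  fix h x assume "\<exists>g. schwartz g \<and> h = (\<lambda>x. cnj (g x))"
  then obtain g where g: "schwartz g" "h = (\<lambda>x. cnj (g x))" by blast
  have D: "(h has_derivative (\<lambda>y. cnj (frechet_derivative g (at x) y))) (at x)" for x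
    unfolding g(2) by (rule bounded_linear.has_derivative[OF bounded_linear_cnj
          differentiable_has_derivative[OF schwartz_differentiable[OF g(1)]]])
  then show "h differentiable (at x)" by (auto simp: differentiable_def)
  have "partial_deriv j h = (\<lambda>x. cnj (partial_deriv j g x))" for j
    by (rule ext, simp only: partial_deriv_eq[OF D]) (simp add: partial_deriv_def)
  then show "\<exists>g. schwartz g \<and> partial_deriv j h = (\<lambda>x. cnj (g x))" for j
    using schwartz_partial_deriv[OF g(1)] by blast
next
  fix h k assume "\<exists>g. schwartz g \<and> h = (\<lambda>x. cnj (g x))"
  then obtain g where g: "schwartz g" "h = (\<lambda>x. cnj (g x))" by blast
  then show "\<exists>C. \<forall>x. (1 + norm x) ^ k * cmod (h x) \<le> C"
    using schwartz_decay[OF g(1), of k] by (metis complex_mod_cnj)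
qed

lemma slow_sum: "finite A \<Longrightarrow> (\<And>i. i \<in> A \<Longrightarrow> slow (f i)) \<Longrightarrow> slow (\<lambda>x. \<Sum>i\<in>A. f i x)"
  by (induction A rule: finite_induct) (auto intro: slow.intros)

lemma slow_power: "slow f \<Longrightarrow> slow (\<lambda>x. f x ^ k)"
  by (induction k) (auto intro: slow.intros)

lemma slow_inner: "slow (\<lambda>x. complex_of_real (x \<bullet> a))"
proof -
  have "slow (\<lambda>x. \<Sum>j\<in>UNIV. complex_of_real (a $ j) * complex_of_real (x $ j))"
    by (intro slow_sum slow.intros) auto
  then show ?thesis by (simp add: inner_vec_def mult.commute)
qed

lemma slow_norm2: "slow (\<lambda>x. complex_of_real ((norm x)\<^sup>2))"
proof -
  have "slow (\<lambda>x. \<Sum>j\<in>UNIV. complex_of_real (x $ j) * complex_of_real (x $ j))"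
    by (intro slow_sum slow.intros) auto
  then show ?thesis by (simp add: power2_norm_eq_inner inner_vec_def)
qed

section \<open>Gaussians\<close>

definition gauss :: "real \<Rightarrow> real^'n::finite \<Rightarrow> complex" where
  "gauss c x = exp (- complex_of_real (c * (norm x)\<^sup>2))"

lemma norm_gauss: "cmod (gauss c x) = exp (- (c * (norm x)\<^sup>2))"
  by (simp add: gauss_def)

lemma gauss_nonzero: "gauss c x \<noteq> 0"
  by (simp add: gauss_def)

text \<open>Every derivative of a Gaussian is a slow function times the same Gaussian, so the slow
  multiples form the family for \<open>schwartz_coinduct\<close>.\<close>

lemma schwartz_gauss:
  assumes "0 < c"
  shows "schwartz (gauss c :: real^'n::finite \<Rightarrow> complex)"
proof (rule schwartz_coinduct[where P = "\<lambda>h. \<exists>m. slow m \<and> h = (\<lambda>x::real^'n. m x * gauss c x)"])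
  have g: "slow (gauss c :: real^'n \<Rightarrow> complex)"
  proof -
    have "slow (\<lambda>x::real^'n. exp (- (complex_of_real c * complex_of_real ((norm x)\<^sup>2))))"
      by (intro slow_exp slow_mult slow_const slow_norm2) (use assms in auto)
    then show ?thesis by (simp add: gauss_def[abs_def])
  qed
  show "\<exists>m. slow m \<and> gauss c = (\<lambda>x::real^'n. m x * gauss c x)"
    by (intro exI[of _ "\<lambda>x. 1"]) (auto intro: slow_const)
  fix h x assume "\<exists>m. slow m \<and> h = (\<lambda>x::real^'n. m x * gauss c x)"
  then obtain m where m: "slow m" "h = (\<lambda>x. m x * gauss c x)" by blast
  then have "slow h" using g by (auto intro: slow_mult)
  then show "h differentiable (at x)" by (rule slow_differentiable)
  show "\<exists>m. slow m \<and> partial_deriv j h = (\<lambda>x. m x * gauss c x)" for j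
  proof -
    have D: "((\<lambda>x::real^'n. - complex_of_real (c * (norm x)\<^sup>2)) has_derivative
        (\<lambda>h. - complex_of_real (c * (2 * (x \<bullet> h))))) (at x)" for x :: "real^'n"
      unfolding power2_norm_eq_inner
      by (intro has_derivative_minus has_derivative_of_real has_derivative_mult_right)
        (auto intro!: derivative_eq_intros simp: inner_commute)
    have "(exp has_derivative (*) (gauss c x)) (at (- complex_of_real (c * (norm x)\<^sup>2)))" for x :: "real^'n"
      using DERIV_exp[of "- complex_of_real (c * (norm x)\<^sup>2)"] by (simp add: has_field_derivative_def gauss_def)
    from partial_deriv_eq[OF has_derivative_compose[OF D this]]
    have "partial_deriv j (gauss c) = (\<lambda>x. (of_real (- 2 * c) * complex_of_real (x $ j)) * gauss c x)"
      by (auto simp: gauss_def[abs_def] cart_eq_inner_axis[symmetric])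
    then have "partial_deriv j h = (\<lambda>x. (m x * (of_real (- 2 * c) * complex_of_real (x $ j)) + partial_deriv j m x) * gauss c x)"
      unfolding m(2) using m(1) g by (subst partial_deriv_mult) (auto intro: slow_differentiable simp: algebra_simps)
    moreover have "slow (\<lambda>x. m x * (of_real (- 2 * c) * complex_of_real (x $ j)) + partial_deriv j m x)"
      by (intro slow_add slow_mult slow_const slow_coord m(1) slow_partial_deriv)
    ultimately show ?thesis by blast
  qed
next
  fix h k assume "\<exists>m. slow m \<and> h = (\<lambda>x::real^'n. m x * gauss c x)"
  then obtain m where m: "slow m" "h = (\<lambda>x. m x * gauss c x)" by blast
  obtain C N where C: "0 \<le> C" "\<And>x. cmod (m x) \<le> C * (1 + norm x) ^ N"
    using slow_growth[OF m(1)] by blast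
  have "(1 + norm x) ^ k * cmod (h x) \<le> C * exp ((real (k + N))\<^sup>2 / (4 * c))" for x
  proof -
    define r where "r = norm x"
    define M where "M = real (k + N)"
    have "(1 + r) ^ (k + N) \<le> (exp r) ^ (k + N)"
      by (intro power_mono) (auto simp: r_def)
    also have "\<dots> = exp (M * r)"
      by (simp add: M_def exp_of_nat_mult[symmetric])
    finally have 1: "(1 + r) ^ (k + N) \<le> exp (M * r)" .
    \<comment> \<open>With the polynomial weight replaced by exp (M r), completing the square bounds
      the exponent M r - c r^2 by its maximum.\<close>
    have "0 \<le> (2 * c * r - M)\<^sup>2 / (4 * c)"
      using assms by simp
    also have "\<dots> = c * r\<^sup>2 - M * r + M\<^sup>2 / (4 * c)"
      using assms by (simp add: power2_eq_square field_simps)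
    finally have 2: "M * r - c * r\<^sup>2 \<le> M\<^sup>2 / (4 * c)" by simp
    have "(1 + r) ^ k * cmod (h x) \<le> (1 + r) ^ k * ((C * (1 + r) ^ N) * exp (- (c * r\<^sup>2)))"
      unfolding m(2) norm_mult norm_gauss r_def by (intro mult_left_mono mult_right_mono C) auto
    also have "\<dots> = C * ((1 + r) ^ (k + N) * exp (- (c * r\<^sup>2)))"
      by (simp add: power_add)
    also have "\<dots> \<le> C * (exp (M * r) * exp (- (c * r\<^sup>2)))"
      by (intro mult_left_mono mult_right_mono 1 C) auto
    also have "\<dots> = C * exp (M * r - c * r\<^sup>2)"
      by (simp add: exp_diff exp_minus divide_inverse)
    also have "\<dots> \<le> C * exp (M\<^sup>2 / (4 * c))"
      using 2 C(1) by (intro mult_left_mono) auto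
    finally show ?thesis by (simp add: r_def M_def)
  qed
  then show "\<exists>C. \<forall>x. (1 + norm x) ^ k * cmod (h x) \<le> C" by blast
qed

section \<open>Integrability of Schwartz functions\<close>

lemma nn_integral_inverse_1_plus_square: "(\<integral>\<^sup>+x. ennreal (1 / (1 + x\<^sup>2)) \<partial>lborel) < \<infinity>"
proof -
  have half: "(\<integral>\<^sup>+x. ennreal (1 / (1 + x\<^sup>2)) * indicator {0..} x \<partial>lborel) = ennreal (pi / 2 - arctan 0)"
    by (rule nn_integral_FTC_atLeast)
      (auto intro!: derivative_eq_intros tendsto_arctan_at_top simp: field_simps power2_eq_square)
  have "(\<integral>\<^sup>+x. ennreal (1 / (1 + x\<^sup>2)) \<partial>lborel)
      \<le> (\<integral>\<^sup>+x. ennreal (1 / (1 + x\<^sup>2)) * indicator {0..} x + ennreal (1 / (1 + (0 + (-1) * x)\<^sup>2)) * indicator {0..} (0 + (-1) * x) \<partial>lborel)"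
    by (intro nn_integral_mono) (auto simp: indicator_def)
  also have "\<dots> = (\<integral>\<^sup>+x. ennreal (1 / (1 + x\<^sup>2)) * indicator {0..} x \<partial>lborel)
      + (\<integral>\<^sup>+x. ennreal (1 / (1 + (0 + (-1) * x)\<^sup>2)) * indicator {0..} (0 + (-1) * x) \<partial>lborel)"
    by (rule nn_integral_add) measurable
  also have "(\<integral>\<^sup>+x. ennreal (1 / (1 + (0 + (-1) * x)\<^sup>2)) * indicator {0..} (0 + (-1) * x) \<partial>lborel)
      = (\<integral>\<^sup>+x. ennreal (1 / (1 + x\<^sup>2)) * indicator {0..} x \<partial>lborel)"
    using nn_integral_real_affine[of "\<lambda>x. ennreal (1 / (1 + x\<^sup>2)) * indicator {0..} x" "-1" 0] by simp
  finally show ?thesis unfolding half by (auto intro: le_less_trans)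
qed

text \<open>The exponent 2n comes from comparison with a product: each of the n factors (1 + |x|)^2
  dominates one 1 + x_b^2, and the product of the one-dimensional weights integrates to a power of
  the integral of 1 / (1 + x^2).\<close>

lemma integrable_weight:
  "integrable lborel (\<lambda>x::real^'n::finite. 1 / (1 + norm x) ^ (2 * CARD('n)))"
proof -
  have "(\<integral>\<^sup>+(x::real^'n). ennreal (1 / (1 + norm x) ^ (2 * CARD('n))) \<partial>lborel)
      \<le> (\<integral>\<^sup>+(x::real^'n). (\<Prod>b\<in>Basis. ennreal (1 / (1 + (x \<bullet> b)\<^sup>2))) \<partial>lborel)"
  proof (rule nn_integral_mono)
    fix x :: "real^'n"
    have "(\<Prod>b\<in>(Basis :: (real^'n) set). (1 + (x \<bullet> b)\<^sup>2)) \<le> (\<Prod>b\<in>(Basis :: (real^'n) set). (1 + norm x)\<^sup>2)"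
    proof (rule prod_mono, safe)
      fix b :: "real^'n" assume "b \<in> Basis"
      then have "(x \<bullet> b)\<^sup>2 \<le> (norm x)\<^sup>2"
        using Basis_le_norm[of b x] by (auto intro: power2_le_iff_abs_le[THEN iffD2])
      then show "1 + (x \<bullet> b)\<^sup>2 \<le> (1 + norm x)\<^sup>2"
        by (auto simp: power2_sum intro: add_increasing2)
    qed simp
    also have "\<dots> = (1 + norm x) ^ (2 * CARD('n))"
      by (simp add: power_mult)
    finally have "1 / (1 + norm x) ^ (2 * CARD('n)) \<le> 1 / (\<Prod>b\<in>(Basis :: (real^'n) set). (1 + (x \<bullet> b)\<^sup>2))"
      by (intro divide_left_mono) (auto intro!: prod_pos mult_pos_pos simp: add_pos_nonneg)
    also have "\<dots> = (\<Prod>b\<in>(Basis :: (real^'n) set). 1 / (1 + (x \<bullet> b)\<^sup>2))"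
      by (simp add: prod_dividef)
    finally show "ennreal (1 / (1 + norm x) ^ (2 * CARD('n))) \<le> (\<Prod>b\<in>Basis. ennreal (1 / (1 + (x \<bullet> b)\<^sup>2)))"
      by (subst prod_ennreal) (auto intro: ennreal_leI)
  qed
  also have "\<dots> = (\<Prod>b\<in>(Basis :: (real^'n) set). (\<integral>\<^sup>+x. ennreal (1 / (1 + x\<^sup>2)) \<partial>lborel))"
    by (rule nn_integral_lborel_prod) auto
  also have "\<dots> < \<infinity>"
    using nn_integral_inverse_1_plus_square by (simp add: power_less_top_ennreal)
  finally show ?thesis
    by (auto simp: integrable_iff_bounded)
qed

lemma integrable_of_decay:
  fixes f :: "real^'n::finite \<Rightarrow> complex"
  assumes "f \<in> borel_measurable borel" "\<And>x. (1 + norm x) ^ (2 * CARD('n)) * cmod (f x) \<le> C"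
  shows "integrable lborel f"
proof (rule Bochner_Integration.integrable_bound)
  show "integrable lborel (\<lambda>x::real^'n. C * (1 / (1 + norm x) ^ (2 * CARD('n))))"
    by (rule integrable_mult_right[OF integrable_weight])
  have "cmod (f x) \<le> C * (1 / (1 + norm x) ^ (2 * CARD('n)))" for x
    using assms(2)[of x] by (simp add: pos_le_divide_eq add_pos_nonneg mult.commute)
  then show "AE x in lborel. norm (f x) \<le> norm (C * (1 / (1 + norm x) ^ (2 * CARD('n))))"
    by (intro AE_I2) (smt (verit) real_norm_def)
qed (use assms in simp)

lemma schwartz_integrable:
  fixes f :: "real^'n::finite \<Rightarrow> complex"
  assumes "schwartz f"
  shows "integrable lborel f"
  using schwartz_decay[OF assms, of "2 * CARD('n)"] integrable_of_decay[OF schwartz_measurable[OF assms]]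
  by metis

text \<open>With \<open>C\<close> a Schwartz seminorm this becomes the continuity estimate that
  makes a square integrable symbol a tempered distribution.\<close>

lemma schwartz_L2_seminorm:
  fixes f :: "real^'n::finite \<Rightarrow> complex"
  assumes "schwartz f" "\<And>x. (1 + norm x) ^ (2 * CARD('n)) * cmod (f x) \<le> C"
  shows "L2 lborel f" "n2 lborel f \<le> C * sqrt (LINT x|lborel. 1 / (1 + norm (x::real^'n)) ^ (2 * CARD('n)))"
proof -
  have "0 \<le> (1 + norm (0::real^'n)) ^ (2 * CARD('n)) * cmod (f 0)" by simp
  also have "\<dots> \<le> C" by (rule assms(2))
  finally have C: "0 \<le> C" .
  have le: "(cmod (f x))\<^sup>2 \<le> C\<^sup>2 * (1 / (1 + norm x) ^ (2 * CARD('n)))" for x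
  proof -
    define w where "w = (1 + norm x) ^ (2 * CARD('n))"
    have w: "1 \<le> w" unfolding w_def by (rule one_le_power) simp
    have "cmod (f x) \<le> C / w"
      using assms(2)[of x] w unfolding w_def[symmetric] by (simp add: pos_le_divide_eq mult.commute)
    then have "(cmod (f x))\<^sup>2 \<le> (C / w)\<^sup>2" by (intro power_mono) auto
    also have "\<dots> = C\<^sup>2 * (1 / w) * (1 / w)" by (simp add: power2_eq_square)
    also have "\<dots> \<le> C\<^sup>2 * (1 / w) * 1" using w by (intro mult_left_mono) auto
    finally show ?thesis by (simp add: w_def)
  qed
  have int: "integrable lborel (\<lambda>x::real^'n. C\<^sup>2 * (1 / (1 + norm x) ^ (2 * CARD('n))))"
    by (rule integrable_mult_right[OF integrable_weight])
  have [measurable]: "f \<in> borel_measurable borel" by (rule schwartz_measurable[OF assms(1)])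
  have int2: "integrable lborel (\<lambda>x. (cmod (f x))\<^sup>2)"
    by (rule Bochner_Integration.integrable_bound[OF int]) (auto intro!: AE_I2 order_trans[OF le])
  then show "L2 lborel f" by (simp add: L2_def)
  have "(LINT x|lborel. (cmod (f x))\<^sup>2) \<le> (LINT x|lborel. C\<^sup>2 * (1 / (1 + norm (x::real^'n)) ^ (2 * CARD('n))))"
    by (rule integral_mono[OF int2 int le])
  then have "n2 lborel f \<le> sqrt (C\<^sup>2 * (LINT x|lborel. 1 / (1 + norm (x::real^'n)) ^ (2 * CARD('n))))"
    unfolding n2_def by (subst (asm) integral_mult_right_zero) (rule real_sqrt_le_mono)
  then show "n2 lborel f \<le> C * sqrt (LINT x|lborel. 1 / (1 + norm (x::real^'n)) ^ (2 * CARD('n)))"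
    using C by (simp add: real_sqrt_mult)
qed

lemma schwartz_L2: "schwartz f \<Longrightarrow> L2 lborel f"
  using schwartz_L2_seminorm(1) schwartz_decay by metis

lemma schwartz_le_seminorm:
  fixes f :: "real^'n::finite \<Rightarrow> complex"
  assumes "schwartz f"
  shows "(1 + norm x) ^ N * cmod (f x) \<le> schwartz_seminorm N f"
proof -
  let ?S = "{js::'n list. length js \<le> N} \<times> (UNIV::(real^'n) set)"
  let ?F = "\<lambda>(js, x). (1 + norm x) ^ N * cmod (iter_partial js f x)"
  have fin: "finite {js::'n list. length js \<le> N}"
    using finite_lists_length_le[of "UNIV::'n set" N] by simp
  have "\<forall>js. \<exists>C. \<forall>x. (1 + norm x) ^ N * cmod (iter_partial js f x) \<le> C"
    using assms by (auto simp: schwartz_def bdd_above_def)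
  then obtain C where C: "\<And>js x. (1 + norm x) ^ N * cmod (iter_partial js f x) \<le> C js" by metis
  \<comment> \<open>A real supremum is meaningful only for a bounded set. Finitely many direction
    lists of length at most N occur, so the bounds for the single lists can be added up.\<close>
  have "bdd_above (?F ` ?S)"
  proof (rule bdd_aboveI2)
    fix p assume "p \<in> ?S"
    then obtain js x where p: "p = (js, x)" "length js \<le> N" by auto
    have "\<bar>C js\<bar> \<le> (\<Sum>js\<in>{js. length js \<le> N}. \<bar>C js\<bar>)"
      using p fin by (intro member_le_sum) auto
    then show "?F p \<le> (\<Sum>js\<in>{js. length js \<le> N}. \<bar>C js\<bar>)"
      using C[of x js] p by auto
  qed
  then have "?F ([], x) \<le> schwartz_seminorm N f"
    unfolding schwartz_seminorm_def by (rule cSUP_upper[rotated]) auto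
  then show ?thesis by (simp add: iter_partial_def)
qed

section \<open>The Fourier transform on the Schwartz class\<close>

lemma borel_measurable_cis [measurable (raw)]:
  "f \<in> borel_measurable M \<Longrightarrow> (\<lambda>x. cis (f x)) \<in> borel_measurable M"
  using measurable_compose[of f M borel cis borel] borel_measurable_continuous_onI[of cis]
    continuous_on_cis[OF continuous_on_id] by simp

lemma integral_lborel_affine:
  fixes f :: "'a::euclidean_space \<Rightarrow> 'b::{banach, second_countable_topology}"
  assumes [measurable]: "f \<in> borel_measurable borel" and c: "c \<noteq> 0"
  shows "integrable lborel (\<lambda>x. f (t + c *\<^sub>R x)) \<longleftrightarrow> integrable lborel f"
    and "(LINT x|lborel. f x) = \<bar>c\<bar> ^ DIM('a) *\<^sub>R (LINT x|lborel. f (t + c *\<^sub>R x))"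
proof -
  have L: "lborel = density (distr lborel borel (\<lambda>x. t + c *\<^sub>R x)) (\<lambda>_. ennreal (\<bar>c\<bar> ^ DIM('a)))"
    using lborel_affine[OF c, of t] by (simp add: ennreal_power)
  have "integrable lborel f \<longleftrightarrow> integrable (density (distr lborel borel (\<lambda>x. t + c *\<^sub>R x)) (\<lambda>_. ennreal (\<bar>c\<bar> ^ DIM('a)))) f"
    using L by simp
  also have "\<dots> \<longleftrightarrow> integrable lborel (\<lambda>x. f (t + c *\<^sub>R x))"
    using c integrable_scaleR_right[of "1 / \<bar>c\<bar> ^ DIM('a)" lborel "\<lambda>x. \<bar>c\<bar> ^ DIM('a) *\<^sub>R f (t + c *\<^sub>R x)"]
    by (subst integrable_density) (auto simp: integrable_distr_eq)
  finally show "integrable lborel (\<lambda>x. f (t + c *\<^sub>R x)) \<longleftrightarrow> integrable lborel f" by simp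
  have "(LINT x|lborel. f x) = (LINT x|density (distr lborel borel (\<lambda>x. t + c *\<^sub>R x)) (\<lambda>_. ennreal (\<bar>c\<bar> ^ DIM('a))). f x)"
    using L by simp
  also have "\<dots> = (LINT x|lborel. \<bar>c\<bar> ^ DIM('a) *\<^sub>R f (t + c *\<^sub>R x))"
    by (subst integral_density) (auto simp: integral_distr)
  finally show "(LINT x|lborel. f x) = \<bar>c\<bar> ^ DIM('a) *\<^sub>R (LINT x|lborel. f (t + c *\<^sub>R x))"
    by simp
qed

lemma integral_lborel_translate:
  fixes f :: "'a::euclidean_space \<Rightarrow> 'b::{banach, second_countable_topology}"
  assumes "f \<in> borel_measurable borel"
  shows "(LINT x|lborel. f (x + a)) = (LINT x|lborel. f x)"
  using integral_lborel_affine(2)[OF assms, of 1 a] by (simp add: add.commute)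

lemma integral_lborel_reflect:
  fixes f :: "'a::euclidean_space \<Rightarrow> 'b::{banach, second_countable_topology}"
  assumes "f \<in> borel_measurable borel"
  shows "(LINT x|lborel. f (- x)) = (LINT x|lborel. f x)"
  using integral_lborel_affine(2)[OF assms, of "-1" 0] by simp

lemma integrable_lborel_reflect:
  fixes f :: "'a::euclidean_space \<Rightarrow> 'b::{banach, second_countable_topology}"
  assumes "f \<in> borel_measurable borel"
  shows "integrable lborel (\<lambda>x. f (- x)) \<longleftrightarrow> integrable lborel f"
  using integral_lborel_affine(1)[OF assms, of "-1" 0] by simp

lemma cis_mult_measurable:
  fixes f :: "real^'n::finite \<Rightarrow> complex"
  assumes "f \<in> borel_measurable borel"
  shows "(\<lambda>x. cis (- (x \<bullet> \<xi>)) * f x) \<in> borel_measurable borel" "(\<lambda>x. cis (x \<bullet> \<xi>) * f x) \<in> borel_measurable borel"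
  using assms by measurable

lemma integrable_cis_mult:
  fixes f :: "real^'n::finite \<Rightarrow> complex"
  assumes "integrable lborel f"
  shows "integrable lborel (\<lambda>x. cis (x \<bullet> \<xi>) * f x)" "integrable lborel (\<lambda>x. cis (- (x \<bullet> \<xi>)) * f x)"
proof -
  have [measurable]: "f \<in> borel_measurable borel" using assms by auto
  show "integrable lborel (\<lambda>x. cis (x \<bullet> \<xi>) * f x)" "integrable lborel (\<lambda>x. cis (- (x \<bullet> \<xi>)) * f x)"
    by (rule Bochner_Integration.integrable_bound[OF assms]; simp add: norm_mult)+
qed

lemma fourier_lborel:
  assumes "f \<in> borel_measurable borel"
  shows "fourier f \<xi> = (LINT x|lborel. cis (- (x \<bullet> \<xi>)) * f x)"
  unfolding fourier_def by (rule integral_completion) (use cis_mult_measurable[OF assms] in simp)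

lemma inv_fourier_fourier_reflect:
  fixes f :: "real^'n::finite \<Rightarrow> complex"
  shows "inv_fourier f x = complex_of_real (1 / (2 * pi) ^ CARD('n)) * fourier f (- x)"
  by (simp add: inv_fourier_def fourier_def inner_commute)

lemma norm_fourier_le:
  assumes "integrable lborel f"
  shows "cmod (fourier f \<xi>) \<le> (LINT x|lborel. cmod (f x))"
proof -
  have "cmod (fourier f \<xi>) \<le> (LINT x|lborel. cmod (cis (- (x \<bullet> \<xi>)) * f x))"
    using assms by (subst fourier_lborel) (auto intro: integral_norm_bound)
  then show ?thesis by (simp add: norm_mult)
qed

lemma fourier_add:
  assumes "integrable lborel f" "integrable lborel g"
  shows "fourier (\<lambda>x. f x + g x) \<xi> = fourier f \<xi> + fourier g \<xi>"
  using assms by (simp add: fourier_lborel distrib_left integrable_cis_mult)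

lemma fourier_diff:
  assumes "integrable lborel f" "integrable lborel g"
  shows "fourier (\<lambda>x. f x - g x) \<xi> = fourier f \<xi> - fourier g \<xi>"
  using assms by (simp add: fourier_lborel right_diff_distrib integrable_cis_mult)

lemma fourier_cmult: "fourier (\<lambda>x. c * f x) \<xi> = c * fourier f \<xi>"
  unfolding fourier_def by (subst integral_mult_right_zero[symmetric]) (simp add: mult_ac)

lemma inv_fourier_cmult: "inv_fourier (\<lambda>x. c * f x) \<xi> = c * inv_fourier f \<xi>"
  by (simp add: inv_fourier_fourier_reflect fourier_cmult)

lemma inv_fourier_add:
  assumes "integrable lborel f" "integrable lborel g"
  shows "inv_fourier (\<lambda>x. f x + g x) \<xi> = inv_fourier f \<xi> + inv_fourier g \<xi>"
  using assms by (simp add: inv_fourier_fourier_reflect fourier_add distrib_left)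

section \<open>Derivatives and multiplication by coordinates under the Fourier transform\<close>

lemma schwartz_coord_mult: "schwartz f \<Longrightarrow> schwartz (\<lambda>x. complex_of_real (x $ j) * f x)"
  by (rule schwartz_slow_mult[OF slow_coord])

lemma cmod_cis_minus_linear: "cmod (cis a - 1 - \<i> * complex_of_real a) \<le> a\<^sup>2"
proof -
  have "cmod (iexp a - (\<Sum>k \<le> 1. (\<i> * a)^k / fact k)) \<le> \<bar>a\<bar>^(Suc 1) / fact (Suc 1)"
    by (rule iexp_approx1)
  then show ?thesis
    by (simp add: cis_conv_exp power2_eq_square diff_diff_eq) (smt (verit) mult_nonneg_nonneg zero_le_square)
qed

text \<open>Differentiation under the integral sign by a second-order estimate: the linearisation
  error of \<open>cis\<close> at an argument a is at most a^2, so the remainder of the transform is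
  at most |h|^2 times the integral of |x|^2 |f|.\<close>

lemma fourier_has_derivative:
  fixes f :: "real^'n::finite \<Rightarrow> complex"
  assumes f: "schwartz f"
  shows "(fourier f has_derivative
    (\<lambda>h. fourier (\<lambda>x. - \<i> * complex_of_real (x \<bullet> h) * f x) \<xi>)) (at \<xi>)"
proof -
  define L where "L h = fourier (\<lambda>x. - \<i> * complex_of_real (x \<bullet> h) * f x) \<xi>" for h
  have sch: "schwartz (\<lambda>x. - \<i> * complex_of_real (x \<bullet> h) * f x)" for h
    by (intro schwartz_slow_mult slow_mult slow_const slow_inner f)
  have int_f: "integrable lborel f" by (rule schwartz_integrable[OF f])
  have [measurable]: "f \<in> borel_measurable borel" by (rule schwartz_measurable[OF f])
  have sch2: "schwartz (\<lambda>x. complex_of_real ((norm x)\<^sup>2) * f x)"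
    by (intro schwartz_slow_mult slow_norm2 f)
  \<comment> \<open>The function |x| is not smooth, so integrability of |x| |f| is borrowed from the
    smooth majorant (1 + |x|^2)^(1/2).\<close>
  have sch1: "schwartz (\<lambda>x. complex_of_real ((1 + (norm x)\<^sup>2) powr (1/2)) * f x)"
    by (intro schwartz_slow_mult slow_bracket f)
  have int1: "integrable lborel (\<lambda>x. norm x * cmod (f x))"
  proof (rule Bochner_Integration.integrable_bound[OF integrable_norm[OF schwartz_integrable[OF sch1]]])
    have "norm x \<le> (1 + (norm x)\<^sup>2) powr (1/2)" for x :: "real^'n"
      by (simp add: powr_half_sqrt) (simp add: real_le_rsqrt)
    then show "AE x in lborel. norm (norm x * cmod (f x)) \<le> norm (cmod (complex_of_real ((1 + (norm x)\<^sup>2) powr (1/2)) * f x))"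
      by (auto simp: norm_mult intro!: mult_right_mono)
  qed measurable
  define K where "K = (LINT x|lborel. norm x * cmod (f x))"
  define K2 where "K2 = (LINT x|lborel. cmod (complex_of_real ((norm x)\<^sup>2) * f x))"
  have L: "bounded_linear L"
  proof (rule bounded_linear_intro)
    fix h k r
    show "L (h + k) = L h + L k"
      unfolding L_def fourier_add[OF schwartz_integrable[OF sch] schwartz_integrable[OF sch], symmetric]
      by (simp add: algebra_simps)
    have "L (r *\<^sub>R h) = complex_of_real r * L h"
      unfolding L_def fourier_cmult[symmetric] by (simp add: mult_ac)
    then show "L (r *\<^sub>R h) = r *\<^sub>R L h"
      by (simp add: scaleR_conv_of_real)
    have "cmod (L h) \<le> (LINT x|lborel. cmod (- \<i> * complex_of_real (x \<bullet> h) * f x))"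
      unfolding L_def by (rule norm_fourier_le[OF schwartz_integrable[OF sch]])
    also have "\<dots> \<le> (LINT x|lborel. norm h * (norm x * cmod (f x)))"
    proof (rule integral_mono)
      show "integrable lborel (\<lambda>x. cmod (- \<i> * complex_of_real (x \<bullet> h) * f x))"
        by (rule integrable_norm[OF schwartz_integrable[OF sch]])
      show "integrable lborel (\<lambda>x. norm h * (norm x * cmod (f x)))"
        by (rule integrable_mult_right[OF int1])
      show "cmod (- \<i> * complex_of_real (x \<bullet> h) * f x) \<le> norm h * (norm x * cmod (f x))" for x
        using mult_right_mono[OF Cauchy_Schwarz_ineq2[of x h] norm_ge_zero[of "f x"]] by (simp add: norm_mult mult_ac)
    qed
    also have "\<dots> = norm h * K"
      by (simp add: K_def)
    finally show "cmod (L h) \<le> norm h * K" .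
  qed
  have main: "cmod (fourier f y - fourier f \<xi> - L (y - \<xi>)) \<le> norm (y - \<xi>) ^ 2 * K2" for y
  proof -
    define h where "h = y - \<xi>"
    have y: "y = \<xi> + h" by (simp add: h_def)
    let ?g = "\<lambda>x. cis (- (x \<bullet> \<xi>)) * ((cis (- (x \<bullet> h)) - 1 - \<i> * complex_of_real (- (x \<bullet> h))) * f x)"
    have int: "integrable lborel (\<lambda>x. cis (- (x \<bullet> y)) * f x)" "integrable lborel (\<lambda>x. cis (- (x \<bullet> \<xi>)) * f x)"
      "integrable lborel (\<lambda>x. cis (- (x \<bullet> \<xi>)) * (- \<i> * complex_of_real (x \<bullet> h) * f x))"
      using integrable_cis_mult(2)[OF int_f] integrable_cis_mult(2)[OF schwartz_integrable[OF sch]] by auto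
    have geq: "?g x = cis (- (x \<bullet> y)) * f x - cis (- (x \<bullet> \<xi>)) * f x
        - cis (- (x \<bullet> \<xi>)) * (- \<i> * complex_of_real (x \<bullet> h) * f x)" for x
    proof -
      have "cis (- (x \<bullet> y)) = cis (- (x \<bullet> \<xi>)) * cis (- (x \<bullet> h))"
        by (simp add: y cis_mult inner_add_right)
      then show ?thesis by (simp add: algebra_simps)
    qed
    have "fourier f y - fourier f \<xi> - L h = (LINT x|lborel. ?g x)"
      unfolding L_def geq using int by (simp add: fourier_lborel)
    also have "cmod \<dots> \<le> (LINT x|lborel. cmod (?g x))" by (rule integral_norm_bound)
    also have "\<dots> \<le> (LINT x|lborel. (norm h)\<^sup>2 * cmod (complex_of_real ((norm x)\<^sup>2) * f x))"
    proof (rule integral_mono)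
      show "integrable lborel (\<lambda>x. cmod (?g x))"
        unfolding geq using int by (intro integrable_norm Bochner_Integration.integrable_diff)
      show "integrable lborel (\<lambda>x. (norm h)\<^sup>2 * cmod (complex_of_real ((norm x)\<^sup>2) * f x))"
        by (intro integrable_mult_right integrable_norm schwartz_integrable[OF sch2])
      fix x
      have "cmod (cis (- (x \<bullet> h)) - 1 - \<i> * complex_of_real (- (x \<bullet> h))) \<le> (- (x \<bullet> h))\<^sup>2"
        by (rule cmod_cis_minus_linear)
      also have "\<dots> \<le> (norm x * norm h)\<^sup>2"
        using Cauchy_Schwarz_ineq2[of x h] by (simp add: abs_le_square_iff[symmetric] abs_mult)
      finally have "cmod (cis (- (x \<bullet> h)) - 1 - \<i> * complex_of_real (- (x \<bullet> h))) * cmod (f x)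
          \<le> (norm x * norm h)\<^sup>2 * cmod (f x)"
        by (rule mult_right_mono) simp
      then show "cmod (?g x) \<le> (norm h)\<^sup>2 * cmod (complex_of_real ((norm x)\<^sup>2) * f x)"
        by (simp add: norm_mult power_mult_distrib mult_ac norm_power)
    qed
    also have "\<dots> = (norm h)\<^sup>2 * K2" by (simp add: K2_def)
    finally show ?thesis by (simp add: h_def)
  qed
  have "(fourier f has_derivative L) (at \<xi>)"
  proof (rule has_derivativeI_sandwich[where e = 1 and H = "\<lambda>y. norm (y - \<xi>) * K2"])
    show "((\<lambda>y. norm (y - \<xi>) * K2) \<longlongrightarrow> 0) (at \<xi>)"
      by (auto intro!: tendsto_eq_intros)
    fix y assume "y \<noteq> \<xi>"
    then show "norm (fourier f y - fourier f \<xi> - L (y - \<xi>)) / norm (y - \<xi>) \<le> norm (y - \<xi>) * K2"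
      using main[of y] by (simp add: divide_le_eq power2_eq_square mult_ac)
  qed (use L in auto)
  then show ?thesis by (simp add: L_def[abs_def])
qed

lemma partial_deriv_fourier:
  assumes "schwartz f"
  shows "partial_deriv j (fourier f) = fourier (\<lambda>x. - \<i> * (complex_of_real (x $ j) * f x))"
  by (rule ext, rule trans[OF partial_deriv_eq[OF fourier_has_derivative[OF assms]]])
    (simp add: cart_eq_inner_axis[symmetric] mult.assoc)

text \<open>Supplies the integrable majorant for difference quotients in
  \<open>fourier_partial_deriv\<close>. The mean value inequality moves the evaluation point by at
  most 1, which costs 1 + |x| <= 2 (1 + |y|) and hence a factor 2^k in the constant.\<close>

lemma schwartz_increment_bound:
  fixes f :: "real^'n::finite \<Rightarrow> complex"
  assumes f: "schwartz f"
  obtains C where "\<And>x s. \<bar>s\<bar> \<le> 1 \<Longrightarrow> (1 + norm x) ^ k * cmod (f (x + s *\<^sub>R axis j 1) - f x) \<le> C * \<bar>s\<bar>" "0 \<le> C"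
proof -
  obtain C where C: "\<And>x. (1 + norm x) ^ k * cmod (partial_deriv j f x) \<le> C" "0 \<le> C"
    using schwartz_decay[OF schwartz_partial_deriv[OF f]] by metis
  have "(1 + norm x) ^ k * cmod (f (x + s *\<^sub>R axis j 1) - f x) \<le> (2 ^ k * C) * \<bar>s\<bar>" if s: "\<bar>s\<bar> \<le> 1" for x s
  proof -
    define w where "w = (1 + norm x) ^ k"
    have w: "0 < w" unfolding w_def by (intro zero_less_power add_pos_nonneg) auto
    define g where "g t = f (x + t *\<^sub>R axis j 1)" for t
    define S where "S = {-1..1::real}"
    have der: "(g has_derivative (\<lambda>r. r *\<^sub>R partial_deriv j f (x + t *\<^sub>R axis j 1))) (at t within S)" for t
    proof -
      have 1: "((\<lambda>t. x + t *\<^sub>R axis j 1) has_derivative (\<lambda>r. r *\<^sub>R axis j 1)) (at t within S)"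
        by (auto intro!: derivative_eq_intros)
      let ?D = "frechet_derivative f (at (x + t *\<^sub>R axis j 1))"
      have 2: "(f has_derivative ?D) (at (x + t *\<^sub>R axis j 1))"
        by (rule differentiable_has_derivative[OF schwartz_differentiable[OF f]])
      have "?D (r *\<^sub>R axis j 1) = r *\<^sub>R partial_deriv j f (x + t *\<^sub>R axis j 1)" for r
        using linear_scale[OF has_derivative_linear[OF 2]] by (simp add: partial_deriv_def)
      then show ?thesis
        using has_derivative_compose[OF 1 2] by (simp add: g_def[abs_def])
    qed
    have "norm (g s - g 0) \<le> (2 ^ k * C / w) * norm (s - 0)"
    proof (rule differentiable_bound[where S = S, OF _ der])
      fix t assume "t \<in> S"
      then have t: "\<bar>t\<bar> \<le> 1" by (auto simp: S_def)
      define y where "y = x + t *\<^sub>R axis j 1"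
      have "norm x \<le> norm y + \<bar>t\<bar>"
        using norm_triangle_ineq4[of y "t *\<^sub>R axis j 1"] by (simp add: y_def)
      then have "1 + norm x \<le> 2 * (1 + norm y)" using t norm_ge_zero[of y] by (smt (verit))
      then have "w \<le> (2 * (1 + norm y)) ^ k" unfolding w_def by (intro power_mono) auto
      then have "w * cmod (partial_deriv j f y) \<le> (2 * (1 + norm y)) ^ k * cmod (partial_deriv j f y)"
        by (rule mult_right_mono) simp
      also have "\<dots> = 2 ^ k * ((1 + norm y) ^ k * cmod (partial_deriv j f y))"
        by (simp only: power_mult_distrib mult.assoc)
      also have "\<dots> \<le> 2 ^ k * C" by (intro mult_left_mono C) auto
      finally have "cmod (partial_deriv j f y) \<le> 2 ^ k * C / w"
        using w by (simp add: pos_le_divide_eq mult.commute)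
      then have "\<bar>r\<bar> * cmod (partial_deriv j f y) \<le> \<bar>r\<bar> * (2 ^ k * C / w)" for r :: real
        by (rule mult_left_mono) simp
      then have "norm (r *\<^sub>R partial_deriv j f y) \<le> (2 ^ k * C / w) * norm r" for r :: real
        by (simp add: mult.commute)
      then show "onorm (\<lambda>r. r *\<^sub>R partial_deriv j f (x + t *\<^sub>R axis j 1)) \<le> 2 ^ k * C / w"
        unfolding y_def by (intro onorm_le) 
    qed (use s in \<open>auto simp: S_def\<close>)
    then show ?thesis
      using w by (simp add: g_def w_def[symmetric] field_simps)
  qed
  then show thesis using C(2) by (intro that[of "2 ^ k * C"]) auto
qed

text \<open>Integration by parts: both sides are the derivative at \<open>h = 0\<close> of the Fourier transform of
  the translate \<open>x \<mapsto> f (x + h e\<^sub>j)\<close>.\<close>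

lemma fourier_partial_deriv:
  fixes f :: "real^'n::finite \<Rightarrow> complex"
  assumes f: "schwartz f"
  shows "fourier (partial_deriv j f) \<xi> = \<i> * complex_of_real (\<xi> $ j) * fourier f \<xi>"
proof -
  define e :: "real^'n" where "e = axis j 1"
  define s where "s n = 1 / real (Suc n)" for n
  have s0: "s n \<noteq> 0" "\<bar>s n\<bar> \<le> 1" for n by (auto simp: s_def)
  have s_lim: "s \<longlonglongrightarrow> 0" unfolding s_def using LIMSEQ_inverse_real_of_nat by (simp add: inverse_eq_divide)
  then have s_at: "filterlim s (at 0) sequentially"
    using s0 by (simp add: filterlim_at)
  have [measurable]: "f \<in> borel_measurable borel" by (rule schwartz_measurable[OF f])
  have int_f: "integrable lborel f" by (rule schwartz_integrable[OF f])
  let ?q = "\<lambda>n x. (f (x + s n *\<^sub>R e) - f x) / complex_of_real (s n)"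
  have sch_q: "schwartz (?q n)" for n
    using schwartz_cmult[OF schwartz_diff[OF schwartz_translate[OF f, of "s n *\<^sub>R e"] f], of "1 / complex_of_real (s n)"]
    by simp
  have trans: "fourier (\<lambda>x. f (x + a)) \<xi> = cis (a \<bullet> \<xi>) * fourier f \<xi>" for a
  proof -
    have "fourier (\<lambda>x. f (x + a)) \<xi> = (LINT x|lborel. cis (- (x \<bullet> \<xi>)) * f (x + a))"
      by (rule fourier_lborel) measurable
    also have "\<dots> = (LINT x|lborel. cis (a \<bullet> \<xi>) * (cis (- ((x + a) \<bullet> \<xi>)) * f (x + a)))"
      by (simp add: cis_mult inner_add_left flip: mult.assoc)
    also have "\<dots> = cis (a \<bullet> \<xi>) * (LINT x|lborel. cis (- ((x + a) \<bullet> \<xi>)) * f (x + a))"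
      by simp
    also have "(LINT x|lborel. cis (- ((x + a) \<bullet> \<xi>)) * f (x + a)) = fourier f \<xi>"
      by (simp add: fourier_lborel integral_lborel_translate[of "\<lambda>x. cis (- (x \<bullet> \<xi>)) * f x"])
    finally show ?thesis .
  qed
  have eq: "fourier (?q n) \<xi> = (cis (s n * \<xi> $ j) - 1) / complex_of_real (s n) * fourier f \<xi>" for n
  proof -
    have "fourier (?q n) \<xi> = fourier (\<lambda>x. (1 / complex_of_real (s n)) * (f (x + s n *\<^sub>R e) - f x)) \<xi>"
      by simp
    also have "\<dots> = (1 / complex_of_real (s n)) * (cis ((s n *\<^sub>R e) \<bullet> \<xi>) * fourier f \<xi> - fourier f \<xi>)"
      unfolding fourier_cmult
      by (subst fourier_diff[OF schwartz_integrable[OF schwartz_translate[OF f]] int_f]) (simp add: trans)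
    finally show ?thesis
      by (simp add: e_def inner_axis' field_simps)
  qed
  have "(\<lambda>n. fourier (?q n) \<xi>) \<longlonglongrightarrow> fourier (partial_deriv j f) \<xi>"
  proof -
    obtain C where C: "\<And>x s. \<bar>s\<bar> \<le> 1 \<Longrightarrow> (1 + norm x) ^ (2 * CARD('n)) * cmod (f (x + s *\<^sub>R axis j 1) - f x) \<le> C * \<bar>s\<bar>"
      using schwartz_increment_bound[OF f] by metis
    note [measurable] = schwartz_measurable[OF schwartz_partial_deriv[OF f]]
    have "(\<lambda>n. LINT x|lborel. cis (- (x \<bullet> \<xi>)) * ?q n x) \<longlonglongrightarrow> (LINT x|lborel. cis (- (x \<bullet> \<xi>)) * partial_deriv j f x)"
    proof (rule integral_dominated_convergence)
      show "integrable lborel (\<lambda>x::real^'n. C * (1 / (1 + norm x) ^ (2 * CARD('n))))"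
        by (rule integrable_mult_right[OF integrable_weight])
      show "AE x in lborel. (\<lambda>n. cis (- (x \<bullet> \<xi>)) * ?q n x) \<longlonglongrightarrow> cis (- (x \<bullet> \<xi>)) * partial_deriv j f x"
      proof (rule AE_I2)
        fix x
        let ?D = "frechet_derivative f (at x)"
        have D: "(f has_derivative ?D) (at x)"
          by (rule differentiable_has_derivative[OF schwartz_differentiable[OF f]])
        have 1: "((\<lambda>t. x + t *\<^sub>R e) has_derivative (\<lambda>r. r *\<^sub>R e)) (at 0)"
          by (auto intro!: derivative_eq_intros)
        have "(f has_derivative ?D) (at (x + 0 *\<^sub>R e))" using D by simp
        from has_derivative_compose[OF 1 this]
        have "((\<lambda>t. f (x + t *\<^sub>R e)) has_derivative (\<lambda>r. r *\<^sub>R ?D e)) (at 0)"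
          using linear_scale[OF has_derivative_linear[OF D]] by simp
        then have lim: "((\<lambda>h. norm (f (x + h *\<^sub>R e) - f x - h *\<^sub>R ?D e) / norm h) \<longlongrightarrow> 0) (at 0)"
          by (simp add: has_derivative_at)
        have "\<forall>\<^sub>F h in at 0. norm (f (x + h *\<^sub>R e) - f x - h *\<^sub>R ?D e) / norm h
            = norm ((1 / h) *\<^sub>R (f (x + h *\<^sub>R e) - f x) - ?D e)"
        proof -
          have "norm (f (x + h *\<^sub>R e) - f x - h *\<^sub>R ?D e) / norm h
            = norm ((1 / h) *\<^sub>R (f (x + h *\<^sub>R e) - f x) - ?D e)" if "h \<noteq> 0" for h
          proof -
            have "(1 / h) *\<^sub>R (f (x + h *\<^sub>R e) - f x) - ?D e = (1 / h) *\<^sub>R (f (x + h *\<^sub>R e) - f x - h *\<^sub>R ?D e)"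
              using that by (simp add: scaleR_diff_right)
            then show ?thesis by (simp add: divide_inverse mult.commute)
          qed
          then show ?thesis by (auto simp: eventually_at_filter)
        qed
        from Lim_transform_eventually[OF lim this]
        have "((\<lambda>h. (1 / h) *\<^sub>R (f (x + h *\<^sub>R e) - f x)) \<longlongrightarrow> ?D e) (at 0)"
          by (intro LIM_zero_cancel[of _ "?D e"]) (rule tendsto_norm_zero_cancel)
        from filterlim_compose[OF this s_at]
        have "(\<lambda>n. ?q n x) \<longlonglongrightarrow> partial_deriv j f x"
          by (simp add: partial_deriv_def e_def scaleR_conv_of_real)
        then show "(\<lambda>n. cis (- (x \<bullet> \<xi>)) * ?q n x) \<longlonglongrightarrow> cis (- (x \<bullet> \<xi>)) * partial_deriv j f x"
          by (intro tendsto_intros)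
      qed
      fix n
      show "AE x in lborel. norm (cis (- (x \<bullet> \<xi>)) * ?q n x) \<le> C * (1 / (1 + norm x) ^ (2 * CARD('n)))"
      proof (rule AE_I2)
        fix x :: "real^'n"
        define w where "w = (1 + norm x) ^ (2 * CARD('n))"
        have w: "0 < w" unfolding w_def by (intro zero_less_power add_pos_nonneg) auto
        have "w * cmod (f (x + s n *\<^sub>R e) - f x) \<le> C * \<bar>s n\<bar>"
          unfolding w_def e_def by (rule C[OF s0(2)])
        then show "norm (cis (- (x \<bullet> \<xi>)) * ?q n x) \<le> C * (1 / (1 + norm x) ^ (2 * CARD('n)))"
          using w s0(1)[of n] unfolding w_def[symmetric]
          unfolding norm_mult norm_divide by (simp add: field_simps)
      qed
    qed (use schwartz_measurable[OF sch_q] in measurable)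
    then show ?thesis
      by (simp add: fourier_lborel[OF schwartz_measurable[OF sch_q]] fourier_lborel)
  qed
  moreover have "(\<lambda>n. (cis (s n * \<xi> $ j) - 1) / complex_of_real (s n) * fourier f \<xi>)
      \<longlonglongrightarrow> \<i> * complex_of_real (\<xi> $ j) * fourier f \<xi>"
  proof (rule tendsto_mult_right)
    define a where "a = \<xi> $ j"
    show "(\<lambda>n. (cis (s n * \<xi> $ j) - 1) / complex_of_real (s n)) \<longlonglongrightarrow> \<i> * complex_of_real (\<xi> $ j)"
      unfolding a_def[symmetric]
    proof (rule LIM_zero_cancel, rule Lim_null_comparison)
      show "(\<lambda>n. \<bar>s n\<bar> * a\<^sup>2) \<longlonglongrightarrow> 0"
        using tendsto_mult_left_zero[OF tendsto_rabs_zero[OF s_lim]] .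
      show "\<forall>\<^sub>F n in sequentially. norm ((cis (s n * a) - 1) / complex_of_real (s n) - \<i> * complex_of_real a) \<le> \<bar>s n\<bar> * a\<^sup>2"
      proof (rule always_eventually, rule allI)
        fix n
        have "(cis (s n * a) - 1) / complex_of_real (s n) - \<i> * complex_of_real a
            = (cis (s n * a) - 1 - \<i> * complex_of_real (s n * a)) / complex_of_real (s n)"
          using s0(1)[of n] by (simp add: field_simps)
        also have "cmod \<dots> \<le> (s n * a)\<^sup>2 / \<bar>s n\<bar>"
          using cmod_cis_minus_linear[of "s n * a"] by (simp add: norm_divide divide_right_mono)
        also have "\<dots> = \<bar>s n\<bar> * a\<^sup>2"
          using s0(1)[of n] by (simp add: power2_eq_square field_simps)
        finally show "norm ((cis (s n * a) - 1) / complex_of_real (s n) - \<i> * complex_of_real a) \<le> \<bar>s n\<bar> * a\<^sup>2" .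
      qed
    qed
  qed
  ultimately show ?thesis unfolding eq by (rule LIMSEQ_unique)
qed

text \<open>The transforms of Schwartz functions are stable under partial derivatives, because such
  a derivative amounts to multiplying the original function by a coordinate.\<close>

lemma schwartz_fourier:
  fixes f :: "real^'n::finite \<Rightarrow> complex"
  assumes "schwartz f"
  shows "schwartz (fourier f)"
proof (rule schwartz_coinduct[where P = "\<lambda>h. \<exists>g. schwartz g \<and> h = fourier g"])
  show "\<exists>g. schwartz g \<and> fourier f = fourier g" using assms by blast
next
  fix h :: "real^'n \<Rightarrow> complex" and x assume "\<exists>g. schwartz g \<and> h = fourier g"
  then show "h differentiable (at x)"
    using fourier_has_derivative by (auto simp: differentiable_def)
next
  fix h :: "real^'n \<Rightarrow> complex" and j assume "\<exists>g. schwartz g \<and> h = fourier g"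
  then show "\<exists>g. schwartz g \<and> partial_deriv j h = fourier g"
    using partial_deriv_fourier schwartz_cmult[OF schwartz_coord_mult] by metis
next
  fix h :: "real^'n \<Rightarrow> complex" and k assume "\<exists>g. schwartz g \<and> h = fourier g"
  \<comment> \<open>Decay of order k + 1 for the transform of g uses decay of order k for the
    transforms of its partial derivatives, which have modulus |\<xi>_j| |F g|. Hence the induction
    over k ranges over all g.\<close>
  moreover have "\<forall>g. schwartz g \<longrightarrow> (\<exists>C. \<forall>\<xi>::real^'n. (1 + norm \<xi>) ^ k * cmod (fourier g \<xi>) \<le> C)"
  proof (induction k)
    case 0
    then show ?case using norm_fourier_le[OF schwartz_integrable] by auto
  next
    case (Suc k)
    show ?case
    proof safe
      fix g :: "real^'n \<Rightarrow> complex" assume g: "schwartz g"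
      obtain C where C: "\<And>\<xi>. (1 + norm \<xi>) ^ k * cmod (fourier g \<xi>) \<le> C"
        using Suc g by blast
      have "\<forall>j. \<exists>C. \<forall>\<xi>. (1 + norm \<xi>) ^ k * cmod (fourier (partial_deriv j g) \<xi>) \<le> C"
        using Suc schwartz_partial_deriv[OF g] by blast
      then obtain C' where C': "\<And>j \<xi>. (1 + norm \<xi>) ^ k * cmod (fourier (partial_deriv j g) \<xi>) \<le> C' j"
        by metis
      have "(1 + norm \<xi>) ^ Suc k * cmod (fourier g \<xi>) \<le> C + (\<Sum>j\<in>UNIV. C' j)" for \<xi>
      proof -
        have "(1 + norm \<xi>) * cmod (fourier g \<xi>) \<le> (1 + (\<Sum>j\<in>UNIV. \<bar>\<xi> $ j\<bar>)) * cmod (fourier g \<xi>)"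
          by (intro mult_right_mono add_left_mono norm_le_l1_cart) auto
        also have "\<dots> = cmod (fourier g \<xi>) + (\<Sum>j\<in>UNIV. cmod (fourier (partial_deriv j g) \<xi>))"
          by (simp add: fourier_partial_deriv[OF g] norm_mult distrib_right sum_distrib_right)
        finally have "(1 + norm \<xi>) ^ k * ((1 + norm \<xi>) * cmod (fourier g \<xi>))
            \<le> (1 + norm \<xi>) ^ k * (cmod (fourier g \<xi>) + (\<Sum>j\<in>UNIV. cmod (fourier (partial_deriv j g) \<xi>)))"
          by (rule mult_left_mono) simp
        also have "\<dots> = (1 + norm \<xi>) ^ k * cmod (fourier g \<xi>)
            + (\<Sum>j\<in>UNIV. (1 + norm \<xi>) ^ k * cmod (fourier (partial_deriv j g) \<xi>))"
          by (simp add: distrib_left sum_distrib_left)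
        also have "\<dots> \<le> C + (\<Sum>j\<in>UNIV. C' j)"
          by (intro add_mono sum_mono C C')
        finally show ?thesis by (simp add: mult_ac)
      qed
      then show "\<exists>C. \<forall>\<xi>. (1 + norm \<xi>) ^ Suc k * cmod (fourier g \<xi>) \<le> C" by blast
    qed
  qed
  ultimately show "\<exists>C. \<forall>x. (1 + norm x) ^ k * cmod (h x) \<le> C" by blast
qed

lemma schwartz_inv_fourier:
  assumes "schwartz f"
  shows "schwartz (inv_fourier f)"
  unfolding inv_fourier_fourier_reflect[abs_def]
  by (intro schwartz_cmult schwartz_reflect[of "fourier f"] schwartz_fourier assms)

section \<open>Fourier inversion and Plancherel on the Schwartz class\<close>

lemma integrable_pair_mult:
  fixes f :: "'a::euclidean_space \<Rightarrow> complex" and g :: "'b::euclidean_space \<Rightarrow> complex"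
  assumes f: "integrable lborel f" and g: "integrable lborel g"
  shows "integrable (lborel \<Otimes>\<^sub>M lborel) (\<lambda>(x, y). f x * g y)"
proof -
  have [measurable]: "f \<in> borel_measurable borel" "g \<in> borel_measurable borel" using assms by auto
  show ?thesis
  proof (rule lborel_pair.Fubini_integrable)
    show "(\<lambda>(x, y). f x * g y) \<in> borel_measurable (lborel \<Otimes>\<^sub>M lborel)" by measurable
    show "integrable lborel (\<lambda>x. LINT y|lborel. norm (case (x, y) of (x, y) \<Rightarrow> f x * g y))"
      using f g by (simp add: norm_mult)
    show "AE x in lborel. integrable lborel (\<lambda>y. case (x, y) of (x, y) \<Rightarrow> f x * g y)"
      using g by simp
  qed
qed

lemma fourier_multiplication_formula:
  fixes f g :: "real^'n::finite \<Rightarrow> complex"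
  assumes f: "integrable lborel f" and g: "integrable lborel g"
  shows "(LINT \<xi>|lborel. fourier f \<xi> * g \<xi>) = (LINT x|lborel. f x * fourier g x)"
proof -
  have [measurable]: "f \<in> borel_measurable borel" "g \<in> borel_measurable borel" using assms by auto
  have int: "integrable (lborel \<Otimes>\<^sub>M lborel) (case_prod (\<lambda>x \<xi>. cis (- (x \<bullet> \<xi>)) * (f x * g \<xi>)))"
    by (rule Bochner_Integration.integrable_bound[OF integrable_pair_mult[OF f g]])
      (auto simp: norm_mult intro!: AE_I2)
  have "(LINT \<xi>|lborel. fourier f \<xi> * g \<xi>) = (LINT \<xi>|lborel. LINT x|lborel. cis (- (x \<bullet> \<xi>)) * (f x * g \<xi>))"
    by (simp add: fourier_lborel mult.assoc flip: integral_mult_left_zero)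
  also have "\<dots> = (LINT x|lborel. LINT \<xi>|lborel. cis (- (x \<bullet> \<xi>)) * (f x * g \<xi>))"
    by (rule lborel_pair.Fubini_integral[OF int])
  also have "\<dots> = (LINT x|lborel. f x * fourier g x)"
    by (simp add: fourier_lborel inner_commute mult_ac flip: integral_mult_right_zero)
  finally show ?thesis .
qed

lemma integral_gauss:
  "(LINT x|lborel. gauss (1/2) (x::real^'n::finite)) = complex_of_real (sqrt (2 * pi) ^ CARD('n))"
proof -
  have g1: "(\<integral>\<^sup>+x. ennreal (exp (- x\<^sup>2 / 2)) \<partial>lborel) = ennreal (sqrt (2 * pi))"
  proof -
    have "has_bochner_integral lborel (\<lambda>x. sqrt (2 * pi) * std_normal_density x) (sqrt (2 * pi) * 1)"
      by (intro has_bochner_integral_mult_right) (auto simp: has_bochner_integral_iff)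
    then have "has_bochner_integral lborel (\<lambda>x::real. exp (- x\<^sup>2 / 2)) (sqrt (2 * pi))"
      by (simp add: std_normal_density_def)
    then show ?thesis
      by (intro nn_integral_eq_integral[THEN trans]) (auto simp: has_bochner_integral_iff)
  qed
  have "(\<integral>\<^sup>+(x::real^'n). ennreal (exp (- (1/2 * (norm x)\<^sup>2))) \<partial>lborel)
      = (\<integral>\<^sup>+(x::real^'n). (\<Prod>b\<in>Basis. ennreal (exp (- (x \<bullet> b)\<^sup>2 / 2))) \<partial>lborel)"
  proof (rule nn_integral_cong)
    fix x :: "real^'n"
    have "(norm x)\<^sup>2 = (\<Sum>b\<in>Basis. (x \<bullet> b)\<^sup>2)"
      by (simp add: norm_eq_sqrt_inner euclidean_inner[of x x] sum_nonneg flip: power2_eq_square)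
    then have "exp (- (1/2 * (norm x)\<^sup>2)) = (\<Prod>b\<in>(Basis::(real^'n) set). exp (- (x \<bullet> b)\<^sup>2 / 2))"
      by (simp add: exp_sum[symmetric] sum_negf sum_divide_distrib[symmetric])
    then show "ennreal (exp (- (1/2 * (norm x)\<^sup>2))) = (\<Prod>b\<in>Basis. ennreal (exp (- (x \<bullet> b)\<^sup>2 / 2)))"
      by (simp add: prod_ennreal)
  qed
  also have "\<dots> = (\<Prod>b\<in>(Basis :: (real^'n) set). (\<integral>\<^sup>+x. ennreal (exp (- x\<^sup>2 / 2)) \<partial>lborel))"
    by (rule nn_integral_lborel_prod) auto
  also have "\<dots> = ennreal (sqrt (2 * pi) ^ CARD('n))"
    using g1 by (simp add: ennreal_power)
  finally have nn: "(\<integral>\<^sup>+(x::real^'n). ennreal (exp (- (1/2 * (norm x)\<^sup>2))) \<partial>lborel) = ennreal (sqrt (2 * pi) ^ CARD('n))" .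
  have "has_bochner_integral lborel (\<lambda>x::real^'n. exp (- (1/2 * (norm x)\<^sup>2))) (sqrt (2 * pi) ^ CARD('n))"
    by (rule has_bochner_integral_nn_integral[OF _ _ _ nn]) auto
  then have "(LINT x|lborel. complex_of_real (exp (- (1/2 * (norm (x::real^'n))\<^sup>2)))) = complex_of_real (sqrt (2 * pi) ^ CARD('n))"
    by (simp only: integral_complex_of_real has_bochner_integral_integral_eq)
  moreover have "gauss (1/2) x = complex_of_real (exp (- (1/2 * (norm x)\<^sup>2)))" for x :: "real^'n"
    by (simp add: gauss_def flip: exp_of_real)
  ultimately show ?thesis by simp
qed

text \<open>The Gaussian satisfies d_j G = - x_j G, and the Fourier transform exchanges the two
  sides of this equation up to constants, so the transform satisfies it as well. Hence exp
  (|\<xi>|^2 / 2) times the transform is constant, and its value at 0 is the Gaussian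
  integral.\<close>

lemma fourier_gauss:
  "fourier (gauss (1/2)) (\<xi>::real^'n::finite) = complex_of_real (sqrt (2 * pi) ^ CARD('n)) * gauss (1/2) \<xi>"
proof -
  define G :: "real^'n \<Rightarrow> complex" where "G = gauss (1/2)"
  have G: "schwartz G" unfolding G_def by (rule schwartz_gauss) simp
  have dG: "partial_deriv j G = (\<lambda>x. - (complex_of_real (x $ j) * G x))" for j
  proof
    fix x
    have D: "((\<lambda>x::real^'n. - complex_of_real (1/2 * (norm x)\<^sup>2)) has_derivative
        (\<lambda>h. - complex_of_real (1/2 * (2 * (x \<bullet> h))))) (at x)" for x :: "real^'n"
      unfolding power2_norm_eq_inner
      by (intro has_derivative_minus has_derivative_of_real has_derivative_mult_right)
        (auto intro!: derivative_eq_intros simp: inner_commute)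
    have "(exp has_derivative (*) (G x)) (at (- complex_of_real (1/2 * (norm x)\<^sup>2)))"
      using DERIV_exp[of "- complex_of_real (1/2 * (norm x)\<^sup>2)"] by (simp add: has_field_derivative_def gauss_def G_def)
    from partial_deriv_eq[OF has_derivative_compose[OF D this]]
    show "partial_deriv j G x = - (complex_of_real (x $ j) * G x)"
      by (simp add: gauss_def[abs_def] G_def cart_eq_inner_axis[symmetric] mult.commute)
  qed
  have dF: "partial_deriv j (fourier G) \<xi> = - complex_of_real (\<xi> $ j) * fourier G \<xi>" for j \<xi>
  proof -
    have "partial_deriv j (fourier G) \<xi> = fourier (\<lambda>x. \<i> * partial_deriv j G x) \<xi>"
      unfolding partial_deriv_fourier[OF G] dG by simp
    also have "\<dots> = \<i> * (\<i> * complex_of_real (\<xi> $ j) * fourier G \<xi>)"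
      by (simp only: fourier_cmult fourier_partial_deriv[OF G])
    finally show ?thesis by (simp flip: mult.assoc)
  qed
  have der: "((\<lambda>\<xi>. exp (complex_of_real (1/2 * (norm \<xi>)\<^sup>2)) * fourier G \<xi>) has_derivative (\<lambda>h. 0)) (at \<xi>)" for \<xi> :: "real^'n"
  proof -
    let ?E = "exp (complex_of_real (1/2 * (norm \<xi>)\<^sup>2))"
    have D: "((\<lambda>x::real^'n. complex_of_real (1/2 * (norm x)\<^sup>2)) has_derivative
        (\<lambda>h. complex_of_real (1/2 * (2 * (\<xi> \<bullet> h))))) (at \<xi>)"
      unfolding power2_norm_eq_inner
      by (intro has_derivative_of_real has_derivative_mult_right)
        (auto intro!: derivative_eq_intros simp: inner_commute)
    have 1: "(exp has_derivative (*) ?E) (at (complex_of_real (1/2 * (norm \<xi>)\<^sup>2)))"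
      using DERIV_exp[of "complex_of_real (1/2 * (norm \<xi>)\<^sup>2)"] by (simp add: has_field_derivative_def)
    have 2: "(fourier G has_derivative (\<lambda>h. \<Sum>j\<in>UNIV. complex_of_real (h $ j) * partial_deriv j (fourier G) \<xi>)) (at \<xi>)"
      by (rule schwartz_has_derivative[OF schwartz_fourier[OF G]])
    have "((\<lambda>\<xi>. exp (complex_of_real (1/2 * (norm \<xi>)\<^sup>2)) * fourier G \<xi>) has_derivative
       (\<lambda>h. ?E * (\<Sum>j\<in>UNIV. complex_of_real (h $ j) * partial_deriv j (fourier G) \<xi>)
        + ?E * complex_of_real (1/2 * (2 * (\<xi> \<bullet> h))) * fourier G \<xi>)) (at \<xi>)"
      by (rule has_derivative_mult[OF has_derivative_compose[OF D 1] 2])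
    moreover have "?E * (\<Sum>j\<in>UNIV. complex_of_real (h $ j) * partial_deriv j (fourier G) \<xi>)
        + ?E * complex_of_real (1/2 * (2 * (\<xi> \<bullet> h))) * fourier G \<xi> = 0" for h
    proof -
      have "(\<Sum>j\<in>UNIV. complex_of_real (h $ j) * partial_deriv j (fourier G) \<xi>)
          = - (complex_of_real (\<xi> \<bullet> h) * fourier G \<xi>)"
        by (simp add: dF inner_vec_def sum_distrib_left sum_negf mult_ac)
      then show ?thesis by (simp add: algebra_simps)
    qed
    ultimately show ?thesis by simp
  qed
  have "\<exists>c. \<forall>\<xi>\<in>(UNIV::(real^'n) set). exp (complex_of_real (1/2 * (norm \<xi>)\<^sup>2)) * fourier G \<xi> = c"
    by (rule has_derivative_zero_constant[OF convex_UNIV der])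
  then obtain c where c: "\<And>\<xi>. exp (complex_of_real (1/2 * (norm \<xi>)\<^sup>2)) * fourier G \<xi> = c" by blast
  have "c = fourier G 0" using c[of 0] by simp
  also have "\<dots> = complex_of_real (sqrt (2 * pi) ^ CARD('n))"
    using schwartz_measurable[OF G] integral_gauss by (simp add: fourier_lborel G_def)
  finally have "exp (complex_of_real (1/2 * (norm \<xi>)\<^sup>2)) * fourier G \<xi> = complex_of_real (sqrt (2 * pi) ^ CARD('n))"
    using c by simp
  then have "gauss (1/2) \<xi> * (exp (complex_of_real (1/2 * (norm \<xi>)\<^sup>2)) * fourier G \<xi>)
     = gauss (1/2) \<xi> * complex_of_real (sqrt (2 * pi) ^ CARD('n))" by simp
  moreover have "gauss (1/2) \<xi> * exp (complex_of_real (1/2 * (norm \<xi>)\<^sup>2)) = 1"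
    unfolding gauss_def exp_add[symmetric] by simp
  ultimately show ?thesis unfolding G_def by (metis mult.assoc mult.commute mult.left_neutral)
qed

text \<open>The double integral behind the inversion formula does not converge absolutely, so a
  Gaussian factor of width 1 / s regularises it. The multiplication formula moves the transform onto
  this factor, where it becomes an approximate identity around x. As s tends to 0, one side tends to
  the inversion integral and the other to a multiple of f x.\<close>

theorem inv_fourier_fourier:
  fixes f :: "real^'n::finite \<Rightarrow> complex"
  assumes f: "schwartz f"
  shows "inv_fourier (fourier f) = f"
proof
  fix x
  define G :: "real^'n \<Rightarrow> complex" where "G = gauss (1/2)"
  define K where "K = complex_of_real (sqrt (2 * pi) ^ CARD('n))"
  have G: "schwartz G" unfolding G_def by (rule schwartz_gauss) simp
  have Gint: "integrable lborel G" by (rule schwartz_integrable[OF G])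
  have Gle: "cmod (G y) \<le> 1" for y by (simp add: G_def norm_gauss)
  have Gcont: "continuous_on UNIV G" by (rule schwartz_continuous[OF G])
  have G0: "G 0 = 1" by (simp add: G_def gauss_def)
  have [measurable]: "f \<in> borel_measurable borel" "G \<in> borel_measurable borel" "fourier f \<in> borel_measurable borel"
    using f G schwartz_fourier schwartz_measurable by blast+
  have FG: "fourier G = (\<lambda>\<xi>. K * G \<xi>)"
    by (auto simp: G_def K_def fourier_gauss)
  define s where "s n = 1 / real (Suc n)" for n
  have s0: "s n \<noteq> 0" "0 < s n" for n by (auto simp: s_def)
  have s_lim: "s \<longlonglongrightarrow> 0" unfolding s_def using LIMSEQ_inverse_real_of_nat by (simp add: inverse_eq_divide)
  have eq: "(LINT \<xi>|lborel. fourier f \<xi> * (cis (x \<bullet> \<xi>) * G (s n *\<^sub>R \<xi>)))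
      = K * (LINT z|lborel. f (x + s n *\<^sub>R z) * G z)" for n
  proof -
    have iG: "integrable lborel (\<lambda>\<xi>. G (s n *\<^sub>R \<xi>))"
      using integral_lborel_affine(1)[of G "s n" 0] Gint s0 by simp
    have int: "integrable lborel (\<lambda>\<xi>. cis (x \<bullet> \<xi>) * G (s n *\<^sub>R \<xi>))"
      using integrable_cis_mult(1)[OF iG, of x] by (simp add: inner_commute)
    have F: "fourier (\<lambda>\<xi>. cis (x \<bullet> \<xi>) * G (s n *\<^sub>R \<xi>)) y = complex_of_real (1 / s n ^ CARD('n)) * (K * G ((1 / s n) *\<^sub>R (y - x)))" for y
    proof -
      have "K * G ((1 / s n) *\<^sub>R (y - x)) = (LINT \<eta>|lborel. cis (- (\<eta> \<bullet> ((1 / s n) *\<^sub>R (y - x)))) * G \<eta>)"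
        unfolding FG[symmetric, THEN fun_cong] by (rule fourier_lborel) measurable
      also have "\<dots> = s n ^ CARD('n) *\<^sub>R (LINT \<xi>|lborel. cis (- ((s n *\<^sub>R \<xi>) \<bullet> ((1 / s n) *\<^sub>R (y - x)))) * G (s n *\<^sub>R \<xi>))"
        using integral_lborel_affine(2)[of "\<lambda>\<eta>. cis (- (\<eta> \<bullet> ((1 / s n) *\<^sub>R (y - x)))) * G \<eta>" "s n" 0] s0[of n] by simp
      also have "(\<lambda>\<xi>. cis (- ((s n *\<^sub>R \<xi>) \<bullet> ((1 / s n) *\<^sub>R (y - x)))) * G (s n *\<^sub>R \<xi>))
          = (\<lambda>\<xi>. cis (- (\<xi> \<bullet> y)) * (cis (x \<bullet> \<xi>) * G (s n *\<^sub>R \<xi>)))"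
        using s0[of n] by (simp add: cis_mult inner_diff_right inner_commute flip: mult.assoc)
      also have "(LINT \<xi>|lborel. cis (- (\<xi> \<bullet> y)) * (cis (x \<bullet> \<xi>) * G (s n *\<^sub>R \<xi>)))
          = fourier (\<lambda>\<xi>. cis (x \<bullet> \<xi>) * G (s n *\<^sub>R \<xi>)) y"
        by (rule fourier_lborel[symmetric]) measurable
      finally show ?thesis using s0[of n] by (simp add: scaleR_conv_of_real)
    qed
    have "(LINT \<xi>|lborel. fourier f \<xi> * (cis (x \<bullet> \<xi>) * G (s n *\<^sub>R \<xi>)))
        = (LINT y|lborel. f y * (complex_of_real (1 / s n ^ CARD('n)) * (K * G ((1 / s n) *\<^sub>R (y - x)))))"
      unfolding fourier_multiplication_formula[OF schwartz_integrable[OF f] int] F ..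
    also have "\<dots> = complex_of_real (1 / s n ^ CARD('n)) * K * (LINT y|lborel. f y * G ((1 / s n) *\<^sub>R (y - x)))"
      by (simp add: mult_ac flip: integral_mult_right_zero)
    also have "(LINT y|lborel. f y * G ((1 / s n) *\<^sub>R (y - x)))
        = s n ^ CARD('n) *\<^sub>R (LINT z|lborel. f (x + s n *\<^sub>R z) * G z)"
      using integral_lborel_affine(2)[of "\<lambda>y. f y * G ((1 / s n) *\<^sub>R (y - x))" "s n" x] s0[of n] by simp
    finally show ?thesis using s0[of n] by (simp add: scaleR_conv_of_real)
  qed
  have "(\<lambda>n. LINT \<xi>|lborel. fourier f \<xi> * (cis (x \<bullet> \<xi>) * G (s n *\<^sub>R \<xi>)))
      \<longlonglongrightarrow> (LINT \<xi>|lborel. fourier f \<xi> * (cis (x \<bullet> \<xi>) * 1))"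
  proof (rule integral_dominated_convergence)
    show "integrable lborel (\<lambda>\<xi>. cmod (fourier f \<xi>))"
      by (intro integrable_norm schwartz_integrable schwartz_fourier f)
    show "AE \<xi> in lborel. (\<lambda>n. fourier f \<xi> * (cis (x \<bullet> \<xi>) * G (s n *\<^sub>R \<xi>))) \<longlonglongrightarrow> fourier f \<xi> * (cis (x \<bullet> \<xi>) * 1)"
    proof (rule AE_I2)
      fix \<xi> :: "real^'n"
      have "(\<lambda>n. s n *\<^sub>R \<xi>) \<longlonglongrightarrow> 0 *\<^sub>R \<xi>" by (rule tendsto_scaleR[OF s_lim tendsto_const])
      then have "(\<lambda>n. G (s n *\<^sub>R \<xi>)) \<longlonglongrightarrow> G 0"
        using continuous_on_tendsto_compose[OF Gcont] by simp
      then show "(\<lambda>n. fourier f \<xi> * (cis (x \<bullet> \<xi>) * G (s n *\<^sub>R \<xi>))) \<longlonglongrightarrow> fourier f \<xi> * (cis (x \<bullet> \<xi>) * 1)"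
        unfolding G0 by (intro tendsto_intros)
    qed
    show "AE \<xi> in lborel. norm (fourier f \<xi> * (cis (x \<bullet> \<xi>) * G (s n *\<^sub>R \<xi>))) \<le> cmod (fourier f \<xi>)" for n
      using Gle by (auto simp: norm_mult intro!: AE_I2 mult_left_le)
  qed measurable
  moreover obtain C where C: "\<And>y. (1 + norm y) ^ 0 * cmod (f y) \<le> C"
    using schwartz_decay[OF f] by metis
  have "(\<lambda>n. K * (LINT z|lborel. f (x + s n *\<^sub>R z) * G z)) \<longlonglongrightarrow> K * (LINT z|lborel. f x * G z)"
  proof (rule tendsto_mult_left, rule integral_dominated_convergence)
    show "integrable lborel (\<lambda>z. C * cmod (G z))"
      by (intro integrable_mult_right integrable_norm Gint)
    show "AE z in lborel. (\<lambda>n. f (x + s n *\<^sub>R z) * G z) \<longlonglongrightarrow> f x * G z"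
    proof (rule AE_I2)
      fix z :: "real^'n"
      have "(\<lambda>n. x + s n *\<^sub>R z) \<longlonglongrightarrow> x + 0 *\<^sub>R z"
        by (rule tendsto_add[OF tendsto_const tendsto_scaleR[OF s_lim tendsto_const]])
      then have "(\<lambda>n. f (x + s n *\<^sub>R z)) \<longlonglongrightarrow> f x"
        using continuous_on_tendsto_compose[OF schwartz_continuous[OF f]] by simp
      then show "(\<lambda>n. f (x + s n *\<^sub>R z) * G z) \<longlonglongrightarrow> f x * G z" by (intro tendsto_intros)
    qed
    show "AE z in lborel. norm (f (x + s n *\<^sub>R z) * G z) \<le> C * cmod (G z)" for n
      using C by (auto simp: norm_mult intro!: AE_I2 mult_right_mono)
  qed measurable
  ultimately have "(LINT \<xi>|lborel. fourier f \<xi> * (cis (x \<bullet> \<xi>) * 1)) = K * (LINT z|lborel. f x * G z)"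
    unfolding eq by (rule LIMSEQ_unique)
  also have "\<dots> = complex_of_real ((2 * pi) ^ CARD('n)) * f x"
  proof -
    \<comment> \<open>One factor \<open>K\<close> comes from the transform of the Gaussian, the
      other from its integral.\<close>
    have "K * K = complex_of_real ((2 * pi) ^ CARD('n))"
      unfolding K_def of_real_mult[symmetric] power_mult_distrib[symmetric] by simp
    then show ?thesis
      using integral_gauss[where 'n = 'n] by (simp add: G_def K_def mult.commute mult.left_commute)
  qed
  finally have "(LINT \<xi>|lborel. cis (x \<bullet> \<xi>) * fourier f \<xi>) = complex_of_real ((2 * pi) ^ CARD('n)) * f x"
    by (simp add: mult.commute)
  moreover have "(LINT \<xi>|lebesgue. cis (x \<bullet> \<xi>) * fourier f \<xi>) = (LINT \<xi>|lborel. cis (x \<bullet> \<xi>) * fourier f \<xi>)"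
    by (rule integral_completion) simp
  ultimately show "inv_fourier (fourier f) x = f x"
    by (simp add: inv_fourier_def)
qed

theorem fourier_inv_fourier:
  fixes f :: "real^'n::finite \<Rightarrow> complex"
  assumes f: "schwartz f"
  shows "fourier (inv_fourier f) = f"
proof
  fix \<xi>
  let ?K = "complex_of_real (1 / (2 * pi) ^ CARD('n))"
  have [measurable]: "fourier f \<in> borel_measurable borel"
    by (rule schwartz_measurable[OF schwartz_fourier[OF f]])
  have "fourier (inv_fourier f) \<xi> = ?K * fourier (\<lambda>x. fourier f (- x)) \<xi>"
    unfolding inv_fourier_fourier_reflect[abs_def] by (rule fourier_cmult)
  also have "fourier (\<lambda>x. fourier f (- x)) \<xi> = (LINT x|lborel. cis (- (x \<bullet> \<xi>)) * fourier f (- x))"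
    by (rule fourier_lborel) measurable
  also have "\<dots> = (LINT x|lborel. cis (x \<bullet> \<xi>) * fourier f x)"
    using integral_lborel_reflect[of "\<lambda>x. cis (x \<bullet> \<xi>) * fourier f x"] by simp
  also have "\<dots> = fourier (fourier f) (- \<xi>)"
    by (simp add: fourier_lborel)
  also have "?K * \<dots> = inv_fourier (fourier f) \<xi>"
    by (simp add: inv_fourier_fourier_reflect)
  also have "\<dots> = f \<xi>" by (simp add: inv_fourier_fourier[OF f])
  finally show "fourier (inv_fourier f) \<xi> = f \<xi>" .
qed

lemma cnj_fourier:
  fixes f :: "real^'n::finite \<Rightarrow> complex"
  shows "cnj (fourier f \<xi>) = complex_of_real ((2 * pi) ^ CARD('n)) * inv_fourier (\<lambda>x. cnj (f x)) \<xi>"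
  unfolding fourier_def inv_fourier_def
  by (subst Bochner_Integration.integral_cnj[symmetric])
    (simp add: cis_cnj inner_commute del: Bochner_Integration.integral_cnj)

theorem plancherel_schwartz:
  fixes f :: "real^'n::finite \<Rightarrow> complex"
  assumes f: "schwartz f"
  shows "(n2 lborel (fourier f))\<^sup>2 = (2 * pi) ^ CARD('n) * (n2 lborel f)\<^sup>2"
proof -
  have "complex_of_real ((n2 lborel (fourier f))\<^sup>2) = (LINT \<xi>|lborel. fourier f \<xi> * cnj (fourier f \<xi>))"
    unfolding n2_power2 integral_complex_of_real[symmetric] complex_norm_square ..
  also have "\<dots> = complex_of_real ((2 * pi) ^ CARD('n)) * (LINT \<xi>|lborel. fourier f \<xi> * inv_fourier (\<lambda>x. cnj (f x)) \<xi>)"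
    unfolding cnj_fourier integral_mult_right_zero[symmetric] by (simp add: mult_ac)
  also have "(LINT \<xi>|lborel. fourier f \<xi> * inv_fourier (\<lambda>x. cnj (f x)) \<xi>)
      = (LINT x|lborel. f x * fourier (inv_fourier (\<lambda>x. cnj (f x))) x)"
    by (intro fourier_multiplication_formula schwartz_integrable schwartz_inv_fourier schwartz_cnj f)
  also have "\<dots> = complex_of_real ((n2 lborel f)\<^sup>2)"
    unfolding fourier_inv_fourier[OF schwartz_cnj[OF f]] n2_power2 integral_complex_of_real[symmetric] complex_norm_square ..
  finally have "complex_of_real ((n2 lborel (fourier f))\<^sup>2) = complex_of_real ((2 * pi) ^ CARD('n) * (n2 lborel f)\<^sup>2)"
    by simp
  then show ?thesis by (simp only: of_real_eq_iff)
qed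

section \<open>Density of the Schwartz class and the Plancherel theorem\<close>

text \<open>The pi-lambda theorem for open boxes, which are stable under intersection. The countable
  disjoint union is rearranged into binary disjoint unions and one increasing union, the form in
  which additivity and dominated convergence apply.\<close>

lemma borel_box_induct [consumes 1, case_names box empty compl union incseq]:
  fixes A :: "'a::euclidean_space set"
  assumes "A \<in> sets borel"
    and box: "\<And>a b. P (box a b)"
    and empty: "P {}"
    and compl: "\<And>A. A \<in> sets borel \<Longrightarrow> P A \<Longrightarrow> P (UNIV - A)"
    and union: "\<And>A B. A \<in> sets borel \<Longrightarrow> B \<in> sets borel \<Longrightarrow> A \<inter> B = {} \<Longrightarrow> P A \<Longrightarrow> P B \<Longrightarrow> P (A \<union> B)"
    and incseq: "\<And>A. range A \<subseteq> sets borel \<Longrightarrow> incseq A \<Longrightarrow> (\<And>k::nat. P (A k)) \<Longrightarrow> P (\<Union>k. A k)"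
  shows "P A"
proof -
  let ?G = "range (\<lambda>(a, b). box a b :: 'a set)"
  have "Int_stable ?G"
    by (auto simp: Int_stable_def box_Int_box)
  moreover have "?G \<subseteq> Pow UNIV" by auto
  moreover have "A \<in> sigma_sets UNIV ?G"
    using assms(1) unfolding borel_eq_box by simp
  moreover have sets_eq: "sigma_sets UNIV ?G = sets borel"
    unfolding borel_eq_box by simp
  ultimately show ?thesis
  proof (induction rule: sigma_sets_induct_disjoint)
    case (basic A)
    then show ?case using box by auto
  next
    case empty
    show ?case by fact
  next
    case (compl A)
    then show ?case using assms(4) sets_eq by auto
  next
    case (union A)
    define B where "B k = (\<Union>i<k. A i)" for k
    have A: "A i \<in> sets borel" for i using union(2) sets_eq by auto
    have B: "B k \<in> sets borel \<and> P (B k)" for k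
    proof (induction k)
      case 0
      then show ?case by (simp add: B_def empty)
    next
      case (Suc k)
      have "B (Suc k) = B k \<union> A k" by (auto simp: B_def lessThan_Suc)
      moreover have "B k \<inter> A k = {}"
        using union(1) unfolding B_def disjoint_family_on_def by (auto dest: less_imp_neq)
      ultimately show ?case
        using Suc A[of k] union(3)[of k] sets_eq assms(5)[of "B k" "A k"] by (simp add: sets.Un)
    qed
    have "P (\<Union>k. B k)"
    proof (rule incseq)
      show "range B \<subseteq> sets borel" using B by blast
      show "incseq B" by (rule incseq_SucI) (auto simp: B_def lessThan_Suc)
      show "P (B k)" for k using B by blast
    qed
    moreover have "(\<Union>k. B k) = (\<Union>k. A k)"
      by (auto simp: B_def)
    ultimately show ?case by simp
  qed
qed

text \<open>In the coordinates y that map the box to the cube (-1, 1)^n this is exp (- sum of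
  y_i^(2k)). As k grows it tends to 1 inside the box and to 0 outside its closure. It takes the
  place of compactly supported bump functions: it is slow, and a Gaussian factor makes it
  Schwartz.\<close>

definition box_bump :: "real^'n::finite \<Rightarrow> real^'n \<Rightarrow> nat \<Rightarrow> real^'n \<Rightarrow> complex" where
  "box_bump a b k x = complex_of_real
     (exp (- (\<Sum>i\<in>UNIV. ((x $ i - (a $ i + b $ i) / 2) / ((b $ i - a $ i) / 2)) ^ (2 * k))))"

lemma slow_box_bump: "slow (box_bump a b k)"
proof -
  let ?c = "\<lambda>i. (a $ i + b $ i) / 2" and ?r = "\<lambda>i. (b $ i - a $ i) / 2"
  have "slow (\<lambda>x. exp (- (\<Sum>i\<in>UNIV. ((complex_of_real (x $ i) + complex_of_real (- ?c i)) * complex_of_real (1 / ?r i)) ^ (2 * k))))"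
  proof (intro slow_exp slow_sum slow_power slow_mult slow_add slow_coord slow_const)
    fix x :: "real^'a"
    have "(\<Sum>i\<in>UNIV. ((complex_of_real (x $ i) + complex_of_real (- ?c i)) * complex_of_real (1 / ?r i)) ^ (2 * k))
       = complex_of_real (\<Sum>i\<in>UNIV. ((x $ i + - ?c i) * (1 / ?r i)) ^ (2 * k))"
      by simp
    also have "Re \<dots> \<ge> 0"
      unfolding Re_complex_of_real by (intro sum_nonneg) (simp add: power_mult)
    finally show "0 \<le> Re (\<Sum>i\<in>UNIV. ((complex_of_real (x $ i) + complex_of_real (- ?c i)) * complex_of_real (1 / ?r i)) ^ (2 * k))" .
  qed simp
  then show ?thesis
    unfolding box_bump_def[abs_def] by (simp flip: exp_of_real)
qed

lemma norm_box_bump_le: "cmod (box_bump a b k x) \<le> 1"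
  unfolding box_bump_def norm_of_real by (auto intro!: sum_nonneg simp: power_mult)

lemma box_bump_tendsto:
  assumes "x \<notin> cbox a b - box a b" "\<And>i. a $ i < b $ i"
  shows "(\<lambda>k. box_bump a b k x) \<longlonglongrightarrow> indicator (box a b) x"
proof -
  define y where "y i = (x $ i - (a $ i + b $ i) / 2) / ((b $ i - a $ i) / 2)" for i
  have y_lt: "\<bar>y i\<bar> < 1 \<longleftrightarrow> a $ i < x $ i \<and> x $ i < b $ i" for i
    using assms(2)[of i] by (auto simp: y_def abs_less_iff field_simps)
  have y_le: "\<bar>y i\<bar> \<le> 1 \<longleftrightarrow> a $ i \<le> x $ i \<and> x $ i \<le> b $ i" for i
    using assms(2)[of i] by (auto simp: y_def abs_le_iff field_simps)
  have bb: "box_bump a b k x = complex_of_real (exp (- (\<Sum>i\<in>UNIV. (\<bar>y i\<bar>\<^sup>2) ^ k)))" for k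
    by (simp only: box_bump_def y_def power_mult power2_abs)
  show ?thesis
  proof (cases "x \<in> box a b")
    case True
    then have "\<bar>y i\<bar> < 1" for i using y_lt by (auto simp: mem_box_cart)
    then have y1: "norm (\<bar>y i\<bar>\<^sup>2) < 1" for i by (simp add: abs_square_less_1)
    have "(\<lambda>k. complex_of_real (exp (- (\<Sum>i\<in>UNIV. (\<bar>y i\<bar>\<^sup>2) ^ k)))) \<longlonglongrightarrow> complex_of_real (exp (- (\<Sum>i\<in>(UNIV::'a set). 0)))"
      by (intro tendsto_intros y1)
    then show ?thesis using True by (simp add: bb)
  next
    case False
    then have "x \<notin> cbox a b" using assms(1) by auto
    then obtain i where "\<not> \<bar>y i\<bar> \<le> 1" using y_le by (auto simp: mem_box_cart)
    then have "1 < \<bar>y i\<bar>" by simp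
    then have "1 < \<bar>y i\<bar>\<^sup>2" by (rule one_less_power) simp
    then have "filterlim (\<lambda>k. (\<bar>y i\<bar>\<^sup>2) ^ k) at_top sequentially"
      by (intro filterlim_at_infinity_imp_filterlim_at_top filterlim_realpow_sequentially_gt1
          always_eventually) (auto intro: zero_less_power less_trans[OF zero_less_one])
    then have lim: "(\<lambda>k. exp (- ((\<bar>y i\<bar>\<^sup>2) ^ k))) \<longlonglongrightarrow> 0"
      by (intro filterlim_compose[OF exp_at_bot]) (simp add: filterlim_uminus_at_bot)
    have "(\<lambda>k. box_bump a b k x) \<longlonglongrightarrow> 0"
    proof (rule Lim_null_comparison[OF _ lim], rule always_eventually, rule allI)
      fix k
      have "(\<bar>y i\<bar>\<^sup>2) ^ k \<le> (\<Sum>i\<in>UNIV. (\<bar>y i\<bar>\<^sup>2) ^ k)"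
        by (rule member_le_sum) auto
      then show "norm (box_bump a b k x) \<le> exp (- ((\<bar>y i\<bar>\<^sup>2) ^ k))"
        unfolding bb by simp
    qed
    then show ?thesis using False by simp
  qed
qed

lemma AE_box_bump_tendsto:
  assumes "\<And>i. a $ i < b $ i"
  shows "AE x in lborel. (\<lambda>k. box_bump a b k x) \<longlonglongrightarrow> indicator (box a b) x"
proof -
  have "cbox a b - box a b \<in> null_sets lebesgue"
    using negligible_frontier_interval[of a b] by (simp add: negligible_iff_null_sets)
  then have "AE x in lebesgue. x \<notin> cbox a b - box a b"
    by (rule AE_not_in)
  then have "AE x in lborel. x \<notin> cbox a b - box a b"
    by (simp add: AE_completion_iff)
  then show ?thesis
    by eventually_elim (rule box_bump_tendsto[OF _ assms])
qed

lemma schwartz_box_bump: "schwartz (\<lambda>x. box_bump a b k x * gauss 1 x)"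
  by (intro schwartz_slow_mult slow_box_bump schwartz_gauss) simp

lemma box_eq_empty_cart: "\<not> (\<forall>i. a $ i < b $ i) \<Longrightarrow> box a b = {}" for a b :: "real^'n::finite"
  by (auto simp: mem_box_cart) (meson less_trans)

section \<open>Density in L2\<close>

definition schwartz_limit :: "(real^'n::finite \<Rightarrow> complex) \<Rightarrow> bool" where
  "schwartz_limit h \<longleftrightarrow> L2 lborel h \<and> (\<forall>e>0. \<exists>f. schwartz f \<and> n2 lborel (\<lambda>x. h x - f x) \<le> e)"

lemma schwartz_limit_L2: "schwartz_limit h \<Longrightarrow> L2 lborel h"
  by (simp add: schwartz_limit_def)

lemma schwartz_limit_schwartz: "schwartz f \<Longrightarrow> schwartz_limit f"
  unfolding schwartz_limit_def using schwartz_L2 by (auto intro!: exI[of _ f])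

lemma schwartz_limit_add:
  assumes "schwartz_limit g" "schwartz_limit h"
  shows "schwartz_limit (\<lambda>x. g x + h x)"
  unfolding schwartz_limit_def
proof (intro conjI allI impI)
  show "L2 lborel (\<lambda>x. g x + h x)" using assms by (intro L2_add) (auto simp: schwartz_limit_def)
  fix e :: real assume "0 < e"
  then obtain f f' where f: "schwartz f" "n2 lborel (\<lambda>x. g x - f x) \<le> e / 2"
    "schwartz f'" "n2 lborel (\<lambda>x. h x - f' x) \<le> e / 2"
    using assms unfolding schwartz_limit_def by (meson half_gt_zero)
  have "n2 lborel (\<lambda>x. (g x - f x) + (h x - f' x)) \<le> n2 lborel (\<lambda>x. g x - f x) + n2 lborel (\<lambda>x. h x - f' x)"
    using assms f by (intro n2_triangle L2_diff schwartz_L2 schwartz_limit_L2)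
  then have "n2 lborel (\<lambda>x. (g x + h x) - (f x + f' x)) \<le> e"
    using f by (simp add: algebra_simps)
  then show "\<exists>f. schwartz f \<and> n2 lborel (\<lambda>x. g x + h x - f x) \<le> e"
    using schwartz_add[OF f(1,3)] by blast
qed

lemma schwartz_limit_cmult:
  assumes "schwartz_limit h"
  shows "schwartz_limit (\<lambda>x. c * h x)"
  unfolding schwartz_limit_def
proof (intro conjI allI impI)
  show "L2 lborel (\<lambda>x. c * h x)" using assms by (intro L2_cmult schwartz_limit_L2)
  fix e :: real assume "0 < e"
  then have "0 < e / (1 + cmod c)" by (simp add: add_pos_nonneg)
  then obtain f where f: "schwartz f" "n2 lborel (\<lambda>x. h x - f x) \<le> e / (1 + cmod c)"
    using assms unfolding schwartz_limit_def by meson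
  have "n2 lborel (\<lambda>x. c * h x - c * f x) = cmod c * n2 lborel (\<lambda>x. h x - f x)"
    by (simp add: n2_cmult flip: right_diff_distrib)
  also have "\<dots> \<le> (1 + cmod c) * (e / (1 + cmod c))"
    using \<open>0 < e\<close> f(2) by (intro mult_mono) auto
  also have "\<dots> = e"
    by (simp add: add_nonneg_eq_0_iff)
  finally show "\<exists>f. schwartz f \<and> n2 lborel (\<lambda>x. c * h x - f x) \<le> e"
    using schwartz_cmult[OF f(1)] by blast
qed

lemma schwartz_limit_tendsto:
  assumes "\<And>k. schwartz_limit (h k)" "L2 lborel g" "(\<lambda>k. n2 lborel (\<lambda>x. h k x - g x)) \<longlonglongrightarrow> 0"
  shows "schwartz_limit g"
  unfolding schwartz_limit_def
proof (intro conjI allI impI)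
  show "L2 lborel g" by fact
  fix e :: real assume "0 < e"
  then obtain k where k: "n2 lborel (\<lambda>x. h k x - g x) < e / 2"
    using LIMSEQ_D[OF assms(3), of "e / 2"] by auto
  obtain f where f: "schwartz f" "n2 lborel (\<lambda>x. h k x - f x) \<le> e / 2"
    using assms(1)[of k] \<open>0 < e\<close> unfolding schwartz_limit_def by (meson half_gt_zero)
  have "n2 lborel (\<lambda>x. g x - f x) \<le> n2 lborel (\<lambda>x. g x - h k x) + n2 lborel (\<lambda>x. h k x - f x)"
    by (intro n2_triangle_diff schwartz_limit_L2 assms schwartz_L2 f)
  then show "\<exists>f. schwartz f \<and> n2 lborel (\<lambda>x. g x - f x) \<le> e"
    using f k n2_minus_commute[of lborel g "h k"] by (intro exI[of _ f]) auto
qed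

lemma schwartz_limit_dominated:
  assumes "\<And>k. schwartz_limit (f k)" "g \<in> borel_measurable borel" "L2 lborel h"
    and "\<And>k. AE x in lborel. cmod (f k x) \<le> cmod (h x)"
    and "AE x in lborel. (\<lambda>k. f k x) \<longlonglongrightarrow> g x"
  shows "schwartz_limit g"
proof -
  have "f k \<in> borel_measurable lborel" for k
    using schwartz_limit_L2[OF assms(1)] by (simp add: L2_def)
  note * = L2_dominated_convergence[OF this _ assms(3,4,5)]
  show ?thesis
    by (rule schwartz_limit_tendsto[OF assms(1) *]) (use assms(2) in simp_all)
qed

lemma indicator_mult_gauss_measurable:
  "A \<in> sets borel \<Longrightarrow> (\<lambda>x. indicator A x * gauss 1 x) \<in> borel_measurable borel"
  using schwartz_measurable[OF schwartz_gauss[of 1]] by (intro borel_measurable_times) auto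

lemma L2_gauss: "L2 lborel (gauss 1)"
  by (intro schwartz_L2 schwartz_gauss) simp

text \<open>The Gaussian factor makes every indicator square integrable, so the induction runs over
  all Borel sets of the whole space, and a complement is a difference from the Gaussian
  itself.\<close>

lemma schwartz_limit_indicator:
  fixes A :: "(real^'n::finite) set"
  assumes "A \<in> sets borel"
  shows "schwartz_limit (\<lambda>x. indicator A x * gauss 1 x)"
  using assms
proof (induction rule: borel_box_induct)
  case (box a b)
  show ?case
  proof (cases "\<forall>i. a $ i < b $ i")
    case True
    show ?thesis
    proof (rule schwartz_limit_dominated)
      show "schwartz_limit (\<lambda>x. box_bump a b k x * gauss 1 x)" for k
        by (rule schwartz_limit_schwartz[OF schwartz_box_bump])
      show "AE x in lborel. (\<lambda>k. box_bump a b k x * gauss 1 x) \<longlonglongrightarrow> indicator (box a b) x * gauss 1 x"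
        using AE_box_bump_tendsto[of a b] True by (auto elim!: eventually_mono intro: tendsto_mult_right)
      show "AE x in lborel. cmod (box_bump a b k x * gauss 1 x) \<le> cmod (gauss 1 x)" for k
        by (intro AE_I2) (simp add: norm_mult mult_left_le_one_le norm_box_bump_le)
    qed (auto intro: indicator_mult_gauss_measurable L2_gauss)
  next
    case False
    then have "box a b = {}" by (rule box_eq_empty_cart)
    then show ?thesis using schwartz_limit_schwartz[OF schwartz_cmult[OF schwartz_gauss[of 1], of 0]] by simp
  qed
next
  case empty
  show ?case using schwartz_limit_schwartz[OF schwartz_cmult[OF schwartz_gauss[of 1], of 0]] by simp
next
  case (compl A)
  have "schwartz_limit (\<lambda>x. gauss 1 x + (-1) * (indicator A x * gauss 1 x))"
    by (intro schwartz_limit_add schwartz_limit_cmult compl schwartz_limit_schwartz schwartz_gauss) simp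
  moreover have "gauss 1 x + (-1) * (indicator A x * gauss 1 x) = indicator (UNIV - A) x * gauss 1 x" for x
    by (auto simp: indicator_def)
  ultimately show ?case by simp
next
  case (union A B)
  have "schwartz_limit (\<lambda>x. indicator A x * gauss 1 x + indicator B x * gauss 1 x)"
    by (intro schwartz_limit_add union)
  moreover have "indicator A x * gauss 1 x + indicator B x * gauss 1 x = indicator (A \<union> B) x * gauss 1 x" for x
    using union(3) by (auto simp: indicator_def)
  ultimately show ?case by simp
next
  case (incseq A)
  have A: "A k \<in> sets borel" for k using incseq(1) by auto
  show ?case
  proof (rule schwartz_limit_dominated[OF incseq(3)])
    show "AE x in lborel. (\<lambda>k. indicator (A k) x * gauss 1 x) \<longlonglongrightarrow> indicator (\<Union>k. A k) x * gauss 1 x"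
      using LIMSEQ_indicator_incseq[OF incseq(2)] by (intro AE_I2 tendsto_mult_right)
    show "AE x in lborel. cmod (indicator (A k) x * gauss 1 x) \<le> cmod (gauss 1 x)" for k
      by (intro AE_I2) (auto simp: indicator_def)
    show "(\<lambda>x. indicator (\<Union>k. A k) x * gauss 1 x) \<in> borel_measurable borel"
      using A by (intro indicator_mult_gauss_measurable) auto
  qed (auto intro: L2_gauss)
qed

text \<open>Simple functions approximate g / gauss rather than g, so that each of them times the
  Gaussian is covered by \<open>schwartz_limit_indicator\<close>. Their size is at most twice that
  of the target, which gives the majorant 2 |g|.\<close>

theorem schwartz_dense:
  fixes g :: "real^'n::finite \<Rightarrow> complex"
  assumes g: "L2 lborel g"
  shows "schwartz_limit g"
proof -
  have [measurable]: "g \<in> borel_measurable borel" "(gauss 1 :: real^'n \<Rightarrow> complex) \<in> borel_measurable borel"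
    using g schwartz_measurable[OF schwartz_gauss[of 1]] by (auto simp: L2_def)
  have "(\<lambda>x. g x / gauss 1 x) \<in> borel_measurable lborel" by measurable
  from borel_measurable_implies_sequence_metric[OF this, of 0]
  obtain F where F: "\<And>i. simple_function lborel (F i)" "\<And>x. (\<lambda>i. F i x) \<longlonglongrightarrow> g x / gauss 1 x"
    "\<And>i x. dist (F i x) 0 \<le> 2 * dist (g x / gauss 1 x) 0"
    by auto
  have Fm [measurable]: "F i \<in> borel_measurable borel" for i
    using borel_measurable_simple_function[OF F(1)[of i]] by simp
  have lim: "schwartz_limit (\<lambda>x. F i x * gauss 1 x)" for i
  proof -
    have fin: "finite (range (F i))" using F(1)[of i] by (simp add: simple_function_def)
    have *: "schwartz_limit (\<lambda>x. \<Sum>y\<in>Y. y * (indicator (F i -` {y}) x * gauss 1 x))" if "finite Y" for Y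
      using that
    proof (induction Y rule: finite_induct)
      case empty
      show ?case using schwartz_limit_schwartz[OF schwartz_cmult[OF schwartz_gauss[of 1], of 0]] by simp
    next
      case (insert y Y)
      have "F i -` {y} \<in> sets borel" using measurable_sets[OF Fm, of "{y}" i] by simp
      then show ?case using insert
        by (simp, intro schwartz_limit_add schwartz_limit_cmult schwartz_limit_indicator) auto
    qed
    have "(\<Sum>y\<in>range (F i). y * (indicator (F i -` {y}) x * gauss 1 x)) = F i x * gauss 1 x" for x
    proof -
      have "(\<Sum>y\<in>range (F i). y * (indicator (F i -` {y}) x * gauss 1 x))
          = (\<Sum>y\<in>range (F i). if y = F i x then y * gauss 1 x else 0)"
        by (intro sum.cong) (auto simp: indicator_def)
      then show ?thesis using fin by simp
    qed
    then show ?thesis using *[OF fin] by simp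
  qed
  have "(\<lambda>k. n2 lborel (\<lambda>x. F k x * gauss 1 x - g x)) \<longlonglongrightarrow> 0"
  proof (rule L2_dominated_convergence(2))
    show "L2 lborel (\<lambda>x. 2 * g x)" by (rule L2_cmult[OF g])
    show "AE x in lborel. cmod (F k x * gauss 1 x) \<le> cmod (2 * g x)" for k
    proof (rule AE_I2)
      fix x
      have "cmod (F k x) * cmod (gauss 1 x) \<le> 2 * cmod (g x / gauss 1 x) * cmod (gauss 1 x)"
        using F(3)[of k x] by (intro mult_right_mono) auto
      then show "cmod (F k x * gauss 1 x) \<le> cmod (2 * g x)"
        by (simp add: norm_mult norm_divide gauss_nonzero)
    qed
    show "AE x in lborel. (\<lambda>k. F k x * gauss 1 x) \<longlonglongrightarrow> g x"
    proof (rule AE_I2)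
      fix x
      have "(\<lambda>k. F k x * gauss 1 x) \<longlonglongrightarrow> g x / gauss 1 x * gauss 1 x"
        by (intro tendsto_mult_right F)
      then show "(\<lambda>k. F k x * gauss 1 x) \<longlonglongrightarrow> g x" by (simp add: gauss_nonzero)
    qed
  qed measurable
  then show ?thesis by (rule schwartz_limit_tendsto[OF lim g])
qed

corollary schwartz_dense_sequence:
  fixes g :: "real^'n::finite \<Rightarrow> complex"
  assumes "L2 lborel g"
  obtains f where "\<And>k. schwartz (f k)" "(\<lambda>k. n2 lborel (\<lambda>x. f k x - g x)) \<longlonglongrightarrow> 0"
proof -
  have "\<forall>k. \<exists>f. schwartz f \<and> n2 lborel (\<lambda>x. g x - f x) \<le> 1 / real (Suc k)"
    using schwartz_dense[OF assms] unfolding schwartz_limit_def by simp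
  then obtain f where f: "\<And>k. schwartz (f k)" "\<And>k. n2 lborel (\<lambda>x. g x - f k x) \<le> 1 / real (Suc k)"
    by metis
  have "(\<lambda>k. n2 lborel (\<lambda>x. f k x - g x)) \<longlonglongrightarrow> 0"
  proof (rule Lim_null_comparison)
    show "(\<lambda>k. 1 / real (Suc k)) \<longlonglongrightarrow> 0"
      using LIMSEQ_inverse_real_of_nat by (simp add: inverse_eq_divide)
    show "\<forall>\<^sub>F k in sequentially. norm (n2 lborel (\<lambda>x. f k x - g x)) \<le> 1 / real (Suc k)"
      using f(2) n2_minus_commute[of lborel g] by (intro always_eventually allI) simp
  qed
  then show thesis using f(1) that by blast
qed

text \<open>Since g is integrable only against Schwartz functions, it is first multiplied by a
  Gaussian. Bumps times the Gaussian are admissible tests, so the resulting integrable function has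
  integral 0 over boxes and, by induction, over all Borel sets.\<close>

lemma schwartz_test_zero:
  fixes g :: "real^'n::finite \<Rightarrow> complex"
  assumes [measurable]: "g \<in> borel_measurable borel"
    and int: "\<And>f. schwartz f \<Longrightarrow> integrable lborel (\<lambda>x. g x * f x)"
    and zero: "\<And>f. schwartz f \<Longrightarrow> (LINT x|lborel. g x * f x) = 0"
  shows "AE x in lborel. g x = 0"
proof -
  define h where "h x = g x * gauss 1 x" for x
  have h: "integrable lborel h" "(LINT x|lborel. h x) = 0"
    unfolding h_def[abs_def] using int zero schwartz_gauss[of 1] by auto
  have [measurable]: "h \<in> borel_measurable borel" using h(1) by auto
  have h_ind: "integrable lborel (\<lambda>x. indicator A x * h x)" if [measurable]: "A \<in> sets borel" for A
    by (rule Bochner_Integration.integrable_bound[OF h(1)]) (auto simp: indicator_def)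
  have "(LINT x|lborel. indicator A x * h x) = 0" if "A \<in> sets borel" for A
    using that
  proof (induction rule: borel_box_induct)
    case (box a b)
    show ?case
    proof (cases "\<forall>i. a $ i < b $ i")
      case True
      have "(\<lambda>k. LINT x|lborel. box_bump a b k x * h x) \<longlonglongrightarrow> (LINT x|lborel. indicator (box a b) x * h x)"
      proof (rule integral_dominated_convergence)
        show "integrable lborel (\<lambda>x. cmod (h x))" using h by (intro integrable_norm)
        show "AE x in lborel. (\<lambda>k. box_bump a b k x * h x) \<longlonglongrightarrow> indicator (box a b) x * h x"
          using AE_box_bump_tendsto[of a b] True by (auto elim!: eventually_mono intro: tendsto_mult_right)
        have [measurable]: "box_bump a b k \<in> borel_measurable borel" for k
          unfolding box_bump_def[abs_def] by measurable
        show "(\<lambda>x. box_bump a b k x * h x) \<in> borel_measurable lborel" for k by measurable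
        show "AE x in lborel. norm (box_bump a b k x * h x) \<le> cmod (h x)" for k
          by (intro AE_I2) (simp add: norm_mult mult_left_le_one_le norm_box_bump_le)
      qed measurable
      moreover have "(LINT x|lborel. box_bump a b k x * h x) = 0" for k
        using zero[OF schwartz_box_bump[of a b k]] by (simp add: h_def mult_ac)
      ultimately show ?thesis by (simp add: LIMSEQ_const_iff)
    next
      case False
      then have "box a b = {}" by (rule box_eq_empty_cart)
      then show ?thesis by simp
    qed
  next
    case empty
    show ?case by simp
  next
    case (compl A)
    have "(LINT x|lborel. indicator (UNIV - A) x * h x) = (LINT x|lborel. h x - indicator A x * h x)"
      by (intro Bochner_Integration.integral_cong) (auto simp: indicator_def)
    also have "\<dots> = 0" using compl h h_ind by simp
    finally show ?case .
  next
    case (union A B)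
    have "(LINT x|lborel. indicator (A \<union> B) x * h x) = (LINT x|lborel. indicator A x * h x + indicator B x * h x)"
      using union(3) by (intro Bochner_Integration.integral_cong) (auto simp: indicator_def)
    also have "\<dots> = 0" using union h_ind by simp
    finally show ?case .
  next
    case (incseq A)
    have [measurable]: "A k \<in> sets borel" for k using incseq(1) by auto
    have "(\<lambda>k. LINT x|lborel. indicator (A k) x * h x) \<longlonglongrightarrow> (LINT x|lborel. indicator (\<Union>k. A k) x * h x)"
    proof (rule integral_dominated_convergence)
      show "integrable lborel (\<lambda>x. cmod (h x))" using h by (intro integrable_norm)
      show "AE x in lborel. (\<lambda>k. indicator (A k) x * h x) \<longlonglongrightarrow> indicator (\<Union>k. A k) x * h x"
        using LIMSEQ_indicator_incseq[OF incseq(2)] by (intro AE_I2 tendsto_mult_right)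
      show "AE x in lborel. norm (indicator (A k) x * h x) \<le> cmod (h x)" for k
        by (auto simp: indicator_def)
    qed measurable
    then show ?case using incseq(3) by (simp add: LIMSEQ_const_iff)
  qed
  then have "AE x in lborel. h x = 0"
    by (intro sigma_finite_measure.density_zero[OF sigma_finite_lborel h(1)])
      (simp add: set_lebesgue_integral_def scaleR_conv_of_real of_real_indicator)
  then show ?thesis by (auto simp: h_def gauss_nonzero)
qed

section \<open>The Fourier transform on L2\<close>

theorem plancherel:
  fixes g :: "real^'n::finite \<Rightarrow> complex"
  assumes g: "L2 lborel g"
  obtains \<tau> where "L2 lborel \<tau>" "(n2 lborel \<tau>)\<^sup>2 = (2 * pi) ^ CARD('n) * (n2 lborel g)\<^sup>2"
    "\<And>\<phi>. schwartz \<phi> \<Longrightarrow> (LINT x|lborel. g x * fourier \<phi> x) = (LINT \<xi>|lborel. \<tau> \<xi> * \<phi> \<xi>)"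
proof -
  obtain f where f: "\<And>k. schwartz (f k)" "(\<lambda>k. n2 lborel (\<lambda>x. f k x - g x)) \<longlonglongrightarrow> 0"
    using schwartz_dense_sequence[OF g] by blast
  define c where "c = sqrt ((2 * pi) ^ CARD('n))"
  have c: "0 < c" by (simp add: c_def)
  have n2F: "n2 lborel (fourier h) = c * n2 lborel h" if "schwartz h" for h :: "real^'n \<Rightarrow> complex"
  proof -
    have "(n2 lborel (fourier h))\<^sup>2 = (c * n2 lborel h)\<^sup>2"
      using plancherel_schwartz[OF that] by (simp add: c_def power_mult_distrib)
    then show ?thesis by (rule power2_eq_imp_eq) (use c in auto)
  qed
  have FL2: "L2 lborel (fourier (f k))" for k
    by (intro schwartz_L2 schwartz_fourier f)
  have diff: "(\<lambda>x. fourier (f m) x - fourier (f n) x) = fourier (\<lambda>x. f m x - f n x)" for m n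
    by (auto simp: fourier_diff schwartz_integrable f)
  have "\<exists>N. \<forall>m\<ge>N. \<forall>n\<ge>N. n2 lborel (\<lambda>x. fourier (f m) x - fourier (f n) x) \<le> e" if "0 < e" for e
  proof -
    obtain N where N: "\<And>m n. m \<ge> N \<Longrightarrow> n \<ge> N \<Longrightarrow> n2 lborel (\<lambda>x. f m x - f n x) \<le> e / c"
      using L2_Cauchy_of_tendsto[OF schwartz_L2[OF f(1)] g f(2), of "e / c"] \<open>0 < e\<close> c by auto
    show ?thesis
      unfolding diff n2F[OF schwartz_diff[OF f(1) f(1)]]
      using N c by (intro exI[of _ N]) (auto simp: field_simps)
  qed
  from L2_complete[OF FL2 this] obtain \<tau> where \<tau>: "L2 lborel \<tau>"
    "(\<lambda>k. n2 lborel (\<lambda>x. fourier (f k) x - \<tau> x)) \<longlonglongrightarrow> 0" by blast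
  have "(\<lambda>k. n2 lborel (fourier (f k))) \<longlonglongrightarrow> n2 lborel \<tau>"
    by (rule tendsto_n2[OF FL2 \<tau>])
  moreover have "(\<lambda>k. n2 lborel (fourier (f k))) \<longlonglongrightarrow> c * n2 lborel g"
    unfolding n2F[OF f(1)] by (intro tendsto_mult_left tendsto_n2 schwartz_L2 f g)
  ultimately have "n2 lborel \<tau> = c * n2 lborel g" by (rule LIMSEQ_unique)
  then have "(n2 lborel \<tau>)\<^sup>2 = (2 * pi) ^ CARD('n) * (n2 lborel g)\<^sup>2"
    by (simp add: c_def power_mult_distrib)
  moreover have "(LINT x|lborel. g x * fourier \<phi> x) = (LINT \<xi>|lborel. \<tau> \<xi> * \<phi> \<xi>)" if \<phi>: "schwartz \<phi>" for \<phi>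
  proof -
    have "(\<lambda>k. LINT x|lborel. f k x * fourier \<phi> x) \<longlonglongrightarrow> (LINT x|lborel. g x * fourier \<phi> x)"
      by (intro tendsto_integral_L2_mult schwartz_L2 schwartz_fourier f g \<phi>)
    moreover have "(\<lambda>k. LINT x|lborel. fourier (f k) x * \<phi> x) \<longlonglongrightarrow> (LINT \<xi>|lborel. \<tau> \<xi> * \<phi> \<xi>)"
      by (intro tendsto_integral_L2_mult FL2 \<tau> schwartz_L2 \<phi>)
    moreover have "(LINT x|lborel. fourier (f k) x * \<phi> x) = (LINT x|lborel. f k x * fourier \<phi> x)" for k
      by (intro fourier_multiplication_formula schwartz_integrable f \<phi>)
    ultimately show ?thesis using LIMSEQ_unique by simp
  qed
  ultimately show thesis using \<tau>(1) that by blast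
qed

text \<open>The inverse Fourier transform of an L2 function, characterised by duality with Schwartz
  functions because its defining integral need not converge. It determines w only almost everywhere,
  and \<open>inv_plancherel\<close> picks one representative.\<close>

definition is_inv_plancherel :: "(real^'n::finite \<Rightarrow> complex) \<Rightarrow> (real^'n \<Rightarrow> complex) \<Rightarrow> bool" where
  "is_inv_plancherel \<tau> w \<longleftrightarrow> L2 lborel w \<and>
     n2 lborel w = n2 lborel \<tau> / sqrt ((2 * pi) ^ CARD('n)) \<and>
     (\<forall>\<phi>. schwartz \<phi> \<longrightarrow> (LINT x|lborel. w x * \<phi> x) = (LINT \<xi>|lborel. \<tau> \<xi> * inv_fourier \<phi> \<xi>))"

definition inv_plancherel :: "(real^'n::finite \<Rightarrow> complex) \<Rightarrow> real^'n \<Rightarrow> complex" where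
  "inv_plancherel \<tau> = (SOME w. is_inv_plancherel \<tau> w)"

lemma is_inv_plancherel_inv_plancherel:
  fixes \<tau> :: "real^'n::finite \<Rightarrow> complex"
  assumes \<tau>: "L2 lborel \<tau>"
  shows "is_inv_plancherel \<tau> (inv_plancherel \<tau>)"
proof -
  obtain \<sigma> where \<sigma>: "L2 lborel \<sigma>" "(n2 lborel \<sigma>)\<^sup>2 = (2 * pi) ^ CARD('n) * (n2 lborel \<tau>)\<^sup>2"
    "\<And>\<phi>. schwartz \<phi> \<Longrightarrow> (LINT x|lborel. \<tau> x * fourier \<phi> x) = (LINT \<xi>|lborel. \<sigma> \<xi> * \<phi> \<xi>)"
    using plancherel[OF \<tau>] by blast
  let ?K = "complex_of_real (1 / (2 * pi) ^ CARD('n))"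
  \<comment> \<open>The inverse transform is the reflected forward transform divided by (2
    pi)^n.\<close>
  define w where "w x = ?K * \<sigma> (- x)" for x
  have [measurable]: "\<sigma> \<in> borel_measurable borel" "\<tau> \<in> borel_measurable borel"
    using \<sigma>(1) \<tau> by (auto simp: L2_def)
  have rL2: "L2 lborel (\<lambda>x. \<sigma> (- x))"
    using \<sigma>(1) integrable_lborel_reflect[of "\<lambda>x. (cmod (\<sigma> x))\<^sup>2"] by (simp add: L2_def)
  have rn2: "n2 lborel (\<lambda>x. \<sigma> (- x)) = n2 lborel \<sigma>"
    using integral_lborel_reflect[of "\<lambda>x. (cmod (\<sigma> x))\<^sup>2"] by (simp add: n2_def)
  define C where "C = (2 * pi) ^ CARD('n)"
  have C: "0 < C" by (simp add: C_def)
  have "n2 lborel \<sigma> = sqrt C * n2 lborel \<tau>"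
    by (rule power2_eq_imp_eq) (use \<sigma>(2) C in \<open>auto simp: C_def power_mult_distrib\<close>)
  then have "n2 lborel w = sqrt C * n2 lborel \<tau> / C"
    using C unfolding w_def n2_cmult rn2 C_def[symmetric] by (simp add: norm_divide)
  also have "\<dots> = n2 lborel \<tau> / sqrt C"
  proof -
    have "sqrt C * sqrt C = C" using C by simp
    then show ?thesis
      using C by (metis divide_divide_eq_left less_imp_neq mult.commute nonzero_mult_div_cancel_left
          real_sqrt_eq_zero_cancel_iff times_divide_eq_left times_divide_eq_right)
  qed
  finally have n2w: "n2 lborel w = n2 lborel \<tau> / sqrt C" .
  have "(LINT x|lborel. w x * \<phi> x) = (LINT \<xi>|lborel. \<tau> \<xi> * inv_fourier \<phi> \<xi>)" if \<phi>: "schwartz \<phi>" for \<phi>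
  proof -
    have [measurable]: "\<phi> \<in> borel_measurable borel" by (rule schwartz_measurable[OF \<phi>])
    have inv: "inv_fourier \<phi> \<xi> = ?K * fourier (\<lambda>x. \<phi> (- x)) \<xi>" for \<xi>
    proof -
      have "fourier (\<lambda>x. \<phi> (- x)) \<xi> = (LINT x|lborel. cis (- (x \<bullet> \<xi>)) * \<phi> (- x))"
        by (rule fourier_lborel) measurable
      also have "\<dots> = (LINT x|lborel. cis (x \<bullet> \<xi>) * \<phi> x)"
        using integral_lborel_reflect[of "\<lambda>x. cis (x \<bullet> \<xi>) * \<phi> x"] by simp
      also have "\<dots> = fourier \<phi> (- \<xi>)" by (simp add: fourier_lborel)
      finally show ?thesis by (simp add: inv_fourier_fourier_reflect)
    qed
    have "(LINT \<xi>|lborel. \<tau> \<xi> * inv_fourier \<phi> \<xi>) = (LINT \<xi>|lborel. ?K * (\<tau> \<xi> * fourier (\<lambda>x. \<phi> (- x)) \<xi>))"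
      unfolding inv by (simp only: mult.left_commute)
    also have "\<dots> = ?K * (LINT \<xi>|lborel. \<sigma> \<xi> * \<phi> (- \<xi>))"
      using \<sigma>(3)[OF schwartz_reflect[OF \<phi>]] by (simp only: integral_mult_right_zero)
    also have "(LINT \<xi>|lborel. \<sigma> \<xi> * \<phi> (- \<xi>)) = (LINT x|lborel. \<sigma> (- x) * \<phi> x)"
      using integral_lborel_reflect[of "\<lambda>x. \<sigma> (- x) * \<phi> x"] by simp
    also have "?K * \<dots> = (LINT x|lborel. w x * \<phi> x)"
      unfolding w_def by (simp only: mult.assoc integral_mult_right_zero)
    finally show ?thesis by simp
  qed
  then have "is_inv_plancherel \<tau> w"
    using L2_cmult[OF rL2, of ?K] n2w by (simp add: is_inv_plancherel_def w_def[abs_def] C_def)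
  then show ?thesis unfolding inv_plancherel_def by (rule someI[of "is_inv_plancherel \<tau>"])
qed

lemma inv_plancherel_L2: "L2 lborel \<tau> \<Longrightarrow> L2 lborel (inv_plancherel \<tau>)"
  using is_inv_plancherel_inv_plancherel unfolding is_inv_plancherel_def by blast

lemma inv_plancherel_n2:
  "L2 lborel \<tau> \<Longrightarrow> n2 lborel (inv_plancherel \<tau> :: real^'n::finite \<Rightarrow> complex) = n2 lborel \<tau> / sqrt ((2 * pi) ^ CARD('n))"
  using is_inv_plancherel_inv_plancherel unfolding is_inv_plancherel_def by blast

lemma inv_plancherel_pairing:
  "L2 lborel \<tau> \<Longrightarrow> schwartz \<phi> \<Longrightarrow>
    (LINT x|lborel. inv_plancherel \<tau> x * \<phi> x) = (LINT \<xi>|lborel. \<tau> \<xi> * inv_fourier \<phi> \<xi>)"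
  using is_inv_plancherel_inv_plancherel unfolding is_inv_plancherel_def by blast

lemma L2_pairing_unique:
  assumes "L2 lborel v" "L2 lborel w"
    and "\<And>\<phi>. schwartz \<phi> \<Longrightarrow> (LINT x|lborel. v x * \<phi> x) = (LINT x|lborel. w x * \<phi> x)"
  shows "AE x in lborel. v x = w x"
proof -
  have "AE x in lborel. v x - w x = 0"
  proof (rule schwartz_test_zero)
    show "(\<lambda>x. v x - w x) \<in> borel_measurable borel"
      using assms(1,2) by (auto simp: L2_def intro: borel_measurable_diff)
    fix f :: "real^'a \<Rightarrow> complex" assume f: "schwartz f"
    show "integrable lborel (\<lambda>x. (v x - w x) * f x)"
      by (intro L2_mult_integrable L2_diff assms schwartz_L2 f)
    show "(LINT x|lborel. (v x - w x) * f x) = 0"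
      using assms(3)[OF f] L2_mult_integrable[OF assms(1) schwartz_L2[OF f]]
        L2_mult_integrable[OF assms(2) schwartz_L2[OF f]] by (simp add: left_diff_distrib)
  qed
  then show ?thesis by simp
qed

text \<open>Because representatives are chosen by \<open>SOME\<close>, linearity survives almost
  everywhere only; it follows from equality of all pairings with Schwartz functions.\<close>

lemma inv_plancherel_diff:
  assumes "L2 lborel \<sigma>" "L2 lborel \<tau>"
  shows "AE x in lborel. inv_plancherel (\<lambda>\<xi>. \<sigma> \<xi> - \<tau> \<xi>) x = inv_plancherel \<sigma> x - inv_plancherel \<tau> x"
proof (rule L2_pairing_unique)
  fix f :: "real^'a \<Rightarrow> complex" assume f: "schwartz f"
  note L2s = L2_mult_integrable[OF inv_plancherel_L2[OF assms(1)] schwartz_L2[OF f]]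
    L2_mult_integrable[OF inv_plancherel_L2[OF assms(2)] schwartz_L2[OF f]]
    L2_mult_integrable[OF assms(1) schwartz_L2[OF schwartz_inv_fourier[OF f]]]
    L2_mult_integrable[OF assms(2) schwartz_L2[OF schwartz_inv_fourier[OF f]]]
  show "(LINT x|lborel. inv_plancherel (\<lambda>\<xi>. \<sigma> \<xi> - \<tau> \<xi>) x * f x)
      = (LINT x|lborel. (inv_plancherel \<sigma> x - inv_plancherel \<tau> x) * f x)"
    using L2s by (simp add: inv_plancherel_pairing[OF L2_diff[OF assms] f] left_diff_distrib
        inv_plancherel_pairing[OF assms(1) f] inv_plancherel_pairing[OF assms(2) f])
qed (intro inv_plancherel_L2 L2_diff assms)+

section \<open>Distributions whose Fourier transform is a function\<close>

definition bracket :: "real \<Rightarrow> real^'n::finite \<Rightarrow> complex" where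
  "bracket s \<xi> = complex_of_real ((1 + (norm \<xi>)\<^sup>2) powr (s / 2))"

lemma slow_bracket_symbol: "slow (bracket s)"
  unfolding bracket_def[abs_def] by (rule slow_bracket)

lemma bracket_mult: "bracket s \<xi> * bracket r \<xi> = bracket (s + r) \<xi>"
  by (simp add: bracket_def powr_add add_divide_distrib)

lemma bracket_zero [simp]: "bracket 0 \<xi> = 1"
proof -
  have "0 < 1 + (norm \<xi>)\<^sup>2" using one_le_bracket[of \<xi>] by linarith
  then show ?thesis by (simp add: bracket_def)
qed

lemma bracket_inverse [simp]: "bracket (- s) \<xi> * (bracket s \<xi> * c) = c" "bracket s \<xi> * (bracket (- s) \<xi> * c) = c"
  by (simp_all add: bracket_mult flip: mult.assoc)

lemma norm_bracket: "cmod (bracket s \<xi>) = (1 + (norm \<xi>)\<^sup>2) powr (s / 2)"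
  by (simp add: bracket_def)

lemma bracket_reflect [simp]: "bracket s (- \<xi>) = bracket s \<xi>"
  by (simp add: bracket_def)

lemma cnj_bracket [simp]: "cnj (bracket s \<xi>) = bracket s \<xi>"
  by (simp add: bracket_def)

lemma bracket_measurable [measurable]: "bracket s \<in> borel_measurable borel"
  unfolding bracket_def[abs_def] by measurable

lemma norm_le_norm_bracket: "norm \<xi> \<le> cmod (bracket 1 \<xi>)" "1 \<le> cmod (bracket 1 \<xi>)"
proof -
  have "cmod (bracket 1 \<xi>) = sqrt (1 + (norm \<xi>)\<^sup>2)"
    by (simp add: norm_bracket powr_half_sqrt)
  then show "norm \<xi> \<le> cmod (bracket 1 \<xi>)" "1 \<le> cmod (bracket 1 \<xi>)"
    by (auto intro: real_le_rsqrt)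
qed

text \<open>The Fourier side of H^s: a function with this property is the symbol of an element of
  H^s, and \<open>hnorm\<close> is the Sobolev norm up to the factor (2 pi)^(n/2).\<close>

definition hs :: "real \<Rightarrow> (real^'n::finite \<Rightarrow> complex) \<Rightarrow> bool" where
  "hs s \<tau> \<longleftrightarrow> L2 lborel (\<lambda>\<xi>. bracket s \<xi> * \<tau> \<xi>)"

definition hnorm :: "real \<Rightarrow> (real^'n::finite \<Rightarrow> complex) \<Rightarrow> real" where
  "hnorm s \<tau> = n2 lborel (\<lambda>\<xi>. bracket s \<xi> * \<tau> \<xi>)"

lemma hs_measurable: "hs s \<tau> \<Longrightarrow> \<tau> \<in> borel_measurable borel"
proof -
  assume "hs s \<tau>"
  then have [measurable]: "(\<lambda>\<xi>. bracket s \<xi> * \<tau> \<xi>) \<in> borel_measurable borel"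
    by (auto simp: hs_def L2_def)
  have "(\<lambda>\<xi>. bracket (- s) \<xi> * (bracket s \<xi> * \<tau> \<xi>)) \<in> borel_measurable borel"
    by measurable
  then show ?thesis by simp
qed

lemma hnorm_nonneg [simp]: "0 \<le> hnorm s \<tau>"
  by (simp add: hnorm_def)

lemma hs_diff: "hs s \<sigma> \<Longrightarrow> hs s \<tau> \<Longrightarrow> hs s (\<lambda>\<xi>. \<sigma> \<xi> - \<tau> \<xi>)"
  unfolding hs_def right_diff_distrib by (rule L2_diff)

lemma hs_add: "hs s \<sigma> \<Longrightarrow> hs s \<tau> \<Longrightarrow> hs s (\<lambda>\<xi>. \<sigma> \<xi> + \<tau> \<xi>)"
  unfolding hs_def distrib_left by (rule L2_add)

lemma hnorm_triangle: "hs s \<sigma> \<Longrightarrow> hs s \<tau> \<Longrightarrow> hnorm s (\<lambda>\<xi>. \<sigma> \<xi> + \<tau> \<xi>) \<le> hnorm s \<sigma> + hnorm s \<tau>"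
  unfolding hs_def hnorm_def distrib_left by (rule n2_triangle)

lemma hnorm_minus_commute: "hnorm s (\<lambda>\<xi>. \<sigma> \<xi> - \<tau> \<xi>) = hnorm s (\<lambda>\<xi>. \<tau> \<xi> - \<sigma> \<xi>)"
  unfolding hnorm_def right_diff_distrib by (rule n2_minus_commute)

lemma hs_cong_AE:
  assumes "\<sigma> \<in> borel_measurable borel" "\<tau> \<in> borel_measurable borel" "AE \<xi> in lborel. \<sigma> \<xi> = \<tau> \<xi>"
  shows "hs s \<sigma> \<longleftrightarrow> hs s \<tau>" "hnorm s \<sigma> = hnorm s \<tau>"
  unfolding hs_def hnorm_def using assms by (intro L2_cong_AE n2_cong_AE; auto)+

lemma hs_bounded_mult:
  assumes "hs s \<tau>" "m \<in> borel_measurable borel" "\<And>\<xi>. cmod (m \<xi>) \<le> C"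
  shows "hs s (\<lambda>\<xi>. m \<xi> * \<tau> \<xi>)" "hnorm s (\<lambda>\<xi>. m \<xi> * \<tau> \<xi>) \<le> C * hnorm s \<tau>"
proof -
  note [measurable] = hs_measurable[OF assms(1)] assms(2)
  have C: "0 \<le> C" using assms(3)[of 0] norm_ge_zero order_trans by blast
  have L: "L2 lborel (\<lambda>\<xi>. complex_of_real C * (bracket s \<xi> * \<tau> \<xi>))"
    using assms(1) unfolding hs_def by (rule L2_cmult)
  have le: "AE \<xi> in lborel. cmod (bracket s \<xi> * (m \<xi> * \<tau> \<xi>)) \<le> cmod (complex_of_real C * (bracket s \<xi> * \<tau> \<xi>))"
  proof (rule AE_I2)
    fix \<xi>
    have "cmod (m \<xi>) * cmod (bracket s \<xi> * \<tau> \<xi>) \<le> C * cmod (bracket s \<xi> * \<tau> \<xi>)"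
      by (rule mult_right_mono[OF assms(3)]) simp
    then show "cmod (bracket s \<xi> * (m \<xi> * \<tau> \<xi>)) \<le> cmod (complex_of_real C * (bracket s \<xi> * \<tau> \<xi>))"
      using C by (simp add: norm_mult mult_ac)
  qed
  show "hs s (\<lambda>\<xi>. m \<xi> * \<tau> \<xi>)"
    unfolding hs_def by (rule L2_dominated[OF L _ le]) measurable
  have "hnorm s (\<lambda>\<xi>. m \<xi> * \<tau> \<xi>) \<le> n2 lborel (\<lambda>\<xi>. complex_of_real C * (bracket s \<xi> * \<tau> \<xi>))"
    unfolding hnorm_def by (rule n2_mono[OF L _ le]) measurable
  then show "hnorm s (\<lambda>\<xi>. m \<xi> * \<tau> \<xi>) \<le> C * hnorm s \<tau>"
    using C by (simp add: n2_cmult hnorm_def)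
qed

text \<open>The weight is moved to the Schwartz side, where multiplication by
  \<open>bracket (- s)\<close> is harmless for every real s, so negative exponents are covered
  too.\<close>

lemma hs_pair_integrable:
  assumes "hs s \<tau>" "schwartz \<phi>"
  shows "integrable lborel (\<lambda>\<xi>. \<tau> \<xi> * \<phi> \<xi>)"
proof -
  have "integrable lborel (\<lambda>\<xi>. (bracket s \<xi> * \<tau> \<xi>) * (bracket (- s) \<xi> * \<phi> \<xi>))"
    using assms(1) unfolding hs_def
    by (rule L2_mult_integrable) (intro schwartz_L2 schwartz_slow_mult slow_bracket_symbol assms(2))
  moreover have "(bracket s \<xi> * \<tau> \<xi>) * (bracket (- s) \<xi> * \<phi> \<xi>) = \<tau> \<xi> * \<phi> \<xi>" for \<xi>
    using bracket_inverse(2)[of s \<xi> "\<tau> \<xi> * \<phi> \<xi>"] by (simp add: mult_ac)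
  ultimately show ?thesis by simp
qed

lemma hs_one_L2:
  assumes "hs 1 \<tau>"
  shows "L2 lborel \<tau>" "n2 lborel \<tau> \<le> hnorm 1 \<tau>"
    "L2 lborel (\<lambda>\<xi>. complex_of_real (norm \<xi>) * \<tau> \<xi>)"
    "n2 lborel (\<lambda>\<xi>. complex_of_real (norm \<xi>) * \<tau> \<xi>) \<le> hnorm 1 \<tau>"
proof -
  note [measurable] = hs_measurable[OF assms]
  have L: "L2 lborel (\<lambda>\<xi>. bracket 1 \<xi> * \<tau> \<xi>)" using assms by (simp add: hs_def)
  have le1: "AE \<xi> in lborel. cmod (\<tau> \<xi>) \<le> cmod (bracket 1 \<xi> * \<tau> \<xi>)"
    using mult_right_mono[OF norm_le_norm_bracket(2) norm_ge_zero] by (intro AE_I2) (simp add: norm_mult)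
  have le2: "AE \<xi> in lborel. cmod (complex_of_real (norm \<xi>) * \<tau> \<xi>) \<le> cmod (bracket 1 \<xi> * \<tau> \<xi>)"
    using mult_right_mono[OF norm_le_norm_bracket(1) norm_ge_zero] by (intro AE_I2) (simp add: norm_mult)
  show "L2 lborel \<tau>" "L2 lborel (\<lambda>\<xi>. complex_of_real (norm \<xi>) * \<tau> \<xi>)"
    by (rule L2_dominated[OF L _ le1] L2_dominated[OF L _ le2], measurable)+
  show "n2 lborel \<tau> \<le> hnorm 1 \<tau>" "n2 lborel (\<lambda>\<xi>. complex_of_real (norm \<xi>) * \<tau> \<xi>) \<le> hnorm 1 \<tau>"
    unfolding hnorm_def by (rule n2_mono[OF L _ le1] n2_mono[OF L _ le2], measurable)+
qed

text \<open>The distribution whose Fourier transform is the function \<tau>.\<close>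

definition symb :: "(real^'n::finite \<Rightarrow> complex) \<Rightarrow> 'n distr" where
  "symb \<tau> f = (LINT \<xi>|lborel. \<tau> \<xi> * inv_fourier f \<xi>)"

lemma symb_diff:
  assumes "hs s \<sigma>" "hs s \<tau>" "schwartz f"
  shows "symb (\<lambda>\<xi>. \<sigma> \<xi> - \<tau> \<xi>) f = symb \<sigma> f - symb \<tau> f"
  using hs_pair_integrable[OF assms(1) schwartz_inv_fourier[OF assms(3)]]
    hs_pair_integrable[OF assms(2) schwartz_inv_fourier[OF assms(3)]]
  by (simp add: symb_def left_diff_distrib)

lemma symb_cong_AE:
  assumes "\<sigma> \<in> borel_measurable borel" "\<tau> \<in> borel_measurable borel" "AE \<xi> in lborel. \<sigma> \<xi> = \<tau> \<xi>" "schwartz f"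
  shows "symb \<sigma> f = symb \<tau> f"
proof -
  note [measurable] = assms(1,2) schwartz_measurable[OF schwartz_inv_fourier[OF assms(4)]]
  show ?thesis unfolding symb_def
    by (rule integral_cong_AE) (use assms(3) in auto)
qed

lemma n2_inv_fourier:
  fixes f :: "real^'n::finite \<Rightarrow> complex"
  assumes f: "schwartz f"
  shows "n2 lborel (inv_fourier f) = n2 lborel f / sqrt ((2 * pi) ^ CARD('n))"
proof -
  have "(n2 lborel f)\<^sup>2 = (sqrt ((2 * pi) ^ CARD('n)) * n2 lborel (inv_fourier f))\<^sup>2"
    using plancherel_schwartz[OF schwartz_inv_fourier[OF f]]
    by (simp add: fourier_inv_fourier[OF f] power_mult_distrib)
  then have "n2 lborel f = sqrt ((2 * pi) ^ CARD('n)) * n2 lborel (inv_fourier f)"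
    by (rule power2_eq_imp_eq) auto
  then show ?thesis by simp
qed

lemma tempered_symb:
  fixes \<tau> :: "real^'n::finite \<Rightarrow> complex"
  assumes \<tau>: "L2 lborel \<tau>"
  shows "tempered_distr (symb \<tau>)"
proof -
  have int: "integrable lborel (\<lambda>\<xi>. \<tau> \<xi> * inv_fourier f \<xi>)" if "schwartz f" for f
    by (intro L2_mult_integrable \<tau> schwartz_L2 schwartz_inv_fourier that)
  define K where "K = sqrt (LINT x|lborel. 1 / (1 + norm (x::real^'n)) ^ (2 * CARD('n)))"
  have "cmod (symb \<tau> f) \<le> (n2 lborel \<tau> * (K / sqrt ((2 * pi) ^ CARD('n)))) * schwartz_seminorm (2 * CARD('n)) f"
    if f: "schwartz f" for f
  proof -
    have "cmod (symb \<tau> f) \<le> n2 lborel \<tau> * n2 lborel (inv_fourier f)"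
      unfolding symb_def by (intro cmod_integral_mult_le \<tau> schwartz_L2 schwartz_inv_fourier f)
    also have "\<dots> \<le> n2 lborel \<tau> * ((schwartz_seminorm (2 * CARD('n)) f * K) / sqrt ((2 * pi) ^ CARD('n)))"
      unfolding n2_inv_fourier[OF f] K_def
      by (intro mult_left_mono divide_right_mono schwartz_L2_seminorm f schwartz_le_seminorm) auto
    finally show ?thesis by (simp add: mult_ac)
  qed
  moreover have "symb \<tau> (\<lambda>x. f x + g x) = symb \<tau> f + symb \<tau> g" if "schwartz f" "schwartz g" for f g
    using int[OF that(1)] int[OF that(2)] unfolding symb_def
    by (simp add: inv_fourier_add schwartz_integrable that distrib_left)
  moreover have "symb \<tau> (\<lambda>x. c * f x) = c * symb \<tau> f" for c f
    unfolding symb_def inv_fourier_cmult by (simp add: mult.left_commute)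
  ultimately show ?thesis unfolding tempered_distr_def by blast
qed

text \<open>Distributions are defined with \<open>lebesgue\<close>, whereas Fubini, translation and
  scaling are applied to \<open>lborel\<close>. A Borel version is the bridge between the two, used
  through \<open>lebesgue_pairing\<close>.\<close>

lemma lebesgue_borel_version:
  fixes g :: "real^'n::finite \<Rightarrow> complex"
  assumes "g \<in> borel_measurable lebesgue"
  obtains h where "h \<in> borel_measurable borel" "AE x in lebesgue. g x = h x"
proof -
  have "(\<lambda>x. Re (g x)) \<in> borel_measurable lebesgue" "(\<lambda>x. Im (g x)) \<in> borel_measurable lebesgue"
    using assms by measurable
  from this[THEN completion_ex_borel_measurable_real]
  obtain r i where ri: "r \<in> borel_measurable lborel" "AE x in lborel. Re (g x) = r x"
    "i \<in> borel_measurable lborel" "AE x in lborel. Im (g x) = i x"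
    by blast
  have "AE x in lborel. g x = Complex (r x) (i x)"
    using ri(2,4) by eventually_elim (simp add: complex_eq_iff)
  moreover have "(\<lambda>x. Complex (r x) (i x)) \<in> borel_measurable borel"
    using ri(1,3) by (simp add: borel_measurable_complex_iff)
  ultimately show thesis using that by (simp add: AE_completion_iff)
qed

lemma borel_measurable_lebesgueI: "f \<in> borel_measurable borel \<Longrightarrow> f \<in> borel_measurable lebesgue"
  by (rule measurable_completion) simp

lemma lebesgue_pairing:
  fixes f g h :: "real^'n::finite \<Rightarrow> complex"
  assumes "g \<in> borel_measurable lebesgue" "h \<in> borel_measurable borel" "AE x in lebesgue. g x = h x"
    and "f \<in> borel_measurable borel"
  shows "integrable lebesgue (\<lambda>x. g x * f x) \<longleftrightarrow> integrable lborel (\<lambda>x. h x * f x)"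
    and "(LINT x|lebesgue. g x * f x) = (LINT x|lborel. h x * f x)"
proof -
  have m: "(\<lambda>x. g x * f x) \<in> borel_measurable lebesgue" "(\<lambda>x. h x * f x) \<in> borel_measurable borel"
    using borel_measurable_times[OF assms(1) borel_measurable_lebesgueI[OF assms(4)]]
      borel_measurable_times[OF assms(2,4)] by simp_all
  have ae: "AE x in lebesgue. g x * f x = h x * f x"
    using assms(3) by eventually_elim simp
  show "integrable lebesgue (\<lambda>x. g x * f x) \<longleftrightarrow> integrable lborel (\<lambda>x. h x * f x)"
    using integrable_cong_AE[OF m(1) borel_measurable_lebesgueI[OF m(2)] ae] integrable_completion[of _ lborel] m(2) by simp
  show "(LINT x|lebesgue. g x * f x) = (LINT x|lborel. h x * f x)"
    using integral_cong_AE[OF m(1) borel_measurable_lebesgueI[OF m(2)] ae] integral_completion[of _ lborel] m(2) by simp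
qed

lemma represents_AE_eq:
  assumes "represents g T" "represents h T"
  shows "AE x in lebesgue. g x = h x"
proof -
  have m: "g \<in> borel_measurable lebesgue" "h \<in> borel_measurable lebesgue"
    using assms by (auto simp: represents_def regular_def)
  obtain g' where g': "g' \<in> borel_measurable borel" "AE x in lebesgue. g x = g' x"
    using lebesgue_borel_version[OF m(1)] by blast
  obtain h' where h': "h' \<in> borel_measurable borel" "AE x in lebesgue. h x = h' x"
    using lebesgue_borel_version[OF m(2)] by blast
  have int: "integrable lborel (\<lambda>x. g' x * f x)" "integrable lborel (\<lambda>x. h' x * f x)"
    "(LINT x|lborel. g' x * f x) = (LINT x|lborel. h' x * f x)" if f: "schwartz f" for f
  proof -
    show "integrable lborel (\<lambda>x. g' x * f x)"
      using assms(1) f lebesgue_pairing(1)[OF m(1) g' schwartz_measurable[OF f]]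
      by (auto simp: represents_def regular_def)
    show "integrable lborel (\<lambda>x. h' x * f x)"
      using assms(2) f lebesgue_pairing(1)[OF m(2) h' schwartz_measurable[OF f]]
      by (auto simp: represents_def regular_def)
    show "(LINT x|lborel. g' x * f x) = (LINT x|lborel. h' x * f x)"
      using assms f lebesgue_pairing(2)[OF m(1) g' schwartz_measurable[OF f]]
        lebesgue_pairing(2)[OF m(2) h' schwartz_measurable[OF f]]
      by (auto simp: represents_def distr_eq_def distr_of_def)
  qed
  have "AE x in lborel. g' x - h' x = 0"
    by (rule schwartz_test_zero) (use g' h' int in \<open>auto simp: left_diff_distrib\<close>)
  then have "AE x in lebesgue. g' x - h' x = 0" by (simp add: AE_completion_iff)
  then show ?thesis using g'(2) h'(2) by eventually_elim simp
qed

lemma represents_fun_of: "represents g T \<Longrightarrow> represents (fun_of T) T"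
  unfolding fun_of_def by (rule someI[of "\<lambda>g. represents g T"])

lemma fun_of_AE: "represents g T \<Longrightarrow> AE x in lebesgue. fun_of T x = g x"
  using represents_AE_eq represents_fun_of by blast

lemma represents_borel:
  assumes "g \<in> borel_measurable borel" "\<And>f. schwartz f \<Longrightarrow> integrable lborel (\<lambda>x. g x * f x)"
    and "\<And>f. schwartz f \<Longrightarrow> T f = (LINT x|lborel. g x * f x)"
  shows "represents g T"
  using assms lebesgue_pairing[OF borel_measurable_lebesgueI[OF assms(1)] assms(1) AE_I2 schwartz_measurable]
  by (auto simp: represents_def regular_def distr_eq_def distr_of_def borel_measurable_lebesgueI)

text \<open>Testing with \<open>fourier f\<close> turns the pairing into one with an arbitrary
  Schwartz function, to which \<open>schwartz_test_zero\<close> applies.\<close>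

lemma symb_AE_eq:
  assumes "hs s \<sigma>" "hs r \<tau>" "\<And>f. schwartz f \<Longrightarrow> symb \<sigma> f = symb \<tau> f"
  shows "AE \<xi> in lborel. \<sigma> \<xi> = \<tau> \<xi>"
proof -
  have "AE \<xi> in lborel. \<sigma> \<xi> - \<tau> \<xi> = 0"
  proof (rule schwartz_test_zero)
    show "(\<lambda>\<xi>. \<sigma> \<xi> - \<tau> \<xi>) \<in> borel_measurable borel"
      using hs_measurable[OF assms(1)] hs_measurable[OF assms(2)] by auto
    fix f :: "real^'a \<Rightarrow> complex" assume f: "schwartz f"
    note i = hs_pair_integrable[OF assms(1) f] hs_pair_integrable[OF assms(2) f]
    show "integrable lborel (\<lambda>\<xi>. (\<sigma> \<xi> - \<tau> \<xi>) * f \<xi>)"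
      using i by (simp add: left_diff_distrib)
    show "(LINT \<xi>|lborel. (\<sigma> \<xi> - \<tau> \<xi>) * f \<xi>) = 0"
      using i assms(3)[OF schwartz_fourier[OF f]]
      by (simp add: left_diff_distrib symb_def inv_fourier_fourier[OF f])
  qed
  then show ?thesis by simp
qed

text \<open>Plancherel turns the square integrable \<open>bessel s T\<close> into an L2 function on
  the Fourier side, and dividing it by the bracket gives the symbol of T.\<close>

lemma sobolev_symbol:
  assumes "T \<in> sobolev s"
  obtains \<tau> where "hs s \<tau>" "distr_eq T (symb \<tau>)"
proof -
  obtain g where g: "represents g (bessel s T)" "square_integrable g"
    using assms by (auto simp: sobolev_def)
  have m: "g \<in> borel_measurable lebesgue" using g(2) by (simp add: square_integrable_def)
  obtain h where h: "h \<in> borel_measurable borel" "AE x in lebesgue. g x = h x"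
    using lebesgue_borel_version[OF m] by blast
  have "integrable lebesgue (\<lambda>x. (cmod (h x))\<^sup>2)"
  proof (rule integrable_cong_AE_imp)
    show "integrable lebesgue (\<lambda>x. (cmod (g x))\<^sup>2)" using g(2) by (simp add: square_integrable_def)
    show "(\<lambda>x. (cmod (h x))\<^sup>2) \<in> borel_measurable lebesgue"
      using borel_measurable_lebesgueI[OF h(1)] by simp
    show "AE x in lebesgue. (cmod (g x))\<^sup>2 = (cmod (h x))\<^sup>2" using h(2) by eventually_elim simp
  qed
  then have "integrable lborel (\<lambda>x. (cmod (h x))\<^sup>2)"
    by (subst (asm) integrable_completion) (use h(1) in auto)
  then have hL2: "L2 lborel h"
    using h(1) by (simp add: L2_def)
  obtain \<sigma> where \<sigma>: "L2 lborel \<sigma>"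
    "\<And>\<phi>. schwartz \<phi> \<Longrightarrow> (LINT x|lborel. h x * fourier \<phi> x) = (LINT \<xi>|lborel. \<sigma> \<xi> * \<phi> \<xi>)"
    using plancherel[OF hL2] by metis
  define \<tau> where "\<tau> \<xi> = bracket (- s) \<xi> * \<sigma> \<xi>" for \<xi>
  have "hs s \<tau>" using \<sigma>(1) by (simp add: hs_def \<tau>_def)
  moreover have "distr_eq T (symb \<tau>)"
    unfolding distr_eq_def
  proof (intro allI impI)
    fix f :: "real^'a \<Rightarrow> complex" assume f: "schwartz f"
    \<comment> \<open>With this choice \<open>bessel s T (fourier \<phi>)\<close> is
      \<open>T f\<close>: the brackets cancel, and so do the Fourier transform and its
      inverse.\<close>
    define \<phi> where "\<phi> \<xi> = bracket (- s) \<xi> * inv_fourier f \<xi>" for \<xi>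
    have \<phi>: "schwartz \<phi>"
      unfolding \<phi>_def[abs_def] by (intro schwartz_slow_mult slow_bracket_symbol schwartz_inv_fourier f)
    have "bessel s T (fourier \<phi>) = T (fourier (\<lambda>\<xi>. bracket s \<xi> * inv_fourier (fourier \<phi>) \<xi>))"
      by (simp add: bessel_def inv_fourier_distr_def mult_distr_def fourier_distr_def bracket_def)
    also have "\<dots> = T f"
      unfolding inv_fourier_fourier[OF \<phi>] by (simp add: \<phi>_def fourier_inv_fourier[OF f])
    finally have "T f = bessel s T (fourier \<phi>)" by simp
    also have "\<dots> = (LINT x|lebesgue. g x * fourier \<phi> x)"
      using g(1) schwartz_fourier[OF \<phi>] by (simp add: represents_def distr_eq_def distr_of_def)
    also have "\<dots> = (LINT x|lborel. h x * fourier \<phi> x)"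
      by (rule lebesgue_pairing[OF m h schwartz_measurable[OF schwartz_fourier[OF \<phi>]]])
    also have "\<dots> = (LINT \<xi>|lborel. \<sigma> \<xi> * \<phi> \<xi>)" by (rule \<sigma>(2)[OF \<phi>])
    also have "\<dots> = symb \<tau> f" by (simp add: symb_def \<tau>_def \<phi>_def mult_ac)
    finally show "T f = symb \<tau> f" .
  qed
  ultimately show thesis by (rule that)
qed

lemma bessel_symbol:
  assumes \<tau>: "hs s \<tau>" and T: "distr_eq T (symb \<tau>)"
  shows "represents (inv_plancherel (\<lambda>\<xi>. bracket s \<xi> * \<tau> \<xi>)) (bessel s T)"
proof (rule represents_borel)
  have L: "L2 lborel (\<lambda>\<xi>. bracket s \<xi> * \<tau> \<xi>)" using \<tau> by (simp add: hs_def)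
  show "inv_plancherel (\<lambda>\<xi>. bracket s \<xi> * \<tau> \<xi>) \<in> borel_measurable borel"
    using inv_plancherel_L2[OF L] by (simp add: L2_def)
  fix f :: "real^'a \<Rightarrow> complex" assume f: "schwartz f"
  show "integrable lborel (\<lambda>x. inv_plancherel (\<lambda>\<xi>. bracket s \<xi> * \<tau> \<xi>) x * f x)"
    by (intro L2_mult_integrable inv_plancherel_L2 L schwartz_L2 f)
  have \<phi>: "schwartz (\<lambda>\<xi>. bracket s \<xi> * inv_fourier f \<xi>)"
    by (intro schwartz_slow_mult slow_bracket_symbol schwartz_inv_fourier f)
  have "bessel s T f = T (fourier (\<lambda>\<xi>. bracket s \<xi> * inv_fourier f \<xi>))"
    by (simp add: bessel_def inv_fourier_distr_def mult_distr_def fourier_distr_def bracket_def)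
  also have "\<dots> = symb \<tau> (fourier (\<lambda>\<xi>. bracket s \<xi> * inv_fourier f \<xi>))"
    using T schwartz_fourier[OF \<phi>] by (simp add: distr_eq_def)
  also have "\<dots> = (LINT \<xi>|lborel. bracket s \<xi> * \<tau> \<xi> * inv_fourier f \<xi>)"
    unfolding symb_def inv_fourier_fourier[OF \<phi>] by (simp add: mult_ac)
  also have "\<dots> = (LINT x|lborel. inv_plancherel (\<lambda>\<xi>. bracket s \<xi> * \<tau> \<xi>) x * f x)"
    by (rule inv_plancherel_pairing[OF L f, symmetric])
  finally show "bessel s T f = (LINT x|lborel. inv_plancherel (\<lambda>\<xi>. bracket s \<xi> * \<tau> \<xi>) x * f x)" .
qed

text \<open>The Fourier transform in this normalisation is isometric only up to the factor (2
  pi)^(n/2). The representative inside \<open>sobolev_norm\<close> is arbitrary and is compared with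
  \<open>inv_plancherel\<close> almost everywhere.\<close>

lemma sobolev_norm_symbol:
  fixes \<tau> :: "real^'n::finite \<Rightarrow> complex"
  assumes \<tau>: "hs s \<tau>" and T: "distr_eq T (symb \<tau>)"
  shows "sobolev_norm s T = hnorm s \<tau> / sqrt ((2 * pi) ^ CARD('n))"
proof -
  let ?w = "inv_plancherel (\<lambda>\<xi>. bracket s \<xi> * \<tau> \<xi>)"
  have L: "L2 lborel (\<lambda>\<xi>. bracket s \<xi> * \<tau> \<xi>)" using \<tau> by (simp add: hs_def)
  have [measurable]: "?w \<in> borel_measurable borel" using inv_plancherel_L2[OF L] by (simp add: L2_def)
  have m: "fun_of (bessel s T) \<in> borel_measurable lebesgue"
    using represents_fun_of[OF bessel_symbol[OF assms]] by (simp add: represents_def regular_def)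
  have "(LINT x|lebesgue. (cmod (fun_of (bessel s T) x))\<^sup>2) = (LINT x|lebesgue. (cmod (?w x))\<^sup>2)"
  proof (rule integral_cong_AE)
    show "(\<lambda>x. (cmod (fun_of (bessel s T) x))\<^sup>2) \<in> borel_measurable lebesgue"
      using m by simp
    show "(\<lambda>x. (cmod (?w x))\<^sup>2) \<in> borel_measurable lebesgue"
      by (rule borel_measurable_lebesgueI) measurable
    show "AE x in lebesgue. (cmod (fun_of (bessel s T) x))\<^sup>2 = (cmod (?w x))\<^sup>2"
      using fun_of_AE[OF bessel_symbol[OF assms]] by eventually_elim simp
  qed
  also have "\<dots> = (LINT x|lborel. (cmod (?w x))\<^sup>2)"
    by (rule integral_completion) simp
  finally show ?thesis
    unfolding sobolev_norm_def hnorm_def inv_plancherel_n2[OF L, symmetric] by (simp only: n2_def)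
qed

lemma L2_square_integrable:
  assumes "L2 lborel g"
  shows "square_integrable g"
proof -
  have g: "g \<in> borel_measurable lborel" "integrable lborel (\<lambda>x. (cmod (g x))\<^sup>2)"
    using assms by (auto simp: L2_def)
  then have "integrable lebesgue (\<lambda>x. (cmod (g x))\<^sup>2)"
    by (subst integrable_completion) auto
  then show ?thesis
    using borel_measurable_lebesgueI[of g] g(1) unfolding square_integrable_def by simp
qed

lemma symb_in_sobolev:
  assumes "hs 1 \<tau>"
  shows "symb \<tau> \<in> sobolev 1"
proof -
  have eq: "distr_eq (symb \<tau>) (symb \<tau>)" by (simp add: distr_eq_def)
  have L: "L2 lborel (\<lambda>\<xi>. bracket 1 \<xi> * \<tau> \<xi>)" using assms by (simp add: hs_def)
  have "square_integrable (inv_plancherel (\<lambda>\<xi>. bracket 1 \<xi> * \<tau> \<xi>))"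
    by (rule L2_square_integrable[OF inv_plancherel_L2[OF L]])
  then show ?thesis
    using tempered_symb[OF hs_one_L2(1)[OF assms]] bessel_symbol[OF assms eq] by (auto simp: sobolev_def)
qed

section \<open>Multipliers acting on symbols\<close>

lemma represents_fourier_distr:
  assumes \<tau>: "hs s \<tau>" and T: "distr_eq T (symb \<tau>)"
  shows "represents \<tau> (fourier_distr T)"
proof (rule represents_borel)
  show "\<tau> \<in> borel_measurable borel" by (rule hs_measurable[OF \<tau>])
  fix f :: "real^'a \<Rightarrow> complex" assume f: "schwartz f"
  show "integrable lborel (\<lambda>\<xi>. \<tau> \<xi> * f \<xi>)" by (rule hs_pair_integrable[OF \<tau> f])
  show "fourier_distr T f = (LINT x|lborel. \<tau> x * f x)"
    using T schwartz_fourier[OF f] by (simp add: fourier_distr_def distr_eq_def symb_def inv_fourier_fourier[OF f])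
qed

text \<open>Whatever representative of the Fourier transform \<open>fun_of\<close> returns, it
  agrees with \<tau> almost everywhere, which is all that the integral sees.\<close>

lemma fourier_multiplier_symbol:
  assumes \<tau>: "hs s \<tau>" and T: "distr_eq T (symb \<tau>)" and m: "m \<in> borel_measurable borel"
  shows "distr_eq (fourier_multiplier m T) (symb (\<lambda>\<xi>. m \<xi> * \<tau> \<xi>))"
  unfolding distr_eq_def
proof (intro allI impI)
  fix f :: "real^'a \<Rightarrow> complex" assume f: "schwartz f"
  note rep = represents_fourier_distr[OF \<tau> T]
  have m1: "fun_of (fourier_distr T) \<in> borel_measurable lebesgue"
    using represents_fun_of[OF rep] by (simp add: represents_def regular_def)
  have m2: "(\<lambda>\<xi>. m \<xi> * fun_of (fourier_distr T) \<xi>) \<in> borel_measurable lebesgue"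
    using m1 borel_measurable_lebesgueI[OF m] by simp
  have m3: "(\<lambda>\<xi>. m \<xi> * \<tau> \<xi>) \<in> borel_measurable borel"
    using m hs_measurable[OF \<tau>] by simp
  have ae: "AE \<xi> in lebesgue. m \<xi> * fun_of (fourier_distr T) \<xi> = m \<xi> * \<tau> \<xi>"
    using fun_of_AE[OF rep] by eventually_elim simp
  show "fourier_multiplier m T f = symb (\<lambda>\<xi>. m \<xi> * \<tau> \<xi>) f"
    unfolding fourier_multiplier_def inv_fourier_distr_def distr_of_def symb_def
    by (rule lebesgue_pairing[OF m2 m3 ae schwartz_measurable[OF schwartz_inv_fourier[OF f]]])
qed

definition heat :: "real \<Rightarrow> real \<Rightarrow> real^'n::finite \<Rightarrow> complex" where
  "heat \<alpha> t \<xi> = complex_of_real (exp (- t * norm \<xi> powr \<alpha>))"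

lemma heat_measurable [measurable]: "heat \<alpha> t \<in> borel_measurable borel"
  unfolding heat_def[abs_def] by measurable

lemma frac_heat_symbol:
  assumes "hs s \<tau>" "distr_eq T (symb \<tau>)"
  shows "distr_eq (frac_heat \<alpha> t T) (symb (\<lambda>\<xi>. heat \<alpha> t \<xi> * \<tau> \<xi>))"
  using fourier_multiplier_symbol[OF assms heat_measurable[of \<alpha> t]]
  by (simp add: frac_heat_def heat_def[abs_def])

section \<open>The quadratic nonlinearity on the Fourier side\<close>

text \<open>Not the gradient, but the square root of the negative Laplacian applied to the function
  with symbol \<tau>, as an element of L2.\<close>

definition grad :: "(real^'n::finite \<Rightarrow> complex) \<Rightarrow> real^'n \<Rightarrow> complex" where
  "grad \<tau> = inv_plancherel (\<lambda>\<xi>. complex_of_real (norm \<xi>) * \<tau> \<xi>)"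

definition quad :: "(real^'n::finite \<Rightarrow> complex) \<Rightarrow> real^'n \<Rightarrow> complex" where
  "quad \<tau> = fourier (\<lambda>x. (grad \<tau> x)\<^sup>2)"

lemma grad_L2: "hs 1 \<tau> \<Longrightarrow> L2 lborel (grad \<tau>)"
  unfolding grad_def by (intro inv_plancherel_L2 hs_one_L2)

lemma grad_n2:
  fixes \<tau> :: "real^'n::finite \<Rightarrow> complex"
  assumes "hs 1 \<tau>"
  shows "n2 lborel (grad \<tau>) \<le> hnorm 1 \<tau> / sqrt ((2 * pi) ^ CARD('n))"
  unfolding grad_def inv_plancherel_n2[OF hs_one_L2(3)[OF assms]]
  by (intro divide_right_mono hs_one_L2 assms) simp

lemma grad_diff:
  assumes "hs 1 \<sigma>" "hs 1 \<tau>"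
  shows "AE x in lborel. grad (\<lambda>\<xi>. \<sigma> \<xi> - \<tau> \<xi>) x = grad \<sigma> x - grad \<tau> x"
  using inv_plancherel_diff[OF hs_one_L2(3)[OF assms(1)] hs_one_L2(3)[OF assms(2)]]
  by (simp add: grad_def right_diff_distrib)

lemma grad_square_integrable: "hs 1 \<tau> \<Longrightarrow> integrable lborel (\<lambda>x. (grad \<tau> x)\<^sup>2)"
  unfolding power2_eq_square by (intro L2_mult_integrable grad_L2)

text \<open>Factor v^2 - w^2 = (v - w) (v + w), apply Cauchy-Schwarz, and bound the transform of an
  integrable function by its L1 norm. The divisor consists of two Plancherel factors (2 pi)^(n/2).
  The bound holds at every frequency, which is what makes the supremum norm usable.\<close>

lemma quad_diff_le:
  fixes \<sigma> \<tau> :: "real^'n::finite \<Rightarrow> complex"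
  assumes "hs 1 \<sigma>" "hs 1 \<tau>"
  shows "cmod (quad \<sigma> \<xi> - quad \<tau> \<xi>) \<le> hnorm 1 (\<lambda>\<xi>. \<sigma> \<xi> - \<tau> \<xi>) * (hnorm 1 \<sigma> + hnorm 1 \<tau>) / (2 * pi) ^ CARD('n)"
proof -
  let ?v = "grad \<sigma>" and ?w = "grad \<tau>"
  define C where "C = (2 * pi) ^ CARD('n)"
  have C: "0 < C" by (simp add: C_def)
  note L = grad_L2[OF assms(1)] grad_L2[OF assms(2)]
  have [measurable]: "?v \<in> borel_measurable borel" "?w \<in> borel_measurable borel"
    "grad (\<lambda>\<xi>. \<sigma> \<xi> - \<tau> \<xi>) \<in> borel_measurable borel"
    using L grad_L2[OF hs_diff[OF assms]] by (auto simp: L2_def)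
  note i = grad_square_integrable[OF assms(1)] grad_square_integrable[OF assms(2)]
  have "quad \<sigma> \<xi> - quad \<tau> \<xi> = fourier (\<lambda>x. (?v x)\<^sup>2 - (?w x)\<^sup>2) \<xi>"
    unfolding quad_def by (rule fourier_diff[OF i, symmetric])
  also have "cmod \<dots> \<le> (LINT x|lborel. cmod ((?v x)\<^sup>2 - (?w x)\<^sup>2))"
    by (intro norm_fourier_le Bochner_Integration.integrable_diff i)
  also have "\<dots> = (LINT x|lborel. cmod (?v x - ?w x) * cmod (?v x + ?w x))"
    by (simp add: norm_mult[symmetric] power2_eq_square algebra_simps)
  also have "\<dots> \<le> n2 lborel (\<lambda>x. ?v x - ?w x) * n2 lborel (\<lambda>x. ?v x + ?w x)"
    by (intro integral_cmod_mult_le L2_diff L2_add L)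
  also have "n2 lborel (\<lambda>x. ?v x - ?w x) = n2 lborel (grad (\<lambda>\<xi>. \<sigma> \<xi> - \<tau> \<xi>))"
    using grad_diff[OF assms] by (intro n2_cong_AE) auto
  also have "n2 lborel (grad (\<lambda>\<xi>. \<sigma> \<xi> - \<tau> \<xi>)) * n2 lborel (\<lambda>x. ?v x + ?w x)
     \<le> (hnorm 1 (\<lambda>\<xi>. \<sigma> \<xi> - \<tau> \<xi>) / sqrt C) * (hnorm 1 \<sigma> / sqrt C + hnorm 1 \<tau> / sqrt C)"
  proof (rule mult_mono)
    show "n2 lborel (grad (\<lambda>\<xi>. \<sigma> \<xi> - \<tau> \<xi>)) \<le> hnorm 1 (\<lambda>\<xi>. \<sigma> \<xi> - \<tau> \<xi>) / sqrt C"
      unfolding C_def by (rule grad_n2[OF hs_diff[OF assms]])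
    show "n2 lborel (\<lambda>x. ?v x + ?w x) \<le> hnorm 1 \<sigma> / sqrt C + hnorm 1 \<tau> / sqrt C"
      using n2_triangle[OF L] grad_n2[OF assms(1)] grad_n2[OF assms(2)] unfolding C_def by linarith
  qed (use C in auto)
  also have "\<dots> = hnorm 1 (\<lambda>\<xi>. \<sigma> \<xi> - \<tau> \<xi>) * (hnorm 1 \<sigma> + hnorm 1 \<tau>) / (sqrt C * sqrt C)"
    by (simp add: add_divide_distrib[symmetric])
  also have "sqrt C * sqrt C = C" using C by simp
  finally show ?thesis by (simp add: C_def)
qed

text \<open>Since \<open>quad_diff_le\<close> is pointwise, changing the symbol on a null set
  changes \<open>quad\<close> at no frequency, although \<open>grad\<close> is only a chosen
  representative.\<close>

lemma quad_cong_AE: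
  fixes \<sigma> \<tau> :: "real^'n::finite \<Rightarrow> complex"
  assumes "hs 1 \<sigma>" "hs 1 \<tau>" "AE \<xi> in lborel. \<sigma> \<xi> = \<tau> \<xi>"
  shows "quad \<sigma> = quad \<tau>"
proof
  fix \<xi> :: "real^'n"
  have "hnorm 1 (\<lambda>\<xi>. \<sigma> \<xi> - \<tau> \<xi>) = hnorm 1 (\<lambda>\<xi>::real^'n. 0)"
    using hs_measurable[OF assms(1)] hs_measurable[OF assms(2)] assms(3) by (intro hs_cong_AE) auto
  then show "quad \<sigma> \<xi> = quad \<tau> \<xi>"
    using quad_diff_le[OF assms(1,2), of \<xi>] by (simp add: hnorm_def)
qed

text \<open>Comparison with the zero symbol in \<open>quad_diff_le\<close>; it remains to see that
  \<open>grad\<close> of the zero symbol vanishes almost everywhere.\<close>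

lemma quad_le:
  fixes \<tau> :: "real^'n::finite \<Rightarrow> complex"
  assumes "hs 1 \<tau>"
  shows "cmod (quad \<tau> \<xi>) \<le> (hnorm 1 \<tau>)\<^sup>2 / (2 * pi) ^ CARD('n)"
proof -
  have z: "hs 1 (\<lambda>\<xi>::real^'n. 0)" by (simp add: hs_def)
  have "AE x in lborel. grad (\<lambda>\<xi>::real^'n. 0) x = 0"
    by (rule n2_eq_0_AE[OF grad_L2[OF z]]) (use grad_n2[OF z] in \<open>simp add: hnorm_def antisym\<close>)
  then have "AE x in lborel. (grad (\<lambda>\<xi>::real^'n. 0) x)\<^sup>2 = 0" by auto
  moreover have [measurable]: "grad (\<lambda>\<xi>::real^'n. 0) \<in> borel_measurable borel"
    using grad_L2[OF z] by (simp add: L2_def)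
  ultimately have "(LINT x|lborel. cmod ((grad (\<lambda>\<xi>::real^'n. 0) x)\<^sup>2)) = (LINT x|(lborel :: (real^'n) measure). 0)"
    by (intro integral_cong_AE) auto
  then have "quad (\<lambda>\<xi>::real^'n. 0) \<xi> = 0"
    using norm_fourier_le[OF grad_square_integrable[OF z], of \<xi>] by (simp add: quad_def)
  then show ?thesis
    using quad_diff_le[OF assms z, of \<xi>] by (simp add: hnorm_def power2_eq_square)
qed

lemma quad_measurable:
  assumes "hs 1 \<tau>"
  shows "quad \<tau> \<in> borel_measurable borel"
proof -
  have [measurable]: "grad \<tau> \<in> borel_measurable borel" using grad_L2[OF assms] by (simp add: L2_def)
  have "quad \<tau> = (\<lambda>\<xi>. LINT x|lborel. cis (- (x \<bullet> \<xi>)) * (grad \<tau> x)\<^sup>2)"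
    unfolding quad_def by (rule ext, rule fourier_lborel) measurable
  then show ?thesis by simp
qed

lemma inv_fourier_translate:
  fixes f :: "real^'n::finite \<Rightarrow> complex"
  assumes f: "schwartz f"
  shows "inv_fourier (\<lambda>x. f (x + y)) \<xi> = cis (- (y \<bullet> \<xi>)) * inv_fourier f \<xi>"
proof -
  have [measurable]: "f \<in> borel_measurable borel" by (rule schwartz_measurable[OF f])
  have "fourier (\<lambda>x. f (x + y)) (- \<xi>) = (LINT x|lborel. cis (x \<bullet> \<xi>) * f (x + y))"
    by (subst fourier_lborel) auto
  also have "\<dots> = (LINT x|lborel. cis (- (y \<bullet> \<xi>)) * (cis ((x + y) \<bullet> \<xi>) * f (x + y)))"
    by (simp add: cis_mult inner_add_left flip: mult.assoc)
  also have "\<dots> = cis (- (y \<bullet> \<xi>)) * (LINT x|lborel. cis ((x + y) \<bullet> \<xi>) * f (x + y))"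
    by simp
  also have "(LINT x|lborel. cis ((x + y) \<bullet> \<xi>) * f (x + y)) = (LINT x|lborel. cis (x \<bullet> \<xi>) * f x)"
    by (rule integral_lborel_translate[of "\<lambda>x. cis (x \<bullet> \<xi>) * f x"]) measurable
  also have "\<dots> = fourier f (- \<xi>)"
    by (subst fourier_lborel) auto
  finally show ?thesis
    by (simp add: inv_fourier_fourier_reflect mult.left_commute)
qed

text \<open>Translating the test function becomes a phase on the Fourier side, and Fubini then turns
  the convolution into multiplication by the transform of the square. The exchange is legitimate
  because the square is integrable and \<beta> pairs absolutely with Schwartz functions.\<close>

lemma nonlinearity_symbol:
  assumes \<tau>: "hs 1 \<tau>" "distr_eq U (symb \<tau>)" and \<beta>: "hs s \<beta>" "distr_eq B (symb \<beta>)"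
  shows "distr_eq (nonlinearity U B) (symb (\<lambda>\<xi>. quad \<tau> \<xi> * \<beta> \<xi>))"
  unfolding distr_eq_def
proof (intro allI impI)
  fix f :: "real^'a \<Rightarrow> complex" assume f: "schwartz f"
  let ?w = "grad \<tau>"
  have [measurable]: "?w \<in> borel_measurable borel" using grad_L2[OF \<tau>(1)] by (simp add: L2_def)
  have [measurable]: "\<beta> \<in> borel_measurable borel" by (rule hs_measurable[OF \<beta>(1)])
  have [measurable]: "inv_fourier f \<in> borel_measurable borel"
    by (rule schwartz_measurable[OF schwartz_inv_fourier[OF f]])
  have lap: "distr_eq (frac_laplacian 1 U) (symb (\<lambda>\<xi>. complex_of_real (norm \<xi>) * \<tau> \<xi>))"
    using fourier_multiplier_symbol[OF \<tau>, of "\<lambda>\<xi>. complex_of_real (norm \<xi>)"]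
    by (simp add: frac_laplacian_def)
  have rep: "represents ?w (frac_laplacian 1 U)"
  proof (rule represents_borel)
    show "?w \<in> borel_measurable borel" by measurable
    fix g :: "real^'a \<Rightarrow> complex" assume g: "schwartz g"
    show "integrable lborel (\<lambda>x. ?w x * g x)"
      by (intro L2_mult_integrable grad_L2 \<tau> schwartz_L2 g)
    show "frac_laplacian 1 U g = (LINT x|lborel. ?w x * g x)"
      using lap g inv_plancherel_pairing[OF hs_one_L2(3)[OF \<tau>(1)] g]
      by (simp add: distr_eq_def symb_def grad_def)
  qed
  have m: "fun_of (frac_laplacian 1 U) \<in> borel_measurable lebesgue"
    using represents_fun_of[OF rep] by (simp add: represents_def regular_def)
  define \<Phi> where "\<Phi> y = (LINT \<xi>|lborel. \<beta> \<xi> * (cis (- (y \<bullet> \<xi>)) * inv_fourier f \<xi>))" for y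
  have B: "B (\<lambda>x. f (x + y)) = \<Phi> y" for y
    using \<beta>(2) schwartz_translate[OF f, of y]
    by (simp add: distr_eq_def symb_def inv_fourier_translate[OF f] \<Phi>_def)
  have [measurable]: "\<Phi> \<in> borel_measurable borel" unfolding \<Phi>_def[abs_def] by measurable
  have int: "integrable (lborel \<Otimes>\<^sub>M lborel) (\<lambda>(y, \<xi>). cis (- (y \<bullet> \<xi>)) * ((?w y)\<^sup>2 * (\<beta> \<xi> * inv_fourier f \<xi>)))"
    by (rule Bochner_Integration.integrable_bound[OF integrable_pair_mult
          [OF grad_square_integrable[OF \<tau>(1)] hs_pair_integrable[OF \<beta>(1) schwartz_inv_fourier[OF f]]]])
      (auto simp: norm_mult intro!: AE_I2)
  have "nonlinearity U B f = (LINT y|lebesgue. (fun_of (frac_laplacian 1 U) y)\<^sup>2 * \<Phi> y)"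
    by (simp add: nonlinearity_def conv_distr_def B)
  also have "\<dots> = (LINT y|lborel. (?w y)\<^sup>2 * \<Phi> y)"
  proof (rule lebesgue_pairing)
    show "(\<lambda>y. (fun_of (frac_laplacian 1 U) y)\<^sup>2) \<in> borel_measurable lebesgue" using m by measurable
    show "AE x in lebesgue. (fun_of (frac_laplacian 1 U) x)\<^sup>2 = (?w x)\<^sup>2"
      using fun_of_AE[OF rep] by eventually_elim simp
  qed measurable
  also have "\<dots> = (LINT y|lborel. LINT \<xi>|lborel. cis (- (y \<bullet> \<xi>)) * ((?w y)\<^sup>2 * (\<beta> \<xi> * inv_fourier f \<xi>)))"
    unfolding \<Phi>_def by (simp add: mult_ac flip: integral_mult_right_zero)
  also have "\<dots> = (LINT \<xi>|lborel. LINT y|lborel. cis (- (y \<bullet> \<xi>)) * ((?w y)\<^sup>2 * (\<beta> \<xi> * inv_fourier f \<xi>)))"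
    by (rule lborel_pair.Fubini_integral[OF int, symmetric])
  also have "\<dots> = (LINT \<xi>|lborel. quad \<tau> \<xi> * \<beta> \<xi> * inv_fourier f \<xi>)"
  proof (rule Bochner_Integration.integral_cong[OF refl])
    fix \<xi>
    have "(LINT y|lborel. cis (- (y \<bullet> \<xi>)) * ((?w y)\<^sup>2 * (\<beta> \<xi> * inv_fourier f \<xi>)))
       = (LINT y|lborel. cis (- (y \<bullet> \<xi>)) * (?w y)\<^sup>2) * (\<beta> \<xi> * inv_fourier f \<xi>)"
      by (simp only: mult.assoc[symmetric] integral_mult_left_zero)
    also have "(LINT y|lborel. cis (- (y \<bullet> \<xi>)) * (?w y)\<^sup>2) = quad \<tau> \<xi>"
      unfolding quad_def by (rule fourier_lborel[symmetric]) measurable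
    finally show "(LINT y|lborel. cis (- (y \<bullet> \<xi>)) * ((?w y)\<^sup>2 * (\<beta> \<xi> * inv_fourier f \<xi>))) = quad \<tau> \<xi> * \<beta> \<xi> * inv_fourier f \<xi>"
      by (simp add: mult_ac)
  qed
  finally show "nonlinearity U B f = symb (\<lambda>\<xi>. quad \<tau> \<xi> * \<beta> \<xi>) f"
    by (simp add: symb_def)
qed

section \<open>Real distributions have Hermitian symbols\<close>

lemma inv_fourier_cnj:
  fixes f :: "real^'n::finite \<Rightarrow> complex"
  shows "inv_fourier (\<lambda>x. cnj (f x)) \<xi> = cnj (inv_fourier f (- \<xi>))"
proof -
  have "cnj (LINT x|lebesgue. cis (x \<bullet> (- \<xi>)) * f x) = (LINT x|lebesgue. cis (x \<bullet> \<xi>) * cnj (f x))"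
    by (subst Bochner_Integration.integral_cnj[symmetric])
      (simp add: cis_cnj inner_commute del: Bochner_Integration.integral_cnj)
  then show ?thesis by (simp add: inv_fourier_def inner_commute)
qed

lemma symb_cnj:
  assumes "hs s \<tau>" "schwartz f"
  shows "symb \<tau> (\<lambda>x. cnj (f x)) = cnj (symb (\<lambda>\<xi>. cnj (\<tau> (- \<xi>))) f)"
proof -
  have [measurable]: "\<tau> \<in> borel_measurable borel" "inv_fourier f \<in> borel_measurable borel"
    using hs_measurable[OF assms(1)] schwartz_measurable[OF schwartz_inv_fourier[OF assms(2)]] by auto
  have "symb \<tau> (\<lambda>x. cnj (f x)) = (LINT \<xi>|lborel. \<tau> \<xi> * cnj (inv_fourier f (- \<xi>)))"
    by (simp add: symb_def inv_fourier_cnj)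
  also have "\<dots> = (LINT \<xi>|lborel. \<tau> (- \<xi>) * cnj (inv_fourier f \<xi>))"
    using integral_lborel_reflect[of "\<lambda>\<xi>. \<tau> (- \<xi>) * cnj (inv_fourier f \<xi>)"] by simp
  also have "\<dots> = cnj (symb (\<lambda>\<xi>. cnj (\<tau> (- \<xi>))) f)"
    unfolding symb_def by (subst Bochner_Integration.integral_cnj[symmetric])
      (simp del: Bochner_Integration.integral_cnj)
  finally show ?thesis .
qed

lemma hs_reflect_cnj:
  assumes "hs s \<tau>"
  shows "hs s (\<lambda>\<xi>. cnj (\<tau> (- \<xi>)))" "hnorm s (\<lambda>\<xi>. cnj (\<tau> (- \<xi>))) = hnorm s \<tau>"
proof -
  have [measurable]: "\<tau> \<in> borel_measurable borel" by (rule hs_measurable[OF assms])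
  let ?h = "\<lambda>\<xi>. (cmod (bracket s \<xi> * \<tau> \<xi>))\<^sup>2"
  have i: "integrable lborel (\<lambda>\<xi>. ?h (- \<xi>))"
    using assms integrable_lborel_reflect[of ?h] unfolding hs_def L2_def by auto
  then show "hs s (\<lambda>\<xi>. cnj (\<tau> (- \<xi>)))"
    unfolding hs_def L2_def by (auto simp: norm_mult)
  have "(LINT \<xi>|lborel. ?h (- \<xi>)) = (LINT \<xi>|lborel. ?h \<xi>)"
    by (rule integral_lborel_reflect) measurable
  then show "hnorm s (\<lambda>\<xi>. cnj (\<tau> (- \<xi>))) = hnorm s \<tau>"
    by (simp add: hnorm_def n2_def norm_mult)
qed

text \<open>Conjugating the test function replaces the symbol by its reflected conjugate, so a real
  distribution has two symbols, which agree by \<open>symb_AE_eq\<close>.\<close>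

lemma real_distr_symbol:
  assumes "hs s \<tau>" "distr_eq T (symb \<tau>)" "real_distr T"
  shows "AE \<xi> in lborel. cnj (\<tau> (- \<xi>)) = \<tau> \<xi>"
proof (rule symb_AE_eq[OF hs_reflect_cnj(1)[OF assms(1)] assms(1)])
  fix f :: "real^'a \<Rightarrow> complex" assume f: "schwartz f"
  have "cnj (symb (\<lambda>\<xi>. cnj (\<tau> (- \<xi>))) f) = T (\<lambda>x. cnj (f x))"
    using assms(2) schwartz_cnj[OF f] by (simp add: symb_cnj[OF assms(1) f] distr_eq_def)
  also have "\<dots> = cnj (symb \<tau> f)"
    using assms(2,3) f by (simp add: real_distr_def distr_eq_def)
  finally show "symb (\<lambda>\<xi>. cnj (\<tau> (- \<xi>))) f = symb \<tau> f" by simp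
qed

lemma real_distr_symb:
  assumes "hs s \<tau>" "\<And>\<xi>. \<tau> (- \<xi>) = cnj (\<tau> \<xi>)"
  shows "real_distr (symb \<tau>)"
  unfolding real_distr_def using symb_cnj[OF assms(1)] by (simp add: assms(2))

text \<open>A Hermitian symbol makes \<open>grad \<tau>\<close> real almost everywhere; its square
  is then real, and the transform of a real function is Hermitian.\<close>

lemma quad_hermitian:
  fixes \<tau> :: "real^'n::finite \<Rightarrow> complex"
  assumes \<tau>: "hs 1 \<tau>" and herm: "\<And>\<xi>. \<tau> (- \<xi>) = cnj (\<tau> \<xi>)"
  shows "quad \<tau> (- \<xi>) = cnj (quad \<tau> \<xi>)"
proof -
  let ?w = "grad \<tau>"
  note L = grad_L2[OF \<tau>]
  have [measurable]: "?w \<in> borel_measurable borel" using L by (simp add: L2_def)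
  define \<sigma> where "\<sigma> \<xi> = complex_of_real (norm \<xi>) * \<tau> \<xi>" for \<xi>
  have \<sigma>: "L2 lborel \<sigma>" unfolding \<sigma>_def[abs_def] by (rule hs_one_L2[OF \<tau>])
  then have \<sigma>0: "hs 0 \<sigma>" by (simp add: hs_def)
  have real: "AE x in lborel. cnj (?w x) = ?w x"
  proof (rule L2_pairing_unique)
    fix f :: "real^'n \<Rightarrow> complex" assume f: "schwartz f"
    have p: "(LINT x|lborel. ?w x * f x) = symb \<sigma> f" if "schwartz f" for f
      using inv_plancherel_pairing[OF \<sigma> that] by (simp add: symb_def grad_def \<sigma>_def[abs_def])
    have "(LINT x|lborel. cnj (?w x) * f x) = cnj (LINT x|lborel. ?w x * cnj (f x))"
      by (subst Bochner_Integration.integral_cnj[symmetric]) (simp del: Bochner_Integration.integral_cnj)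
    also have "\<dots> = symb \<sigma> f"
      using real_distr_symb[OF \<sigma>0] f by (simp add: p[OF schwartz_cnj[OF f]] \<sigma>_def herm real_distr_def)
    finally show "(LINT x|lborel. cnj (?w x) * f x) = (LINT x|lborel. ?w x * f x)"
      by (simp add: p[OF f])
  qed (use L L2_cnj in auto)
  have "quad \<tau> (- \<xi>) = (LINT x|lborel. cis (x \<bullet> \<xi>) * (?w x)\<^sup>2)"
    unfolding quad_def by (subst fourier_lborel) auto
  also have "\<dots> = (LINT x|lborel. cnj (cis (- (x \<bullet> \<xi>)) * (?w x)\<^sup>2))"
    using real by (intro integral_cong_AE) (auto simp: cis_cnj)
  also have "\<dots> = cnj (LINT x|lborel. cis (- (x \<bullet> \<xi>)) * (?w x)\<^sup>2)"
    by (rule Bochner_Integration.integral_cnj)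
  also have "(LINT x|lborel. cis (- (x \<bullet> \<xi>)) * (?w x)\<^sup>2) = quad \<tau> \<xi>"
    unfolding quad_def by (subst fourier_lborel) auto
  finally show ?thesis .
qed

section \<open>Measurability in time\<close>

lemma AE_lebesgue_on_iff:
  fixes S :: "'a::euclidean_space set"
  assumes "S \<in> sets borel"
  shows "(AE x in lebesgue_on S. P x) \<longleftrightarrow> (AE x in lborel. x \<in> S \<longrightarrow> P x)"
  using assms by (subst AE_restrict_space_iff) (auto simp: AE_completion_iff)

lemma lebesgue_set_borel_version:
  fixes A :: "'a::euclidean_space set"
  assumes "A \<in> sets lebesgue"
  obtains B where "B \<in> sets borel" "AE x in lborel. x \<in> A \<longleftrightarrow> x \<in> B"
proof -
  have "(indicator A :: 'a \<Rightarrow> real) \<in> borel_measurable lebesgue"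
    using assms by simp
  from completion_ex_borel_measurable_real[OF this] obtain g :: "'a \<Rightarrow> real"
    where g: "g \<in> borel_measurable lborel" "AE x in lborel. indicator A x = g x" by blast
  have [measurable]: "g \<in> borel_measurable borel" using g(1) by simp
  have "{x. g x = 1} \<in> sets borel" by measurable
  moreover have "AE x in lborel. x \<in> A \<longleftrightarrow> x \<in> {x. g x = 1}"
    using g(2) by eventually_elim (auto simp: indicator_def split: if_splits)
  ultimately show thesis by (rule that)
qed

text \<open>Only finitely many distributions D occur as values of S, so no measurability of D |-> F
  D is involved. The Lebesgue measurable level sets are replaced by Borel sets up to null
  sets.\<close>

lemma simple_borel_version:
  fixes S :: "real \<Rightarrow> 'd" and F :: "'d \<Rightarrow> 'e::euclidean_space \<Rightarrow> complex"
  assumes S: "simple_function (lebesgue_on I) S" and I: "I \<in> sets borel"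
    and F: "\<And>D. D \<in> S ` I \<Longrightarrow> F D \<in> borel_measurable borel"
  obtains G where "(\<lambda>(t, \<xi>). G t \<xi>) \<in> borel_measurable (borel \<Otimes>\<^sub>M borel)"
    "AE t in lborel. t \<in> I \<longrightarrow> G t = F (S t)"
proof -
  have fin: "finite (S ` I)" using S by (simp add: simple_function_def)
  have "\<exists>B. B \<in> sets borel \<and> (AE x in lborel. x \<in> S -` {D} \<inter> I \<longleftrightarrow> x \<in> B)" if "D \<in> S ` I" for D
  proof -
    have "\<forall>D\<in>S ` I. S -` {D} \<inter> I \<in> sets (lebesgue_on I)"
      using S by (simp add: simple_function_def)
    then have "S -` {D} \<inter> I \<in> sets (lebesgue_on I)"
      using that by (rule bspec)
    then have "S -` {D} \<inter> I \<in> sets lebesgue"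
      using I by (subst (asm) sets_restrict_space_iff) auto
    then show ?thesis using lebesgue_set_borel_version by metis
  qed
  then obtain B where B: "\<And>D. D \<in> S ` I \<Longrightarrow> B D \<in> sets borel"
    "\<And>D. D \<in> S ` I \<Longrightarrow> AE x in lborel. x \<in> S -` {D} \<inter> I \<longleftrightarrow> x \<in> B D" by metis
  define G where "G t \<xi> = (\<Sum>D\<in>S ` I. indicator (B D) t * F D \<xi>)" for t \<xi>
  have "(\<lambda>p. \<Sum>D\<in>S ` I. indicator (B D) (fst p) * F D (snd p)) \<in> borel_measurable (borel \<Otimes>\<^sub>M borel)"
  proof (rule borel_measurable_sum)
    fix D assume D: "D \<in> S ` I"
    note [measurable] = B(1)[OF D] F[OF D]
    show "(\<lambda>p. indicator (B D) (fst p) * F D (snd p)) \<in> borel_measurable (borel \<Otimes>\<^sub>M borel)"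
      by measurable
  qed
  moreover have "AE t in lborel. \<forall>D\<in>S ` I. t \<in> S -` {D} \<inter> I \<longleftrightarrow> t \<in> B D"
    using B(2) by (intro AE_finite_allI fin) auto
  then have "AE t in lborel. t \<in> I \<longrightarrow> G t = F (S t)"
  proof eventually_elim
    case (elim t)
    show ?case
    proof
      assume t: "t \<in> I"
      show "G t = F (S t)"
      proof
        fix \<xi>
        have "G t \<xi> = (\<Sum>D\<in>S ` I. if D = S t then F D \<xi> else 0)"
          unfolding G_def by (intro sum.cong refl) (use elim t in \<open>auto simp: indicator_def\<close>)
        also have "\<dots> = F (S t) \<xi>" using fin t by simp
        finally show "G t \<xi> = F (S t) \<xi>" .
      qed
    qed
  qed
  ultimately show thesis
    by (intro that[of G]) (auto simp: G_def case_prod_unfold)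
qed

section \<open>Measurable choices of symbols\<close>

definition symbol :: "real \<Rightarrow> 'n::finite distr \<Rightarrow> real^'n \<Rightarrow> complex" where
  "symbol s T = (SOME \<tau>. hs s \<tau> \<and> distr_eq T (symb \<tau>))"

lemma symbol:
  assumes "T \<in> sobolev s"
  shows "hs s (symbol s T)" "distr_eq T (symb (symbol s T))"
proof -
  have "\<exists>\<tau>. hs s \<tau> \<and> distr_eq T (symb \<tau>)" using sobolev_symbol[OF assms] by metis
  from someI_ex[OF this] show "hs s (symbol s T)" "distr_eq T (symb (symbol s T))"
    by (simp_all add: symbol_def)
qed

lemma sobolev_norm_diff_symbol:
  fixes S T :: "'n::finite distr"
  assumes "T \<in> sobolev s" "S \<in> sobolev s"
  shows "sobolev_norm s (\<lambda>f. T f - S f) = hnorm s (\<lambda>\<xi>. symbol s T \<xi> - symbol s S \<xi>) / sqrt ((2 * pi) ^ CARD('n))"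
  using symbol[OF assms(1)] symbol[OF assms(2)]
  by (intro sobolev_norm_symbol hs_diff) (auto simp: distr_eq_def symb_diff)

lemma L_infty_sobolev_symbols:
  fixes u :: "real \<Rightarrow> 'n::finite distr"
  assumes u: "u \<in> L_infty_sobolev I s" and I: "I \<in> sets borel"
  obtains S C where "\<And>k::nat. simple_function (lebesgue_on I) (S k)" "\<And>k. S k ` I \<subseteq> sobolev s" "0 \<le> C"
    "AE t in lborel. t \<in> I \<longrightarrow> u t \<in> sobolev s \<and> hnorm s (symbol s (u t)) \<le> C \<and>
      (\<lambda>k. hnorm s (\<lambda>\<xi>. symbol s (S k t) \<xi> - symbol s (u t) \<xi>)) \<longlonglongrightarrow> 0"
proof -
  obtain S C where S: "\<And>k::nat. simple_function (lebesgue_on I) (S k)" "\<And>k. S k ` I \<subseteq> sobolev s"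
    and lim: "AE t in lebesgue_on I. u t \<in> sobolev s \<and> (\<lambda>k. sobolev_norm s (\<lambda>f. u t f - S k t f)) \<longlonglongrightarrow> 0"
    and C: "AE t in lebesgue_on I. sobolev_norm s (u t) \<le> C"
    using u unfolding L_infty_sobolev_def by blast
  define c where "c = sqrt ((2 * pi) ^ CARD('n))"
  have c: "0 < c" by (simp add: c_def)
  \<comment> \<open>The absolute value keeps the bound nonnegative even if I is a null set and C is
    negative.\<close>
  have "AE t in lborel. t \<in> I \<longrightarrow> u t \<in> sobolev s \<and> hnorm s (symbol s (u t)) \<le> \<bar>c * C\<bar> \<and>
      (\<lambda>k. hnorm s (\<lambda>\<xi>. symbol s (S k t) \<xi> - symbol s (u t) \<xi>)) \<longlonglongrightarrow> 0"
    using lim[unfolded AE_lebesgue_on_iff[OF I]] C[unfolded AE_lebesgue_on_iff[OF I]]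
  proof eventually_elim
    case (elim t)
    show ?case
    proof
      assume t: "t \<in> I"
      have ut: "u t \<in> sobolev s" and St: "S k t \<in> sobolev s" for k using elim t S(2)[of k] by auto
      have "hnorm s (symbol s (u t)) / c \<le> C"
        using elim t sobolev_norm_symbol[OF symbol[OF ut]] by (simp add: c_def)
      then have "hnorm s (symbol s (u t)) \<le> c * C" using c by (simp add: field_simps)
      moreover have "(\<lambda>k. hnorm s (\<lambda>\<xi>. symbol s (S k t) \<xi> - symbol s (u t) \<xi>)) \<longlonglongrightarrow> 0"
      proof -
        have "(\<lambda>k. hnorm s (\<lambda>\<xi>. symbol s (S k t) \<xi> - symbol s (u t) \<xi>) / c) \<longlonglongrightarrow> 0"
          using elim t sobolev_norm_diff_symbol[OF ut St]
            hnorm_minus_commute[of s "symbol s (u t)"] by (simp add: c_def)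
        from tendsto_mult_left[OF this, of c] show ?thesis using c by simp
      qed
      ultimately show "u t \<in> sobolev s \<and> hnorm s (symbol s (u t)) \<le> \<bar>c * C\<bar> \<and>
        (\<lambda>k. hnorm s (\<lambda>\<xi>. symbol s (S k t) \<xi> - symbol s (u t) \<xi>)) \<longlonglongrightarrow> 0"
        using ut by linarith
    qed
  qed
  then show thesis using S by (intro that[of S "\<bar>c * C\<bar>"]) auto
qed

lemma quad_tendsto:
  assumes "\<And>k. hs 1 (\<sigma> k)" "hs 1 \<tau>" "(\<lambda>k. hnorm 1 (\<lambda>\<xi>. \<sigma> k \<xi> - \<tau> \<xi>)) \<longlonglongrightarrow> 0"
  shows "(\<lambda>k. quad (\<sigma> k) \<xi>) \<longlonglongrightarrow> quad \<tau> (\<xi> :: real^'n::finite)"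
proof (rule LIM_zero_cancel, rule Lim_null_comparison)
  let ?d = "\<lambda>k. hnorm 1 (\<lambda>\<xi>. \<sigma> k \<xi> - \<tau> \<xi>)"
  show "(\<lambda>k. ?d k * (?d k + 2 * hnorm 1 \<tau>) / (2 * pi) ^ CARD('n)) \<longlonglongrightarrow> 0"
  proof -
    have "(\<lambda>k. ?d k * (?d k + 2 * hnorm 1 \<tau>) / (2 * pi) ^ CARD('n)) \<longlonglongrightarrow> 0 * (0 + 2 * hnorm 1 \<tau>) / (2 * pi) ^ CARD('n)"
      by (intro tendsto_divide tendsto_mult tendsto_add tendsto_const assms(3)) simp
    then show ?thesis by simp
  qed
  show "\<forall>\<^sub>F k in sequentially. norm (quad (\<sigma> k) \<xi> - quad \<tau> \<xi>) \<le> ?d k * (?d k + 2 * hnorm 1 \<tau>) / (2 * pi) ^ CARD('n)"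
  proof (rule always_eventually, rule allI)
    fix k
    have "hnorm 1 (\<sigma> k) \<le> hnorm 1 (\<lambda>\<xi>. \<sigma> k \<xi> - \<tau> \<xi>) + hnorm 1 \<tau>"
      using hnorm_triangle[OF hs_diff[OF assms(1)[of k] assms(2)] assms(2)] by simp
    then have "?d k * (hnorm 1 (\<sigma> k) + hnorm 1 \<tau>) / (2 * pi) ^ CARD('n) \<le> ?d k * (?d k + 2 * hnorm 1 \<tau>) / (2 * pi) ^ CARD('n)"
      by (intro divide_right_mono mult_left_mono) auto
    then show "norm (quad (\<sigma> k) \<xi> - quad \<tau> \<xi>) \<le> ?d k * (?d k + 2 * hnorm 1 \<tau>) / (2 * pi) ^ CARD('n)"
      using quad_diff_le[OF assms(1)[of k] assms(2), of \<xi>] by linarith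
  qed
qed

text \<open>Along the approximating simple functions \<open>quad\<close> converges at every
  frequency by \<open>quad_tendsto\<close>, so an ordinary pointwise limit is already jointly
  measurable.\<close>

lemma L_infty_sobolev_quad:
  fixes u :: "real \<Rightarrow> 'n::finite distr"
  assumes u: "u \<in> L_infty_sobolev I 1" and I: "I \<in> sets borel"
  obtains q :: "real \<Rightarrow> real^'n \<Rightarrow> complex" and R where
    "(\<lambda>(t, \<xi>). q t \<xi>) \<in> borel_measurable (borel \<Otimes>\<^sub>M borel)" "\<And>t \<xi>. cmod (q t \<xi>) \<le> R"
    "AE t in lborel. t \<in> I \<longrightarrow> u t \<in> sobolev 1 \<and> q t = quad (symbol 1 (u t))"
proof -
  obtain S C where S: "\<And>k::nat. simple_function (lebesgue_on I) (S k)" "\<And>k. S k ` I \<subseteq> sobolev 1" "0 \<le> C"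
    and lim: "AE t in lborel. t \<in> I \<longrightarrow> u t \<in> sobolev 1 \<and> hnorm 1 (symbol 1 (u t)) \<le> C \<and>
      (\<lambda>k. hnorm 1 (\<lambda>\<xi>. symbol 1 (S k t) \<xi> - symbol 1 (u t) \<xi>)) \<longlonglongrightarrow> 0"
    using L_infty_sobolev_symbols[OF u I] by blast
  have "\<exists>G. (\<lambda>(t, \<xi>). G t \<xi>) \<in> borel_measurable (borel \<Otimes>\<^sub>M borel) \<and>
    (AE t in lborel. t \<in> I \<longrightarrow> G t = quad (symbol 1 (S k t)))" for k
  proof -
    have "quad (symbol 1 D) \<in> borel_measurable borel" if "D \<in> S k ` I" for D
      using that S(2)[of k] by (intro quad_measurable symbol) auto
    then show ?thesis
      using simple_borel_version[OF S(1) I, of k "\<lambda>D. quad (symbol 1 D)"] by blast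
  qed
  from choice[OF allI[OF this]] obtain G where "\<forall>k. (\<lambda>(t, \<xi>). G k t \<xi>) \<in> borel_measurable (borel \<Otimes>\<^sub>M borel) \<and>
    (AE t in lborel. t \<in> I \<longrightarrow> G k t = quad (symbol 1 (S k t)))" ..
  then have G: "\<And>k. (\<lambda>(t, \<xi>). G k t \<xi>) \<in> borel_measurable (borel \<Otimes>\<^sub>M borel)"
    "\<And>k. AE t in lborel. t \<in> I \<longrightarrow> G k t = quad (symbol 1 (S k t))" by simp_all
  define R where "R = C\<^sup>2 / (2 * pi) ^ CARD('n)"
  have R: "0 \<le> R" by (simp add: R_def)
  define L where "L t \<xi> = lim (\<lambda>k. G k t \<xi>)" for t \<xi>
  have L [measurable]: "(\<lambda>p. L (fst p) (snd p)) \<in> borel_measurable (borel \<Otimes>\<^sub>M borel)"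
    unfolding L_def using G(1) by (intro borel_measurable_lim_metric) (simp add: case_prod_unfold)
  \<comment> \<open>The cut-off makes the bound hold at all times, including those where
    \<open>L\<close> is an arbitrary value; at the others it changes nothing, by
    \<open>quad_le\<close>.\<close>
  define q where "q t \<xi> = (if cmod (L t \<xi>) \<le> R then L t \<xi> else 0)" for t \<xi>
  have "(\<lambda>p. q (fst p) (snd p)) \<in> borel_measurable (borel \<Otimes>\<^sub>M borel)"
    unfolding q_def by measurable
  then have "(\<lambda>(t, \<xi>). q t \<xi>) \<in> borel_measurable (borel \<Otimes>\<^sub>M borel)"
    by (simp add: case_prod_unfold)
  moreover have "cmod (q t \<xi>) \<le> R" for t \<xi> using R by (simp add: q_def)
  moreover have "AE t in lborel. \<forall>k. t \<in> I \<longrightarrow> G k t = quad (symbol 1 (S k t))"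
    by (rule AE_all_countable[THEN iffD2, OF allI[OF G(2)]])
  then have "AE t in lborel. t \<in> I \<longrightarrow> u t \<in> sobolev 1 \<and> q t = quad (symbol 1 (u t))"
    using lim
  proof eventually_elim
    case (elim t)
    show ?case
    proof
      assume t: "t \<in> I"
      have ut: "u t \<in> sobolev 1" and St: "S k t \<in> sobolev 1" for k using elim t S(2)[of k] by auto
      have "q t \<xi> = quad (symbol 1 (u t)) \<xi>" for \<xi>
      proof -
        have "(\<lambda>k. quad (symbol 1 (S k t)) \<xi>) \<longlonglongrightarrow> quad (symbol 1 (u t)) \<xi>"
          using elim t by (intro quad_tendsto symbol ut St) auto
        then have "L t \<xi> = quad (symbol 1 (u t)) \<xi>"
          using elim(1) t by (simp add: L_def limI)
        moreover have "cmod (quad (symbol 1 (u t)) \<xi>) \<le> R"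
        proof -
          have "(hnorm 1 (symbol 1 (u t)))\<^sup>2 / (2 * pi) ^ CARD('n) \<le> R"
            unfolding R_def using elim t by (intro divide_right_mono power_mono) auto
          then show ?thesis using quad_le[OF symbol(1)[OF ut], of \<xi>] by linarith
        qed
        ultimately show ?thesis by (simp add: q_def)
      qed
      then show "u t \<in> sobolev 1 \<and> q t = quad (symbol 1 (u t))" using ut by auto
    qed
  qed
  ultimately show thesis by (rule that)
qed

text \<open>Strong measurability provides the symbol of \<open>b t\<close> only separately for almost every \<open>t\<close>; a
  jointly measurable version comes from the completeness of \<open>L\<^sup>2\<close> of the product space.\<close>

lemma L2_joint_limit:
  fixes H :: "nat \<Rightarrow> real \<Rightarrow> real^'n::finite \<Rightarrow> complex" and X :: "real \<Rightarrow> real^'n \<Rightarrow> complex"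
  assumes H_meas: "\<And>k. (\<lambda>(t, \<xi>). H k t \<xi>) \<in> borel_measurable (borel \<Otimes>\<^sub>M borel)"
    and H_L2: "\<And>k t. L2 lborel (H k t)" and H_le: "\<And>k t. n2 lborel (H k t) \<le> C"
    and H_0: "\<And>k t. t \<notin> {0..1} \<Longrightarrow> H k t = (\<lambda>\<xi>. 0)"
    and lim: "AE t in lborel. t \<in> {0..1} \<longrightarrow> L2 lborel (X t) \<and> (\<lambda>k. n2 lborel (\<lambda>\<xi>. H k t \<xi> - X t \<xi>)) \<longlonglongrightarrow> 0"
  obtains B where "(\<lambda>(t, \<xi>). B t \<xi>) \<in> borel_measurable (borel \<Otimes>\<^sub>M borel)"
    "AE t in lborel. t \<in> {0..1} \<longrightarrow> (AE \<xi> in lborel. B t \<xi> = X t \<xi>)"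
proof -
  let ?M = "lborel \<Otimes>\<^sub>M lborel :: (real \<times> (real^'n)) measure"
  have [measurable]: "(\<lambda>p. H k (fst p) (snd p)) \<in> borel_measurable (borel \<Otimes>\<^sub>M borel)" for k
    using H_meas[of k] by (simp add: case_prod_unfold)
  have C: "0 \<le> C" using H_le[of 0 0] n2_nonneg order_trans by blast
  define d where "d k l t = (n2 lborel (\<lambda>\<xi>. H k t \<xi> - H l t \<xi>))\<^sup>2" for k l t
  have d_meas [measurable]: "d k l \<in> borel_measurable borel" for k l
    unfolding d_def[abs_def] n2_power2 by measurable
  have d_le: "d k l t \<le> 4 * C\<^sup>2 * indicator {0..1} t" for k l t
  proof (cases "t \<in> {0..1}")
    case True
    have "n2 lborel (\<lambda>\<xi>. H k t \<xi> - H l t \<xi>) \<le> n2 lborel (\<lambda>\<xi>. H k t \<xi> - 0) + n2 lborel (\<lambda>\<xi>. 0 - H l t \<xi>)"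
      by (rule n2_triangle_diff) (auto intro: H_L2)
    also have "\<dots> \<le> C + C"
      using H_le[of k t] H_le[of l t] n2_minus_commute[of lborel "\<lambda>\<xi>. 0" "H l t"] by simp
    finally have "d k l t \<le> (C + C)\<^sup>2" unfolding d_def by (intro power_mono) auto
    then show ?thesis using True by (simp add: power2_eq_square)
  next
    case False
    then show ?thesis by (simp add: d_def H_0)
  qed
  have nn: "(\<integral>\<^sup>+p. ennreal ((cmod (H k (fst p) (snd p) - H l (fst p) (snd p)))\<^sup>2) \<partial>?M) = (\<integral>\<^sup>+t. ennreal (d k l t) \<partial>lborel)" for k l
  proof -
    have "(\<integral>\<^sup>+p. ennreal ((cmod (H k (fst p) (snd p) - H l (fst p) (snd p)))\<^sup>2) \<partial>?M)
        = (\<integral>\<^sup>+t. \<integral>\<^sup>+\<xi>. ennreal ((cmod (H k t \<xi> - H l t \<xi>))\<^sup>2) \<partial>lborel \<partial>lborel)"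
      by (subst lborel.nn_integral_fst[symmetric]) auto
    then show ?thesis
      by (simp add: n2_nn_integral[OF L2_diff[OF H_L2 H_L2]] d_def)
  qed
  \<comment> \<open>The tail supremum measures how far the slice at time t is from being Cauchy. It
    tends to 0 for almost every t and is dominated by a constant on [0, 1], so the sequence is
    Cauchy in L2 of the product space.\<close>
  define u where "u k t = (SUP l\<in>{k..}. ennreal (d k l t))" for k t
  have u_meas [measurable]: "u k \<in> borel_measurable borel" for k
    unfolding u_def[abs_def] by (rule borel_measurable_SUP) auto
  have "(\<lambda>k. \<integral>\<^sup>+t. u k t \<partial>lborel) \<longlonglongrightarrow> (\<integral>\<^sup>+t. 0 \<partial>(lborel :: real measure))"
  proof (rule nn_integral_dominated_convergence)
    show "AE t in lborel. u k t \<le> ennreal (4 * C\<^sup>2 * indicator {0..1} t)" for k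
      unfolding u_def by (intro AE_I2 SUP_least ennreal_leI d_le)
    have "(\<integral>\<^sup>+t. ennreal (4 * C\<^sup>2 * indicator {0..1::real} t) \<partial>lborel) = (\<integral>\<^sup>+t. ennreal (4 * C\<^sup>2) * indicator {0..1::real} t \<partial>lborel)"
      by (intro nn_integral_cong) (auto simp: indicator_def)
    also have "\<dots> < \<infinity>" by (subst nn_integral_cmult_indicator) (auto simp: ennreal_mult_less_top)
    finally show "(\<integral>\<^sup>+t. ennreal (4 * C\<^sup>2 * indicator {0..1::real} t) \<partial>lborel) < \<infinity>" .
    show "AE t in lborel. (\<lambda>k. u k t) \<longlonglongrightarrow> 0"
      using lim
    proof eventually_elim
      case (elim t)
      show ?case
      proof (cases "t \<in> {0..1}")
        case True
        show ?thesis
        proof (rule order_tendstoI)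
          fix y :: ennreal assume "0 < y"
          then obtain z where z: "0 < z" "z < y" using dense by blast
          define e where "e = enn2real z"
          have "z < top" using z(2) by (rule less_le_trans) simp
          then have e: "0 < e" "ennreal e < y"
            using z by (simp_all add: e_def enn2real_positive_iff)
          have "0 < sqrt e" using e by simp
          then obtain N where N: "\<And>m n. m \<ge> N \<Longrightarrow> n \<ge> N \<Longrightarrow> n2 lborel (\<lambda>\<xi>. H m t \<xi> - H n t \<xi>) \<le> sqrt e"
            using L2_Cauchy_of_tendsto[of lborel "\<lambda>k. H k t" "X t" "sqrt e"] H_L2 elim True by blast
          show "\<forall>\<^sub>F k in sequentially. u k t < y"
          proof (rule eventually_sequentiallyI)
            fix k assume "N \<le> k"
            then have "d k l t \<le> (sqrt e)\<^sup>2" if "l \<ge> k" for l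
              unfolding d_def using that by (intro power_mono N) auto
            then have "u k t \<le> ennreal e"
              unfolding u_def using e(1) by (intro SUP_least ennreal_leI) auto
            then show "u k t < y" using e(2) by (rule le_less_trans)
          qed
        qed simp
      next
        case False
        then show ?thesis by (simp add: u_def d_def H_0)
      qed
    qed
  qed auto
  then have u_lim: "(\<lambda>k. \<integral>\<^sup>+t. u k t \<partial>lborel) \<longlonglongrightarrow> 0" by simp
  have L2H: "L2 ?M (\<lambda>p. H k (fst p) (snd p))" for k
  proof -
    have "(\<integral>\<^sup>+p. ennreal ((cmod (H k (fst p) (snd p)))\<^sup>2) \<partial>?M)
        = (\<integral>\<^sup>+t. \<integral>\<^sup>+\<xi>. ennreal ((cmod (H k t \<xi>))\<^sup>2) \<partial>lborel \<partial>lborel)"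
      by (subst lborel.nn_integral_fst[symmetric]) auto
    also have "\<dots> \<le> (\<integral>\<^sup>+t. ennreal (C\<^sup>2) * indicator {0..1::real} t \<partial>lborel)"
    proof (rule nn_integral_mono)
      fix t :: real
      show "(\<integral>\<^sup>+\<xi>. ennreal ((cmod (H k t \<xi>))\<^sup>2) \<partial>lborel) \<le> ennreal (C\<^sup>2) * indicator {0..1} t"
        using H_le[of k t] H_0[of t k]
        by (cases "t \<in> {0..1}") (auto simp: n2_nn_integral[OF H_L2] intro!: ennreal_leI power_mono)
    qed
    also have "\<dots> < \<infinity>" by (subst nn_integral_cmult_indicator) (auto simp: ennreal_mult_less_top)
    finally show ?thesis by (simp add: L2_iff_nn_integral)
  qed
  have "\<exists>N. \<forall>m\<ge>N. \<forall>n\<ge>N. n2 ?M (\<lambda>p. H m (fst p) (snd p) - H n (fst p) (snd p)) \<le> e" if "0 < e" for e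
  proof -
    have "\<forall>\<^sub>F k in sequentially. (\<integral>\<^sup>+t. u k t \<partial>lborel) < ennreal (e\<^sup>2)"
      using order_tendstoD(2)[OF u_lim, of "ennreal (e\<^sup>2)"] that by simp
    then obtain N where N: "\<And>k. k \<ge> N \<Longrightarrow> (\<integral>\<^sup>+t. u k t \<partial>lborel) < ennreal (e\<^sup>2)"
      by (auto simp: eventually_sequentially)
    have *: "n2 ?M (\<lambda>p. H m (fst p) (snd p) - H n (fst p) (snd p)) \<le> e" if "N \<le> m" "m \<le> n" for m n
    proof (rule n2_le_nn_integral(2))
      have "(\<integral>\<^sup>+t. ennreal (d m n t) \<partial>lborel) \<le> (\<integral>\<^sup>+t. u m t \<partial>lborel)"
        unfolding u_def using that by (intro nn_integral_mono SUP_upper) auto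
      also have "\<dots> \<le> ennreal (e\<^sup>2)" using N[OF that(1)] by simp
      finally show "(\<integral>\<^sup>+p. ennreal ((cmod (H m (fst p) (snd p) - H n (fst p) (snd p)))\<^sup>2) \<partial>?M) \<le> ennreal (e\<^sup>2)"
        unfolding nn .
    qed (use \<open>0 < e\<close> in auto)
    show ?thesis
    proof (intro exI allI impI)
      fix m n assume "N \<le> m" "N \<le> n"
      then show "n2 ?M (\<lambda>p. H m (fst p) (snd p) - H n (fst p) (snd p)) \<le> e"
        using *[of m n] *[of n m] n2_minus_commute[of ?M "\<lambda>p. H m (fst p) (snd p)" "\<lambda>p. H n (fst p) (snd p)"]
        by (cases "m \<le> n") auto
    qed
  qed
  from L2_complete[OF L2H this] obtain B where B: "L2 ?M B"
    "(\<lambda>k. n2 ?M (\<lambda>p. H k (fst p) (snd p) - B p)) \<longlonglongrightarrow> 0" by blast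
  have Bm [measurable]: "B \<in> borel_measurable (borel \<Otimes>\<^sub>M borel)"
  proof -
    have "B \<in> borel_measurable ?M" using B(1) by (simp add: L2_def)
    then show ?thesis by (simp cong: measurable_cong_sets sets_pair_measure_cong)
  qed
  \<comment> \<open>By Fubini the squared distances of the slices to those of \<open>B\<close> tend
    to 0 in L1 of time. Along a subsequence they tend to 0 for almost every t, which identifies the
    slice of \<open>B\<close> with \<open>X t\<close>.\<close>
  define D where "D k t = (LINT \<xi>|lborel. (cmod (H k t \<xi> - B (t, \<xi>)))\<^sup>2)" for k t
  have int: "integrable ?M (\<lambda>(t, \<xi>). (cmod (H k t \<xi> - B (t, \<xi>)))\<^sup>2)" for k
    using L2_integrable[OF L2_diff[OF L2H[of k] B(1)]] by (simp add: case_prod_unfold)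
  have D_int: "integrable lborel (D k)" for k
    unfolding D_def[abs_def] by (rule lborel_pair.integrable_fst[OF int])
  have D_eq: "(LINT t|lborel. norm (D k t)) = (n2 ?M (\<lambda>p. H k (fst p) (snd p) - B p))\<^sup>2" for k
    using lborel_pair.integral_fst[OF int[of k]]
    by (simp add: D_def n2_power2 case_prod_unfold)
  have "(\<lambda>k. LINT t|lborel. norm (D k t)) \<longlonglongrightarrow> 0"
    unfolding D_eq using tendsto_power[OF B(2), of 2] by simp
  from tendsto_L1_AE_subseq[OF D_int this]
  obtain r where r: "strict_mono r" "AE t in lborel. (\<lambda>k. D (r k) t) \<longlonglongrightarrow> 0" by blast
  have "AE t in lborel. \<forall>k. integrable lborel (\<lambda>\<xi>. (cmod (H k t \<xi> - B (t, \<xi>)))\<^sup>2)"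
    using lborel_pair.AE_integrable_fst[OF int] by (simp add: AE_all_countable)
  then have "AE t in lborel. t \<in> {0..1} \<longrightarrow> (AE \<xi> in lborel. B (t, \<xi>) = X t \<xi>)"
    using r(2) lim
  proof eventually_elim
    case (elim t)
    show ?case
    proof
      assume t: "t \<in> {0..1}"
      have HB: "L2 lborel (\<lambda>\<xi>. H k t \<xi> - B (t, \<xi>))" for k
      proof -
        have "H k t \<in> borel_measurable lborel" using H_L2[of k t] by (simp add: L2_def)
        moreover have "(\<lambda>\<xi>. B (t, \<xi>)) \<in> borel_measurable lborel"
          using measurable_compose[OF measurable_Pair1' Bm, of t] by simp
        ultimately show ?thesis using elim(1) by (simp add: L2_def borel_measurable_diff)
      qed
      have BL: "L2 lborel (\<lambda>\<xi>. B (t, \<xi>))"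
        using L2_diff[OF H_L2[of 0 t] HB[of 0]] by simp
      have XL: "L2 lborel (X t)" using elim(3) t by simp
      have "(\<lambda>k. sqrt (D (r k) t)) \<longlonglongrightarrow> sqrt 0"
        by (intro tendsto_real_sqrt elim(2))
      then have 1: "(\<lambda>k. n2 lborel (\<lambda>\<xi>. H (r k) t \<xi> - B (t, \<xi>))) \<longlonglongrightarrow> 0"
        by (simp add: D_def n2_def)
      have 2: "(\<lambda>k. n2 lborel (\<lambda>\<xi>. H (r k) t \<xi> - X t \<xi>)) \<longlonglongrightarrow> 0"
        using LIMSEQ_subseq_LIMSEQ[OF conjunct2[OF elim(3)[rule_format, OF t]] r(1)] by (simp add: o_def)
      have "(\<lambda>k. n2 lborel (\<lambda>\<xi>. H (r k) t \<xi> - B (t, \<xi>)) + n2 lborel (\<lambda>\<xi>. H (r k) t \<xi> - X t \<xi>)) \<longlonglongrightarrow> 0"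
        using tendsto_add[OF 1 2] by simp
      moreover have "n2 lborel (\<lambda>\<xi>. B (t, \<xi>) - X t \<xi>) \<le> n2 lborel (\<lambda>\<xi>. H (r k) t \<xi> - B (t, \<xi>)) + n2 lborel (\<lambda>\<xi>. H (r k) t \<xi> - X t \<xi>)" for k
        using n2_triangle_diff[OF BL H_L2[of "r k" t] XL] n2_minus_commute[of lborel "\<lambda>\<xi>. B (t, \<xi>)" "H (r k) t"] by simp
      ultimately have "n2 lborel (\<lambda>\<xi>. B (t, \<xi>) - X t \<xi>) \<le> 0"
        by (intro LIMSEQ_le_const) auto
      then have "n2 lborel (\<lambda>\<xi>. B (t, \<xi>) - X t \<xi>) = 0" by (simp add: antisym)
      from n2_eq_0_AE[OF L2_diff[OF BL XL] this] show "AE \<xi> in lborel. B (t, \<xi>) = X t \<xi>" by simp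
    qed
  qed
  then show thesis by (intro that[of "\<lambda>t \<xi>. B (t, \<xi>)"]) (simp_all add: case_prod_unfold)
qed

text \<open>Cut-offs by the norm of the slice, before and after the limit, turn information valid
  for almost every t into bounds for every t, as the locale \<open>duhamel\<close> assumes
  them.\<close>

lemma L_infty_sobolev_joint_symbol:
  fixes b :: "real \<Rightarrow> 'n::finite distr"
  assumes b: "b \<in> L_infty_sobolev {0..} s"
  obtains \<beta> :: "real \<Rightarrow> real^'n \<Rightarrow> complex" and C where
    "(\<lambda>(t, \<xi>). \<beta> t \<xi>) \<in> borel_measurable (borel \<Otimes>\<^sub>M borel)"
    "\<And>t. hs s (\<beta> t)" "\<And>t. hnorm s (\<beta> t) \<le> C" "0 \<le> C"
    "AE t in lborel. t \<in> {0..1} \<longrightarrow> distr_eq (b t) (symb (\<beta> t))"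
proof -
  obtain S C0 where S: "\<And>k::nat. simple_function (lebesgue_on {0..}) (S k)" "\<And>k. S k ` {0..} \<subseteq> sobolev s" "0 \<le> C0"
    and lim: "AE t in lborel. t \<in> {0..} \<longrightarrow> b t \<in> sobolev s \<and> hnorm s (symbol s (b t)) \<le> C0 \<and>
      (\<lambda>k. hnorm s (\<lambda>\<xi>. symbol s (S k t) \<xi> - symbol s (b t) \<xi>)) \<longlonglongrightarrow> 0"
    using L_infty_sobolev_symbols[OF b] by auto
  \<comment> \<open>The slack makes the norm of the limit strictly smaller than \<open>C\<close>, so
    that the approximants eventually pass the cut-off \<open>small\<close>.\<close>
  define C where "C = C0 + 1"
  have C: "0 \<le> C" using S(3) by (simp add: C_def)
  have "\<exists>G. (\<lambda>(t, \<xi>). G t \<xi>) \<in> borel_measurable (borel \<Otimes>\<^sub>M borel) \<and>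
    (AE t in lborel. t \<in> {0..} \<longrightarrow> G t = (\<lambda>\<xi>. bracket s \<xi> * symbol s (S k t) \<xi>))" for k
  proof -
    have "(\<lambda>\<xi>. bracket s \<xi> * symbol s D \<xi>) \<in> borel_measurable borel" if "D \<in> S k ` {0..}" for D
      using hs_measurable[OF symbol(1), of D s] that S(2)[of k] by auto
    then show ?thesis
      using simple_borel_version[OF S(1), of k "\<lambda>D \<xi>. bracket s \<xi> * symbol s D \<xi>"] by auto
  qed
  from choice[OF allI[OF this]] obtain G where "\<forall>k. (\<lambda>(t, \<xi>). G k t \<xi>) \<in> borel_measurable (borel \<Otimes>\<^sub>M borel) \<and>
    (AE t in lborel. t \<in> {0..} \<longrightarrow> G k t = (\<lambda>\<xi>. bracket s \<xi> * symbol s (S k t) \<xi>))" ..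
  then have G: "\<And>k. (\<lambda>(t, \<xi>). G k t \<xi>) \<in> borel_measurable (borel \<Otimes>\<^sub>M borel)"
    "\<And>k. AE t in lborel. t \<in> {0..} \<longrightarrow> G k t = (\<lambda>\<xi>. bracket s \<xi> * symbol s (S k t) \<xi>)" by simp_all
  have [measurable]: "(\<lambda>p. G k (fst p) (snd p)) \<in> borel_measurable (borel \<Otimes>\<^sub>M borel)" for k
    using G(1)[of k] by (simp add: case_prod_unfold)
  \<comment> \<open>Discarding large slices and times outside [0, 1] gives the approximants a common
    bound and finite norm on the product space.\<close>
  define small where "small k t \<longleftrightarrow> t \<in> {0..1} \<and> (\<integral>\<^sup>+\<xi>. ennreal ((cmod (G k t \<xi>))\<^sup>2) \<partial>lborel) \<le> ennreal (C\<^sup>2)" for k t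
  have [measurable]: "Measurable.pred borel (small k)" for k
    unfolding small_def by measurable
  define H where "H k t \<xi> = (if small k t then G k t \<xi> else 0)" for k t \<xi>
  have "(\<lambda>p. H k (fst p) (snd p)) \<in> borel_measurable (borel \<Otimes>\<^sub>M borel)" for k
    unfolding H_def by measurable
  then have H_meas: "(\<lambda>(t, \<xi>). H k t \<xi>) \<in> borel_measurable (borel \<Otimes>\<^sub>M borel)" for k
    by (simp add: case_prod_unfold)
  have H: "L2 lborel (H k t)" "n2 lborel (H k t) \<le> C" for k t
  proof -
    have "H k t \<in> borel_measurable lborel"
      using measurable_compose[OF measurable_Pair1' H_meas, of t k] by simp
    moreover have "(\<integral>\<^sup>+\<xi>. ennreal ((cmod (H k t \<xi>))\<^sup>2) \<partial>lborel) \<le> ennreal (C\<^sup>2)"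
      by (cases "small k t") (auto simp: H_def small_def)
    ultimately show "L2 lborel (H k t)" "n2 lborel (H k t) \<le> C"
      using n2_le_nn_integral[of "H k t" lborel C] C by auto
  qed
  have H_0: "H k t = (\<lambda>\<xi>. 0)" if "t \<notin> {0..1}" for k t
    using that by (auto simp: H_def small_def)
  define X where "X t \<xi> = bracket s \<xi> * symbol s (b t) \<xi>" for t \<xi>
  have "AE t in lborel. \<forall>k. t \<in> {0..} \<longrightarrow> G k t = (\<lambda>\<xi>. bracket s \<xi> * symbol s (S k t) \<xi>)"
    by (rule AE_all_countable[THEN iffD2, OF allI[OF G(2)]])
  then have limH: "AE t in lborel. t \<in> {0..1} \<longrightarrow> L2 lborel (X t) \<and> (\<lambda>k. n2 lborel (\<lambda>\<xi>. H k t \<xi> - X t \<xi>)) \<longlonglongrightarrow> 0"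
    using lim
  proof eventually_elim
    case (elim t)
    show ?case
    proof
      assume t: "t \<in> {0..1}"
      then have t0: "t \<in> {0..}" by auto
      have bt: "b t \<in> sobolev s" and St: "S k t \<in> sobolev s" for k using elim t0 S(2)[of k] by auto
      have XL: "L2 lborel (X t)" unfolding X_def[abs_def] using symbol(1)[OF bt] by (simp add: hs_def)
      have Geq: "G k t = (\<lambda>\<xi>. bracket s \<xi> * symbol s (S k t) \<xi>)" for k using elim(1) t0 by blast
      have GL: "L2 lborel (G k t)" for k unfolding Geq using symbol(1)[OF St] by (simp add: hs_def)
      have GX: "(\<lambda>k. n2 lborel (\<lambda>\<xi>. G k t \<xi> - X t \<xi>)) \<longlonglongrightarrow> 0"
        using elim(2) t0 by (simp add: Geq X_def hnorm_def right_diff_distrib)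
      have "n2 lborel (X t) < C"
        using elim(2) t0 by (simp add: X_def[abs_def] hnorm_def C_def)
      then have "\<forall>\<^sub>F k in sequentially. n2 lborel (G k t) < C"
        using order_tendstoD(2)[OF tendsto_n2[OF GL XL GX]] by blast
      then have "\<forall>\<^sub>F k in sequentially. n2 lborel (\<lambda>\<xi>. G k t \<xi> - X t \<xi>) = n2 lborel (\<lambda>\<xi>. H k t \<xi> - X t \<xi>)"
      proof eventually_elim
        case (elim k)
        then have "small k t"
          using t C by (auto simp: small_def n2_nn_integral[OF GL] intro!: ennreal_leI power_mono)
        then show ?case by (simp add: H_def)
      qed
      from Lim_transform_eventually[OF GX this]
      show "L2 lborel (X t) \<and> (\<lambda>k. n2 lborel (\<lambda>\<xi>. H k t \<xi> - X t \<xi>)) \<longlonglongrightarrow> 0" using XL by simp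
    qed
  qed
  obtain B where B: "(\<lambda>(t, \<xi>). B t \<xi>) \<in> borel_measurable (borel \<Otimes>\<^sub>M borel)"
    "AE t in lborel. t \<in> {0..1} \<longrightarrow> (AE \<xi> in lborel. B t \<xi> = X t \<xi>)"
    using L2_joint_limit[OF H_meas H H_0 limH] by blast
  have Bm [measurable]: "(\<lambda>p. B (fst p) (snd p)) \<in> borel_measurable (borel \<Otimes>\<^sub>M borel)"
    using B(1) by (simp add: case_prod_unfold)
  \<comment> \<open>A Borel set of times outside which the symbol is set to 0; almost every t in
    [0, 1] belongs to it.\<close>
  define good where "good t \<longleftrightarrow> (\<integral>\<^sup>+\<xi>. ennreal ((cmod (B t \<xi>))\<^sup>2) \<partial>lborel) \<le> ennreal (C\<^sup>2)" for t
  have [measurable]: "Measurable.pred borel good"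
    unfolding good_def by measurable
  define \<beta> where "\<beta> t \<xi> = (if good t then bracket (- s) \<xi> * B t \<xi> else 0)" for t \<xi>
  have "(\<lambda>p. \<beta> (fst p) (snd p)) \<in> borel_measurable (borel \<Otimes>\<^sub>M borel)"
    unfolding \<beta>_def by measurable
  then have \<beta>_meas: "(\<lambda>(t, \<xi>). \<beta> t \<xi>) \<in> borel_measurable (borel \<Otimes>\<^sub>M borel)"
    by (simp add: case_prod_unfold)
  have Bt: "B t \<in> borel_measurable lborel" for t
    using measurable_compose[OF measurable_Pair1' B(1), of t] by simp
  have \<beta>: "hs s (\<beta> t)" "hnorm s (\<beta> t) \<le> C" for t
  proof -
    have "L2 lborel (B t) \<and> n2 lborel (B t) \<le> C" if "good t"
      using n2_le_nn_integral[OF Bt[of t] _ C] that by (auto simp: good_def)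
    then show "hs s (\<beta> t)" "hnorm s (\<beta> t) \<le> C"
      using C by (cases "good t"; simp add: hs_def hnorm_def \<beta>_def)+
  qed
  have "AE t in lborel. t \<in> {0..1} \<longrightarrow> distr_eq (b t) (symb (\<beta> t))"
    using B(2) lim
  proof eventually_elim
    case (elim t)
    show ?case
    proof
      assume t: "t \<in> {0..1}"
      then have t0: "t \<in> {0..}" by auto
      have bt: "b t \<in> sobolev s" using elim t0 by auto
      have XL: "L2 lborel (X t)" unfolding X_def[abs_def] using symbol(1)[OF bt] by (simp add: hs_def)
      have BX: "AE \<xi> in lborel. B t \<xi> = X t \<xi>" using elim t by blast
      have "(\<integral>\<^sup>+\<xi>. ennreal ((cmod (B t \<xi>))\<^sup>2) \<partial>lborel) = (\<integral>\<^sup>+\<xi>. ennreal ((cmod (X t \<xi>))\<^sup>2) \<partial>lborel)"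
        by (rule nn_integral_cong_AE) (use BX in \<open>eventually_elim, simp\<close>)
      also have "\<dots> = ennreal ((n2 lborel (X t))\<^sup>2)" by (rule n2_nn_integral[OF XL])
      also have "\<dots> \<le> ennreal (C\<^sup>2)"
        using elim(2) t0 by (intro ennreal_leI power_mono) (auto simp: X_def[abs_def] hnorm_def C_def)
      finally have good: "good t" by (simp add: good_def)
      have "AE \<xi> in lborel. symbol s (b t) \<xi> = \<beta> t \<xi>"
        using BX by eventually_elim (simp add: \<beta>_def good X_def)
      then have "symb (symbol s (b t)) f = symb (\<beta> t) f" if "schwartz f" for f
        by (intro symb_cong_AE that hs_measurable[OF \<beta>(1)] hs_measurable[OF symbol(1)[OF bt]])
      then show "distr_eq (b t) (symb (\<beta> t))"
        using symbol(2)[OF bt] by (simp add: distr_eq_def)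
    qed
  qed
  with \<beta>_meas \<beta> C show thesis by (rule that[of \<beta> C])
qed

lemma hermitian_version:
  fixes b :: "real \<Rightarrow> 'n::finite distr"
  assumes b: "b \<in> L_infty_sobolev {0..} s" and real: "AE t in lebesgue_on {0..}. real_distr (b t)"
  obtains \<beta> :: "real \<Rightarrow> real^'n \<Rightarrow> complex" and C where
    "(\<lambda>(t, \<xi>). \<beta> t \<xi>) \<in> borel_measurable (borel \<Otimes>\<^sub>M borel)"
    "\<And>t. hs s (\<beta> t)" "\<And>t. hnorm s (\<beta> t) \<le> C" "0 \<le> C"
    "AE t in lborel. t \<in> {0..1} \<longrightarrow> distr_eq (b t) (symb (\<beta> t))"
    "\<And>t \<xi>. \<beta> t (- \<xi>) = cnj (\<beta> t \<xi>)"
proof -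
  obtain \<beta> :: "real \<Rightarrow> real^'n \<Rightarrow> complex" and C where
    \<beta>: "(\<lambda>(t, \<xi>). \<beta> t \<xi>) \<in> borel_measurable (borel \<Otimes>\<^sub>M borel)"
    "\<And>t. hs s (\<beta> t)" "\<And>t. hnorm s (\<beta> t) \<le> C" "0 \<le> C"
    and beq: "AE t in lborel. t \<in> {0..1} \<longrightarrow> distr_eq (b t) (symb (\<beta> t))"
    using L_infty_sobolev_joint_symbol[OF b] by blast
  have [measurable]: "(\<lambda>p. \<beta> (fst p) (snd p)) \<in> borel_measurable (borel \<Otimes>\<^sub>M borel)"
    using \<beta>(1) by (simp add: case_prod_unfold)
  \<comment> \<open>Averaging with the reflected conjugate makes the symmetry exact everywhere. For
    almost every t in [0, 1] it changes the symbol only on a null set, because b t is real.\<close>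
  define \<beta>' where "\<beta>' t \<xi> = (1/2) * (\<beta> t \<xi> + cnj (\<beta> t (- \<xi>)))" for t \<xi>
  have "(\<lambda>p. \<beta>' (fst p) (snd p)) \<in> borel_measurable (borel \<Otimes>\<^sub>M borel)"
  proof -
    have "(\<lambda>p::real \<times> (real^'n). (fst p, - snd p)) \<in> borel \<Otimes>\<^sub>M borel \<rightarrow>\<^sub>M borel \<Otimes>\<^sub>M borel"
      by measurable
    from measurable_compose[OF this, of "\<lambda>p. \<beta> (fst p) (snd p)" borel]
    have [measurable]: "(\<lambda>p. \<beta> (fst p) (- snd p)) \<in> borel_measurable (borel \<Otimes>\<^sub>M borel)" by simp
    show ?thesis unfolding \<beta>'_def by measurable
  qed
  then have m: "(\<lambda>(t, \<xi>). \<beta>' t \<xi>) \<in> borel_measurable (borel \<Otimes>\<^sub>M borel)"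
    by (simp add: case_prod_unfold)
  have hsum: "hs s (\<lambda>\<xi>. \<beta> t \<xi> + cnj (\<beta> t (- \<xi>)))" "hnorm s (\<lambda>\<xi>. \<beta> t \<xi> + cnj (\<beta> t (- \<xi>))) \<le> 2 * C" for t
    using hs_add[OF \<beta>(2) hs_reflect_cnj(1)[OF \<beta>(2)]] hs_reflect_cnj(2)[OF \<beta>(2), of t] \<beta>(3)[of t]
      hnorm_triangle[OF \<beta>(2) hs_reflect_cnj(1)[OF \<beta>(2)], of t t] by auto
  have h1: "hs s (\<beta>' t)" for t
    unfolding \<beta>'_def[abs_def] by (rule hs_bounded_mult(1)[OF hsum(1), of _ "1/2"]) auto
  have h2: "hnorm s (\<beta>' t) \<le> C" for t
    using hs_bounded_mult(2)[OF hsum(1), of "\<lambda>_. 1/2" "1/2" t] hsum(2)[of t] by (simp add: \<beta>'_def[abs_def])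
  have "AE t in lborel. t \<in> {0..} \<longrightarrow> real_distr (b t)"
    using real by (subst (asm) AE_lebesgue_on_iff) auto
  then have "AE t in lborel. t \<in> {0..1} \<longrightarrow> distr_eq (b t) (symb (\<beta>' t))"
    using beq
  proof eventually_elim
    case (elim t)
    show ?case
    proof
      assume t: "t \<in> {0..1}"
      have "AE \<xi> in lborel. cnj (\<beta> t (- \<xi>)) = \<beta> t \<xi>"
        using elim t by (intro real_distr_symbol[OF \<beta>(2)]) auto
      then have "AE \<xi> in lborel. \<beta> t \<xi> = \<beta>' t \<xi>"
        by eventually_elim (simp add: \<beta>'_def)
      then have "symb (\<beta> t) f = symb (\<beta>' t) f" if "schwartz f" for f
        by (intro symb_cong_AE that hs_measurable[OF \<beta>(2)] hs_measurable[OF h1])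
      then show "distr_eq (b t) (symb (\<beta>' t))" using elim t by (simp add: distr_eq_def)
    qed
  qed
  moreover have "\<beta>' t (- \<xi>) = cnj (\<beta>' t \<xi>)" for t \<xi> by (simp add: \<beta>'_def add.commute)
  ultimately show thesis using m h1 h2 \<beta>(4) by (intro that[of \<beta>' C])
qed

section \<open>The Duhamel operator\<close>

lemma heat_measurable_pair [measurable (raw)]:
  assumes "f \<in> borel_measurable N" "g \<in> borel_measurable N"
  shows "(\<lambda>x. heat \<alpha> (f x) (g x)) \<in> borel_measurable N"
  using assms unfolding heat_def by measurable

lemma norm_heat_le: "0 \<le> t \<Longrightarrow> cmod (heat \<alpha> t \<xi>) \<le> 1"
  by (simp add: heat_def)

lemma heat_add: "heat \<alpha> (s + t) \<xi> = heat \<alpha> s \<xi> * heat \<alpha> t \<xi>"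
  by (simp add: heat_def algebra_simps flip: exp_add of_real_mult)

lemma heat_reflect [simp]: "heat \<alpha> t (- \<xi>) = heat \<alpha> t \<xi>"
  by (simp add: heat_def)

lemma cnj_heat [simp]: "cnj (heat \<alpha> t \<xi>) = heat \<alpha> t \<xi>"
  by (simp add: heat_def)

lemma hs_heat:
  assumes "hs s \<tau>" "0 \<le> t"
  shows "hs s (\<lambda>\<xi>. heat \<alpha> t \<xi> * \<tau> \<xi>)" "hnorm s (\<lambda>\<xi>. heat \<alpha> t \<xi> * \<tau> \<xi>) \<le> hnorm s \<tau>"
  using hs_bounded_mult[OF assms(1) heat_measurable norm_heat_le[OF assms(2)]] by auto

text \<open>Strong continuity of the heat semigroup, by dominated convergence with the weighted
  symbol itself as majorant. There is no rate, since the symbol has no regularity to spare.\<close>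

lemma heat_tendsto:
  fixes h :: "nat \<Rightarrow> real" and \<tau> :: "real^'n::finite \<Rightarrow> complex"
  assumes \<tau>: "hs s \<tau>" and h: "\<And>k. 0 \<le> h k" "h \<longlonglongrightarrow> 0"
  shows "(\<lambda>k. hnorm s (\<lambda>\<xi>. heat \<alpha> (h k) \<xi> * \<tau> \<xi> - \<tau> \<xi>)) \<longlonglongrightarrow> 0"
proof -
  note [measurable] = hs_measurable[OF \<tau>]
  have L: "L2 lborel (\<lambda>\<xi>. bracket s \<xi> * \<tau> \<xi>)" using \<tau> by (simp add: hs_def)
  have "(\<lambda>k. n2 lborel (\<lambda>\<xi>. heat \<alpha> (h k) \<xi> * (bracket s \<xi> * \<tau> \<xi>) - bracket s \<xi> * \<tau> \<xi>)) \<longlonglongrightarrow> 0"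
  proof (rule L2_dominated_convergence(2)[OF _ _ L])
    show "AE \<xi> in lborel. cmod (heat \<alpha> (h k) \<xi> * (bracket s \<xi> * \<tau> \<xi>)) \<le> cmod (bracket s \<xi> * \<tau> \<xi>)" for k
    proof (rule AE_I2)
      fix \<xi> :: "real^'n"
      have "cmod (heat \<alpha> (h k) \<xi>) * cmod (bracket s \<xi> * \<tau> \<xi>) \<le> 1 * cmod (bracket s \<xi> * \<tau> \<xi>)"
        by (intro mult_right_mono norm_heat_le h) simp
      then show "cmod (heat \<alpha> (h k) \<xi> * (bracket s \<xi> * \<tau> \<xi>)) \<le> cmod (bracket s \<xi> * \<tau> \<xi>)"
        by (simp only: norm_mult mult_1_left)
    qed
    show "AE \<xi> in lborel. (\<lambda>k. heat \<alpha> (h k) \<xi> * (bracket s \<xi> * \<tau> \<xi>)) \<longlonglongrightarrow> bracket s \<xi> * \<tau> \<xi>"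
    proof (rule AE_I2)
      fix \<xi> :: "real^'n"
      have "(\<lambda>k. heat \<alpha> (h k) \<xi>) \<longlonglongrightarrow> complex_of_real (exp (- 0 * norm \<xi> powr \<alpha>))"
        unfolding heat_def by (intro tendsto_of_real tendsto_exp tendsto_mult tendsto_minus h(2) tendsto_const)
      from tendsto_mult_right[OF this, of "bracket s \<xi> * \<tau> \<xi>"]
      show "(\<lambda>k. heat \<alpha> (h k) \<xi> * (bracket s \<xi> * \<tau> \<xi>)) \<longlonglongrightarrow> bracket s \<xi> * \<tau> \<xi>" by simp
    qed
  qed measurable
  then show ?thesis by (simp add: hnorm_def algebra_simps)
qed

text \<open>The bounds on \<beta> are required at every time rather than almost everywhere. The
  estimates of the Duhamel term then hold at each t in [0, 1], as right continuity of the flow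
  demands.\<close>

locale duhamel =
  fixes \<alpha> \<sigma> :: real and \<beta> :: "real \<Rightarrow> real^'n::finite \<Rightarrow> complex" and Cb :: real
  assumes alpha: "0 < \<alpha>" and sigma: "\<sigma> < 1" "1 - \<sigma> < \<alpha>"
    and beta_joint: "(\<lambda>(t, \<xi>). \<beta> t \<xi>) \<in> borel_measurable (borel \<Otimes>\<^sub>M borel)"
    and beta_hs: "\<And>t. hs \<sigma> (\<beta> t)" and beta_le: "\<And>t. hnorm \<sigma> (\<beta> t) \<le> Cb"
begin

definition \<theta> :: real where "\<theta> = (1 - \<sigma>) / \<alpha>"

text \<open>The constant in (1 + r^2)^(p/2) <= K max(1, r)^p for p = 1 - \<sigma>.\<close>

definition K :: real where "K = 2 powr ((1 - \<sigma>) / 2)"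

text \<open>For h >= 0 this is the integral of K s^(-\<theta>) over 0 <= s <= h.\<close>

definition E :: "real \<Rightarrow> real" where "E h = K * h powr (1 - \<theta>) / (1 - \<theta>)"

lemma theta: "0 < \<theta>" "\<theta> < 1"
  using alpha sigma by (auto simp: \<theta>_def)

lemma K_pos: "0 < K" by (simp add: K_def)

lemma E_nonneg [simp]: "0 \<le> E h"
  using theta K_pos by (simp add: E_def)

lemma Cb_nonneg: "0 \<le> Cb"
  using beta_le[of 0] hnorm_nonneg order_trans by blast

lemma E_tendsto: "h \<longlonglongrightarrow> 0 \<Longrightarrow> (\<And>k. 0 \<le> h k) \<Longrightarrow> (\<lambda>k::nat. E (h k)) \<longlonglongrightarrow> 0"
proof -
  assume h: "h \<longlonglongrightarrow> 0" "\<And>k. 0 \<le> h k"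
  have "(\<lambda>k. h k powr (1 - \<theta>)) \<longlonglongrightarrow> 0"
    by (rule tendsto_zero_powrI[OF h(1) tendsto_const]) (use h theta in auto)
  then have "(\<lambda>k. K * h k powr (1 - \<theta>) / (1 - \<theta>)) \<longlonglongrightarrow> K * 0 / (1 - \<theta>)"
    by (intro tendsto_intros) (use theta in auto)
  then show ?thesis by (simp add: E_def)
qed

lemma E_mono: "0 \<le> a \<Longrightarrow> a \<le> b \<Longrightarrow> E a \<le> E b"
  unfolding E_def using theta K_pos by (intro divide_right_mono mult_left_mono powr_mono2) auto

text \<open>The excess weight of order p = 1 - \<sigma> is traded for a power of \<tau>. For |\<xi>|
  <= 1 the weight is at most K, and 1 <= \<tau>^(-\<theta>) because \<tau> <= 1. For larger |\<xi>|
  put y = \<tau> |\<xi>|^\<alpha>; since p = \<alpha> \<theta>, the claim reduces to y^\<theta> exp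
  (- y) <= 1.\<close>

lemma kernel:
  assumes "0 < \<tau>" "\<tau> \<le> 1"
  shows "cmod (bracket 1 \<xi> * heat \<alpha> \<tau> \<xi>) \<le> K * \<tau> powr (- \<theta>) * cmod (bracket \<sigma> \<xi>)"
proof -
  define r where "r = norm \<xi>"
  define p where "p = 1 - \<sigma>"
  have p: "0 < p" "p = \<alpha> * \<theta>" using sigma alpha by (auto simp: p_def \<theta>_def)
  have r: "0 \<le> r" by (simp add: r_def)
  have "(1 + r\<^sup>2) powr (p / 2) * exp (- \<tau> * r powr \<alpha>) \<le> K * \<tau> powr (- \<theta>)"
  proof (cases "r \<le> 1")
    case True
    then have "r\<^sup>2 \<le> 1" using r by (simp add: power_le_one)
    then have "(1 + r\<^sup>2) powr (p / 2) \<le> K"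
      unfolding K_def p_def[symmetric] using p by (intro powr_mono2) auto
    moreover have "exp (- \<tau> * r powr \<alpha>) \<le> \<tau> powr (- \<theta>)"
    proof -
      have "exp (- \<tau> * r powr \<alpha>) \<le> 1" using assms by simp
      also have "1 = \<tau> powr 0" using assms by simp
      also have "\<dots> \<le> \<tau> powr (- \<theta>)" using assms theta by (intro powr_mono') auto
      finally show ?thesis .
    qed
    ultimately show ?thesis using K_pos by (intro mult_mono) auto
  next
    case False
    then have r1: "1 < r" by simp
    have "(1 + r\<^sup>2) powr (p / 2) \<le> (2 * r\<^sup>2) powr (p / 2)"
      using r1 p by (intro powr_mono2) auto
    also have "\<dots> = K * r powr p"
    proof -
      have "(r\<^sup>2) powr (p / 2) = (r powr 2) powr (p / 2)" using r1 by simp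
      also have "\<dots> = r powr p" by (subst powr_powr) simp
      finally show ?thesis by (simp add: powr_mult K_def p_def)
    qed
    finally have 1: "(1 + r\<^sup>2) powr (p / 2) \<le> K * r powr p" .
    define y where "y = \<tau> * r powr \<alpha>"
    have y: "0 < y" using assms r1 by (simp add: y_def)
    have "y powr \<theta> \<le> exp y"
    proof -
      \<comment> \<open>Here 0 < \<theta> < 1 enters: ln y <= y - 1 settles the case y >= 1, and for
        y < 1 the left side is not positive.\<close>
      have "\<theta> * ln y \<le> y"
      proof (cases "0 \<le> ln y")
        case True
        have "\<theta> * ln y \<le> 1 * ln y" using theta True by (intro mult_right_mono) auto
        then show ?thesis using ln_le_minus_one[OF y] by linarith
      next
        case False
        then have "\<theta> * ln y \<le> 0" using theta by (simp add: mult_le_0_iff)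
        then show ?thesis using y by linarith
      qed
      then show ?thesis using y by (simp add: powr_def)
    qed
    then have "y powr \<theta> * exp (- y) \<le> 1"
      by (simp add: exp_minus field_simps)
    moreover have "y powr \<theta> = \<tau> powr \<theta> * r powr p"
      using assms r1 by (simp add: y_def powr_mult powr_powr p(2))
    ultimately have "\<tau> powr (- \<theta>) * (\<tau> powr \<theta> * r powr p * exp (- y)) \<le> \<tau> powr (- \<theta>) * 1"
      by (intro mult_left_mono) auto
    then have 2: "r powr p * exp (- y) \<le> \<tau> powr (- \<theta>)"
      using assms by (simp add: powr_minus field_simps)
    have "(1 + r\<^sup>2) powr (p / 2) * exp (- y) \<le> K * r powr p * exp (- y)"
      by (intro mult_right_mono 1) auto
    also have "\<dots> \<le> K * \<tau> powr (- \<theta>)"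
      using mult_left_mono[OF 2, of K] K_pos by (simp add: mult_ac)
    finally show ?thesis by (simp add: y_def)
  qed
  then have *: "cmod (bracket p \<xi>) * cmod (heat \<alpha> \<tau> \<xi>) \<le> K * \<tau> powr (- \<theta>)"
    by (simp add: norm_bracket heat_def r_def)
  have "bracket 1 \<xi> = bracket p \<xi> * bracket \<sigma> \<xi>"
    by (simp add: bracket_mult p_def)
  then have "cmod (bracket 1 \<xi> * heat \<alpha> \<tau> \<xi>) = cmod (bracket p \<xi>) * cmod (heat \<alpha> \<tau> \<xi>) * cmod (bracket \<sigma> \<xi>)"
    by (simp add: norm_mult)
  also have "\<dots> \<le> K * \<tau> powr (- \<theta>) * cmod (bracket \<sigma> \<xi>)"
    by (intro mult_right_mono *) simp
  finally show ?thesis .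
qed

lemma kernel_integral:
  assumes "a \<le> t"
  shows "(\<integral>\<^sup>+s. ennreal (indicator {a..t} s * (K * (t - s) powr (- \<theta>))) \<partial>lborel) = ennreal (E (t - a))"
proof -
  have "((\<lambda>x. K * x powr (- \<theta>)) has_integral K * ((t - a) powr (- \<theta> + 1) / (- \<theta> + 1))) {0..t - a}"
    using theta assms by (intro has_integral_mult_right has_integral_powr_from_0) auto
  then have I: "(\<integral>\<^sup>+x. ennreal (indicator {0..t - a} x * (K * x powr (- \<theta>))) \<partial>lborel) = ennreal (E (t - a))"
    using K_pos by (subst nn_integral_has_integral_lebesgue) (auto simp: E_def)
  have "(\<integral>\<^sup>+s. ennreal (indicator {a..t} s * (K * (t - s) powr (- \<theta>))) \<partial>lborel)
     = (\<integral>\<^sup>+x. ennreal (indicator {a..t} (t + (-1) * x) * (K * (t - (t + (-1) * x)) powr (- \<theta>))) \<partial>lborel)"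
    by (subst nn_integral_real_affine[where c = "-1" and t = t]) auto
  also have "\<dots> = (\<integral>\<^sup>+x. ennreal (indicator {0..t - a} x * (K * x powr (- \<theta>))) \<partial>lborel)"
    by (intro nn_integral_cong) (auto simp: indicator_def)
  finally show ?thesis using I by simp
qed

lemma beta_measurable [measurable (raw)]:
  assumes "f \<in> borel_measurable N" "g \<in> borel_measurable N"
  shows "(\<lambda>x. \<beta> (f x) (g x)) \<in> borel_measurable N"
  using measurable_compose[OF measurable_Pair[OF assms] beta_joint] by simp

section \<open>The Duhamel integral\<close>

definition admissible :: "real \<Rightarrow> (real \<Rightarrow> real^'n \<Rightarrow> complex) \<Rightarrow> bool" where
  "admissible R q \<longleftrightarrow> (\<lambda>(t, \<xi>). q t \<xi>) \<in> borel_measurable (borel \<Otimes>\<^sub>M borel) \<and> (\<forall>t \<xi>. cmod (q t \<xi>) \<le> R)"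

lemma admissible_measurable:
  assumes "admissible R q" "f \<in> borel_measurable N" "g \<in> borel_measurable N"
  shows "(\<lambda>x. q (f x) (g x)) \<in> borel_measurable N"
proof -
  have "(\<lambda>(t, \<xi>). q t \<xi>) \<in> borel_measurable (borel \<Otimes>\<^sub>M borel)" using assms(1) by (simp add: admissible_def)
  from measurable_compose[OF measurable_Pair[OF assms(2,3)] this] show ?thesis by simp
qed

lemma admissible_nonneg: "admissible R q \<Longrightarrow> 0 \<le> R"
  unfolding admissible_def using norm_ge_zero order_trans by blast

definition duh :: "(real \<Rightarrow> real^'n \<Rightarrow> complex) \<Rightarrow> real \<Rightarrow> real^'n \<Rightarrow> complex" where
  "duh q t \<xi> = (LINT s|lborel. indicator {0..t} s * (heat \<alpha> (t - s) \<xi> * (q s \<xi> * \<beta> s \<xi>)))"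

lemma duh_measurable:
  assumes "admissible R q"
  shows "duh q t \<in> borel_measurable borel"
proof -
  note [measurable (raw)] = admissible_measurable[OF assms]
  show ?thesis unfolding duh_def[abs_def] by measurable
qed

text \<open>Minkowski's inequality for the time integral is replaced by the Cauchy-Schwarz inequality with
  respect to the measure \<open>K (t - s)\<^bsup>-\<theta>\<^esup> ds\<close>, which gives the same constant.\<close>

lemma duh_estimate:
  assumes q: "admissible R q" and t: "0 \<le> a" "a \<le> t" "t \<le> 1" and M: "0 \<le> M"
    and le: "AE s in lborel. s \<in> {0..t} \<longrightarrow> (\<forall>\<xi>. cmod (q s \<xi>) \<le> M * indicator {a..} s)"
  shows "hs 1 (duh q t)" "hnorm 1 (duh q t) \<le> M * Cb * E (t - a)"
proof -
  note [measurable (raw)] = admissible_measurable[OF q]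
  note [measurable] = duh_measurable[OF q, of t]
  \<comment> \<open>The density of the time measure, of total mass M E (t - a). It starts at a
    because q vanishes before that time, almost everywhere; this matters for uniqueness on
    successive intervals.\<close>
  define k where "k s = M * (indicator {a..t} s * (K * (t - s) powr (- \<theta>)))" for s
  have k: "0 \<le> k s" for s using M K_pos by (simp add: k_def)
  have [measurable]: "k \<in> borel_measurable borel" unfolding k_def[abs_def] by measurable
  define A where "A = ennreal (M * E (t - a))"
  have k_int: "(\<integral>\<^sup>+s. ennreal (k s) \<partial>lborel) = A"
  proof -
    have "(\<integral>\<^sup>+s. ennreal (k s) \<partial>lborel)
        = (\<integral>\<^sup>+s. ennreal M * ennreal (indicator {a..t} s * (K * (t - s) powr (- \<theta>))) \<partial>lborel)"
      using M K_pos by (simp add: k_def ennreal_mult)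
    also have "\<dots> = ennreal M * ennreal (E (t - a))"
      by (subst nn_integral_cmult) (auto simp: kernel_integral[OF t(2)])
    finally show ?thesis using M by (simp add: A_def ennreal_mult)
  qed
  define F where "F \<xi> s = indicator {0..t} s * (heat \<alpha> (t - s) \<xi> * (q s \<xi> * \<beta> s \<xi>))" for \<xi> s
  \<comment> \<open>The bound \<open>kernel\<close> needs t - s > 0, so the endpoint is
    discarded.\<close>
  have ne: "AE s in lborel. s \<noteq> t" using AE_lborel_singleton[of t] by (auto elim: eventually_mono)
  have F_le: "AE s in lborel. cmod (bracket 1 \<xi>) * cmod (F \<xi> s) \<le> k s * cmod (bracket \<sigma> \<xi> * \<beta> s \<xi>)" for \<xi>
    using le ne
  proof eventually_elim
    case (elim s)
    show ?case
    proof (cases "s \<in> {a..t}")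
      case True
      then have s: "0 < t - s" "t - s \<le> 1" "s \<in> {0..t}" using t elim(2) by auto
      then have qs: "cmod (q s \<xi>) \<le> M" using elim(1) True by auto
      have "cmod (bracket 1 \<xi>) * cmod (F \<xi> s) = cmod (bracket 1 \<xi> * heat \<alpha> (t - s) \<xi>) * (cmod (q s \<xi>) * cmod (\<beta> s \<xi>))"
        using s by (simp add: F_def norm_mult)
      also have "\<dots> \<le> (K * (t - s) powr (- \<theta>) * cmod (bracket \<sigma> \<xi>)) * (M * cmod (\<beta> s \<xi>))"
        using K_pos s M by (intro mult_mono kernel qs) auto
      also have "\<dots> = k s * cmod (bracket \<sigma> \<xi> * \<beta> s \<xi>)"
        using True by (simp add: k_def norm_mult mult_ac)
      finally show ?thesis .
    next
      case False
      have "F \<xi> s = 0"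
      proof (cases "s \<in> {0..t}")
        case True
        then have "cmod (q s \<xi>) \<le> 0" using elim(1)[rule_format, of \<xi>] False by (auto simp: indicator_def)
        then show ?thesis by (simp add: F_def)
      qed (simp add: F_def)
      then show ?thesis using k[of s] by simp
    qed
  qed
  have bound: "ennreal ((cmod (bracket 1 \<xi> * duh q t \<xi>))\<^sup>2)
      \<le> A * (\<integral>\<^sup>+s. ennreal (k s) * ennreal ((cmod (bracket \<sigma> \<xi> * \<beta> s \<xi>))\<^sup>2) \<partial>lborel)" for \<xi>
  proof -
    have duhF: "duh q t \<xi> = (LINT s|lborel. F \<xi> s)"
      by (simp only: duh_def F_def)
    \<comment> \<open>Where the time integral does not exist, \<open>duh\<close> has the default
      value 0, so the estimate holds at every frequency without an integrability argument.\<close>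
    have "ennreal (cmod (duh q t \<xi>)) \<le> (\<integral>\<^sup>+s. ennreal (cmod (F \<xi> s)) \<partial>lborel)"
    proof (cases "integrable lborel (F \<xi>)")
      case True
      then show ?thesis unfolding duhF by (rule integral_norm_bound_ennreal)
    next
      case False
      then have "duh q t \<xi> = 0"
        unfolding duhF by (rule not_integrable_integral_eq)
      then show ?thesis by simp
    qed
    then have "ennreal (cmod (bracket 1 \<xi> * duh q t \<xi>)) \<le> ennreal (cmod (bracket 1 \<xi>)) * (\<integral>\<^sup>+s. ennreal (cmod (F \<xi> s)) \<partial>lborel)"
      by (simp add: norm_mult ennreal_mult mult_left_mono)
    also have "\<dots> = (\<integral>\<^sup>+s. ennreal (cmod (bracket 1 \<xi>) * cmod (F \<xi> s)) \<partial>lborel)"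
      unfolding F_def by (subst nn_integral_cmult[symmetric]) (auto simp: ennreal_mult)
    also have "\<dots> \<le> (\<integral>\<^sup>+s. ennreal (sqrt (k s)) * ennreal (sqrt (k s) * cmod (bracket \<sigma> \<xi> * \<beta> s \<xi>)) \<partial>lborel)"
    proof (rule nn_integral_mono_AE)
      show "AE s in lborel. ennreal (cmod (bracket 1 \<xi>) * cmod (F \<xi> s))
          \<le> ennreal (sqrt (k s)) * ennreal (sqrt (k s) * cmod (bracket \<sigma> \<xi> * \<beta> s \<xi>))"
        using F_le[of \<xi>]
      proof eventually_elim
        case (elim s)
        have "ennreal (sqrt (k s)) * ennreal (sqrt (k s) * cmod (bracket \<sigma> \<xi> * \<beta> s \<xi>)) = ennreal (k s * cmod (bracket \<sigma> \<xi> * \<beta> s \<xi>))"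
          using k[of s] by (simp add: mult.assoc[symmetric] flip: ennreal_mult)
        then show ?case using elim by (simp add: ennreal_leI)
      qed
    qed
    finally have "(ennreal (cmod (bracket 1 \<xi> * duh q t \<xi>)))\<^sup>2
       \<le> (\<integral>\<^sup>+s. ennreal (sqrt (k s)) * ennreal (sqrt (k s) * cmod (bracket \<sigma> \<xi> * \<beta> s \<xi>)) \<partial>lborel)\<^sup>2"
      by (rule power_mono) simp
    also have "\<dots> \<le> (\<integral>\<^sup>+s. (ennreal (sqrt (k s)))\<^sup>2 \<partial>lborel) * (\<integral>\<^sup>+s. (ennreal (sqrt (k s) * cmod (bracket \<sigma> \<xi> * \<beta> s \<xi>)))\<^sup>2 \<partial>lborel)"
      by (rule Cauchy_Schwarz_nn_integral) measurable
    also have "(\<integral>\<^sup>+s. (ennreal (sqrt (k s)))\<^sup>2 \<partial>lborel) = A"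
      using k k_int by (simp add: ennreal_power)
    also have "(\<integral>\<^sup>+s. (ennreal (sqrt (k s) * cmod (bracket \<sigma> \<xi> * \<beta> s \<xi>)))\<^sup>2 \<partial>lborel)
        = (\<integral>\<^sup>+s. ennreal (k s) * ennreal ((cmod (bracket \<sigma> \<xi> * \<beta> s \<xi>))\<^sup>2) \<partial>lborel)"
      using k by (intro nn_integral_cong) (simp add: ennreal_power power_mult_distrib ennreal_mult)
    finally show ?thesis by (simp add: ennreal_power)
  qed
  have "(\<integral>\<^sup>+\<xi>. ennreal ((cmod (bracket 1 \<xi> * duh q t \<xi>))\<^sup>2) \<partial>lborel)
     \<le> (\<integral>\<^sup>+\<xi>. A * (\<integral>\<^sup>+s. ennreal (k s) * ennreal ((cmod (bracket \<sigma> \<xi> * \<beta> s \<xi>))\<^sup>2) \<partial>lborel) \<partial>lborel)"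
    by (intro nn_integral_mono bound)
  also have "\<dots> = A * (\<integral>\<^sup>+\<xi>. \<integral>\<^sup>+s. ennreal (k s) * ennreal ((cmod (bracket \<sigma> \<xi> * \<beta> s \<xi>))\<^sup>2) \<partial>lborel \<partial>lborel)"
    by (rule nn_integral_cmult) measurable
  also have "(\<integral>\<^sup>+\<xi>. \<integral>\<^sup>+s. ennreal (k s) * ennreal ((cmod (bracket \<sigma> \<xi> * \<beta> s \<xi>))\<^sup>2) \<partial>lborel \<partial>lborel)
     = (\<integral>\<^sup>+s. \<integral>\<^sup>+\<xi>. ennreal (k s) * ennreal ((cmod (bracket \<sigma> \<xi> * \<beta> s \<xi>))\<^sup>2) \<partial>lborel \<partial>lborel)"
    by (rule lborel_pair.Fubini') measurable
  also have "\<dots> = (\<integral>\<^sup>+s. ennreal (k s) * ennreal ((hnorm \<sigma> (\<beta> s))\<^sup>2) \<partial>lborel)"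
    using beta_hs by (simp add: nn_integral_cmult n2_nn_integral hs_def hnorm_def)
  also have "\<dots> \<le> (\<integral>\<^sup>+s. ennreal (k s) * ennreal (Cb\<^sup>2) \<partial>lborel)"
    using beta_le by (intro nn_integral_mono mult_left_mono ennreal_leI power_mono) auto
  also have "\<dots> = A * ennreal (Cb\<^sup>2)"
    by (simp add: nn_integral_multc k_int)
  also have "A * (A * ennreal (Cb\<^sup>2)) = ennreal ((M * Cb * E (t - a))\<^sup>2)"
    using M Cb_nonneg by (simp add: A_def power2_eq_square mult_ac flip: ennreal_mult)
  finally have fin: "(\<integral>\<^sup>+\<xi>. ennreal ((cmod (bracket 1 \<xi> * duh q t \<xi>))\<^sup>2) \<partial>lborel) \<le> ennreal ((M * Cb * E (t - a))\<^sup>2)"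
    by (simp add: mult_left_mono)
  show "hs 1 (duh q t)" "hnorm 1 (duh q t) \<le> M * Cb * E (t - a)"
    unfolding hs_def hnorm_def by (rule n2_le_nn_integral[OF _ fin]; use M Cb_nonneg in simp)+
qed

lemma beta_sq_integral: "(\<integral>\<^sup>+\<xi>. \<integral>\<^sup>+s. ennreal (indicator {0..1} s * (cmod (bracket \<sigma> \<xi> * \<beta> s \<xi>))\<^sup>2) \<partial>lborel \<partial>lborel) < \<infinity>"
proof -
  have "(\<integral>\<^sup>+\<xi>. \<integral>\<^sup>+s. ennreal (indicator {0..1} s * (cmod (bracket \<sigma> \<xi> * \<beta> s \<xi>))\<^sup>2) \<partial>lborel \<partial>lborel)
    = (\<integral>\<^sup>+s. \<integral>\<^sup>+\<xi>. ennreal (indicator {0..1} s * (cmod (bracket \<sigma> \<xi> * \<beta> s \<xi>))\<^sup>2) \<partial>lborel \<partial>lborel)"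
    by (rule lborel_pair.Fubini') measurable
  also have "\<dots> = (\<integral>\<^sup>+s. ennreal (indicator {0..1} s) * ennreal ((hnorm \<sigma> (\<beta> s))\<^sup>2) \<partial>lborel)"
    using beta_hs by (simp add: ennreal_mult nn_integral_cmult n2_nn_integral hs_def hnorm_def)
  also have "\<dots> \<le> (\<integral>\<^sup>+s. ennreal (Cb\<^sup>2) * indicator {0..1::real} s \<partial>lborel)"
    using beta_le by (intro nn_integral_mono) (auto simp: indicator_def intro!: ennreal_leI power_mono)
  also have "\<dots> < \<infinity>" by (subst nn_integral_cmult_indicator) (auto simp: ennreal_mult_less_top)
  finally show ?thesis .
qed

text \<open>Prepares the exchange of integrals in \<open>duhamel_formula\<close>. Against a test
  function the heat factor is simply bounded by 1, and the duality between the weights of order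
  \<sigma> and - \<sigma> suffices.\<close>

lemma duh_integrable_pair:
  assumes q: "admissible R q" and t: "0 \<le> t" "t \<le> 1" and L: "L2 lborel (\<lambda>\<xi>. bracket (- \<sigma>) \<xi> * \<phi> \<xi>)"
    and [measurable]: "\<phi> \<in> borel_measurable borel"
  shows "integrable (lborel \<Otimes>\<^sub>M lborel) (\<lambda>(s, \<xi>). indicator {0..t} s * (heat \<alpha> (t - s) \<xi> * (q s \<xi> * \<beta> s \<xi>)) * \<phi> \<xi>)"
proof -
  note [measurable (raw)] = admissible_measurable[OF q]
  let ?f = "\<lambda>s \<xi>. indicator {0..t} s * (heat \<alpha> (t - s) \<xi> * (q s \<xi> * \<beta> s \<xi>)) * \<phi> \<xi>"
  have pt: "ennreal (cmod (?f s \<xi>)) \<le> ennreal R * (ennreal (indicator {0..1} s * (cmod (bracket \<sigma> \<xi> * \<beta> s \<xi>))\<^sup>2)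
      + indicator {0..1} s * ennreal ((cmod (bracket (- \<sigma>) \<xi> * \<phi> \<xi>))\<^sup>2))" for s \<xi>
  proof (cases "s \<in> {0..t}")
    case True
    define x where "x = cmod (bracket \<sigma> \<xi> * \<beta> s \<xi>)"
    define y where "y = cmod (bracket (- \<sigma>) \<xi> * \<phi> \<xi>)"
    have eq: "\<beta> s \<xi> * \<phi> \<xi> = (bracket \<sigma> \<xi> * \<beta> s \<xi>) * (bracket (- \<sigma>) \<xi> * \<phi> \<xi>)"
      using bracket_inverse(2)[of \<sigma> \<xi> "\<beta> s \<xi> * \<phi> \<xi>"] by (simp add: mult_ac)
    have xy: "cmod (\<beta> s \<xi>) * cmod (\<phi> \<xi>) = x * y"
      unfolding x_def y_def norm_mult[symmetric] eq ..
    have "cmod (?f s \<xi>) = cmod (heat \<alpha> (t - s) \<xi>) * cmod (q s \<xi>) * (cmod (\<beta> s \<xi>) * cmod (\<phi> \<xi>))"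
      using True by (simp add: norm_mult mult_ac)
    also have "\<dots> \<le> 1 * R * (x * y)"
      unfolding xy using norm_heat_le[of "t - s" \<alpha> \<xi>] q admissible_nonneg[OF q] True
      by (intro mult_mono) (auto simp: admissible_def x_def y_def)
    also have "\<dots> \<le> R * (x\<^sup>2 + y\<^sup>2)"
    proof -
      have "0 \<le> x * y" by (simp add: x_def y_def)
      then have "x * y \<le> x\<^sup>2 + y\<^sup>2" using sum_squares_bound[of x y] by linarith
      then show ?thesis using admissible_nonneg[OF q] by (simp add: mult_left_mono)
    qed
    finally have "ennreal (cmod (?f s \<xi>)) \<le> ennreal (R * (x\<^sup>2 + y\<^sup>2))" by (rule ennreal_leI)
    also have "\<dots> = ennreal R * (ennreal (x\<^sup>2) + ennreal (y\<^sup>2))"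
      using admissible_nonneg[OF q] by (simp add: ennreal_mult ennreal_plus)
    finally show ?thesis using True t by (simp add: x_def y_def)
  qed simp
  have "(\<integral>\<^sup>+p. ennreal (norm (?f (fst p) (snd p))) \<partial>(lborel \<Otimes>\<^sub>M lborel))
      = (\<integral>\<^sup>+s. \<integral>\<^sup>+\<xi>. ennreal (cmod (?f s \<xi>)) \<partial>lborel \<partial>lborel)"
    by (subst lborel.nn_integral_fst[symmetric]) (auto simp: case_prod_unfold)
  also have "\<dots> \<le> (\<integral>\<^sup>+s. \<integral>\<^sup>+\<xi>. ennreal R * (ennreal (indicator {0..1} s * (cmod (bracket \<sigma> \<xi> * \<beta> s \<xi>))\<^sup>2)
      + indicator {0..1} s * ennreal ((cmod (bracket (- \<sigma>) \<xi> * \<phi> \<xi>))\<^sup>2)) \<partial>lborel \<partial>lborel)"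
    by (intro nn_integral_mono pt)
  also have "\<dots> = ennreal R * ((\<integral>\<^sup>+s. \<integral>\<^sup>+\<xi>. ennreal (indicator {0..1} s * (cmod (bracket \<sigma> \<xi> * \<beta> s \<xi>))\<^sup>2) \<partial>lborel \<partial>lborel)
      + (\<integral>\<^sup>+s. indicator {0..1::real} s * ennreal ((n2 lborel (\<lambda>\<xi>. bracket (- \<sigma>) \<xi> * \<phi> \<xi>))\<^sup>2) \<partial>lborel))"
    by (simp add: nn_integral_cmult nn_integral_add n2_nn_integral[OF L])
  also have "(\<integral>\<^sup>+s. \<integral>\<^sup>+\<xi>. ennreal (indicator {0..1} s * (cmod (bracket \<sigma> \<xi> * \<beta> s \<xi>))\<^sup>2) \<partial>lborel \<partial>lborel)
     = (\<integral>\<^sup>+\<xi>. \<integral>\<^sup>+s. ennreal (indicator {0..1} s * (cmod (bracket \<sigma> \<xi> * \<beta> s \<xi>))\<^sup>2) \<partial>lborel \<partial>lborel)"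
    by (rule lborel_pair.Fubini'[symmetric]) measurable
  also have "(\<integral>\<^sup>+s. indicator {0..1::real} s * ennreal ((n2 lborel (\<lambda>\<xi>. bracket (- \<sigma>) \<xi> * \<phi> \<xi>))\<^sup>2) \<partial>lborel)
     = ennreal ((n2 lborel (\<lambda>\<xi>. bracket (- \<sigma>) \<xi> * \<phi> \<xi>))\<^sup>2)"
    by (subst nn_integral_multc) auto
  finally have "(\<integral>\<^sup>+p. ennreal (norm (?f (fst p) (snd p))) \<partial>(lborel \<Otimes>\<^sub>M lborel)) < \<infinity>"
    using beta_sq_integral by (auto elim!: le_less_trans simp: ennreal_mult_less_top)
  moreover have "(\<lambda>p. ?f (fst p) (snd p)) \<in> borel_measurable (lborel \<Otimes>\<^sub>M lborel)" by measurable
  ultimately have "integrable (lborel \<Otimes>\<^sub>M lborel) (\<lambda>p. ?f (fst p) (snd p))"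
    by (simp add: integrable_iff_bounded)
  then show ?thesis by (simp add: case_prod_unfold)
qed

text \<open>Additivity of \<open>duh\<close> needs integrability in time, since a divergent Bochner
  integral has the default value 0. Square integrability on [0, 1] gives it for almost every
  frequency, with an exceptional set independent of q and t.\<close>

lemma AE_integrable_beta: "AE \<xi> in lborel. integrable lborel (\<lambda>s. indicator {0..1} s * \<beta> s \<xi>)"
proof -
  have "AE \<xi> in lborel. (\<integral>\<^sup>+s. ennreal (indicator {0..1} s * (cmod (bracket \<sigma> \<xi> * \<beta> s \<xi>))\<^sup>2) \<partial>lborel) \<noteq> \<infinity>"
    using beta_sq_integral by (intro nn_integral_PInf_AE) auto
  then show ?thesis
  proof eventually_elim
    case (elim \<xi>)
    have L: "L2 lborel (\<lambda>s. indicator {0..1} s * (bracket \<sigma> \<xi> * \<beta> s \<xi>))"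
    proof -
      have eq: "(cmod (indicator {0..1} s * (bracket \<sigma> \<xi> * \<beta> s \<xi>)))\<^sup>2 = indicator {0..1} s * (cmod (bracket \<sigma> \<xi> * \<beta> s \<xi>))\<^sup>2" for s :: real
        by (auto simp: indicator_def)
      show ?thesis unfolding L2_iff_nn_integral eq using elim by (auto simp: less_top)
    qed
    have "L2 lborel (indicator {0..1::real} :: real \<Rightarrow> complex)"
    proof -
      have eq: "(cmod (indicator {0..1} s))\<^sup>2 = indicator {0..1} s" for s :: real by (auto simp: indicator_def)
      show ?thesis unfolding L2_def eq by simp
    qed
    from L2_mult_integrable[OF L this]
    have "integrable lborel (\<lambda>s. bracket (- \<sigma>) \<xi> * (indicator {0..1} s * (bracket \<sigma> \<xi> * \<beta> s \<xi>) * indicator {0..1} s))"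
      by (rule integrable_mult_right)
    moreover have "bracket (- \<sigma>) \<xi> * (indicator {0..1} s * (bracket \<sigma> \<xi> * \<beta> s \<xi>) * indicator {0..1} s) = indicator {0..1} s * \<beta> s \<xi>" for s :: real
      using bracket_inverse(1)[of \<sigma> \<xi> "\<beta> s \<xi>"] by (auto simp: indicator_def)
    ultimately show ?case by simp
  qed
qed

lemma duh_integrable:
  assumes q: "admissible R q" and t: "0 \<le> t" "t \<le> 1" and b: "integrable lborel (\<lambda>s. indicator {0..1} s * \<beta> s \<xi>)"
  shows "integrable lborel (\<lambda>s. indicator {0..t} s * (heat \<alpha> (t - s) \<xi> * (q s \<xi> * \<beta> s \<xi>)))"
proof (rule Bochner_Integration.integrable_bound)
  note [measurable (raw)] = admissible_measurable[OF q]
  show "integrable lborel (\<lambda>s. complex_of_real R * (indicator {0..1} s * \<beta> s \<xi>))"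
    by (rule integrable_mult_right[OF b])
  show "(\<lambda>s. indicator {0..t} s * (heat \<alpha> (t - s) \<xi> * (q s \<xi> * \<beta> s \<xi>))) \<in> borel_measurable lborel"
    by measurable
  show "AE s in lborel. norm (indicator {0..t} s * (heat \<alpha> (t - s) \<xi> * (q s \<xi> * \<beta> s \<xi>)))
     \<le> norm (complex_of_real R * (indicator {0..1} s * \<beta> s \<xi>))"
  proof (rule AE_I2)
    fix s
    show "norm (indicator {0..t} s * (heat \<alpha> (t - s) \<xi> * (q s \<xi> * \<beta> s \<xi>))) \<le> norm (complex_of_real R * (indicator {0..1} s * \<beta> s \<xi>))"
    proof (cases "s \<in> {0..t}")
      case True
      have "cmod (heat \<alpha> (t - s) \<xi>) * (cmod (q s \<xi>) * cmod (\<beta> s \<xi>)) \<le> 1 * (R * cmod (\<beta> s \<xi>))"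
        using norm_heat_le[of "t - s" \<alpha> \<xi>] True q admissible_nonneg[OF q]
        by (intro mult_mono mult_right_mono) (auto simp: admissible_def)
      then show ?thesis using True t admissible_nonneg[OF q] by (simp add: norm_mult)
    qed simp
  qed
qed

lemma duh_diff:
  assumes q: "admissible R q" "admissible R' q'" and t: "0 \<le> t" "t \<le> 1"
  shows "AE \<xi> in lborel. duh q t \<xi> - duh q' t \<xi> = duh (\<lambda>s \<xi>. q s \<xi> - q' s \<xi>) t \<xi>"
  using AE_integrable_beta
proof eventually_elim
  case (elim \<xi>)
  show ?case
    unfolding duh_def using duh_integrable[OF q(1) t elim] duh_integrable[OF q(2) t elim]
    by (simp add: algebra_simps flip: Bochner_Integration.integral_diff)
qed

lemma admissible_diff:
  assumes "admissible R q" "admissible R' q'"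
  shows "admissible (R + R') (\<lambda>s \<xi>. q s \<xi> - q' s \<xi>)"
proof -
  note [measurable (raw)] = admissible_measurable[OF assms(1)] admissible_measurable[OF assms(2)]
  have "(\<lambda>p. q (fst p) (snd p) - q' (fst p) (snd p)) \<in> borel_measurable (borel \<Otimes>\<^sub>M borel)" by measurable
  moreover have "cmod (q s \<xi> - q' s \<xi>) \<le> R + R'" for s \<xi>
    using norm_triangle_ineq4[of "q s \<xi>" "q' s \<xi>"] assms unfolding admissible_def by (smt (verit))
  ultimately show ?thesis by (simp add: admissible_def case_prod_unfold)
qed

lemma admissible_after:
  assumes "admissible R q"
  shows "admissible R (\<lambda>s \<xi>. indicator {t<..} s * q s \<xi>)"
proof -
  note [measurable (raw)] = admissible_measurable[OF assms]
  have "(\<lambda>p. indicator {t<..} (fst p) * q (fst p) (snd p)) \<in> borel_measurable (borel \<Otimes>\<^sub>M borel)" by measurable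
  moreover have "cmod (indicator {t<..} s * q s \<xi>) \<le> R" for s \<xi>
    using assms admissible_nonneg[OF assms] by (auto simp: admissible_def indicator_def)
  ultimately show ?thesis by (simp add: admissible_def case_prod_unfold)
qed

text \<open>The semigroup law splits the history at time t: what happened before is propagated by
  the heat factor, what happens after is the Duhamel term of the truncated q.\<close>

lemma duh_shift:
  assumes q: "admissible R q" and t: "0 \<le> t" "0 \<le> h" "t + h \<le> 1"
  shows "AE \<xi> in lborel. duh q (t + h) \<xi> = heat \<alpha> h \<xi> * duh q t \<xi> + duh (\<lambda>s \<xi>. indicator {t<..} s * q s \<xi>) (t + h) \<xi>"
  using AE_integrable_beta
proof eventually_elim
  case (elim \<xi>)
  let ?f = "\<lambda>s. indicator {0..t} s * (heat \<alpha> (t - s) \<xi> * (q s \<xi> * \<beta> s \<xi>))"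
  let ?g = "\<lambda>s. indicator {0..t + h} s * (heat \<alpha> (t + h - s) \<xi> * ((indicator {t<..} s * q s \<xi>) * \<beta> s \<xi>))"
  have i: "integrable lborel ?f" "integrable lborel ?g"
    using duh_integrable[OF q t(1) _ elim] duh_integrable[OF admissible_after[OF q] _ t(3) elim] t by auto
  have eq: "indicator {0..t + h} s * (heat \<alpha> (t + h - s) \<xi> * (q s \<xi> * \<beta> s \<xi>)) = heat \<alpha> h \<xi> * ?f s + ?g s" for s
  proof -
    have "heat \<alpha> (t + h - s) \<xi> = heat \<alpha> h \<xi> * heat \<alpha> (t - s) \<xi>"
      by (simp add: algebra_simps flip: heat_add)
    then show ?thesis using t by (auto simp: indicator_def)
  qed
  show ?case unfolding duh_def eq using i by simp
qed

section \<open>The solution map and its regularity in time\<close>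

definition flow :: "(real^'n \<Rightarrow> complex) \<Rightarrow> (real \<Rightarrow> real^'n \<Rightarrow> complex) \<Rightarrow> real \<Rightarrow> real^'n \<Rightarrow> complex" where
  "flow \<tau> q t \<xi> = heat \<alpha> t \<xi> * \<tau> \<xi> + duh q t \<xi>"

lemma duh_hs:
  assumes q: "admissible R q" and t: "0 \<le> t" "t \<le> 1"
  shows "hs 1 (duh q t)" "hnorm 1 (duh q t) \<le> R * Cb * E t"
  using duh_estimate[OF q order_refl t admissible_nonneg[OF q]] q by (auto simp: admissible_def)

lemma flow_hs:
  assumes \<tau>: "hs 1 \<tau>" and q: "admissible R q" and t: "0 \<le> t" "t \<le> 1"
  shows "hs 1 (flow \<tau> q t)" "hnorm 1 (flow \<tau> q t) \<le> hnorm 1 \<tau> + R * Cb * E t"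
proof -
  show "hs 1 (flow \<tau> q t)"
    unfolding flow_def[abs_def] by (intro hs_add hs_heat \<tau> t duh_hs[OF q])
  have "hnorm 1 (flow \<tau> q t) \<le> hnorm 1 (\<lambda>\<xi>. heat \<alpha> t \<xi> * \<tau> \<xi>) + hnorm 1 (duh q t)"
    unfolding flow_def[abs_def] by (intro hnorm_triangle hs_heat \<tau> t duh_hs[OF q])
  then show "hnorm 1 (flow \<tau> q t) \<le> hnorm 1 \<tau> + R * Cb * E t"
    using hs_heat(2)[OF \<tau> t(1), of \<alpha>] duh_hs(2)[OF q t] by linarith
qed

text \<open>The free evolution cancels in the difference, and \<open>duh\<close> is linear up to
  null sets, so only the Duhamel term of q - q' remains.\<close>

lemma flow_diff_estimate:
  assumes \<tau>: "hs 1 \<tau>" and q: "admissible R q" "admissible R' q'" and t: "0 \<le> a" "a \<le> t" "t \<le> 1" and M: "0 \<le> M"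
    and le: "AE s in lborel. s \<in> {0..t} \<longrightarrow> (\<forall>\<xi>. cmod (q s \<xi> - q' s \<xi>) \<le> M * indicator {a..} s)"
  shows "hnorm 1 (\<lambda>\<xi>. flow \<tau> q t \<xi> - flow \<tau> q' t \<xi>) \<le> M * Cb * E (t - a)"
proof -
  have t0: "0 \<le> t" using t by linarith
  note est = duh_estimate[OF admissible_diff[OF q] t M le]
  have "hnorm 1 (\<lambda>\<xi>. flow \<tau> q t \<xi> - flow \<tau> q' t \<xi>) = hnorm 1 (duh (\<lambda>s \<xi>. q s \<xi> - q' s \<xi>) t)"
  proof (rule hs_cong_AE(2))
    show "(\<lambda>\<xi>. flow \<tau> q t \<xi> - flow \<tau> q' t \<xi>) \<in> borel_measurable borel"
      by (intro borel_measurable_diff hs_measurable[OF flow_hs(1)[OF \<tau> q(1) t0 t(3)]] hs_measurable[OF flow_hs(1)[OF \<tau> q(2) t0 t(3)]])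
    show "duh (\<lambda>s \<xi>. q s \<xi> - q' s \<xi>) t \<in> borel_measurable borel" by (rule hs_measurable[OF est(1)])
    show "AE \<xi> in lborel. flow \<tau> q t \<xi> - flow \<tau> q' t \<xi> = duh (\<lambda>s \<xi>. q s \<xi> - q' s \<xi>) t \<xi>"
      using duh_diff[OF q t0 t(3)] by eventually_elim (simp add: flow_def)
  qed
  then show ?thesis using est(2) by simp
qed

text \<open>By \<open>duh_shift\<close> the increment over [t, t + h] is the heat increment of the
  flow at t plus a Duhamel term of norm at most R Cb E h, and both tend to 0. Continuity from the
  right is what the semigroup law gives directly, and it suffices for strong measurability.\<close>

lemma flow_right_continuous:
  assumes \<tau>: "hs 1 \<tau>" and q: "admissible R q" and t: "0 \<le> t" and r: "\<And>k. t \<le> r k" "\<And>k. r k \<le> 1" "r \<longlonglongrightarrow> t"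
  shows "(\<lambda>k::nat. hnorm 1 (\<lambda>\<xi>. flow \<tau> q (r k) \<xi> - flow \<tau> q t \<xi>)) \<longlonglongrightarrow> 0"
proof -
  have t1: "t \<le> 1" using r(1,2) order_trans by blast
  define h where "h k = r k - t" for k
  have h: "0 \<le> h k" "t + h k = r k" "t + h k \<le> 1" for k using r by (auto simp: h_def)
  have h_lim: "h \<longlonglongrightarrow> 0" unfolding h_def[abs_def] using r(3) by (simp add: LIM_zero)
  let ?w = "flow \<tau> q t"
  have w: "hs 1 ?w" by (rule flow_hs(1)[OF \<tau> q t t1])
  let ?a = "\<lambda>s \<xi>. indicator {t<..} s * q s \<xi>"
  have a_le: "AE s in lborel. s \<in> {0..r k} \<longrightarrow> (\<forall>\<xi>. cmod (?a s \<xi>) \<le> R * indicator {t..} s)" for k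
    using q admissible_nonneg[OF q] by (intro AE_I2) (auto simp: admissible_def indicator_def)
  note est = duh_estimate[OF admissible_after[OF q] t r(1) r(2) admissible_nonneg[OF q] a_le]
  have le: "hnorm 1 (\<lambda>\<xi>. flow \<tau> q (r k) \<xi> - ?w \<xi>) \<le> hnorm 1 (\<lambda>\<xi>. heat \<alpha> (h k) \<xi> * ?w \<xi> - ?w \<xi>) + R * Cb * E (h k)" for k
  proof -
    have hw: "hs 1 (\<lambda>\<xi>. heat \<alpha> (h k) \<xi> * ?w \<xi> - ?w \<xi>)"
      by (intro hs_diff hs_heat w h)
    have "hnorm 1 (\<lambda>\<xi>. flow \<tau> q (r k) \<xi> - ?w \<xi>)
        = hnorm 1 (\<lambda>\<xi>. (heat \<alpha> (h k) \<xi> * ?w \<xi> - ?w \<xi>) + duh ?a (r k) \<xi>)"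
    proof (rule hs_cong_AE(2))
      have "0 \<le> r k" using t r(1)[of k] by linarith
      then show "(\<lambda>\<xi>. flow \<tau> q (r k) \<xi> - ?w \<xi>) \<in> borel_measurable borel"
        by (intro borel_measurable_diff hs_measurable[OF w] hs_measurable[OF flow_hs(1)[OF \<tau> q _ r(2)]])
      show "(\<lambda>\<xi>. (heat \<alpha> (h k) \<xi> * ?w \<xi> - ?w \<xi>) + duh ?a (r k) \<xi>) \<in> borel_measurable borel"
        by (intro borel_measurable_add hs_measurable[OF hw] hs_measurable[OF est(1)])
      show "AE \<xi> in lborel. flow \<tau> q (r k) \<xi> - ?w \<xi> = (heat \<alpha> (h k) \<xi> * ?w \<xi> - ?w \<xi>) + duh ?a (r k) \<xi>"
        using duh_shift[OF q t h(1) h(3)[of k]]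
      proof eventually_elim
        case (elim \<xi>)
        have "heat \<alpha> (r k) \<xi> = heat \<alpha> (h k) \<xi> * heat \<alpha> t \<xi>"
          by (simp add: h_def flip: heat_add)
        then show ?case using elim by (simp add: flow_def h(2) algebra_simps)
      qed
    qed
    also have "\<dots> \<le> hnorm 1 (\<lambda>\<xi>. heat \<alpha> (h k) \<xi> * ?w \<xi> - ?w \<xi>) + hnorm 1 (duh ?a (r k))"
      by (rule hnorm_triangle[OF hw est(1)])
    finally show ?thesis using est(2)[of k] by (simp add: h_def)
  qed
  show ?thesis
  proof (rule Lim_null_comparison)
    show "\<forall>\<^sub>F k in sequentially. norm (hnorm 1 (\<lambda>\<xi>. flow \<tau> q (r k) \<xi> - ?w \<xi>))
        \<le> hnorm 1 (\<lambda>\<xi>. heat \<alpha> (h k) \<xi> * ?w \<xi> - ?w \<xi>) + R * Cb * E (h k)"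
      using le by (intro always_eventually allI) simp
    show "(\<lambda>k. hnorm 1 (\<lambda>\<xi>. heat \<alpha> (h k) \<xi> * ?w \<xi> - ?w \<xi>) + R * Cb * E (h k)) \<longlonglongrightarrow> 0"
      using tendsto_add[OF heat_tendsto[OF w h(1) h_lim, of \<alpha>] tendsto_mult_left[OF E_tendsto[OF h_lim h(1)], of "R * Cb"]] by simp
  qed
qed

lemma flow_L_infty:
  assumes \<tau>: "hs 1 \<tau>" and q: "admissible R q" and T: "0 < T" "T \<le> 1"
  shows "(\<lambda>t. symb (flow \<tau> q t)) \<in> L_infty_sobolev {0..T} 1"
proof -
  define c where "c = sqrt ((2 * pi) ^ CARD('n))"
  have c: "0 < c" by (simp add: c_def)
  have hsf: "hs 1 (flow \<tau> q t)" if "t \<in> {0..T}" for t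
    using flow_hs(1)[OF \<tau> q] that T by auto
  have eq: "distr_eq (symb \<sigma>) (symb \<sigma>)" for \<sigma> :: "real^'n \<Rightarrow> complex" by (simp add: distr_eq_def)
  \<comment> \<open>The next point to the right of t on the grid of mesh 1 / (k + 1), capped at T.
    Sampling from the right matches \<open>flow_right_continuous\<close>, and finitely many sample
    points make the sampled flow a simple function.\<close>
  define r where "r k t = min T ((real_of_int \<lfloor>real (Suc k) * t\<rfloor> + 1) / real (Suc k))" for k :: nat and t :: real
  have r_ge: "t \<le> r k t" if "t \<le> T" for k t
  proof -
    have "real (Suc k) * t \<le> real_of_int \<lfloor>real (Suc k) * t\<rfloor> + 1" by linarith
    then have "t \<le> (real_of_int \<lfloor>real (Suc k) * t\<rfloor> + 1) / real (Suc k)"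
      by (simp add: pos_le_divide_eq mult.commute)
    then show ?thesis using that by (simp add: r_def)
  qed
  have r_le: "r k t \<le> T" for k t by (simp add: r_def)
  have r_lim: "(\<lambda>k. r k t) \<longlonglongrightarrow> t" if "t \<le> T" for t
  proof (rule LIM_zero_cancel, rule Lim_null_comparison)
    show "(\<lambda>k. 1 / real (Suc k)) \<longlonglongrightarrow> 0"
      using LIMSEQ_inverse_real_of_nat by (simp add: inverse_eq_divide)
    show "\<forall>\<^sub>F k in sequentially. norm (r k t - t) \<le> 1 / real (Suc k)"
    proof (rule always_eventually, rule allI)
      fix k
      have "r k t \<le> (real_of_int \<lfloor>real (Suc k) * t\<rfloor> + 1) / real (Suc k)" by (simp add: r_def)
      also have "\<dots> \<le> (real (Suc k) * t + 1) / real (Suc k)"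
        by (intro divide_right_mono add_right_mono of_int_floor_le) simp
      also have "\<dots> = t + 1 / real (Suc k)" by (simp add: add_divide_distrib)
      finally show "norm (r k t - t) \<le> 1 / real (Suc k)" using r_ge[OF that, of k] by simp
    qed
  qed
  have r_simple: "simple_function (lebesgue_on {0..T}) (r k)" for k
  proof (rule simple_function_borel_measurable)
    have "r k \<in> borel_measurable borel" unfolding r_def[abs_def] by measurable
    then show "r k \<in> borel_measurable (lebesgue_on {0..T})"
      by (intro measurable_restrict_space1 borel_measurable_lebesgueI)
    have "r k ` {0..T} \<subseteq> (\<lambda>j. min T ((real_of_int j + 1) / real (Suc k))) ` {0..\<lfloor>real (Suc k) * T\<rfloor>}"
    proof
      fix y assume "y \<in> r k ` {0..T}"
      then obtain t where t: "0 \<le> t" "t \<le> T" "y = r k t" by auto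
      have "\<lfloor>real (Suc k) * t\<rfloor> \<in> {0..\<lfloor>real (Suc k) * T\<rfloor>}"
        using t by (auto intro!: floor_mono mult_left_mono simp del: of_nat_Suc)
      then show "y \<in> (\<lambda>j. min T ((real_of_int j + 1) / real (Suc k))) ` {0..\<lfloor>real (Suc k) * T\<rfloor>}"
        unfolding t(3) r_def by (rule imageI)
    qed
    then show "finite (r k ` space (lebesgue_on {0..T}))"
      by (simp add: finite_subset)
  qed
  let ?u = "\<lambda>t. symb (flow \<tau> q t)"
  let ?S = "\<lambda>k t. ?u (r k t)"
  have rT: "r k t \<in> {0..T}" if "t \<in> {0..T}" for k t using that r_ge[of t k] r_le[of k t] by auto
  have S1: "simple_function (lebesgue_on {0..T}) (?S k)" for k
    using simple_function_compose[OF r_simple, of ?u k] by (simp add: o_def)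
  have S2: "?S k ` {0..T} \<subseteq> sobolev 1" for k
    using symb_in_sobolev[OF hsf[OF rT]] by auto
  have S3: "AE t in lebesgue_on {0..T}. ?u t \<in> sobolev 1 \<and> (\<lambda>k. sobolev_norm 1 (\<lambda>f. ?u t f - ?S k t f)) \<longlonglongrightarrow> 0"
  proof (rule AE_I2)
    fix t assume "t \<in> space (lebesgue_on {0..T})"
    then have t: "t \<in> {0..T}" by simp
    have "sobolev_norm 1 (\<lambda>f. ?u t f - ?S k t f) = hnorm 1 (\<lambda>\<xi>. flow \<tau> q (r k t) \<xi> - flow \<tau> q t \<xi>) / c" for k
      unfolding c_def hnorm_minus_commute[of 1 "flow \<tau> q (r k t)"]
      by (rule sobolev_norm_symbol) (auto simp: distr_eq_def symb_diff[OF hsf[OF t] hsf[OF rT[OF t]]] intro!: hs_diff hsf t rT)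
    moreover have "(\<lambda>k. hnorm 1 (\<lambda>\<xi>. flow \<tau> q (r k t) \<xi> - flow \<tau> q t \<xi>) / c) \<longlonglongrightarrow> 0 / c"
      using t T r_ge r_le r_lim by (intro tendsto_divide tendsto_const flow_right_continuous[OF \<tau> q]) (use c order_trans[OF r_le T(2)] in auto)
    ultimately show "?u t \<in> sobolev 1 \<and> (\<lambda>k. sobolev_norm 1 (\<lambda>f. ?u t f - ?S k t f)) \<longlonglongrightarrow> 0"
      using symb_in_sobolev[OF hsf[OF t]] by simp
  qed
  have S4: "AE t in lebesgue_on {0..T}. sobolev_norm 1 (?u t) \<le> (hnorm 1 \<tau> + R * Cb * E T) / c"
  proof (rule AE_I2)
    fix t assume "t \<in> space (lebesgue_on {0..T})"
    then have t: "t \<in> {0..T}" by simp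
    have "hnorm 1 (flow \<tau> q t) \<le> hnorm 1 \<tau> + R * Cb * E t" using flow_hs(2)[OF \<tau> q, of t] t T by auto
    also have "\<dots> \<le> hnorm 1 \<tau> + R * Cb * E T"
      using t admissible_nonneg[OF q] Cb_nonneg by (intro add_left_mono mult_left_mono E_mono) auto
    finally show "sobolev_norm 1 (?u t) \<le> (hnorm 1 \<tau> + R * Cb * E T) / c"
      unfolding sobolev_norm_symbol[OF hsf[OF t] eq] c_def by (rule divide_right_mono) simp
  qed
  show ?thesis unfolding L_infty_sobolev_def
    by (rule CollectI, rule conjI, rule exI[of _ ?S], intro conjI allI S1 S2 S3, rule exI, rule S4)
qed

text \<open>The function u and its q are kept independent of the construction, so that this serves
  both to verify the constructed solution and to read a fixed point off an arbitrary mild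
  solution.\<close>

lemma duhamel_formula:
  assumes \<tau>: "hs 1 \<tau>" "distr_eq U0 (symb \<tau>)" and q: "admissible R q" and t: "0 \<le> t" "t \<le> 1"
    and b: "AE s in lborel. s \<in> {0..1} \<longrightarrow> distr_eq (b s) (symb (\<beta> s))"
    and u: "AE s in lborel. s \<in> {0..t} \<longrightarrow> (\<exists>\<sigma>. hs 1 \<sigma> \<and> distr_eq (u s) (symb \<sigma>) \<and> q s = quad \<sigma>)"
    and f: "schwartz f"
  shows "integrable (lebesgue_on {0..t}) (\<lambda>s. frac_heat \<alpha> (t - s) (nonlinearity (u s) (b s)) f)"
    and "frac_heat \<alpha> t U0 f + (LINT s|lebesgue_on {0..t}. frac_heat \<alpha> (t - s) (nonlinearity (u s) (b s)) f) = symb (flow \<tau> q t) f"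
proof -
  note [measurable (raw)] = admissible_measurable[OF q]
  have [measurable]: "inv_fourier f \<in> borel_measurable borel"
    by (rule schwartz_measurable[OF schwartz_inv_fourier[OF f]])
  let ?F = "\<lambda>s \<xi>. indicator {0..t} s * (heat \<alpha> (t - s) \<xi> * (q s \<xi> * \<beta> s \<xi>)) * inv_fourier f \<xi>"
  have L: "L2 lborel (\<lambda>\<xi>. bracket (- \<sigma>) \<xi> * inv_fourier f \<xi>)"
    by (intro schwartz_L2 schwartz_slow_mult slow_bracket_symbol schwartz_inv_fourier f)
  have int: "integrable (lborel \<Otimes>\<^sub>M lborel) (\<lambda>(s, \<xi>). ?F s \<xi>)"
    by (rule duh_integrable_pair[OF q t L]) measurable
  define \<Phi> where "\<Phi> s = (LINT \<xi>|lborel. ?F s \<xi>)" for s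
  have \<Phi>_int: "integrable lborel \<Phi>" unfolding \<Phi>_def[abs_def] by (rule lborel_pair.integrable_fst[OF int])
  let ?g = "\<lambda>s. frac_heat \<alpha> (t - s) (nonlinearity (u s) (b s)) f"
  \<comment> \<open>The integrand of the Duhamel formula is built from \<open>fun_of\<close> and has
    no evident measurability. It agrees almost everywhere with \<open>\<Phi>\<close> and inherits
    measurability from it, because Lebesgue measure is complete.\<close>
  have "AE s in lborel. indicator {0..t} s *\<^sub>R ?g s = \<Phi> s"
    using b u
  proof eventually_elim
    case (elim s)
    show ?case
    proof (cases "s \<in> {0..t}")
      case True
      then obtain \<rho> where \<rho>: "hs 1 \<rho>" "distr_eq (u s) (symb \<rho>)" "q s = quad \<rho>" using elim by blast
      have bs: "distr_eq (b s) (symb (\<beta> s))" using elim True t by auto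
      have N: "distr_eq (nonlinearity (u s) (b s)) (symb (\<lambda>\<xi>. q s \<xi> * \<beta> s \<xi>))"
        unfolding \<rho>(3) by (rule nonlinearity_symbol[OF \<rho>(1,2) beta_hs bs])
      have "hs \<sigma> (\<lambda>\<xi>. q s \<xi> * \<beta> s \<xi>)"
        using q quad_measurable[OF \<rho>(1), folded \<rho>(3)]
        by (intro hs_bounded_mult(1)[OF beta_hs, where C = R]) (auto simp: admissible_def)
      from frac_heat_symbol[OF this N, of \<alpha> "t - s"]
      show ?thesis using True f by (simp add: distr_eq_def \<Phi>_def symb_def)
    qed (simp add: \<Phi>_def)
  qed
  then have ae: "AE s in lebesgue. indicator {0..t} s *\<^sub>R ?g s = \<Phi> s" by (simp add: AE_completion_iff)
  have m\<Phi>: "\<Phi> \<in> borel_measurable lborel" using \<Phi>_int by auto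
  then have m\<Phi>': "\<Phi> \<in> borel_measurable lebesgue" by (rule measurable_completion)
  have mg: "(\<lambda>s. indicator {0..t} s *\<^sub>R ?g s) \<in> borel_measurable lebesgue"
    by (rule borel_measurable_AE[OF m\<Phi>']) (use ae in \<open>eventually_elim, simp\<close>)
  have \<Phi>_leb: "integrable lebesgue \<Phi>" using integrable_completion[OF m\<Phi>] \<Phi>_int by simp
  have ig: "integrable lebesgue (\<lambda>s. indicator {0..t} s *\<^sub>R ?g s)"
    using integrable_cong_AE[OF mg m\<Phi>' ae] \<Phi>_leb by simp
  then show "integrable (lebesgue_on {0..t}) ?g"
    by (subst integrable_restrict_space) auto
  have "(LINT s|lebesgue_on {0..t}. ?g s) = (LINT s|lebesgue. indicator {0..t} s *\<^sub>R ?g s)"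
    by (rule integral_restrict_space) auto
  also have "\<dots> = (LINT s|lebesgue. \<Phi> s)" by (rule integral_cong_AE[OF mg m\<Phi>' ae])
  also have "\<dots> = (LINT s|lborel. \<Phi> s)" by (rule integral_completion[OF m\<Phi>])
  also have "\<dots> = (LINT \<xi>|lborel. LINT s|lborel. ?F s \<xi>)"
    unfolding \<Phi>_def by (rule lborel_pair.Fubini_integral[OF int, symmetric])
  also have "\<dots> = symb (duh q t) f"
    unfolding symb_def duh_def by (simp only: integral_mult_left_zero)
  finally have I: "(LINT s|lebesgue_on {0..t}. ?g s) = symb (duh q t) f" .
  have "frac_heat \<alpha> t U0 f = symb (\<lambda>\<xi>. heat \<alpha> t \<xi> * \<tau> \<xi>) f"
    using frac_heat_symbol[OF \<tau>] f by (simp add: distr_eq_def)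
  moreover have "symb (flow \<tau> q t) f = symb (\<lambda>\<xi>. heat \<alpha> t \<xi> * \<tau> \<xi>) f + symb (duh q t) f"
    using hs_pair_integrable[OF hs_heat(1)[OF \<tau>(1) t(1), of \<alpha>] schwartz_inv_fourier[OF f]]
      hs_pair_integrable[OF duh_hs(1)[OF q t] schwartz_inv_fourier[OF f]]
    by (simp add: symb_def flow_def distrib_right)
  ultimately show "frac_heat \<alpha> t U0 f + (LINT s|lebesgue_on {0..t}. ?g s) = symb (flow \<tau> q t) f"
    using I by simp
qed

end

section \<open>Fixed points of the Duhamel operator\<close>

lemma geometric_increments_limit:
  fixes x :: "nat \<Rightarrow> complex"
  assumes le: "\<And>k. cmod (x (Suc k) - x k) \<le> D * (1/2) ^ k"
  shows "x \<longlonglongrightarrow> lim x" "cmod (x k - lim x) \<le> 2 * D * (1/2) ^ k"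
proof -
  have D: "0 \<le> D" using order_trans[OF norm_ge_zero le[of 0]] by simp
  have step: "cmod (x (k + m) - x k) \<le> 2 * D * (1/2) ^ k * (1 - (1/2) ^ m)" for k m
  proof (induction m)
    case (Suc m)
    have "cmod (x (k + Suc m) - x k) \<le> cmod (x (Suc (k + m)) - x (k + m)) + cmod (x (k + m) - x k)"
      using norm_triangle_ineq[of "x (Suc (k + m)) - x (k + m)" "x (k + m) - x k"] by simp
    also have "\<dots> \<le> D * (1/2) ^ (k + m) + 2 * D * (1/2) ^ k * (1 - (1/2) ^ m)"
      by (intro add_mono le Suc)
    also have "\<dots> = 2 * D * (1/2) ^ k * (1 - (1/2) ^ Suc m)"
      by (simp add: power_add algebra_simps)
    finally show ?case .
  qed simp
  have step': "cmod (x n - x k) \<le> 2 * D * (1/2) ^ k" if "k \<le> n" for k n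
  proof -
    have "2 * D * (1/2) ^ k * (1 - (1/2) ^ (n - k)) \<le> 2 * D * (1/2) ^ k * 1"
      using D by (intro mult_left_mono) auto
    then show ?thesis using step[of k "n - k"] that by simp
  qed
  have small: "(\<lambda>k. 2 * D * (1/2::real) ^ k) \<longlonglongrightarrow> 0"
    by (intro tendsto_mult_right_zero LIMSEQ_realpow_zero) auto
  have "Cauchy x"
  proof (rule CauchyI)
    fix e :: real assume "0 < e"
    then obtain k where k: "2 * D * (1/2) ^ k < e / 2"
      using order_tendstoD(2)[OF small, of "e / 2"] by (auto simp: eventually_sequentially)
    show "\<exists>M. \<forall>m\<ge>M. \<forall>n\<ge>M. norm (x m - x n) < e"
    proof (intro exI[of _ k] allI impI)
      fix m n assume "k \<le> m" "k \<le> n"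
      then show "norm (x m - x n) < e"
        using step'[of k m] step'[of k n] k norm_triangle_ineq4[of "x m - x k" "x n - x k"] by simp
    qed
  qed
  then show lim: "x \<longlonglongrightarrow> lim x"
    by (simp add: Cauchy_convergent_iff convergent_LIMSEQ_iff)
  have "(\<lambda>n. cmod (x n - x k)) \<longlonglongrightarrow> cmod (lim x - x k)"
    by (intro tendsto_intros lim)
  then have "cmod (lim x - x k) \<le> 2 * D * (1/2) ^ k"
    by (rule LIMSEQ_le_const2) (use step' in blast)
  then show "cmod (x k - lim x) \<le> 2 * D * (1/2) ^ k" by (simp add: norm_minus_commute)
qed

context duhamel
begin

lemma small_time:
  assumes "0 \<le> c"
  obtains T where "0 < T" "T \<le> 1" "c * E T \<le> 1"
proof -
  define h where "h k = 1 / real (Suc k)" for k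
  have h: "h \<longlonglongrightarrow> 0" "\<And>k. 0 \<le> h k"
    unfolding h_def using LIMSEQ_inverse_real_of_nat by (simp_all add: inverse_eq_divide)
  have "(\<lambda>k. c * E (h k)) \<longlonglongrightarrow> 0"
    using tendsto_mult_left[OF E_tendsto[OF h], of c] by simp
  then have "\<forall>\<^sub>F k in sequentially. c * E (h k) < 1"
    by (rule order_tendstoD(2)) simp
  then obtain k where "c * E (h k) < 1"
    by (auto simp: eventually_sequentially)
  then show thesis by (intro that[of "h k"]) (auto simp: h_def)
qed

lemma admissible_truncate:
  assumes m: "(\<lambda>p. q (fst p) (snd p)) \<in> borel_measurable (borel \<Otimes>\<^sub>M borel)" and R: "0 \<le> R"
  shows "admissible R (\<lambda>t \<xi>. if cmod (q t \<xi>) \<le> R then q t \<xi> else 0)"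
proof -
  note [measurable] = m
  have "(\<lambda>p. if cmod (q (fst p) (snd p)) \<le> R then q (fst p) (snd p) else 0) \<in> borel_measurable (borel \<Otimes>\<^sub>M borel)"
    by measurable
  then show ?thesis using R by (simp add: admissible_def case_prod_unfold)
qed

lemma quad_symbol:
  assumes "hs 1 \<sigma>'" "u \<in> sobolev 1" "distr_eq u (symb \<sigma>')"
  shows "quad (symbol 1 u) = quad \<sigma>'"
proof (rule quad_cong_AE[OF symbol(1)[OF assms(2)] assms(1)])
  show "AE \<xi> in lborel. symbol 1 u \<xi> = \<sigma>' \<xi>"
    using symbol(2)[OF assms(2)] assms(3)
    by (intro symb_AE_eq[OF symbol(1)[OF assms(2)] assms(1)]) (simp add: distr_eq_def)
qed

section \<open>The fixed-point equation\<close>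

definition fixed_point :: "(real^'n \<Rightarrow> complex) \<Rightarrow> real \<Rightarrow> (real \<Rightarrow> real^'n \<Rightarrow> complex) \<Rightarrow> bool" where
  "fixed_point \<tau> T q \<longleftrightarrow> (AE t in lborel. t \<in> {0..T} \<longrightarrow> q t = quad (flow \<tau> q t))"

definition hermitian :: "real \<Rightarrow> (real \<Rightarrow> real^'n \<Rightarrow> complex) \<Rightarrow> bool" where
  "hermitian T q \<longleftrightarrow> (AE t in lborel. t \<in> {0..T} \<longrightarrow> (\<forall>\<xi>. q t (- \<xi>) = cnj (q t \<xi>)))"

text \<open>The transform of the square at time t is obtained through \<open>SOME\<close>, so its
  joint measurability in (t, \<xi>) is not evident. Strong measurability of the flow supplies a
  version for almost every t, and a cut-off keeps this version in the ball of radius R.\<close>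

lemma quad_flow_version:
  assumes \<tau>: "hs 1 \<tau>" and q: "admissible R' q" and T: "0 < T" "T \<le> 1"
    and le: "\<And>t \<xi>. t \<in> {0..T} \<Longrightarrow> cmod (quad (flow \<tau> q t) \<xi>) \<le> R" and R: "0 \<le> R"
  shows "\<exists>q'. admissible R q' \<and> (AE t in lborel. t \<in> {0..T} \<longrightarrow> q' t = quad (flow \<tau> q t))"
proof -
  obtain q1 :: "real \<Rightarrow> real^'n \<Rightarrow> complex" where q1: "(\<lambda>(t, \<xi>). q1 t \<xi>) \<in> borel_measurable (borel \<Otimes>\<^sub>M borel)"
    "AE t in lborel. t \<in> {0..T} \<longrightarrow> symb (flow \<tau> q t) \<in> sobolev 1 \<and> q1 t = quad (symbol 1 (symb (flow \<tau> q t)))"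
    by (rule L_infty_sobolev_quad[OF flow_L_infty[OF \<tau> q T]]) auto
  define q2 where "q2 t \<xi> = (if cmod (q1 t \<xi>) \<le> R then q1 t \<xi> else 0)" for t \<xi>
  have "admissible R q2"
    unfolding q2_def[abs_def] by (rule admissible_truncate[OF _ R]) (use q1(1) in \<open>simp add: case_prod_unfold\<close>)
  moreover have "AE t in lborel. t \<in> {0..T} \<longrightarrow> q2 t = quad (flow \<tau> q t)"
    using q1(2)
  proof eventually_elim
    case (elim t)
    show ?case
    proof
      assume t: "t \<in> {0..T}"
      have "q1 t = quad (flow \<tau> q t)"
        using elim t T by (auto intro!: quad_symbol flow_hs(1)[OF \<tau> q] simp: distr_eq_def)
      then show "q2 t = quad (flow \<tau> q t)" using le[OF t] by (auto simp: q2_def)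
    qed
  qed
  ultimately show ?thesis by blast
qed

lemma flow_hermitian:
  assumes \<tau>: "\<And>\<xi>. \<tau> (- \<xi>) = cnj (\<tau> \<xi>)" and \<beta>: "\<And>t \<xi>. \<beta> t (- \<xi>) = cnj (\<beta> t \<xi>)"
    and q: "admissible R q" "hermitian T q" and t: "t \<le> T"
  shows "flow \<tau> q t (- \<xi>) = cnj (flow \<tau> q t \<xi>)"
proof -
  note [measurable (raw)] = admissible_measurable[OF q(1)]
  have "duh q t (- \<xi>) = (LINT s|lborel. cnj (indicator {0..t} s * (heat \<alpha> (t - s) \<xi> * (q s \<xi> * \<beta> s \<xi>))))"
    unfolding duh_def
  proof (rule integral_cong_AE)
    show "AE s in lborel. indicator {0..t} s * (heat \<alpha> (t - s) (- \<xi>) * (q s (- \<xi>) * \<beta> s (- \<xi>)))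
       = cnj (indicator {0..t} s * (heat \<alpha> (t - s) \<xi> * (q s \<xi> * \<beta> s \<xi>)))"
      using q(2)[unfolded hermitian_def]
    proof eventually_elim
      case (elim s)
      then show ?case using t by (cases "s \<in> {0..t}") (auto simp: \<beta>)
    qed
  qed measurable
  also have "\<dots> = cnj (duh q t \<xi>)"
    unfolding duh_def by (rule Bochner_Integration.integral_cnj)
  finally show ?thesis by (simp add: flow_def \<tau>)
qed

text \<open>Banach's argument on the ball of radius R. Each iterate satisfies its equation for
  almost every time only, so the countably many exceptional sets are collected before passing to the
  limit.\<close>

lemma fixed_point_exists:
  assumes \<tau>: "hs 1 \<tau>" and herm: "\<And>\<xi>. \<tau> (- \<xi>) = cnj (\<tau> \<xi>)" "\<And>t \<xi>. \<beta> t (- \<xi>) = cnj (\<beta> t \<xi>)"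
  obtains T q R where "0 < T" "T \<le> 1" "admissible R q" "fixed_point \<tau> T q" "hermitian T q"
proof -
  define C where "C = (2 * pi) ^ CARD('n)"
  have C: "0 < C" by (simp add: C_def)
  \<comment> \<open>For short times the Duhamel term adds at most 1 to the norm of the data;
    \<open>R\<close> is the bound on \<open>quad\<close> that results from
    \<open>quad_le\<close>.\<close>
  define B where "B = hnorm 1 \<tau> + 1"
  have B: "0 \<le> B" by (simp add: B_def)
  define R where "R = B\<^sup>2 / C"
  have R: "0 \<le> R" using C by (simp add: R_def)
  \<comment> \<open>One smallness condition contains two, since both summands are nonnegative: R Cb
    E T <= 1 keeps the flow below \<open>B\<close>, and Cb (4 B / C) E T <= 1 makes the contraction
    factor 1/2.\<close>
  obtain T where T: "0 < T" "T \<le> 1" "(Cb * (R + 4 * B / C)) * E T \<le> 1"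
    using small_time[of "Cb * (R + 4 * B / C)"] Cb_nonneg R B C by auto
  have p: "0 \<le> Cb * R * E T" "0 \<le> Cb * (4 * B / C) * E T"
    using Cb_nonneg R B C by auto
  then have T1: "R * Cb * E T \<le> 1" and T2: "Cb * (4 * B / C) * E T \<le> 1"
    using T(3) by (simp_all add: algebra_simps)
  have flow_le: "hnorm 1 (flow \<tau> q t) \<le> B" if "admissible R q" "t \<in> {0..T}" for q t
  proof -
    have "R * Cb * E t \<le> R * Cb * E T"
      using that R Cb_nonneg by (intro mult_left_mono E_mono) auto
    then show ?thesis using flow_hs(2)[OF \<tau> that(1), of t] that T T1 by (auto simp: B_def)
  qed
  have quad_flow_le: "cmod (quad (flow \<tau> q t) \<xi>) \<le> R" if "admissible R q" "t \<in> {0..T}" for q t \<xi>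
  proof -
    have "cmod (quad (flow \<tau> q t) \<xi>) \<le> (hnorm 1 (flow \<tau> q t))\<^sup>2 / C"
      unfolding C_def using that T by (intro quad_le flow_hs(1)[OF \<tau>]) auto
    also have "\<dots> \<le> R" unfolding R_def using C by (intro divide_right_mono power_mono flow_le that) auto
    finally show ?thesis .
  qed
  have contraction: "cmod (quad (flow \<tau> q t) \<xi> - quad (flow \<tau> q' t) \<xi>) \<le> M / 2"
    if q: "admissible R q" "admissible R q'" and t: "t \<in> {0..T}" and M: "0 \<le> M"
      and le: "AE s in lborel. s \<in> {0..T} \<longrightarrow> (\<forall>\<xi>. cmod (q s \<xi> - q' s \<xi>) \<le> M)" for q q' t M \<xi>
  proof -
    have "AE s in lborel. s \<in> {0..t} \<longrightarrow> (\<forall>\<xi>. cmod (q s \<xi> - q' s \<xi>) \<le> M * indicator {0..} s)"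
      using le by eventually_elim (use t in auto)
    then have d: "hnorm 1 (\<lambda>\<xi>. flow \<tau> q t \<xi> - flow \<tau> q' t \<xi>) \<le> M * Cb * E (t - 0)"
      using t T by (intro flow_diff_estimate[OF \<tau> q _ _ _ M]) auto
    also have "\<dots> \<le> M * Cb * E T"
      using t M Cb_nonneg by (intro mult_left_mono E_mono) auto
    finally have d: "hnorm 1 (\<lambda>\<xi>. flow \<tau> q t \<xi> - flow \<tau> q' t \<xi>) \<le> M * Cb * E T" .
    have "cmod (quad (flow \<tau> q t) \<xi> - quad (flow \<tau> q' t) \<xi>)
        \<le> hnorm 1 (\<lambda>\<xi>. flow \<tau> q t \<xi> - flow \<tau> q' t \<xi>) * (hnorm 1 (flow \<tau> q t) + hnorm 1 (flow \<tau> q' t)) / C"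
      unfolding C_def using t T by (intro quad_diff_le flow_hs(1)[OF \<tau> q(1)] flow_hs(1)[OF \<tau> q(2)]) auto
    also have "\<dots> \<le> (M * Cb * E T) * (B + B) / C"
      using C M Cb_nonneg by (intro divide_right_mono mult_mono d add_mono flow_le q t) auto
    also have "\<dots> = M / 2 * (Cb * (4 * B / C) * E T)" by (simp add: field_simps)
    also have "\<dots> \<le> M / 2 * 1" using M by (intro mult_left_mono T2) auto
    finally show ?thesis by simp
  qed
  \<comment> \<open>The map q |-> quad (flow q) followed by the choice of a jointly measurable
    version; it equals the exact expression off a null set of times that depends on q.\<close>
  define step where "step q = (SOME q'. admissible R q' \<and> (AE t in lborel. t \<in> {0..T} \<longrightarrow> q' t = quad (flow \<tau> q t)))" for q
  have step: "admissible R (step q)" "AE t in lborel. t \<in> {0..T} \<longrightarrow> step q t = quad (flow \<tau> q t)"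
    if "admissible R q" for q
    using someI_ex[OF quad_flow_version[OF \<tau> that T(1,2) quad_flow_le[OF that] R]] unfolding step_def by auto
  define Q where "Q k = (step ^^ k) (\<lambda>t \<xi>. 0)" for k
  have Q_Suc: "Q (Suc k) = step (Q k)" for k by (simp add: Q_def)
  have adm: "admissible R (Q k)" for k
  proof (induction k)
    case 0
    show ?case using R by (simp add: Q_def admissible_def)
  next
    case (Suc k)
    then show ?case unfolding Q_Suc by (rule step(1))
  qed
  have Q_eq: "AE t in lborel. t \<in> {0..T} \<longrightarrow> Q (Suc k) t = quad (flow \<tau> (Q k) t)" for k
    unfolding Q_Suc by (rule step(2)[OF adm])
  have Q_herm: "hermitian T (Q k)" for k
  proof (induction k)
    case 0
    show ?case by (simp add: Q_def hermitian_def)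
  next
    case (Suc k)
    show ?case
      unfolding hermitian_def using Q_eq[of k]
    proof eventually_elim
      case (elim t)
      show ?case
      proof
        assume t: "t \<in> {0..T}"
        have "quad (flow \<tau> (Q k) t) (- \<xi>) = cnj (quad (flow \<tau> (Q k) t) \<xi>)" for \<xi>
          using t T Suc herm adm[of k]
          by (intro quad_hermitian flow_hs(1)[OF \<tau> adm] flow_hermitian[where R = R and T = T]) auto
        then show "\<forall>\<xi>. Q (Suc k) t (- \<xi>) = cnj (Q (Suc k) t \<xi>)" using elim t by simp
      qed
    qed
  qed
  have incr: "AE t in lborel. t \<in> {0..T} \<longrightarrow> (\<forall>\<xi>. cmod (Q (Suc k) t \<xi> - Q k t \<xi>) \<le> R * (1/2) ^ k)" for k
  proof (induction k)
    case 0
    show ?case using adm[of 1] by (intro AE_I2) (simp add: Q_def admissible_def)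
  next
    case (Suc k)
    show ?case
      using Q_eq[of k] Q_eq[of "Suc k"]
    proof eventually_elim
      case (elim t)
      show ?case
      proof (intro impI allI)
        fix \<xi> assume t: "t \<in> {0..T}"
        have "cmod (quad (flow \<tau> (Q (Suc k)) t) \<xi> - quad (flow \<tau> (Q k) t) \<xi>) \<le> R * (1/2) ^ k / 2"
          using R by (intro contraction adm t Suc) auto
        then show "cmod (Q (Suc (Suc k)) t \<xi> - Q (Suc k) t \<xi>) \<le> R * (1/2) ^ Suc k"
          using elim t by simp
      qed
    qed
  qed
  have all: "AE t in lborel. \<forall>k. t \<in> {0..T} \<longrightarrow> (\<forall>\<xi>. cmod (Q (Suc k) t \<xi> - Q k t \<xi>) \<le> R * (1/2) ^ k)"
    by (rule AE_all_countable[THEN iffD2, OF allI[OF incr]])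
  define L where "L t \<xi> = lim (\<lambda>k. Q k t \<xi>)" for t \<xi>
  have "(\<lambda>p. L (fst p) (snd p)) \<in> borel_measurable (borel \<Otimes>\<^sub>M borel)"
    unfolding L_def using adm by (intro borel_measurable_lim_metric) (simp add: admissible_def case_prod_unfold)
  \<comment> \<open>The limit exists only for almost every t; the cut-off keeps \<open>L\<close> in
    the ball at all the other times as well.\<close>
  then have q_adm: "admissible R (\<lambda>t \<xi>. if cmod (L t \<xi>) \<le> R then L t \<xi> else 0)"
    by (rule admissible_truncate[OF _ R])
  define q where "q t \<xi> = (if cmod (L t \<xi>) \<le> R then L t \<xi> else 0)" for t \<xi>
  have q: "admissible R q" unfolding q_def[abs_def] by (rule q_adm)
  have lims: "AE t in lborel. t \<in> {0..T} \<longrightarrow> (\<forall>\<xi>. (\<lambda>k. Q k t \<xi>) \<longlonglongrightarrow> q t \<xi> \<and> (\<forall>k. cmod (q t \<xi> - Q k t \<xi>) \<le> 2 * R * (1/2) ^ k))"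
    using all
  proof eventually_elim
    case (elim t)
    show ?case
    proof (intro impI allI)
      fix \<xi> assume t: "t \<in> {0..T}"
      have inc: "cmod (Q (Suc k) t \<xi> - Q k t \<xi>) \<le> R * (1/2) ^ k" for k using elim t by blast
      note lim = geometric_increments_limit[of "\<lambda>k. Q k t \<xi>", OF inc, folded L_def]
      have "cmod (L t \<xi>) \<le> R"
        by (rule LIMSEQ_le_const2[OF tendsto_norm[OF lim(1)]]) (use adm in \<open>auto simp: admissible_def\<close>)
      then have "q t \<xi> = L t \<xi>" by (simp add: q_def)
      then show "(\<lambda>k. Q k t \<xi>) \<longlonglongrightarrow> q t \<xi> \<and> (\<forall>k. cmod (q t \<xi> - Q k t \<xi>) \<le> 2 * R * (1/2) ^ k)"
        using lim by (simp add: norm_minus_commute)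
    qed
  qed
  have "fixed_point \<tau> T q"
  proof -
    have close: "AE t in lborel. t \<in> {0..T} \<longrightarrow> (\<forall>\<xi>. cmod (q t \<xi> - Q k t \<xi>) \<le> 2 * R * (1/2) ^ k)" for k
      using lims by eventually_elim auto
    have "AE t in lborel. \<forall>k. t \<in> {0..T} \<longrightarrow> Q (Suc k) t = quad (flow \<tau> (Q k) t)"
      by (rule AE_all_countable[THEN iffD2, OF allI[OF Q_eq]])
    then show ?thesis
      unfolding fixed_point_def using lims
    proof eventually_elim
      case (elim t)
      show ?case
      proof (intro impI ext)
        fix \<xi> assume t: "t \<in> {0..T}"
        have "(\<lambda>k. Q (Suc k) t \<xi>) \<longlonglongrightarrow> q t \<xi>"
          using elim(2) t by (intro LIMSEQ_Suc) auto
        \<comment> \<open>The estimate \<open>contraction\<close> is applied to the limit and the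
          k-th iterate, whose distance is at most 2 R / 2^k uniformly on almost all of
          [0, T].\<close>
        moreover have "(\<lambda>k. Q (Suc k) t \<xi>) \<longlonglongrightarrow> quad (flow \<tau> q t) \<xi>"
        proof (rule LIM_zero_cancel, rule Lim_null_comparison)
          show "(\<lambda>k. R * (1/2::real) ^ k) \<longlonglongrightarrow> 0"
            by (intro tendsto_mult_right_zero LIMSEQ_realpow_zero) auto
          have "cmod (quad (flow \<tau> q t) \<xi> - quad (flow \<tau> (Q k) t) \<xi>) \<le> 2 * R * (1/2) ^ k / 2" for k
            using R by (intro contraction q adm t close) auto
          then show "\<forall>\<^sub>F k in sequentially. norm (Q (Suc k) t \<xi> - quad (flow \<tau> q t) \<xi>) \<le> R * (1/2) ^ k"
            using elim(1) t by (intro always_eventually allI) (simp add: norm_minus_commute)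
        qed
        ultimately show "q t \<xi> = quad (flow \<tau> q t) \<xi>" by (rule LIMSEQ_unique)
      qed
    qed
  qed
  moreover have "hermitian T q"
  proof -
    have "AE t in lborel. \<forall>k. t \<in> {0..T} \<longrightarrow> (\<forall>\<xi>. Q k t (- \<xi>) = cnj (Q k t \<xi>))"
      by (rule AE_all_countable[THEN iffD2, OF allI[OF Q_herm[unfolded hermitian_def]]])
    then show ?thesis
      unfolding hermitian_def using lims
    proof eventually_elim
      case (elim t)
      show ?case
      proof (intro impI allI)
        fix \<xi> assume t: "t \<in> {0..T}"
        have "(\<lambda>k. Q k t (- \<xi>)) \<longlonglongrightarrow> q t (- \<xi>)" using elim(2) t by blast
        moreover have "(\<lambda>k. Q k t (- \<xi>)) \<longlonglongrightarrow> cnj (q t \<xi>)"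
          using elim t by (auto intro: tendsto_cnj)
        ultimately show "q t (- \<xi>) = cnj (q t \<xi>)" by (rule LIMSEQ_unique)
      qed
    qed
  qed
  ultimately show thesis using T(1,2) q by (intro that)
qed

text \<open>The difference of two fixed points is halved repeatedly on each of finitely many successive
  time intervals of a length \<open>d\<close> that depends only on the bounds.\<close>

lemma fixed_point_unique:
  assumes \<tau>: "hs 1 \<tau>" and q: "admissible R1 q" "fixed_point \<tau> T q"
    and q': "admissible R2 q'" "fixed_point \<tau> T q'" and T: "T \<le> 1"
  shows "AE t in lborel. t \<in> {0..T} \<longrightarrow> q t = q' t"
proof -
  define C where "C = (2 * pi) ^ CARD('n)"
  have C: "0 < C" by (simp add: C_def)
  have R: "0 \<le> R1" "0 \<le> R2" using admissible_nonneg[OF q(1)] admissible_nonneg[OF q'(1)] by auto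
  \<comment> \<open>The bounds of the two fixed points are arbitrary, so this a priori bound on
    [0, 1] comes first and the interval length \<open>d\<close> is adapted to it.\<close>
  define B where "B = hnorm 1 \<tau> + (R1 + R2) * Cb * E 1"
  have B: "0 \<le> B" using R Cb_nonneg by (simp add: B_def)
  have flow_le: "hnorm 1 (flow \<tau> q t) \<le> B" "hnorm 1 (flow \<tau> q' t) \<le> B" if "0 \<le> t" "t \<le> 1" for t
  proof -
    have E: "E t \<le> E 1" using that by (intro E_mono) auto
    have "R1 * Cb * E t \<le> (R1 + R2) * Cb * E 1" "R2 * Cb * E t \<le> (R1 + R2) * Cb * E 1"
      using E R Cb_nonneg by (intro mult_mono mult_nonneg_nonneg; simp)+
    then show "hnorm 1 (flow \<tau> q t) \<le> B" "hnorm 1 (flow \<tau> q' t) \<le> B"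
      using flow_hs(2)[OF \<tau> q(1) that] flow_hs(2)[OF \<tau> q'(1) that] by (auto simp: B_def)
  qed
  obtain d where d: "0 < d" "d \<le> 1" "(Cb * (4 * B / C)) * E d \<le> 1"
    using small_time[of "Cb * (4 * B / C)"] Cb_nonneg B C by auto
  have fp: "AE t in lborel. t \<in> {0..T} \<longrightarrow> q t = quad (flow \<tau> q t)" "AE t in lborel. t \<in> {0..T} \<longrightarrow> q' t = quad (flow \<tau> q' t)"
    using q(2) q'(2) by (auto simp: fixed_point_def)
  have main: "AE t in lborel. t \<in> {0..T} \<and> t \<le> real n * d \<longrightarrow> q t = q' t" for n
  proof (induction n)
    case 0
    \<comment> \<open>For n = 0 the only time concerned is t = 0, a null set.\<close>
    show ?case using AE_lborel_singleton[of "0::real"] by (auto elim!: eventually_mono)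
  next
    case (Suc n)
    define a where "a = real n * d"
    have a: "0 \<le> a" "real (Suc n) * d = a + d" using d by (auto simp: a_def algebra_simps)
    have half: "AE t in lborel. t \<in> {0..T} \<and> t \<le> a + d \<longrightarrow> (\<forall>\<xi>. cmod (q t \<xi> - q' t \<xi>) \<le> (R1 + R2) * (1/2) ^ j)" for j
    proof (induction j)
      case 0
      show ?case using admissible_diff[OF q(1) q'(1)] by (intro AE_I2) (simp add: admissible_def)
    next
      case (Suc j)
      define M where "M = (R1 + R2) * (1/2) ^ j"
      have M: "0 \<le> M" using R by (simp add: M_def)
      \<comment> \<open>Up to time \<open>a\<close> the two functions already agree, so only the
        history since \<open>a\<close> counts, and the estimate contains E (t - a) <= E d.\<close>
      have le: "AE s in lborel. s \<in> {0..T} \<and> s \<le> a + d \<longrightarrow> (\<forall>\<xi>. cmod (q s \<xi> - q' s \<xi>) \<le> M * indicator {a..} s)"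
        using Suc[folded M_def] \<open>AE t in lborel. t \<in> {0..T} \<and> t \<le> real n * d \<longrightarrow> q t = q' t\<close>[folded a_def]
        by eventually_elim (auto simp: indicator_def)
      show ?case
        using fp \<open>AE t in lborel. t \<in> {0..T} \<and> t \<le> real n * d \<longrightarrow> q t = q' t\<close>[folded a_def]
      proof eventually_elim
        case (elim t)
        show ?case
        proof (intro impI allI)
          fix \<xi> assume t: "t \<in> {0..T} \<and> t \<le> a + d"
          show "cmod (q t \<xi> - q' t \<xi>) \<le> (R1 + R2) * (1/2) ^ Suc j"
          proof (cases "t \<le> a")
            case True
            then show ?thesis using elim t R by simp
          next
            case False
            then have t': "a \<le> t" "t \<le> 1" "0 \<le> t" using t T by auto
            have "AE s in lborel. s \<in> {0..t} \<longrightarrow> (\<forall>\<xi>. cmod (q s \<xi> - q' s \<xi>) \<le> M * indicator {a..} s)"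
              using le by eventually_elim (use t in auto)
            then have "hnorm 1 (\<lambda>\<xi>. flow \<tau> q t \<xi> - flow \<tau> q' t \<xi>) \<le> M * Cb * E (t - a)"
              by (rule flow_diff_estimate[OF \<tau> q(1) q'(1) a(1) t'(1,2) M])
            also have "\<dots> \<le> M * Cb * E d"
              using t t' M Cb_nonneg by (intro mult_left_mono E_mono) auto
            finally have h: "hnorm 1 (\<lambda>\<xi>. flow \<tau> q t \<xi> - flow \<tau> q' t \<xi>) \<le> M * Cb * E d" .
            have "cmod (quad (flow \<tau> q t) \<xi> - quad (flow \<tau> q' t) \<xi>)
                \<le> hnorm 1 (\<lambda>\<xi>. flow \<tau> q t \<xi> - flow \<tau> q' t \<xi>) * (hnorm 1 (flow \<tau> q t) + hnorm 1 (flow \<tau> q' t)) / C"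
              unfolding C_def by (intro quad_diff_le flow_hs(1)[OF \<tau> q(1)] flow_hs(1)[OF \<tau> q'(1)] t')
            also have "\<dots> \<le> (M * Cb * E d) * (B + B) / C"
              using C M Cb_nonneg by (intro divide_right_mono mult_mono h add_mono flow_le t') auto
            also have "\<dots> = M / 2 * (Cb * (4 * B / C) * E d)" by (simp add: field_simps)
            also have "\<dots> \<le> M / 2 * 1" using M by (intro mult_left_mono d(3)) auto
            finally show ?thesis using elim(1,2) t by (simp add: M_def)
          qed
        qed
      qed
    qed
    have "AE t in lborel. \<forall>j. t \<in> {0..T} \<and> t \<le> a + d \<longrightarrow> (\<forall>\<xi>. cmod (q t \<xi> - q' t \<xi>) \<le> (R1 + R2) * (1/2) ^ j)"
      by (rule AE_all_countable[THEN iffD2, OF allI[OF half]])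
    then show ?case
      unfolding a(2)
    proof eventually_elim
      case (elim t)
      show ?case
      proof (intro impI ext)
        fix \<xi> assume t: "t \<in> {0..T} \<and> t \<le> a + d"
        have "(\<lambda>j. (R1 + R2) * (1/2::real) ^ j) \<longlonglongrightarrow> 0"
          by (intro tendsto_mult_right_zero LIMSEQ_realpow_zero) auto
        then have "cmod (q t \<xi> - q' t \<xi>) \<le> 0"
          by (rule LIMSEQ_le_const) (use elim t in blast)
        then show "q t \<xi> = q' t \<xi>" by simp
      qed
    qed
  qed
  obtain n where "T / d \<le> real n" using real_arch_simple by blast
  then have "T \<le> real n * d" using d by (simp add: field_simps)
  then show ?thesis using main[of n] by (auto elim!: eventually_mono)
qed

text \<open>The time integral ignores null sets of times, so the flows agree at every time and every
  frequency. This turns uniqueness of q into uniqueness of the solution.\<close>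

lemma flow_cong_AE:
  assumes q: "admissible R q" "admissible R' q'" and t: "t \<le> T"
    and eq: "AE s in lborel. s \<in> {0..T} \<longrightarrow> q s = q' s"
  shows "flow \<tau> q t = flow \<tau> q' t"
proof
  fix \<xi>
  note [measurable (raw)] = admissible_measurable[OF q(1)] admissible_measurable[OF q(2)]
  have "duh q t \<xi> = duh q' t \<xi>"
    unfolding duh_def
  proof (rule integral_cong_AE)
    show "AE s in lborel. indicator {0..t} s * (heat \<alpha> (t - s) \<xi> * (q s \<xi> * \<beta> s \<xi>))
        = indicator {0..t} s * (heat \<alpha> (t - s) \<xi> * (q' s \<xi> * \<beta> s \<xi>))"
      using eq
    proof eventually_elim
      case (elim s)
      then show ?case using t by (cases "s \<in> {0..t}") auto
    qed
  qed measurable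
  then show "flow \<tau> q t \<xi> = flow \<tau> q' t \<xi>" by (simp add: flow_def)
qed

end

section \<open>Mild solutions\<close>

text \<open>Averaging with the reflected conjugate turns the almost everywhere symmetry from
  \<open>real_distr_symbol\<close> into an exact one, as \<open>flow_hermitian\<close>
  requires.\<close>

lemma hermitian_symbol:
  assumes "T \<in> sobolev s" "real_distr T"
  obtains \<tau> where "hs s \<tau>" "distr_eq T (symb \<tau>)" "\<And>\<xi>. \<tau> (- \<xi>) = cnj (\<tau> \<xi>)"
proof -
  obtain \<sigma> where \<sigma>: "hs s \<sigma>" "distr_eq T (symb \<sigma>)" using sobolev_symbol[OF assms(1)] by blast
  define \<tau> where "\<tau> \<xi> = (1/2) * (\<sigma> \<xi> + cnj (\<sigma> (- \<xi>)))" for \<xi>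
  have \<tau>: "hs s \<tau>"
    unfolding \<tau>_def[abs_def]
    by (rule hs_bounded_mult(1)[OF hs_add[OF \<sigma>(1) hs_reflect_cnj(1)[OF \<sigma>(1)]], of _ "1/2"]) auto
  have "AE \<xi> in lborel. \<sigma> \<xi> = \<tau> \<xi>"
    using real_distr_symbol[OF \<sigma> assms(2)] by eventually_elim (simp add: \<tau>_def)
  then have "symb \<sigma> f = symb \<tau> f" if "schwartz f" for f
    by (intro symb_cong_AE that hs_measurable[OF \<sigma>(1)] hs_measurable[OF \<tau>])
  then have "distr_eq T (symb \<tau>)" using \<sigma>(2) by (simp add: distr_eq_def)
  then show thesis using \<tau> by (intro that[of \<tau>]) (simp_all add: \<tau>_def add.commute)
qed

lemma real_distr_distr_of: "real_distr (distr_of (\<lambda>x. complex_of_real (g x)))"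
proof -
  have "(LINT x|lebesgue. complex_of_real (g x) * cnj (f x)) = cnj (LINT x|lebesgue. complex_of_real (g x) * f x)"
    for f :: "real^'a \<Rightarrow> complex"
    by (subst Bochner_Integration.integral_cnj[symmetric]) (simp del: Bochner_Integration.integral_cnj)
  then show ?thesis by (simp add: real_distr_def distr_of_def)
qed

theorem theorem1:
  fixes \<alpha> \<gamma> :: real
    and u0 :: "real^'n::finite \<Rightarrow> real"
    and b :: "real \<Rightarrow> 'n distr"
  assumes alpha: "0 < \<alpha>" "\<alpha> \<le> 2"
    and u0_fun: "regular (\<lambda>x. complex_of_real (u0 x))"
    and u0_H1: "distr_of (\<lambda>x. complex_of_real (u0 x)) \<in> sobolev 1"
    and b_real: "AE t in lebesgue_on {0..}. real_distr (b t)"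
    and cases:
      "(1 < \<alpha> \<and> \<alpha> \<le> 2 \<and> 0 \<le> \<gamma> \<and> \<gamma> < \<alpha> - 1 \<and> b \<in> L_infty_sobolev {0..} (- \<gamma>)) \<or>
       (0 < \<alpha> \<and> \<alpha> \<le> 1 \<and> 0 \<le> 1 - \<alpha> \<and> 1 - \<alpha> < \<gamma> \<and> \<gamma> < 1 \<and> b \<in> L_infty_sobolev {0..} \<gamma>)"
  shows "\<exists>T0>0. \<exists>u.
    mild_solution \<alpha> b (distr_of (\<lambda>x. complex_of_real (u0 x))) T0 u \<and>
    (AE t in lebesgue_on {0..T0}. real_distr (u t)) \<and>
    (\<forall>v. mild_solution \<alpha> b (distr_of (\<lambda>x. complex_of_real (u0 x))) T0 v \<longrightarrow>
         (AE t in lebesgue_on {0..T0}. distr_eq (v t) (u t)))"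
proof -
  let ?U0 = "distr_of (\<lambda>x. complex_of_real (u0 x))"
  \<comment> \<open>In case 1 this means 0 < 1 + \<gamma> < \<alpha>, in case 2 it means 0 < 1 -
    \<gamma> < \<alpha>.\<close>
  obtain \<sigma> where \<sigma>: "\<sigma> < 1" "1 - \<sigma> < \<alpha>" "b \<in> L_infty_sobolev {0..} \<sigma>"
    using cases
  proof
    assume "1 < \<alpha> \<and> \<alpha> \<le> 2 \<and> 0 \<le> \<gamma> \<and> \<gamma> < \<alpha> - 1 \<and> b \<in> L_infty_sobolev {0..} (- \<gamma>)"
    then show thesis by (intro that[of "- \<gamma>"]) auto
  next
    assume "0 < \<alpha> \<and> \<alpha> \<le> 1 \<and> 0 \<le> 1 - \<alpha> \<and> 1 - \<alpha> < \<gamma> \<and> \<gamma> < 1 \<and> b \<in> L_infty_sobolev {0..} \<gamma>"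
    then show thesis by (intro that[of \<gamma>]) auto
  qed
  obtain \<tau> where \<tau>: "hs 1 \<tau>" "distr_eq ?U0 (symb \<tau>)" "\<And>\<xi>. \<tau> (- \<xi>) = cnj (\<tau> \<xi>)"
    using hermitian_symbol[OF u0_H1 real_distr_distr_of] by blast
  obtain \<beta> Cb where \<beta>: "(\<lambda>(t, \<xi>). \<beta> t \<xi>) \<in> borel_measurable (borel \<Otimes>\<^sub>M borel)"
    "\<And>t. hs \<sigma> (\<beta> t)" "\<And>t. hnorm \<sigma> (\<beta> t) \<le> Cb"
    "AE t in lborel. t \<in> {0..1} \<longrightarrow> distr_eq (b t) (symb (\<beta> t))"
    "\<And>t \<xi>. \<beta> t (- \<xi>) = cnj (\<beta> t \<xi>)"
    by (rule hermitian_version[OF \<sigma>(3) b_real], rule that, assumption+)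
  interpret duhamel \<alpha> \<sigma> \<beta> Cb
    by standard (use alpha \<sigma> \<beta> in auto)
  obtain T q R where T: "0 < T" "T \<le> 1" and q: "admissible R q" "fixed_point \<tau> T q" "hermitian T q"
    using fixed_point_exists[OF \<tau>(1,3) \<beta>(5)] by blast
  let ?u = "\<lambda>t. symb (flow \<tau> q t)"
  have flow: "hs 1 (flow \<tau> q t)" if "t \<in> {0..T}" for t
    using flow_hs(1)[OF \<tau>(1) q(1)] that T by auto
  have "mild_solution \<alpha> b ?U0 T ?u"
    unfolding mild_solution_def
  proof (intro conjI)
    show "?u \<in> L_infty_sobolev {0..T} 1" by (rule flow_L_infty[OF \<tau>(1) q(1) T])
    show "AE t in lebesgue_on {0..T}. \<forall>f. schwartz f \<longrightarrow>
        integrable (lebesgue_on {0..t}) (\<lambda>s. frac_heat \<alpha> (t - s) (nonlinearity (?u s) (b s)) f) \<and>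
        ?u t f = frac_heat \<alpha> t ?U0 f +
          (LINT s|lebesgue_on {0..t}. frac_heat \<alpha> (t - s) (nonlinearity (?u s) (b s)) f)"
    proof (rule AE_I2)
      fix t assume "t \<in> space (lebesgue_on {0..T})"
      then have t: "0 \<le> t" "t \<le> T" by auto
      have "AE s in lborel. s \<in> {0..t} \<longrightarrow> (\<exists>\<sigma>. hs 1 \<sigma> \<and> distr_eq (?u s) (symb \<sigma>) \<and> q s = quad \<sigma>)"
        using q(2)[unfolded fixed_point_def]
      proof eventually_elim
        case (elim s)
        then show ?case using t flow[of s] by (intro impI exI[of _ "flow \<tau> q s"]) (auto simp: distr_eq_def)
      qed
      note D = duhamel_formula[OF \<tau>(1,2) q(1) t(1) order_trans[OF t(2) T(2)] \<beta>(4) this]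
      show "\<forall>f. schwartz f \<longrightarrow>
        integrable (lebesgue_on {0..t}) (\<lambda>s. frac_heat \<alpha> (t - s) (nonlinearity (?u s) (b s)) f) \<and>
        ?u t f = frac_heat \<alpha> t ?U0 f +
          (LINT s|lebesgue_on {0..t}. frac_heat \<alpha> (t - s) (nonlinearity (?u s) (b s)) f)"
        using D by simp
    qed
  qed
  moreover have "AE t in lebesgue_on {0..T}. real_distr (?u t)"
  proof (rule AE_I2)
    fix t assume "t \<in> space (lebesgue_on {0..T})"
    then have t: "t \<in> {0..T}" by simp
    show "real_distr (?u t)"
      using t \<tau>(3) \<beta>(5) q
      by (intro real_distr_symb[OF flow[OF t]] flow_hermitian[where R = R and T = T]) auto
  qed
  moreover have "AE t in lebesgue_on {0..T}. distr_eq (v t) (?u t)" if v: "mild_solution \<alpha> b ?U0 T v" for v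
  proof -
    have I: "{0..T} \<in> sets borel" by simp
    have vL: "v \<in> L_infty_sobolev {0..T} 1" using v by (simp add: mild_solution_def)
    \<comment> \<open>The unknown of the fixed-point problem is recovered from the given solution;
      its bound \<open>R'\<close> is unrelated to \<open>R\<close>.\<close>
    obtain p :: "real \<Rightarrow> real^'n \<Rightarrow> complex" and R' where p: "(\<lambda>(t, \<xi>). p t \<xi>) \<in> borel_measurable (borel \<Otimes>\<^sub>M borel)"
      "\<And>t \<xi>. cmod (p t \<xi>) \<le> R'"
      and pv: "AE t in lborel. t \<in> {0..T} \<longrightarrow> v t \<in> sobolev 1 \<and> p t = quad (symbol 1 (v t))"
      by (rule L_infty_sobolev_quad[OF vL I], rule that, assumption+)
    have p_adm: "admissible R' p" using p by (simp add: admissible_def)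
    have mild: "AE t in lborel. t \<in> {0..T} \<longrightarrow> (\<forall>f. schwartz f \<longrightarrow>
        v t f = frac_heat \<alpha> t ?U0 f + (LINT s|lebesgue_on {0..t}. frac_heat \<alpha> (t - s) (nonlinearity (v s) (b s)) f))"
      using v unfolding mild_solution_def AE_lebesgue_on_iff[OF I] by (auto elim!: eventually_mono)
    have v_eq: "AE t in lborel. t \<in> {0..T} \<longrightarrow> distr_eq (v t) (symb (flow \<tau> p t))"
      using mild
    proof eventually_elim
      case (elim t)
      show ?case
      proof
        assume t: "t \<in> {0..T}"
        have "AE s in lborel. s \<in> {0..t} \<longrightarrow> (\<exists>\<sigma>. hs 1 \<sigma> \<and> distr_eq (v s) (symb \<sigma>) \<and> p s = quad \<sigma>)"
          using pv
        proof eventually_elim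
          case (elim s)
          show ?case
          proof
            assume "s \<in> {0..t}"
            then have "v s \<in> sobolev 1" "p s = quad (symbol 1 (v s))" using elim t by auto
            then show "\<exists>\<sigma>. hs 1 \<sigma> \<and> distr_eq (v s) (symb \<sigma>) \<and> p s = quad \<sigma>" using symbol by blast
          qed
        qed
        note D = duhamel_formula(2)[OF \<tau>(1,2) p_adm _ _ \<beta>(4) this]
        show "distr_eq (v t) (symb (flow \<tau> p t))"
          using elim t T D unfolding distr_eq_def by simp
      qed
    qed
    \<comment> \<open>The Duhamel formula identifies v t with the flow of p, so the transforms of
      the squares formed from the two symbols coincide.\<close>
    have "fixed_point \<tau> T p"
      unfolding fixed_point_def using v_eq pv
    proof eventually_elim
      case (elim t)
      then show ?case
        using T by (auto intro!: quad_symbol flow_hs(1)[OF \<tau>(1) p_adm])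
    qed
    then have eq: "AE t in lborel. t \<in> {0..T} \<longrightarrow> p t = q t"
      by (rule fixed_point_unique[OF \<tau>(1) p_adm _ q(1,2) T(2)])
    have "flow \<tau> p t = flow \<tau> q t" if "t \<le> T" for t
      by (rule flow_cong_AE[OF p_adm q(1) that eq])
    then show ?thesis
      using v_eq unfolding AE_lebesgue_on_iff[OF I] by (auto elim!: eventually_mono)
  qed
  ultimately show ?thesis using T(1) by blast
qed


end
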